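(* Let $\eta$ be a Lévy noise with all moments, and let $X=\sum_{j\ge0}(-\lambda)^jX_j$ be the formal power series solution of $\partial_tX=\Delta X-m_0^2X-\lambda X^p+\eta$ ($t>0$), $X(0,\cdot)=f$. Let $n\ge1$ and $\mathbf x_1,\dots,\mathbf x_n\in L_\delta$. Then the perturbation series of the truncated moments converges in the sense of formal power series in $\lambda$ (i.e. coefficient by coefficient) as all times go to infinity simultaneously: $$\lim_{t\to\infty}\big\langle X(t,\mathbf x_1)\cdots X(t,\mathbf x_n)\big\rangle^T=\langle X_\infty(\mathbf x_1)\cdots X_\infty(\mathbf x_n)\rangle^T,$$ where $$\langle X_\infty(\mathbf x_1)\cdots X_\infty(\mathbf x_n)\rangle^T:=\sum_{m=0}^\infty(-\lambda)^m\sum_{\mathcal G\in P'_{1,c}(m,n)}\mathcal V_\infty[\mathcal G](\mathbf x_1,\dots,\mathbf x_n).$$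
   Context: Fix integers $d,p\ge1$ and reals $\delta>0$, $m_0>0$. Let $L_\delta=\delta\mathbb Z^d$ and $\Gamma=\mathbb R\times L_\delta$, with points $x=(t,\mathbf x)$; $\Gamma_\pm=\{(t,\mathbf x)\in\Gamma:\pm t>0\}$. Put $\int g(\mathbf x)\,d\mathbf x=\sum_{\mathbf x\in L_\delta}\delta^dg(\mathbf x)$ and $\int g(x)\,dx=\sum_{\mathbf x\in L_\delta}\delta^d\int_{\mathbb R}g(t,\mathbf x)\,dt$. Convolutions: $(g*h)(x)=\int g(x-y)h(y)\,dy$ on $\Gamma$ and $(g\star h)(\mathbf x)=\int g(\mathbf x-\mathbf y)h(\mathbf y)\,d\mathbf y$ on $L_\delta$. Lattice Laplacian: $\Delta g(\mathbf x)=\delta^{-2}\big[-2d\,g(\mathbf x)+\sum_{|\mathbf y-\mathbf x|=\delta}g(\mathbf y)\big]$. Let $\mu^2(\mathbf p)=2\delta^{-2}\big(d-\sum_{j=1}^d\cos(\delta p_j)\big)+m_0^2$, $\tilde G_t(\mathbf x)=(2\pi)^{-d}\int_{[0,2\pi/\delta]^d}e^{-i\mathbf p\cdot\mathbf x}e^{-t\mu^2(\mathbf p)}\,d\mathbf p$ for $t\ge0$, and $G(t,\mathbf x)=\theta(t)\tilde G_t(\mathbf x)$ with $\theta(t)=1$ if $t>0$ and $\theta(t)=0$ otherwise. Lévy noise. $\psi(t)=iat-\frac{\sigma^2t^2}2+z\int_{\mathbb R\setminus\{0\}}(e^{ist}-1)\,dr(s)$ with $a\in\mathbb R$, $\sigma^2\ge0$,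 $z\ge0$ and $r$ a probability measure on $\mathbb R\setminus\{0\}$ with all moments finite. $\eta$ is the coordinate process on $S'(\Gamma)$ (tempered distributions) under the probability measure $P_\psi$ with $\int e^{i\langle g,\xi\rangle}dP_\psi(\xi)=\exp\big(\int_{\Gamma_+}\psi(g(x))\,dx\big)$, $g\in S(\Gamma)$. Put $c_n=(-i)^n\psi^{(n)}(0)=\delta_{n,1}a+\delta_{n,2}\sigma^2+z\int s^n\,dr(s)$, $n\ge1$. $(G*\eta)(x)=\int G(x-z)\eta(z)\,dz$ is the stochastic integral (with a version that is measurable and polynomially bounded in the integrated sense: for each $k$ there is $N$ with $\int|(G*\eta)(x)|^k(1+|x|^2)^{-N}dx<\infty$ a.s.). Solution. $f\in S(L_\delta)$. $X=\sum_{j\ge0}(-\lambda)^jX_j$ solves $X=-\lambda G*(X^p)+G*\eta+\tilde G_t\star f$ order by order ($\tilde G_t\star f$ being set to $0$ for $t\le0$), i.e. $X_0=G*\eta+\tilde G_t\star f$ and, for $j\ge1$, $X_j=G*\sum\frac{p!}{n_0!n_1!\cdots}\prod_{i\ge0}X_i^{n_i}$, the sum running over nonnegative integers $n_0,n_1,\dots$ with $\sum_in_i=p$, $\sum_i i\,n_i=j-1$. $\langle\cdot\rangle$ is expectation; $\langle\prod_iX(x_i)\rangle$ is the formal power series obtained by multiplying out and taking expectations of the coefficients. Truncated moments are defined recursively by $\langle\prod_{i=1}^nX(x_i)\rangle=\sum_{I}\prod_{l=1}^k\langle\prod_{j\in I_l}X(x_j)\rangle^T$, summing over all partitions $I=\{I_1,\dots,I_k\}$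 of $\{1,\dots,n\}$ into nonempty blocks. Trees. $\mathcal A(j)$ is the set of rooted trees with a root of degree one, $j$ inner vertices each having $p+1$ legs, all other vertices being leaves of degree one, each leaf being either of type one or of type two. $\mathcal A(0)$ has two elements: the root joined to a single leaf of type one, respectively of type two. For $j\ge1$, a tree $T\in\mathcal A(j)$ is obtained by joining the root to an inner vertex $v_0$ to which $p$ rooted trees with root $v_0$ are attached, $n_i$ of them from $\mathcal A(i)$, with $\sum_in_i=p$ and $\sum_i i\,n_i=j-1$. $T$ is specified by the $n_i$, by the number $n_0'\le n_0$ of attached elements of $\mathcal A(0)$ whose leaf is of type one, and, for each $i\ge1$, by the list $(T_{i,1},\dots,T_{i,n_i})$ of attached elements of $\mathcal A(i)$; the order of the attached elements of $\mathcal A(0)$ is immaterial, while for $i\ge1$ different lists give different elements of $\mathcal A(j)$. For vertices, $v\le w$ means every walk from $w$ to the root passes through $v$. For an inner vertex $v$, $M(v)=\frac{p!}{n_0'!\,(n_0-n_0')!\,n_1!\,n_2!\cdots}$, where $n_i$ is the number of rooted subtrees attached at $v$ (away from the root) with $i$ inner vertices, and $n_0'$ the number of those with no inner vertex and a leaf of type one. $L_1(T)$ is the set of leaves of type one. Graphs. A generalized Parisi–Wu graph of order $m$ with $n$ roots consists of $n$ rooted trees $T_1\in\mathcal A(j_1),\dots,T_n\in\mathcal A(j_n)$, $j_1+\dots+j_n=m$, together with additional (inner) "empty" vertices, such that each leaf of type one is joined by an edge to exactly one empty vertex, each empty vertex having at least one leg. Such a graph is the same as a tuple $(T_1,\dots,T_n;I)$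 with $I$ a partition of the disjoint union $\bigcup_iL_1(T_i)$, the blocks being the sets of leaves joined to a common empty vertex; graphs are counted as such tuples (leaves are treated as distinct elements). $P_c(m,n)$ is the set of connected ones. $P_c'(m,n)$ is the collection of graphs obtained, one for each $\mathcal G\in P_c(m,n)$, by replacing each leaf of type one, with its edges to its tree neighbour $v$ and to its empty vertex $q$, by a single edge $\{v,q\}$ (multiple edges allowed). $P'_{1,c}(m,n)$ is the subset of graphs in $P'_c(m,n)$ having no leaf of type two. Value. For $\mathcal G\in P'_{1,c}(m,n)$, $\mathcal V_\infty[\mathcal G](\mathbf x_1,\dots,\mathbf x_n)$: assign $(0,\mathbf x_1),\dots,(0,\mathbf x_n)$ to the roots of the trees $T_1,\dots,T_n$, variables $y_1,\dots,y_m$ to the inner vertices of the trees and $z_1,\dots,z_k$ to the empty vertices. Multiply a factor $M(v)$ for each inner vertex $v$ of a tree, $c_l$ for each empty vertex with $l$ legs, and $G(e)=G(v-w)$ for each edge $e=\{v,w\}$, where $v\le w$ if $e$ is a tree edge and $w$ is the empty vertex if $e$ joins a tree vertex to an empty vertex. Integrate all the variables $y_1,\dots,y_m,z_1,\dots,z_k$ over $\Gamma_-$. *)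

theory Defs
  imports
    "HOL-Probability.Probability"
    "HOL-Computational_Algebra.Formal_Power_Series"
    "HOL-Library.Disjoint_Sets"
    "Graph_Theory.Digraph_Component"
begin

section \<open>The lattice and the heat kernel\<close>

text \<open>The dimension is \<open>d = CARD('d)\<close>. A function on the lattice (or on
  \<open>\<Gamma> = \<real> \<times> L\<^sub>\<delta>\<close>) is represented by a function on the whole ambient space; only its values
  on the lattice (on \<open>\<Gamma>\<close>) matter, because the reference measures live there.\<close>

definition lattice :: "real \<Rightarrow> (real ^ 'd) set" where
  "lattice \<delta> = {x. \<forall>i. \<exists>k::int. x $ i = \<delta> * of_int k}"

definition Gam :: "real \<Rightarrow> (real \<times> (real ^ 'd)) set" where
  "Gam \<delta> = UNIV \<times> lattice \<delta>"

definition Gam_pos :: "real \<Rightarrow> (real \<times> (real ^ 'd)) set" where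
  "Gam_pos \<delta> = {0<..} \<times> lattice \<delta>"

definition Gam_neg :: "real \<Rightarrow> (real \<times> (real ^ 'd)) set" where
  "Gam_neg \<delta> = {..<0} \<times> lattice \<delta>"

definition lattice_measure :: "real \<Rightarrow> (real ^ 'd) measure" where
  "lattice_measure \<delta> = density (count_space (lattice \<delta>)) (\<lambda>_. ennreal (\<delta> ^ CARD('d)))"

definition Gam_measure :: "real \<Rightarrow> (real \<times> (real ^ 'd)) measure" where
  "Gam_measure \<delta> = lborel \<Otimes>\<^sub>M lattice_measure \<delta>"

definition mu2 :: "real \<Rightarrow> real \<Rightarrow> real ^ 'd \<Rightarrow> real" where
  "mu2 \<delta> m0 q = 2 / \<delta>\<^sup>2 * (real CARD('d) - (\<Sum>j\<in>UNIV. cos (\<delta> * q $ j))) + m0\<^sup>2"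

text \<open>The Fourier integral is real, since the symbol is even and periodic; taking the real part
  only adjusts the type.\<close>

definition heat_kernel :: "real \<Rightarrow> real \<Rightarrow> real \<Rightarrow> real ^ 'd \<Rightarrow> real" where
  "heat_kernel \<delta> m0 t x =
     Re ((CLINT q : cbox 0 (\<chi> i. 2 * pi / \<delta>) | lborel.
            exp (- \<i> * of_real (q \<bullet> x)) * exp (- of_real (t * mu2 \<delta> m0 q)))
         / of_real ((2 * pi) ^ CARD('d)))"

definition green :: "real \<Rightarrow> real \<Rightarrow> real \<times> (real ^ 'd) \<Rightarrow> real" where
  "green \<delta> m0 = (\<lambda>(t, x). if t > 0 then heat_kernel \<delta> m0 t x else 0)"

definition conv_Gam ::
    "real \<Rightarrow> (real \<times> (real ^ 'd) \<Rightarrow> real) \<Rightarrow> (real \<times> (real ^ 'd) \<Rightarrow> real) \<Rightarrow> real \<times> (real ^ 'd) \<Rightarrow> real" where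
  "conv_Gam \<delta> g h x = (LINT y | Gam_measure \<delta>. g (x - y) * h y)"

definition conv_lattice ::
    "real \<Rightarrow> (real ^ 'd \<Rightarrow> real) \<Rightarrow> (real ^ 'd \<Rightarrow> real) \<Rightarrow> real ^ 'd \<Rightarrow> real" where
  "conv_lattice \<delta> g h x = (LINT y | lattice_measure \<delta>. g (x - y) * h y)"

section \<open>Rapidly decreasing functions and tempered distributions\<close>

text \<open>To make the elements of the two spaces below functions on the lattice and on \<open>\<Gamma>\<close>, they
  are extended by zero.\<close>

definition schwartz_lattice :: "real \<Rightarrow> (real ^ 'd \<Rightarrow> real) set" where
  "schwartz_lattice \<delta> =
     {f. (\<forall>x. x \<notin> lattice \<delta> \<longrightarrow> f x = 0) \<and>
         (\<forall>N::nat. bdd_above ((\<lambda>x. (1 + (norm x)\<^sup>2) ^ N * \<bar>f x\<bar>) ` lattice \<delta>))}"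

definition time_deriv :: "nat \<Rightarrow> (real \<times> (real ^ 'd) \<Rightarrow> real) \<Rightarrow> real \<times> (real ^ 'd) \<Rightarrow> real" where
  "time_deriv k g = (\<lambda>(t, x). (deriv ^^ k) (\<lambda>s. g (s, x)) t)"

definition schwartz_Gam :: "real \<Rightarrow> (real \<times> (real ^ 'd) \<Rightarrow> real) set" where
  "schwartz_Gam \<delta> =
     {g. (\<forall>x. x \<notin> Gam \<delta> \<longrightarrow> g x = 0) \<and>
         (\<forall>x\<in>lattice \<delta>. \<forall>k t. (\<lambda>s. time_deriv k g (s, x)) differentiable (at t)) \<and>
         (\<forall>k N. bdd_above ((\<lambda>x. (1 + (norm x)\<^sup>2) ^ N * \<bar>time_deriv k g x\<bar>) ` Gam \<delta>))}"

definition schwartz_seminorm :: "real \<Rightarrow> nat \<Rightarrow> nat \<Rightarrow> (real \<times> (real ^ 'd) \<Rightarrow> real) \<Rightarrow> real" where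
  "schwartz_seminorm \<delta> k N g = (SUP x\<in>Gam \<delta>. (1 + (norm x)\<^sup>2) ^ N * \<bar>time_deriv k g x\<bar>)"

definition tempered :: "real \<Rightarrow> ((real \<times> (real ^ 'd) \<Rightarrow> real) \<Rightarrow> real) set" where
  "tempered \<delta> =
     {\<xi> \<in> extensional (schwartz_Gam \<delta>).
        (\<forall>g\<in>schwartz_Gam \<delta>. \<forall>h\<in>schwartz_Gam \<delta>. \<xi> (\<lambda>x. g x + h x) = \<xi> g + \<xi> h) \<and>
        (\<forall>g\<in>schwartz_Gam \<delta>. \<forall>c. \<xi> (\<lambda>x. c * g x) = c * \<xi> g) \<and>
        (\<exists>C N. \<forall>g\<in>schwartz_Gam \<delta>. \<bar>\<xi> g\<bar> \<le> C * (\<Sum>k\<le>N. schwartz_seminorm \<delta> k N g))}"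

section \<open>Levy noise\<close>

definition levy_exponent :: "real \<Rightarrow> real \<Rightarrow> real \<Rightarrow> real measure \<Rightarrow> real \<Rightarrow> complex" where
  "levy_exponent a \<sigma> z r t =
     \<i> * of_real (a * t) - of_real (\<sigma>\<^sup>2 * t\<^sup>2 / 2) +
     of_real z * (CLINT s | r. exp (\<i> * of_real (s * t)) - 1)"

definition jump_law :: "real measure \<Rightarrow> bool" where
  "jump_law r \<longleftrightarrow> prob_space r \<and> sets r = sets (restrict_space borel (- {0})) \<and>
     (\<forall>n::nat. integrable r (\<lambda>s. s ^ n))"

text \<open>The value of \<open>(-\<i>)\<^sup>n\<close> times the \<open>n\<close>-th derivative of the Levy exponent at \<open>0\<close>,
  for \<open>n \<ge> 1\<close>.\<close>

definition levy_cumulant :: "real \<Rightarrow> real \<Rightarrow> real \<Rightarrow> real measure \<Rightarrow> nat \<Rightarrow> real" where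
  "levy_cumulant a \<sigma> z r n =
     (if n = 1 then a else 0) + (if n = 2 then \<sigma>\<^sup>2 else 0) + z * (LINT s | r. s ^ n)"

text \<open>The \<open>\<sigma>\<close>-algebra on the tempered distributions is the one generated by the evaluations
  \<open>\<xi> \<mapsto> \<langle>g, \<xi>\<rangle>\<close>.\<close>

definition levy_noise_law ::
    "real \<Rightarrow> real \<Rightarrow> real \<Rightarrow> real \<Rightarrow> real measure \<Rightarrow> ((real \<times> (real ^ 'd) \<Rightarrow> real) \<Rightarrow> real) measure \<Rightarrow> bool" where
  "levy_noise_law \<delta> a \<sigma> z r P \<longleftrightarrow>
     prob_space P \<and>
     space P = tempered \<delta> \<and>
     sets P = sigma_sets (tempered \<delta>)
       {{\<xi> \<in> tempered \<delta>. \<xi> g \<in> B} | g B. g \<in> schwartz_Gam \<delta> \<and> B \<in> sets borel} \<and>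
     (\<forall>g\<in>schwartz_Gam \<delta>.
        (CLINT \<xi> | P. exp (\<i> * of_real (\<xi> g))) =
        exp (CLINT x : Gam_pos \<delta> | Gam_measure \<delta>. levy_exponent a \<sigma> z r (g x)))"

text \<open>\<open>Y\<close> is a version of \<open>\<integral> h(y) \<eta>(y) dy\<close>. The map \<open>g \<mapsto> \<langle>g, \<eta>\<rangle>\<close> is continuous from
  \<open>L\<^sup>1 \<inter> L\<^sup>2\<close> of the positive half of \<open>\<Gamma>\<close> to \<open>L\<^sup>2(P)\<close>, because the mean is
  \<open>c\<^sub>1 \<integral> g\<close> and the variance is \<open>c\<^sub>2 \<integral> g\<^sup>2\<close>; the stochastic integral is its continuous extension.
  In particular it does not depend on the approximating sequence.\<close>

definition stochastic_integral ::
    "real \<Rightarrow> ((real \<times> (real ^ 'd) \<Rightarrow> real) \<Rightarrow> real) measure \<Rightarrow> (real \<times> (real ^ 'd) \<Rightarrow> real) \<Rightarrow>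
     (((real \<times> (real ^ 'd) \<Rightarrow> real) \<Rightarrow> real) \<Rightarrow> real) \<Rightarrow> bool" where
  "stochastic_integral \<delta> P h Y \<longleftrightarrow>
     Y \<in> borel_measurable P \<and>
     (\<exists>g :: nat \<Rightarrow> real \<times> (real ^ 'd) \<Rightarrow> real.
        (\<forall>k. g k \<in> schwartz_Gam \<delta>) \<and>
        (\<lambda>k. \<integral>\<^sup>+x\<in>Gam_pos \<delta>. ennreal \<bar>g k x - h x\<bar> \<partial>Gam_measure \<delta>) \<longlonglongrightarrow> 0 \<and>
        (\<lambda>k. \<integral>\<^sup>+x\<in>Gam_pos \<delta>. ennreal ((g k x - h x)\<^sup>2) \<partial>Gam_measure \<delta>) \<longlonglongrightarrow> 0 \<and>
        (\<lambda>k. \<integral>\<^sup>+\<xi>. ennreal ((\<xi> (g k) - Y \<xi>)\<^sup>2) \<partial>P) \<longlonglongrightarrow> 0)"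

definition noise_convolution ::
    "real \<Rightarrow> real \<Rightarrow> ((real \<times> (real ^ 'd) \<Rightarrow> real) \<Rightarrow> real) measure \<Rightarrow>
     (((real \<times> (real ^ 'd) \<Rightarrow> real) \<Rightarrow> real) \<Rightarrow> real \<times> (real ^ 'd) \<Rightarrow> real) \<Rightarrow> bool" where
  "noise_convolution \<delta> m0 P Y \<longleftrightarrow>
     (\<lambda>(\<xi>, x). Y \<xi> x) \<in> borel_measurable (P \<Otimes>\<^sub>M Gam_measure \<delta>) \<and>
     (\<forall>x\<in>Gam \<delta>. stochastic_integral \<delta> P (\<lambda>y. green \<delta> m0 (x - y)) (\<lambda>\<xi>. Y \<xi> x)) \<and>
     (\<forall>k::nat. \<exists>N::nat. AE \<xi> in P.
        (\<integral>\<^sup>+x. ennreal (\<bar>Y \<xi> x\<bar> ^ k / (1 + (norm x)\<^sup>2) ^ N) \<partial>Gam_measure \<delta>) < \<infinity>)"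

section \<open>The formal power series solution\<close>

definition multiplicities :: "nat \<Rightarrow> nat \<Rightarrow> (nat \<Rightarrow> nat) set" where
  "multiplicities p j =
     {\<nu>. (\<forall>i\<ge>j. \<nu> i = 0) \<and> (\<Sum>i<j. \<nu> i) = p \<and> (\<Sum>i<j. i * \<nu> i) = j - 1}"

text \<open>The restriction \<open>\<nu> i = 0\<close> for \<open>i \<ge> j\<close> is implied by \<open>\<Sum>\<^sub>i i * \<nu> i = j - 1\<close>, for \<open>j \<ge> 1\<close>.
  The argument \<open>Y\<close> is a path of \<open>G * \<eta>\<close>. The coefficients are those of
  \<open>X = \<Sum>\<^sub>j (- \<lambda>)\<^sup>j X\<^sub>j\<close> in the mild form of the equation,
  \<open>X = - \<lambda> G * X\<^sup>p + G * \<eta> + heat_kernel t \<star> f\<close>, with \<open>X\<^sup>p\<close> expanded multinomially.\<close>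

fun solution_coeff ::
    "real \<Rightarrow> real \<Rightarrow> nat \<Rightarrow> (real ^ 'd \<Rightarrow> real) \<Rightarrow> (real \<times> (real ^ 'd) \<Rightarrow> real) \<Rightarrow> nat \<Rightarrow> real \<times> (real ^ 'd) \<Rightarrow> real"
where
  "solution_coeff \<delta> m0 p f Y j =
     (if j = 0 then
        (\<lambda>(t, x). Y (t, x) + (if t > 0 then conv_lattice \<delta> (heat_kernel \<delta> m0 t) f x else 0))
      else
        conv_Gam \<delta> (green \<delta> m0)
          (\<lambda>y. \<Sum>\<nu>\<in>multiplicities p j. fact p / (\<Prod>i<j. fact (\<nu> i)) *
                 (\<Prod>i<j. solution_coeff \<delta> m0 p f Y i y ^ \<nu> i)))"

declare solution_coeff.simps [simp del]

text \<open>The power series are in the variable \<open>\<lambda>\<close>, hence the signs.\<close>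

definition solution_series ::
    "real \<Rightarrow> real \<Rightarrow> nat \<Rightarrow> (real ^ 'd \<Rightarrow> real) \<Rightarrow> (real \<times> (real ^ 'd) \<Rightarrow> real) \<Rightarrow> real \<times> (real ^ 'd) \<Rightarrow> real fps"
where
  "solution_series \<delta> m0 p f Y x = Abs_fps (\<lambda>j. (- 1) ^ j * solution_coeff \<delta> m0 p f Y j x)"

section \<open>Moments and truncated moments\<close>

definition moment_series :: "'w measure \<Rightarrow> ('i \<Rightarrow> 'w \<Rightarrow> real fps) \<Rightarrow> 'i set \<Rightarrow> real fps" where
  "moment_series P F A = Abs_fps (\<lambda>m. LINT \<omega> | P. fps_nth (\<Prod>i\<in>A. F i \<omega>) m)"

text \<open>The defining relation of the truncated moments, solved for the term of the one-block
  partition; see \<open>moment_eq_sum_truncated\<close> below.\<close>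

function truncated :: "('i set \<Rightarrow> 'a::comm_ring_1) \<Rightarrow> 'i set \<Rightarrow> 'a" where
  "truncated M A =
     (if finite A then
        M A - (\<Sum>I\<in>{I. partition_on A I \<and> I \<noteq> {A}}. \<Prod>B\<in>I. truncated M B)
      else 0)"
  by pat_completeness auto
termination
proof (relation "Wellfounded.measure (\<lambda>(M, A). card A)", goal_cases)
  case (2 M A I B)
  then have fin: "finite A" and I: "partition_on A I" "I \<noteq> {A}" and B: "B \<in> I" by auto
  have sub: "B \<subseteq> A" using partition_onD1[OF I(1)] B by blast
  have "B \<noteq> A"
  proof
    assume "B = A"
    have "C = A" if "C \<in> I" for C
    proof (rule ccontr)
      assume "C \<noteq> A"
      then have "C \<inter> A = {}"
        using partition_onD2[OF I(1)] B that \<open>B = A\<close> by (auto simp: disjoint_def)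
      moreover have "C \<subseteq> A" "C \<noteq> {}"
        using partition_onD1[OF I(1)] partition_onD3[OF I(1)] that by blast+
      ultimately show False by blast
    qed
    then have "I = {A}" using B \<open>B = A\<close> by blast
    then show False using I(2) by simp
  qed
  with sub fin show ?case by (simp add: psubset_card_mono)
qed simp

declare truncated.simps [simp del]

lemma moment_eq_sum_truncated:
  assumes "finite A" "A \<noteq> {}"
  shows "M A = (\<Sum>I\<in>{I. partition_on A I}. \<Prod>B\<in>I. truncated M B)"
proof -
  let ?S = "{I. partition_on A I \<and> I \<noteq> {A}}"
  have "{I. partition_on A I} \<subseteq> Pow (Pow A)"
    by (auto simp: partition_on_def)
  then have fin: "finite ?S"
    using finite_subset assms(1) by fastforce
  have eq: "{I. partition_on A I} = insert {A} ?S"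
    using partition_on_space[OF assms(2)] by auto
  have "(\<Sum>I\<in>{I. partition_on A I}. \<Prod>B\<in>I. truncated M B) =
        truncated M A + (\<Sum>I\<in>?S. \<Prod>B\<in>I. truncated M B)"
    unfolding eq by (simp add: sum.insert[OF fin])
  also have "\<dots> = M A"
    using assms(1) by (subst truncated.simps) simp
  finally show ?thesis by simp
qed

section \<open>Trees\<close>

text \<open>The root is left implicit: a term stands for the part of the tree hanging from the root,
  and the argument of \<open>Inner\<close> lists the subtrees attached to an inner vertex. Since the order among
  leaves and among subtrees with different numbers of inner vertices carries no information, the
  list is put in a normal form: first the leaves of type one, then those of type two, then
  the subtrees with one inner vertex, those with two, and so on. Thus it amounts to the numbers of
  leaves of either type together with, for each \<open>i \<ge> 1\<close>, the list of subtrees with \<open>i\<close> inner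
  vertices.\<close>

datatype ptree = Leaf1 | Leaf2 | Inner "ptree list"

fun inner_count :: "ptree \<Rightarrow> nat" where
  "inner_count Leaf1 = 0"
| "inner_count Leaf2 = 0"
| "inner_count (Inner ts) = Suc (sum_list (map inner_count ts))"

fun sort_key :: "ptree \<Rightarrow> nat" where
  "sort_key Leaf1 = 0"
| "sort_key Leaf2 = 1"
| "sort_key (Inner ts) = 1 + inner_count (Inner ts)"

fun admissible :: "nat \<Rightarrow> ptree \<Rightarrow> bool" where
  "admissible p Leaf1 \<longleftrightarrow> True"
| "admissible p Leaf2 \<longleftrightarrow> True"
| "admissible p (Inner ts) \<longleftrightarrow>
     length ts = p \<and> sorted (map sort_key ts) \<and> (\<forall>t\<in>set ts. admissible p t)"

definition trees :: "nat \<Rightarrow> nat \<Rightarrow> ptree set" where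
  "trees p j = {T. admissible p T \<and> inner_count T = j}"

text \<open>A vertex other than the root is addressed by the path of child positions leading to it; the
  empty path is the neighbour of the root. The function returns the subtree from there on.\<close>

fun subtree_at :: "ptree \<Rightarrow> nat list \<Rightarrow> ptree option" where
  "subtree_at T [] = Some T"
| "subtree_at (Inner ts) (i # w) = (if i < length ts then subtree_at (ts ! i) w else None)"
| "subtree_at _ (i # w) = None"

definition vertex_factor :: "nat \<Rightarrow> ptree list \<Rightarrow> real" where
  "vertex_factor p ts =
     fact p / (fact (count_list ts Leaf1) * fact (count_list ts Leaf2) *
               (\<Prod>i=1..inner_count (Inner ts). fact (length (filter (\<lambda>t. inner_count t = i) ts))))"

section \<open>Generalized Parisi--Wu graphs\<close>

text \<open>A graph is given by a list of trees and a partition of their leaves of type one. The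
  trees, and hence their roots, are numbered from \<open>0\<close>.\<close>

type_synonym address = "nat \<times> nat list"

definition addresses :: "ptree list \<Rightarrow> address set" where
  "addresses Ts = {(i, w). i < length Ts \<and> subtree_at (Ts ! i) w \<noteq> None}"

definition leaves1 :: "ptree list \<Rightarrow> address set" where
  "leaves1 Ts = {(i, w). i < length Ts \<and> subtree_at (Ts ! i) w = Some Leaf1}"

definition leaves2 :: "ptree list \<Rightarrow> address set" where
  "leaves2 Ts = {(i, w). i < length Ts \<and> subtree_at (Ts ! i) w = Some Leaf2}"

definition inner_addresses :: "ptree list \<Rightarrow> address set" where
  "inner_addresses Ts = {(i, w). i < length Ts \<and> (\<exists>ts. subtree_at (Ts ! i) w = Some (Inner ts))}"

fun children_at :: "ptree list \<Rightarrow> address \<Rightarrow> ptree list" where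
  "children_at Ts (i, w) = (case subtree_at (Ts ! i) w of Some (Inner ts) \<Rightarrow> ts | _ \<Rightarrow> [])"

datatype vertex = Root nat | Tree_Vertex address | Empty_Vertex "address set"

text \<open>\<open>Tree_Edge u\<close> joins the tree vertex at \<open>u\<close> to its neighbour towards the root, and
  \<open>Noise_Edge u\<close> is the edge that leads to the empty vertex of the leaf at \<open>u\<close>. All edges are oriented
  away from the roots.\<close>

datatype edge = Tree_Edge address | Noise_Edge address

fun parent :: "address \<Rightarrow> vertex" where
  "parent (i, w) = (if w = [] then Root i else Tree_Vertex (i, butlast w))"

definition block_of :: "address set set \<Rightarrow> address \<Rightarrow> address set" where
  "block_of I u = (THE B. B \<in> I \<and> u \<in> B)"

definition pw_graph :: "ptree list \<Rightarrow> address set set \<Rightarrow> (vertex, edge) pre_digraph" where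
  "pw_graph Ts I =
     \<lparr> verts = Root ` {..<length Ts} \<union> Tree_Vertex ` addresses Ts \<union> Empty_Vertex ` I,
       arcs = Tree_Edge ` addresses Ts \<union> Noise_Edge ` leaves1 Ts,
       tail = (\<lambda>e. case e of Tree_Edge u \<Rightarrow> parent u | Noise_Edge u \<Rightarrow> Tree_Vertex u),
       head = (\<lambda>e. case e of Tree_Edge u \<Rightarrow> Tree_Vertex u | Noise_Edge u \<Rightarrow> Empty_Vertex (block_of I u)) \<rparr>"

text \<open>Here each leaf of type one, together with its two edges, is replaced by a single edge.\<close>

definition reduced_graph :: "ptree list \<Rightarrow> address set set \<Rightarrow> (vertex, edge) pre_digraph" where
  "reduced_graph Ts I =
     \<lparr> verts = Root ` {..<length Ts} \<union> Tree_Vertex ` (addresses Ts - leaves1 Ts) \<union> Empty_Vertex ` I,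
       arcs = Tree_Edge ` (addresses Ts - leaves1 Ts) \<union> Noise_Edge ` leaves1 Ts,
       tail = (\<lambda>e. case e of Tree_Edge u \<Rightarrow> parent u | Noise_Edge u \<Rightarrow> parent u),
       head = (\<lambda>e. case e of Tree_Edge u \<Rightarrow> Tree_Vertex u | Noise_Edge u \<Rightarrow> Empty_Vertex (block_of I u)) \<rparr>"

definition connected_pw_graphs :: "nat \<Rightarrow> nat \<Rightarrow> nat \<Rightarrow> (ptree list \<times> address set set) set" where
  "connected_pw_graphs p m n =
     {(Ts, I). length Ts = n \<and> (\<forall>T\<in>set Ts. \<exists>j. T \<in> trees p j) \<and> sum_list (map inner_count Ts) = m \<and>
        partition_on (leaves1 Ts) I \<and> Digraph_Component.connected (pw_graph Ts I)}"

text \<open>As reduced graphs are counted once for each original graph, they are indexed by the same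
  pairs \<open>(Ts, I)\<close>.\<close>

definition noise_pw_graphs :: "nat \<Rightarrow> nat \<Rightarrow> nat \<Rightarrow> (ptree list \<times> address set set) set" where
  "noise_pw_graphs p m n = {(Ts, I) \<in> connected_pw_graphs p m n. leaves2 Ts = {}}"

section \<open>Values of graphs\<close>

text \<open>The roots sit at \<open>(0, x i)\<close>; the variables of all other vertices are given by \<open>y\<close>.\<close>

fun position ::
    "(nat \<Rightarrow> real ^ 'd) \<Rightarrow> (vertex \<Rightarrow> real \<times> (real ^ 'd)) \<Rightarrow> vertex \<Rightarrow> real \<times> (real ^ 'd)" where
  "position x y (Root i) = (0, x i)"
| "position x y v = y v"

definition graph_value ::
    "real \<Rightarrow> real \<Rightarrow> nat \<Rightarrow> (nat \<Rightarrow> real) \<Rightarrow> (nat \<Rightarrow> real ^ 'd) \<Rightarrow> ptree list \<times> address set set \<Rightarrow> real"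
where
  "graph_value \<delta> m0 p c x = (\<lambda>(Ts, I).
     let H = reduced_graph Ts I; V = verts H - range Root in
       (\<Prod>u\<in>inner_addresses Ts. vertex_factor p (children_at Ts u)) *
       (\<Prod>B\<in>I. c (card B)) *
       (LINT y : (\<Pi>\<^sub>E v\<in>V. Gam_neg \<delta>) | (\<Pi>\<^sub>M v\<in>V. Gam_measure \<delta>).
          \<Prod>e\<in>arcs H. green \<delta> m0 (position x y (tail H e) - position x y (head H e))))"

definition limit_series ::
    "real \<Rightarrow> real \<Rightarrow> nat \<Rightarrow> (nat \<Rightarrow> real) \<Rightarrow> nat \<Rightarrow> (nat \<Rightarrow> real ^ 'd) \<Rightarrow> real fps" where
  "limit_series \<delta> m0 p c n x =
     Abs_fps (\<lambda>m. (- 1) ^ m * (\<Sum>g\<in>noise_pw_graphs p m n. graph_value \<delta> m0 p c x g))"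

end

theory Submission imports Defs begin

text \<open>Iterating the mild equation and expanding the powers multinomially writes the coefficient
  \<open>X\<^sub>j\<close> as a sum over rooted trees with \<open>j\<close> inner vertices, whose leaves of type one carry
  \<open>G * \<eta>\<close> and whose leaves of type two carry the evolved initial value. The joint characteristic function of
  the variables \<open>(G * \<eta>)(x)\<close> gives their moments as sums over partitions, with a factor \<open>c\<^sub>l\<close> and an integral over an
  empty vertex for each block of size \<open>l\<close>; with Fubini, moments of \<open>X\<close> become sums over all graphs.
  The value of a graph is the product over its connected components, so the recursion
  for the truncated moments selects the connected graphs. Finally all time variables are translated by \<open>t\<close>: the roots
  move to time \<open>0\<close>, the restriction of the empty vertices to positive times becomes a restriction to times above \<open>-t\<close>,
  each leaf of type two contributes a factor of order \<open>exp (- m0\<^sup>2 t)\<close>, and dominated convergence applies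
  because \<open>G\<close> is nonnegative, bounded and integrable.\<close>

section \<open>The lattice heat kernel\<close>

text \<open>Positivity of G is invisible in its Fourier integral. On lattice points that integral
  factorises over the coordinates, and each factor is a power series with nonnegative coefficients;
  mass, supremum and integral of G all come from there. The noise is known only through its
  characteristic functional, so existence of moments has to be proved before any formula for them:
  difference quotients and Fatou give even moments, and the bounds must be uniform in the points
  because these become integration variables. The iterated integrals defining X_j exist pathwise
  only almost surely, while a Bochner integral that does not exist is 0; hence absolute tree
  integrals are followed as extended reals, and the expansion in trees is asserted outside null sets
  of paths and of intermediate points. The combinatorics is proved for an abstract kernel,
  instantiated once with the noise and once with trivial leaves, which yields the dominating
  function. Integration over negative times in the limit is a consequence of causality: an edge
  vanishes unless its far end is earlier, and the roots sit at time 0.\<close>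

text \<open>Modified Bessel functions of integer order: \<open>walk_count n k\<close> is the number of walks of
  length \<open>n\<close> from \<open>0\<close> to \<open>k\<close> on the integers.\<close>

definition walk_count :: "nat \<Rightarrow> int \<Rightarrow> real" where
  "walk_count n k = (\<Sum>j\<le>n. if 2 * int j - int n = k then real (n choose j) else 0)"

definition bessel :: "real \<Rightarrow> int \<Rightarrow> real" where
  "bessel s k = (\<Sum>n. (s / 2) ^ n / fact n * walk_count n k)"

lemma walk_count_nonneg: "walk_count n k \<ge> 0"
  unfolding walk_count_def by (intro sum_nonneg) auto

lemma walk_count_le: "walk_count n k \<le> 2 ^ n"
proof -
  have "walk_count n k \<le> (\<Sum>j\<le>n. real (n choose j))"
    unfolding walk_count_def by (intro sum_mono) auto
  also have "\<dots> = real (\<Sum>j\<le>n. n choose j)" by simp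
  also have "\<dots> = 2 ^ n" by (simp only: choose_row_sum) simp
  finally show ?thesis .
qed

lemma nn_integral_walk_count: "(\<integral>\<^sup>+k. ennreal (walk_count n k) \<partial>count_space UNIV) = ennreal (2 ^ n)"
proof -
  have "(\<integral>\<^sup>+k. ennreal (walk_count n k) \<partial>count_space UNIV) =
      (\<integral>\<^sup>+k. (\<Sum>j\<le>n. ennreal (real (n choose j)) * indicator {2 * int j - int n} k) \<partial>count_space UNIV)"
  proof (rule nn_integral_cong)
    fix k
    have "ennreal (walk_count n k) = (\<Sum>j\<le>n. ennreal (if 2 * int j - int n = k then real (n choose j) else 0))"
      unfolding walk_count_def by (intro sum_ennreal[symmetric]) auto
    also have "\<dots> = (\<Sum>j\<le>n. ennreal (real (n choose j)) * indicator {2 * int j - int n} k)"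
      by (intro sum.cong refl) (auto simp: indicator_def)
    finally show "ennreal (walk_count n k) = (\<Sum>j\<le>n. ennreal (real (n choose j)) * indicator {2 * int j - int n} k)" .
  qed
  also have "\<dots> = (\<Sum>j\<le>n. ennreal (real (n choose j)))"
    by (subst nn_integral_sum) (auto simp: nn_integral_cmult)
  also have "\<dots> = ennreal (real (\<Sum>j\<le>n. n choose j))" by (simp add: sum_ennreal)
  also have "\<dots> = ennreal (2 ^ n)" by (simp only: choose_row_sum) simp
  finally show ?thesis .
qed

text \<open>The bound 2^n on the number of walks cancels the halving of s, so the exponential series
  of \<bar>s\<bar> dominates.\<close>

lemma bessel_sums: "(\<lambda>n. (s / 2) ^ n / fact n * walk_count n k) sums bessel s k"
  unfolding bessel_def
proof (rule summable_sums, rule summable_comparison_test')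
  show "summable (\<lambda>n. inverse (fact n) * \<bar>s\<bar> ^ n)" by (rule summable_exp)
  fix n :: nat
  have "norm ((s / 2) ^ n / fact n * walk_count n k) = \<bar>s / 2\<bar> ^ n / fact n * walk_count n k"
    using walk_count_nonneg[of n k] by (simp add: abs_mult power_abs)
  also have "\<dots> \<le> \<bar>s / 2\<bar> ^ n / fact n * 2 ^ n"
    by (intro mult_left_mono walk_count_le) simp
  also have "\<dots> = inverse (fact n) * \<bar>s\<bar> ^ n"
    by (simp add: power_divide field_simps)
  finally show "norm ((s / 2) ^ n / fact n * walk_count n k) \<le> inverse (fact n) * \<bar>s\<bar> ^ n" .
qed

lemma bessel_nonneg: "s \<ge> 0 \<Longrightarrow> bessel s k \<ge> 0"
  unfolding bessel_def using sums_summable[OF bessel_sums] walk_count_nonneg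
  by (intro suminf_nonneg) auto

lemma bessel_measurable [measurable]: "(\<lambda>s. bessel s k) \<in> borel_measurable borel"
  unfolding bessel_def by measurable

text \<open>Every walk ends at some k, so the counts of length n add up to 2^n and the exponential
  series reappears. With the lattice weights this becomes the total mass of the heat kernel.\<close>

lemma nn_integral_bessel:
  assumes "s \<ge> 0"
  shows "(\<integral>\<^sup>+k. ennreal (bessel s k) \<partial>count_space UNIV) = ennreal (exp s)"
proof -
  have "(\<integral>\<^sup>+k. ennreal (bessel s k) \<partial>count_space UNIV) =
      (\<integral>\<^sup>+k. (\<Sum>n. ennreal ((s / 2) ^ n / fact n * walk_count n k)) \<partial>count_space UNIV)"
    unfolding bessel_def using assms walk_count_nonneg sums_summable[OF bessel_sums]
    by (intro nn_integral_cong suminf_ennreal2[symmetric]) auto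
  also have "\<dots> = (\<Sum>n. \<integral>\<^sup>+k. ennreal ((s / 2) ^ n / fact n * walk_count n k) \<partial>count_space UNIV)"
    by (intro nn_integral_suminf) auto
  also have "\<dots> = (\<Sum>n. ennreal (s ^ n /\<^sub>R fact n))"
  proof (rule suminf_cong)
    fix n
    have "(\<integral>\<^sup>+k. ennreal ((s / 2) ^ n / fact n * walk_count n k) \<partial>count_space UNIV) =
        (\<integral>\<^sup>+k. ennreal ((s / 2) ^ n / fact n) * ennreal (walk_count n k) \<partial>count_space UNIV)"
      using assms walk_count_nonneg by (intro nn_integral_cong ennreal_mult) auto
    also have "\<dots> = ennreal ((s / 2) ^ n / fact n) * ennreal (2 ^ n)"
      by (simp add: nn_integral_cmult nn_integral_walk_count)
    also have "\<dots> = ennreal (s ^ n /\<^sub>R fact n)"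
    proof -
      have "(s / 2) ^ n / fact n * 2 ^ n = s ^ n /\<^sub>R fact n"
        by (simp add: power_divide field_simps)
      then show ?thesis using assms by (subst ennreal_mult[symmetric]) auto
    qed
    finally show "(\<integral>\<^sup>+k. ennreal ((s / 2) ^ n / fact n * walk_count n k) \<partial>count_space UNIV) = ennreal (s ^ n /\<^sub>R fact n)" .
  qed
  also have "\<dots> = ennreal (exp s)"
    using exp_converges[of s] assms by (intro suminf_ennreal_eq) auto
  finally show ?thesis .
qed

section \<open>Fourier coefficients of exp (s cos \<theta>) and the product form of the heat
  kernel\<close>

lemma integral_exp_int_period:
  fixes l :: int
  assumes "\<delta> > 0"
  shows "has_bochner_integral lborel (\<lambda>q. indicator {0..2 * pi / \<delta>} q *\<^sub>R exp (\<i> * of_real (of_int l * (\<delta> * q))))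
    (if l = 0 then of_real (2 * pi / \<delta>) else 0)"
proof (cases "l = 0")
  case True
  have "has_bochner_integral lborel (\<lambda>q. indicator {0..2 * pi / \<delta>} q *\<^sub>R (1::complex)) (of_real (2 * pi / \<delta>) - of_real 0)"
  proof (rule has_bochner_integral_FTC_Icc)
    fix x :: real
    have "(complex_of_real has_vector_derivative 1) (at x)"
      using has_vector_derivative_real_field[of "\<lambda>z. z" 1 x] by (auto intro!: derivative_eq_intros)
    then show "(complex_of_real has_vector_derivative 1) (at x within {0..2 * pi / \<delta>})"
      by (rule has_vector_derivative_at_within)
  qed (use assms in auto)
  then show ?thesis using True by simp
next
  case False
  let ?c = "\<i> * of_real (of_int l * \<delta>)"
  have c0: "?c \<noteq> 0" using False assms by auto
  have "has_bochner_integral lborel (\<lambda>q. indicator {0..2 * pi / \<delta>} q *\<^sub>R exp (?c * of_real q))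
     (exp (?c * of_real (2 * pi / \<delta>)) / ?c - exp (?c * of_real 0) / ?c)"
  proof (rule has_bochner_integral_FTC_Icc)
    fix x :: real
    have "((\<lambda>w. exp (?c * w) / ?c) has_field_derivative exp (?c * of_real x)) (at (of_real x))"
      using c0 by (auto intro!: derivative_eq_intros)
    from has_vector_derivative_real_field[OF this]
    show "((\<lambda>q. exp (?c * of_real q) / ?c) has_vector_derivative exp (?c * of_real x)) (at x within {0..2 * pi / \<delta>})"
      by (rule has_vector_derivative_at_within)
  qed (use assms in \<open>auto intro!: continuous_intros\<close>)
  moreover have "exp (?c * of_real (2 * pi / \<delta>)) = 1"
  proof -
    have "?c * of_real (2 * pi / \<delta>) = 2 * of_int l * of_real pi * \<i>" using assms by simp
    then show ?thesis by (auto simp: exp_eq_1)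
  qed
  ultimately show ?thesis using False by (simp add: mult.assoc)
qed

text \<open>The Jacobi-Anger expansion: powers of the cosine are expanded binomially into
  characters, and orthogonality over one period keeps those with \<open>2 * j - n = k\<close>, which
  is exactly what \<open>walk_count\<close> counts. Sum and integral are exchanged because the terms
  are dominated by the exponential series of \<bar>s\<bar> on an interval of finite length.\<close>

lemma fourier_exp_cos:
  fixes k :: int
  assumes \<delta>: "\<delta> > 0"
  shows "has_bochner_integral lborel
    (\<lambda>q. indicator {0..2 * pi / \<delta>} q *\<^sub>R (exp (- \<i> * of_real (q * (\<delta> * of_int k))) * of_real (exp (s * cos (\<delta> * q)))))
    (of_real (2 * pi / \<delta> * bessel s k))"
proof -
  let ?I = "{0..2 * pi / \<delta>}"
  define e where "e = (\<lambda>q. exp (- \<i> * of_real (q * (\<delta> * of_int k))))"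
  define f where "f = (\<lambda>n q. indicator ?I q *\<^sub>R (e q * of_real ((s * cos (\<delta> * q)) ^ n / fact n)))"
  have [measurable]: "e \<in> borel_measurable borel" unfolding e_def by measurable
  have ne: "norm (e q) = 1" for q by (simp add: e_def)
  have expand: "f n q = of_real ((s / 2) ^ n / fact n) *
     (\<Sum>j\<le>n. of_nat (n choose j) * (indicator ?I q *\<^sub>R exp (\<i> * of_real (of_int (2 * int j - int n - k) * (\<delta> * q)))))" for n q
  proof -
    let ?z = "exp (\<i> * of_real (\<delta> * q))" and ?w = "exp (- (\<i> * of_real (\<delta> * q)))"
    have "of_real (cos (\<delta> * q)) = (?z + ?w) / 2" by (simp add: cos_of_real[symmetric] cos_exp_eq)
    then have "of_real ((s * cos (\<delta> * q)) ^ n / fact n) = (of_real s * ((?z + ?w) / 2)) ^ n / fact n"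
      by (simp only: of_real_power of_real_mult of_real_divide of_real_fact)
    also have "\<dots> = of_real ((s / 2) ^ n / fact n) * (?z + ?w) ^ n"
      by (simp add: power_mult_distrib power_divide)
    also have "(?z + ?w) ^ n = (\<Sum>j\<le>n. of_nat (n choose j) * ?z ^ j * ?w ^ (n - j))"
      by (rule binomial_ring)
    finally have "f n q = of_real ((s / 2) ^ n / fact n) *
       (\<Sum>j\<le>n. of_nat (n choose j) * (indicator ?I q *\<^sub>R (e q * (?z ^ j * ?w ^ (n - j)))))"
      by (simp only: f_def sum_distrib_left scaleR_conv_of_real mult_ac)
    moreover have "e q * (?z ^ j * ?w ^ (n - j)) = exp (\<i> * of_real (of_int (2 * int j - int n - k) * (\<delta> * q)))" if "j \<le> n" for j
      using that by (simp add: e_def exp_of_nat_mult[symmetric] mult_exp_exp algebra_simps of_nat_diff)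
    ultimately show ?thesis by simp
  qed
  have f_int: "has_bochner_integral lborel (f n) (of_real (2 * pi / \<delta> * ((s / 2) ^ n / fact n * walk_count n k)))" for n
  proof -
    have "has_bochner_integral lborel (\<lambda>q. of_real ((s / 2) ^ n / fact n) *
     (\<Sum>j\<le>n. of_nat (n choose j) * (indicator ?I q *\<^sub>R exp (\<i> * of_real (of_int (2 * int j - int n - k) * (\<delta> * q))))))
     (of_real ((s / 2) ^ n / fact n) *
     (\<Sum>j\<le>n. of_nat (n choose j) * (if 2 * int j - int n - k = 0 then of_real (2 * pi / \<delta>) else 0)))"
      by (intro has_bochner_integral_mult_right has_bochner_integral_sum integral_exp_int_period \<delta>)
    moreover have "of_real ((s / 2) ^ n / fact n) *
     (\<Sum>j\<le>n. of_nat (n choose j) * (if 2 * int j - int n - k = 0 then of_real (2 * pi / \<delta>) else 0)) =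
      complex_of_real ((s / 2) ^ n / fact n * (2 * pi / \<delta> * walk_count n k))"
    proof -
      have "(\<Sum>j\<le>n. of_nat (n choose j) * (if 2 * int j - int n - k = 0 then of_real (2 * pi / \<delta>) else 0)) =
          complex_of_real (2 * pi / \<delta> * walk_count n k)"
        unfolding walk_count_def sum_distrib_left of_real_sum by (intro sum.cong refl) auto
      then show ?thesis by (simp only: of_real_mult)
    qed
    moreover have "f n = (\<lambda>q. of_real ((s / 2) ^ n / fact n) *
     (\<Sum>j\<le>n. of_nat (n choose j) * (indicator ?I q *\<^sub>R exp (\<i> * of_real (of_int (2 * int j - int n - k) * (\<delta> * q))))))"
      by (rule ext) (rule expand)
    ultimately show ?thesis by (simp add: mult_ac)
  qed
  have fle: "norm (f n q) \<le> indicator ?I q *\<^sub>R (inverse (fact n) * \<bar>s\<bar> ^ n)" for n q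
  proof -
    have "\<bar>s * cos (\<delta> * q)\<bar> ^ n \<le> \<bar>s\<bar> ^ n"
      using mult_left_mono[OF abs_cos_le_one[of "\<delta> * q"], of "\<bar>s\<bar>"] by (intro power_mono) (auto simp: abs_mult)
    then show ?thesis
      by (auto simp: f_def norm_mult ne indicator_def norm_divide norm_power divide_inverse abs_mult power_abs
        mult.commute intro!: mult_left_mono simp flip: of_real_mult of_real_power)
  qed
  have b_int: "has_bochner_integral lborel (\<lambda>q. indicator ?I q *\<^sub>R (inverse (fact n) * \<bar>s\<bar> ^ n)) (2 * pi / \<delta> * (inverse (fact n) * \<bar>s\<bar> ^ n))" for n
  proof -
    have "has_bochner_integral lborel (\<lambda>q. indicator ?I q *\<^sub>R (inverse (fact n) * \<bar>s\<bar> ^ n))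
       (measure lborel ?I *\<^sub>R (inverse (fact n) * \<bar>s\<bar> ^ n))"
      by (intro has_bochner_integral_scaleR_left has_bochner_integral_real_indicator) (auto simp: emeasure_lborel_Icc_eq)
    moreover have "measure lborel ?I = 2 * pi / \<delta>" using \<delta> by (subst measure_lborel_Icc) auto
    ultimately show ?thesis by (simp only: real_scaleR_def)
  qed
  have int: "integrable lborel (f n)" for n using f_int has_bochner_integral_iff by blast
  have sm: "summable (\<lambda>n. norm (f n q))" for q
    by (rule summable_comparison_test'[OF summable_scaleR_right[OF summable_exp[of "\<bar>s\<bar>"], of "indicator ?I q"]])
      (simp only: real_norm_def abs_norm_cancel fle)
  have smi: "summable (\<lambda>n. LINT q | lborel. norm (f n q))"
  proof (rule summable_comparison_test'[where g = "\<lambda>n. 2 * pi / \<delta> * (inverse (fact n) * \<bar>s\<bar> ^ n)"])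
    show "summable (\<lambda>n. 2 * pi / \<delta> * (inverse (fact n) * \<bar>s\<bar> ^ n))"
      by (intro summable_mult summable_exp)
    fix n
    have "(LINT q | lborel. norm (f n q)) \<le> (LINT q | lborel. indicator ?I q *\<^sub>R (inverse (fact n) * \<bar>s\<bar> ^ n))"
      using b_int[of n] int[of n] fle by (intro integral_mono integrable_norm) (auto simp: has_bochner_integral_iff)
    also have "\<dots> = 2 * pi / \<delta> * (inverse (fact n) * \<bar>s\<bar> ^ n)"
      using b_int[of n] by (simp only: has_bochner_integral_iff)
    finally show "norm (LINT q | lborel. norm (f n q)) \<le> 2 * pi / \<delta> * (inverse (fact n) * \<bar>s\<bar> ^ n)"
      by (simp add: integral_nonneg_AE)
  qed
  have fs: "(\<Sum>n. f n q) = indicator ?I q *\<^sub>R (e q * of_real (exp (s * cos (\<delta> * q))))" for q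
  proof -
    have "(\<lambda>n. of_real ((s * cos (\<delta> * q)) ^ n / fact n) :: complex) sums of_real (exp (s * cos (\<delta> * q)))"
      using exp_converges[of "s * cos (\<delta> * q)"] by (intro sums_of_real) (simp add: divide_inverse mult.commute)
    then have "f n q = f n q \<and> (\<lambda>n. indicator ?I q *\<^sub>R (e q * of_real ((s * cos (\<delta> * q)) ^ n / fact n))) sums
        (indicator ?I q *\<^sub>R (e q * of_real (exp (s * cos (\<delta> * q)))))" for n
      by (intro conjI refl sums_scaleR_right sums_mult)
    then show ?thesis unfolding f_def by (simp add: sums_iff)
  qed
  have i1: "integrable lborel (\<lambda>q. \<Sum>n. f n q)"
    by (rule integrable_suminf[OF int _ smi]) (use sm in auto)
  have "(\<lambda>n. LINT q | lborel. f n q) sums (LINT q | lborel. (\<Sum>n. f n q))"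
    by (rule sums_integral[OF int _ smi]) (use sm in auto)
  moreover have "(LINT q | lborel. f n q) = of_real (2 * pi / \<delta> * ((s / 2) ^ n / fact n * walk_count n k))" for n
    using f_int[of n] by (simp only: has_bochner_integral_iff)
  moreover have "(\<lambda>n. complex_of_real (2 * pi / \<delta> * ((s / 2) ^ n / fact n * walk_count n k))) sums of_real (2 * pi / \<delta> * bessel s k)"
    by (intro sums_of_real sums_mult bessel_sums)
  ultimately have "(LINT q | lborel. (\<Sum>n. f n q)) = of_real (2 * pi / \<delta> * bessel s k)"
    using sums_unique2 by (simp only:)
  then show ?thesis using i1 unfolding fs by (simp only: has_bochner_integral_iff e_def)
qed

text \<open>Lebesgue measure on vectors is presented as the image of a product measure indexed by
  basis vectors, not by coordinates; hence the detour through \<open>axis j 1\<close>.\<close>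

lemma integral_lborel_vec_prod:
  fixes f :: "'d::finite \<Rightarrow> real \<Rightarrow> complex"
  assumes int: "\<And>j. integrable lborel (f j)"
  shows "(LINT q | lborel. (\<Prod>j\<in>UNIV. f j ((q :: real ^ 'd) $ j))) = (\<Prod>j\<in>UNIV. LINT q | lborel. f j q)"
proof -
  \<comment> \<open>The factor belonging to a basis vector; the description recovers the coordinate
    whose axis it is.\<close>
  define g where "g = (\<lambda>b :: real ^ 'd. f (THE j. b = axis j 1))"
  have g: "g (axis j 1) = f j" for j
    unfolding g_def by (rule arg_cong[where f = f]) (auto simp: axis_eq_axis)
  have B: "(Basis :: (real ^ 'd) set) = range (\<lambda>j. axis j 1)"
    by (auto simp: Basis_vec_def)
  have inj: "inj (\<lambda>j. axis j 1 :: real ^ 'd)" by (auto simp: inj_def axis_eq_axis)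
  have re: "(\<Prod>b\<in>Basis. h b) = (\<Prod>j\<in>UNIV. h (axis j 1))" for h :: "real ^ 'd \<Rightarrow> complex"
    unfolding B by (subst prod.reindex[OF inj]) simp
  interpret product_sigma_finite "\<lambda>_ :: real ^ 'd. lborel :: real measure"
    by unfold_locales
  have gi: "integrable lborel (g b)" if "b \<in> Basis" for b using that int g by (auto simp: B)
  have [measurable]: "f j \<in> borel_measurable borel" for j
    using borel_measurable_integrable[OF int[of j]] by simp
  have "(LINT q | lborel. (\<Prod>j\<in>UNIV. f j ((q :: real ^ 'd) $ j))) =
     (LINT x | (\<Pi>\<^sub>M b\<in>Basis. lborel). (\<Prod>j\<in>UNIV. f j ((\<Sum>b\<in>Basis. x b *\<^sub>R b :: real ^ 'd) $ j)))"
    by (subst lborel_eq, subst integral_distr) auto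
  also have "\<dots> = (LINT x | (\<Pi>\<^sub>M b\<in>Basis. lborel). (\<Prod>b\<in>Basis. g b (x b)))"
  proof (rule Bochner_Integration.integral_cong)
    fix x :: "real ^ 'd \<Rightarrow> real"
    have "(\<Sum>b\<in>Basis. x b *\<^sub>R b :: real ^ 'd) $ j = x (axis j 1)" for j
    proof -
      have "(\<Sum>b\<in>Basis. x b *\<^sub>R b :: real ^ 'd) $ j = (\<Sum>b\<in>Basis. x b *\<^sub>R b) \<bullet> axis j 1"
        by (simp add: inner_axis)
      also have "\<dots> = x (axis j 1)" by (intro inner_sum_left_Basis) (auto simp: B)
      finally show ?thesis .
    qed
    then show "(\<Prod>j\<in>UNIV. f j ((\<Sum>b\<in>Basis. x b *\<^sub>R b :: real ^ 'd) $ j)) = (\<Prod>b\<in>Basis. g b (x b))"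
      by (simp add: re g)
  qed simp
  also have "\<dots> = (\<Prod>b\<in>Basis. LINT q | lborel. g b q)"
    using gi by (intro product_integral_prod) auto
  finally show ?thesis by (simp add: re g)
qed

text \<open>The symbol \<open>mu2\<close> is a constant minus a sum over coordinates, so the
  exponential and the integral factorise. At lattice points the one-dimensional integrals are Bessel
  coefficients, and there the kernel is seen to be nonnegative.\<close>

lemma heat_kernel_lattice:
  fixes k :: "'d::finite \<Rightarrow> int" and x :: "real ^ 'd"
  assumes \<delta>: "\<delta> > 0" and x: "\<And>j. x $ j = \<delta> * of_int (k j)"
  shows "heat_kernel \<delta> m0 t x =
    exp (- t * (2 * real CARD('d) / \<delta>\<^sup>2 + m0\<^sup>2)) * (\<Prod>j\<in>UNIV. bessel (2 * t / \<delta>\<^sup>2) (k j) / \<delta>)"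
proof -
  define s where "s = 2 * t / \<delta>\<^sup>2"
  define f where "f = (\<lambda>j q. indicator {0..2 * pi / \<delta>} q *\<^sub>R
     (exp (- \<i> * of_real (q * (\<delta> * of_int (k j)))) * complex_of_real (exp (s * cos (\<delta> * q)))))"
  define E where "E = exp (- t * (2 * real CARD('d) / \<delta>\<^sup>2 + m0\<^sup>2))"
  have fint: "has_bochner_integral lborel (f j) (of_real (2 * pi / \<delta> * bessel s (k j)))" for j
    unfolding f_def by (rule fourier_exp_cos[OF \<delta>])
  have ptw: "indicator (cbox 0 (\<chi> i. 2 * pi / \<delta>)) q *\<^sub>R
      (exp (- \<i> * of_real (q \<bullet> x)) * exp (- of_real (t * mu2 \<delta> m0 q))) = of_real E * (\<Prod>j\<in>UNIV. f j (q $ j))" for q :: "real ^ 'd"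
  proof -
    have ind: "indicator (cbox 0 (\<chi> i. 2 * pi / \<delta>)) q = (\<Prod>j\<in>UNIV. indicator {0..2 * pi / \<delta>} (q $ j) :: real)"
      by (auto simp: indicator_def cbox_def Basis_vec_def inner_axis)
    have e1: "exp (- \<i> * of_real (q \<bullet> x)) = (\<Prod>j\<in>UNIV. exp (- \<i> * of_real (q $ j * (\<delta> * of_int (k j)))))"
      by (simp add: inner_vec_def x exp_sum[symmetric] sum_distrib_left sum_negf)
    have "- (t * mu2 \<delta> m0 q) = - t * (2 * real CARD('d) / \<delta>\<^sup>2 + m0\<^sup>2) + (\<Sum>j\<in>UNIV. s * cos (\<delta> * q $ j))"
      unfolding mu2_def s_def sum_distrib_left[symmetric] using \<delta> by (simp add: field_simps)
    then have "exp (- (t * mu2 \<delta> m0 q)) = E * (\<Prod>j\<in>UNIV. exp (s * cos (\<delta> * q $ j)))"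
      by (simp only: exp_add exp_sum[OF finite] E_def)
    moreover have "exp (- complex_of_real (t * mu2 \<delta> m0 q)) = of_real (exp (- (t * mu2 \<delta> m0 q)))"
      by (simp only: of_real_minus[symmetric] exp_of_real)
    ultimately have e2: "exp (- complex_of_real (t * mu2 \<delta> m0 q)) = of_real E * (\<Prod>j\<in>UNIV. of_real (exp (s * cos (\<delta> * q $ j))))"
      by (simp only: of_real_mult of_real_prod)
    show ?thesis unfolding ind e1 e2 f_def
      by (simp add: prod.distrib scaleR_conv_of_real mult_ac)
  qed
  have "(CLINT q : cbox 0 (\<chi> i. 2 * pi / \<delta>) | lborel. exp (- \<i> * of_real (q \<bullet> x)) * exp (- of_real (t * mu2 \<delta> m0 q)))
     = of_real E * (\<Prod>j\<in>UNIV. LINT q | lborel. f j q)"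
    unfolding set_lebesgue_integral_def ptw integral_mult_right_zero
    using fint by (subst integral_lborel_vec_prod) (auto simp: has_bochner_integral_iff)
  also have "\<dots> = of_real (E * (\<Prod>j\<in>UNIV. 2 * pi / \<delta> * bessel s (k j)))"
    using fint by (simp add: has_bochner_integral_iff)
  finally have "heat_kernel \<delta> m0 t x = E * (\<Prod>j\<in>UNIV. 2 * pi / \<delta> * bessel s (k j)) / (2 * pi) ^ CARD('d)"
    unfolding heat_kernel_def by (simp only: of_real_divide[symmetric] Re_complex_of_real)
  also have "(\<Prod>j\<in>UNIV. 2 * pi / \<delta> * bessel s (k j)) = (\<Prod>j\<in>UNIV. (2 * pi) * (bessel s (k j) / \<delta>))"
    by (simp add: mult_ac)
  also have "\<dots> = (2 * pi) ^ CARD('d) * (\<Prod>j\<in>UNIV. bessel s (k j) / \<delta>)"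
    by (subst prod.distrib) (simp only: prod_constant)
  finally show ?thesis by (simp add: E_def s_def)
qed

section \<open>The lattice measure and estimates of the kernel\<close>

lemma lattice_bij:
  assumes "\<delta> > 0"
  shows "bij_betw (\<lambda>k::'d::finite \<Rightarrow> int. \<chi> j. \<delta> * of_int (k j)) UNIV (lattice \<delta>)"
proof (rule bij_betwI')
  fix x y :: "'d \<Rightarrow> int"
  show "((\<chi> j. \<delta> * of_int (x j)) = (\<chi> j. \<delta> * of_int (y j))) = (x = y)"
    using assms by (auto simp: vec_eq_iff fun_eq_iff)
  show "(\<chi> j. \<delta> * of_int (x j)) \<in> lattice \<delta>" by (auto simp: lattice_def)
next
  fix v :: "real ^ 'd" assume "v \<in> lattice \<delta>"
  then have "\<forall>j. \<exists>k::int. v $ j = \<delta> * of_int k" by (simp add: lattice_def)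
  then obtain k :: "'d \<Rightarrow> int" where "\<forall>j. v $ j = \<delta> * of_int (k j)" by metis
  then show "\<exists>x\<in>UNIV. v = (\<chi> j. \<delta> * of_int (x j))" by (intro bexI[of _ k]) (auto simp: vec_eq_iff)
qed

lemma lattice_minus: "x \<in> lattice \<delta> \<Longrightarrow> y \<in> lattice \<delta> \<Longrightarrow> x - y \<in> lattice \<delta>"
proof -
  assume a: "x \<in> lattice \<delta>" "y \<in> lattice \<delta>"
  have "\<exists>k::int. (x - y) $ i = \<delta> * of_int k" for i
  proof -
    obtain k l :: int where "x $ i = \<delta> * of_int k" "y $ i = \<delta> * of_int l" using a unfolding lattice_def by blast
    then have "(x - y) $ i = \<delta> * of_int (k - l)" by (simp add: algebra_simps)
    then show ?thesis by blast
  qed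
  then show ?thesis by (simp add: lattice_def)
qed

lemma space_lattice_measure [simp]: "space (lattice_measure \<delta>) = lattice \<delta>"
  and sets_lattice_measure: "sets (lattice_measure \<delta>) = Pow (lattice \<delta>)"
  by (simp_all add: lattice_measure_def)

lemma space_Gam_measure [simp]: "space (Gam_measure \<delta>) = Gam \<delta>"
  by (simp add: Gam_measure_def Gam_def space_pair_measure)

lemma nn_integral_lattice_measure:
  "(\<integral>\<^sup>+x. f x \<partial>(lattice_measure \<delta> :: (real ^ 'd::finite) measure)) =
     (\<integral>\<^sup>+x. ennreal (\<delta> ^ CARD('d)) * f x \<partial>count_space (lattice \<delta>))"
  unfolding lattice_measure_def by (subst nn_integral_density) auto

lemma measurable_Gam_snd: "snd \<in> Gam_measure \<delta> \<rightarrow>\<^sub>M count_space (lattice \<delta> :: (real ^ 'd::finite) set)"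
proof -
  have e: "sets (count_space (lattice \<delta>) :: (real ^ 'd) measure) = sets (lattice_measure \<delta>)"
    by (simp add: sets_lattice_measure)
  show ?thesis
    unfolding Gam_measure_def measurable_cong_sets[OF refl e] by (rule measurable_snd)
qed

lemma measurable_Gam_fst: "fst \<in> borel_measurable (Gam_measure \<delta> :: (real \<times> (real ^ 'd::finite)) measure)"
  unfolding Gam_measure_def using measurable_fst[of lborel "lattice_measure \<delta> :: (real ^ 'd) measure"] by simp

locale lattice_kernel =
  fixes \<delta> m0 :: real
  assumes \<delta>: "\<delta> > 0" and m0: "m0 > 0"
begin

lemma countable_lattice: "countable (lattice \<delta> :: (real ^ 'd::finite) set)"
  using lattice_bij[OF \<delta>] by (metis bij_betw_imp_surj_on countable_image countableI_type)

lemma sigma_finite_lattice_measure: "sigma_finite_measure (lattice_measure \<delta> :: (real ^ 'd::finite) measure)"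
proof -
  interpret sigma_finite_measure "count_space (lattice \<delta> :: (real ^ 'd) set)"
    by (rule sigma_finite_measure_count_space_countable[OF countable_lattice])
  show ?thesis unfolding lattice_measure_def
    by (intro sigma_finite_iff_density_finite[THEN iffD2]) auto
qed

lemma sigma_finite_Gam_measure: "sigma_finite_measure (Gam_measure \<delta> :: (real \<times> (real ^ 'd::finite)) measure)"
proof -
  interpret l: sigma_finite_measure "lattice_measure \<delta> :: (real ^ 'd) measure" by (rule sigma_finite_lattice_measure)
  interpret pair_sigma_finite "lborel :: real measure" "lattice_measure \<delta> :: (real ^ 'd) measure" by unfold_locales
  show ?thesis unfolding Gam_measure_def by (rule sigma_finite_measure_axioms)
qed

text \<open>There are only countably many lattice points and every subset of the lattice is
  measurable, so measurability has to be checked in time only, for one lattice point after the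
  other.\<close>

lemma measurable_Gam_iff:
  fixes f :: "real \<times> (real ^ 'd::finite) \<Rightarrow> 'b"
  assumes "\<And>x. x \<in> lattice \<delta> \<Longrightarrow> (\<lambda>t. f (t, x)) \<in> borel \<rightarrow>\<^sub>M N"
  shows "f \<in> Gam_measure \<delta> \<rightarrow>\<^sub>M N"
proof -
  have a: "(\<lambda>y. f (fst y, x)) \<in> Gam_measure \<delta> \<rightarrow>\<^sub>M N" if "x \<in> lattice \<delta>" for x
    by (rule measurable_compose[OF measurable_Gam_fst assms[OF that]])
  have "(\<lambda>y. f (fst y, snd y)) \<in> Gam_measure \<delta> \<rightarrow>\<^sub>M N"
    using measurable_compose_countable'[where f = "\<lambda>x y. f (fst y, x)", OF a measurable_Gam_snd countable_lattice] .
  then show ?thesis by simp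
qed

lemma heat_kernel_nonneg: "x \<in> lattice \<delta> \<Longrightarrow> t \<ge> 0 \<Longrightarrow> heat_kernel \<delta> m0 t x \<ge> 0"
proof -
  assume x: "x \<in> lattice \<delta>" and t: "t \<ge> 0"
  obtain k :: "'a \<Rightarrow> int" where k: "\<And>j. x $ j = \<delta> * of_int (k j)" using x unfolding lattice_def mem_Collect_eq by metis
  show ?thesis unfolding heat_kernel_lattice[OF \<delta> k]
    using t \<delta> by (intro mult_nonneg_nonneg prod_nonneg) (auto intro!: divide_nonneg_pos bessel_nonneg)
qed

lemma green_borel: "x \<in> lattice \<delta> \<Longrightarrow> (\<lambda>t. green \<delta> m0 (t, x)) \<in> borel_measurable borel"
proof -
  assume x: "x \<in> lattice \<delta>"
  obtain k :: "'a \<Rightarrow> int" where k: "\<And>j. x $ j = \<delta> * of_int (k j)" using x unfolding lattice_def mem_Collect_eq by metis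
  show ?thesis unfolding green_def split_conv heat_kernel_lattice[OF \<delta> k] by measurable
qed

text \<open>The weight \<delta>^d cancels the denominators of the d factors, and each Bessel
  sequence sums to exp (2 t / \<delta>^2). This cancels the constant part of the symbol of the
  lattice Laplacian, and the mass term alone remains.\<close>

lemma nn_integral_heat_kernel:
  assumes t: "t \<ge> 0"
  shows "(\<integral>\<^sup>+x. ennreal (heat_kernel \<delta> m0 t x) \<partial>(lattice_measure \<delta> :: (real ^ 'd::finite) measure)) = ennreal (exp (- m0\<^sup>2 * t))"
proof -
  define s where "s = 2 * t / \<delta>\<^sup>2"
  define E where "E = exp (- t * (2 * real CARD('d) / \<delta>\<^sup>2 + m0\<^sup>2))"
  have s: "s \<ge> 0" using t by (simp add: s_def)
  let ?v = "\<lambda>k::'d \<Rightarrow> int. \<chi> j. \<delta> * of_int (k j)"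
  have hk: "ennreal (\<delta> ^ CARD('d)) * ennreal (heat_kernel \<delta> m0 t (?v k)) = ennreal E * (\<Prod>j\<in>UNIV. ennreal (bessel s (k j)))" for k
  proof -
    have "heat_kernel \<delta> m0 t (?v k) = E * (\<Prod>j\<in>UNIV. bessel s (k j) / \<delta>)"
      by (subst heat_kernel_lattice[OF \<delta>, of _ k]) (auto simp: E_def s_def)
    also have "(\<Prod>j\<in>UNIV. bessel s (k j) / \<delta>) = (\<Prod>j\<in>UNIV. bessel s (k j)) / \<delta> ^ CARD('d)"
      by (simp add: prod_dividef)
    finally have "\<delta> ^ CARD('d) * heat_kernel \<delta> m0 t (?v k) = E * (\<Prod>j\<in>UNIV. bessel s (k j))"
      using \<delta> by simp
    moreover have "ennreal (\<delta> ^ CARD('d)) * ennreal (heat_kernel \<delta> m0 t (?v k)) = ennreal (\<delta> ^ CARD('d) * heat_kernel \<delta> m0 t (?v k))"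
      using \<delta> t by (intro ennreal_mult[symmetric] heat_kernel_nonneg) (auto simp: lattice_def)
    moreover have "ennreal (E * (\<Prod>j\<in>UNIV. bessel s (k j))) = ennreal E * (\<Prod>j\<in>UNIV. ennreal (bessel s (k j)))"
      using bessel_nonneg[OF s] by (simp add: ennreal_mult prod_ennreal prod_nonneg E_def)
    ultimately show ?thesis by simp
  qed
  interpret product_sigma_finite "\<lambda>_ :: 'd. count_space (UNIV :: int set)"
    by (intro product_sigma_finite.intro sigma_finite_measure_count_space)
  have "(\<integral>\<^sup>+x. ennreal (heat_kernel \<delta> m0 t x) \<partial>(lattice_measure \<delta> :: (real ^ 'd) measure)) =
     (\<integral>\<^sup>+k. ennreal (\<delta> ^ CARD('d)) * ennreal (heat_kernel \<delta> m0 t (?v k)) \<partial>count_space UNIV)"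
    unfolding nn_integral_lattice_measure by (rule nn_integral_bij_count_space[OF lattice_bij[OF \<delta>], symmetric])
  also have "\<dots> = ennreal E * (\<integral>\<^sup>+k. (\<Prod>j\<in>UNIV. ennreal (bessel s (k j))) \<partial>count_space (UNIV :: ('d \<Rightarrow> int) set))"
    unfolding hk by (rule nn_integral_cmult) simp
  also have "count_space (UNIV :: ('d \<Rightarrow> int) set) = PiM UNIV (\<lambda>_. count_space UNIV)"
    by (subst count_space_PiM_finite) (auto simp: PiE_UNIV_domain)
  also have "(\<integral>\<^sup>+k. (\<Prod>j\<in>UNIV. ennreal (bessel s (k j))) \<partial>PiM (UNIV :: 'd set) (\<lambda>_. count_space UNIV)) =
      (\<Prod>j\<in>(UNIV :: 'd set). \<integral>\<^sup>+k. ennreal (bessel s k) \<partial>count_space UNIV)"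
    by (rule product_nn_integral_prod) auto
  also have "\<dots> = ennreal (exp s ^ CARD('d))"
    by (simp add: nn_integral_bessel[OF s] ennreal_power)
  also have "ennreal E * ennreal (exp s ^ CARD('d)) = ennreal (E * exp s ^ CARD('d))"
    by (simp add: ennreal_mult E_def)
  also have "E * exp s ^ CARD('d) = exp (- m0\<^sup>2 * t)"
    unfolding E_def exp_of_nat_mult[symmetric] mult_exp_exp by (simp add: s_def algebra_simps)
  finally show ?thesis .
qed

text \<open>A single point carries weight \<delta>^d, so its share of the total mass bounds the
  value there.\<close>

lemma heat_kernel_le:
  assumes x: "x \<in> lattice \<delta>" and t: "t \<ge> 0"
  shows "heat_kernel \<delta> m0 t (x :: real ^ 'd::finite) \<le> exp (- m0\<^sup>2 * t) / \<delta> ^ CARD('d)"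
proof -
  have "ennreal (\<delta> ^ CARD('d) * heat_kernel \<delta> m0 t x) =
     (\<integral>\<^sup>+y. ennreal (\<delta> ^ CARD('d)) * ennreal (heat_kernel \<delta> m0 t x) * indicator {x} y \<partial>count_space (lattice \<delta> :: (real ^ 'd) set))"
    using x \<delta> t by (subst nn_integral_cmult_indicator) (auto simp: ennreal_mult heat_kernel_nonneg)
  also have "\<dots> \<le> (\<integral>\<^sup>+y. ennreal (\<delta> ^ CARD('d)) * ennreal (heat_kernel \<delta> m0 t y) \<partial>count_space (lattice \<delta> :: (real ^ 'd) set))"
    by (intro nn_integral_mono) (auto simp: indicator_def)
  also have "\<dots> = ennreal (exp (- m0\<^sup>2 * t))"
    using nn_integral_heat_kernel[OF t, where 'd = 'd] by (simp add: nn_integral_lattice_measure)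
  finally have "\<delta> ^ CARD('d) * heat_kernel \<delta> m0 t x \<le> exp (- m0\<^sup>2 * t)" by simp
  then show ?thesis using \<delta> by (simp add: field_simps)
qed

lemma green_nonneg: "x \<in> Gam \<delta> \<Longrightarrow> green \<delta> m0 x \<ge> 0"
  by (auto simp: green_def Gam_def heat_kernel_nonneg)

lemma green_le: "x \<in> Gam \<delta> \<Longrightarrow> green \<delta> m0 (x :: real \<times> (real ^ 'd::finite)) \<le> 1 / \<delta> ^ CARD('d)"
proof -
  assume "x \<in> Gam \<delta>"
  then obtain t y where x: "x = (t, y)" and y: "y \<in> lattice \<delta>" by (auto simp: Gam_def)
  show ?thesis
  proof (cases "t > 0")
    case True
    have "heat_kernel \<delta> m0 t y \<le> exp (- m0\<^sup>2 * t) / \<delta> ^ CARD('d)" using y True by (intro heat_kernel_le) auto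
    also have "\<dots> \<le> 1 / \<delta> ^ CARD('d)" using True \<delta> by (intro divide_right_mono) auto
    finally show ?thesis using True by (simp add: green_def x)
  qed (use \<delta> in \<open>simp add: green_def x\<close>)
qed

lemma Gam_minus: "x \<in> Gam \<delta> \<Longrightarrow> y \<in> Gam \<delta> \<Longrightarrow> x - y \<in> Gam \<delta>"
  by (auto simp: Gam_def lattice_minus)

text \<open>Freezing the two lattice coordinates one after the other leaves a measurable function of
  the time difference; countability of the lattice puts the pieces together.\<close>

lemma green_diff_measurable:
  "(\<lambda>(x, y). green \<delta> m0 (x - y)) \<in> borel_measurable (Gam_measure \<delta> \<Otimes>\<^sub>M (Gam_measure \<delta> :: (real \<times> (real ^ 'd::finite)) measure))"
    (is "_ \<in> borel_measurable (?G \<Otimes>\<^sub>M ?G)")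
proof -
  note measurable_Gam_fst[measurable]
  have s1: "(\<lambda>w. snd (fst w)) \<in> ?G \<Otimes>\<^sub>M ?G \<rightarrow>\<^sub>M count_space (lattice \<delta>)"
    by (rule measurable_compose[OF measurable_fst measurable_Gam_snd])
  have s2: "(\<lambda>w. snd (snd w)) \<in> ?G \<Otimes>\<^sub>M ?G \<rightarrow>\<^sub>M count_space (lattice \<delta>)"
    by (rule measurable_compose[OF measurable_snd measurable_Gam_snd])
  have ab: "(\<lambda>w. green \<delta> m0 (fst (fst w) - fst (snd w), a - b)) \<in> borel_measurable (?G \<Otimes>\<^sub>M ?G)"
    if "a \<in> lattice \<delta>" "b \<in> lattice \<delta>" for a b :: "real ^ 'd"
  proof -
    have "(\<lambda>w. fst (fst w) - fst (snd w)) \<in> borel_measurable (?G \<Otimes>\<^sub>M ?G)"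
      by (intro borel_measurable_diff measurable_compose[OF measurable_fst measurable_Gam_fst]
        measurable_compose[OF measurable_snd measurable_Gam_fst])
    from measurable_compose[OF this green_borel[OF lattice_minus[OF that]]] show ?thesis .
  qed
  have a: "(\<lambda>w. green \<delta> m0 (fst (fst w) - fst (snd w), a - snd (snd w))) \<in> borel_measurable (?G \<Otimes>\<^sub>M ?G)"
    if "a \<in> lattice \<delta>" for a :: "real ^ 'd"
    using measurable_compose_countable'[where f = "\<lambda>b w. green \<delta> m0 (fst (fst w) - fst (snd w), a - b)", OF ab[OF that] s2 countable_lattice] .
  have "(\<lambda>w. green \<delta> m0 (fst (fst w) - fst (snd w), snd (fst w) - snd (snd w))) \<in> borel_measurable (?G \<Otimes>\<^sub>M ?G)"
    using measurable_compose_countable'[where f = "\<lambda>a w. green \<delta> m0 (fst (fst w) - fst (snd w), a - snd (snd w))", OF a s1 countable_lattice] .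
  then show ?thesis by (simp add: split_beta' minus_prod_def)
qed

lemma nn_integral_lattice_reflect:
  assumes "x \<in> lattice \<delta>"
  shows "(\<integral>\<^sup>+y. f (x - y) \<partial>(lattice_measure \<delta> :: (real ^ 'd::finite) measure)) = (\<integral>\<^sup>+y. f y \<partial>lattice_measure \<delta>)"
proof -
  have "bij_betw (\<lambda>y. x - y) (lattice \<delta>) (lattice \<delta>)"
    by (rule bij_betwI[where g = "\<lambda>y. x - y"]) (auto intro: lattice_minus assms)
  from nn_integral_bij_count_space[OF this, of "\<lambda>y. ennreal (\<delta> ^ CARD('d)) * f y"]
  show ?thesis by (simp add: nn_integral_lattice_measure)
qed

text \<open>For each time difference u > 0 the space integral is exp (- m0^2 u), and integrating in
  u gives 1 / m0^2, finite because m0 > 0. This is the constant \<kappa> of the tree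
  estimates.\<close>

lemma nn_integral_green:
  assumes x: "x \<in> Gam \<delta>"
  shows "(\<integral>\<^sup>+y. ennreal (green \<delta> m0 (x - y)) \<partial>(Gam_measure \<delta> :: (real \<times> (real ^ 'd::finite)) measure)) = ennreal (1 / m0\<^sup>2)"
proof -
  let ?L = "lattice_measure \<delta> :: (real ^ 'd) measure"
  interpret l: sigma_finite_measure "lattice_measure \<delta> :: (real ^ 'd) measure" by (rule sigma_finite_lattice_measure)
  obtain t0 x0 where x': "x = (t0, x0)" and x0: "x0 \<in> lattice \<delta>" using x by (auto simp: Gam_def)
  have m: "(\<lambda>y. ennreal (green \<delta> m0 (x - y))) \<in> borel_measurable (lborel \<Otimes>\<^sub>M lattice_measure \<delta>)"
  proof -
    have "(\<lambda>y. green \<delta> m0 (x - y)) \<in> borel_measurable (Gam_measure \<delta>)"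
      using measurable_Pair2[OF green_diff_measurable, of x] x by simp
    then show ?thesis unfolding Gam_measure_def by measurable
  qed
  have "(\<integral>\<^sup>+y. ennreal (green \<delta> m0 (x - y)) \<partial>(Gam_measure \<delta> :: (real \<times> (real ^ 'd)) measure)) =
      (\<integral>\<^sup>+t. (\<integral>\<^sup>+y. ennreal (green \<delta> m0 (t0 - t, x0 - y)) \<partial>?L) \<partial>lborel)"
    unfolding Gam_measure_def using l.nn_integral_fst[OF m] by (simp add: x')
  also have "\<dots> = (\<integral>\<^sup>+t. ennreal (exp (- m0\<^sup>2 * (t0 - t))) * indicator {0<..} (t0 - t) \<partial>lborel)"
  proof (rule nn_integral_cong)
    fix t
    have "(\<integral>\<^sup>+y. ennreal (green \<delta> m0 (t0 - t, x0 - y)) \<partial>?L) = (\<integral>\<^sup>+y. ennreal (green \<delta> m0 (t0 - t, y)) \<partial>?L)"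
      by (rule nn_integral_lattice_reflect[OF x0])
    also have "\<dots> = ennreal (exp (- m0\<^sup>2 * (t0 - t))) * indicator {0<..} (t0 - t)"
      using nn_integral_heat_kernel[of "t0 - t", where 'd = 'd] by (auto simp: green_def indicator_def)
    finally show "(\<integral>\<^sup>+y. ennreal (green \<delta> m0 (t0 - t, x0 - y)) \<partial>?L) = ennreal (exp (- m0\<^sup>2 * (t0 - t))) * indicator {0<..} (t0 - t)" .
  qed
  also have "\<dots> = (\<integral>\<^sup>+u. ennreal (exp (- m0\<^sup>2 * u)) * indicator {0<..} u \<partial>lborel)"
    by (subst nn_integral_real_affine[where c = "-1" and t = t0]) auto
  \<comment> \<open>The fundamental theorem used next is stated for a closed half-line; the added
    endpoint is a null set.\<close>
  also have "\<dots> = (\<integral>\<^sup>+u. ennreal (exp (- m0\<^sup>2 * u)) * indicator {0..} u \<partial>lborel)"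
    by (intro nn_integral_cong_AE) (auto simp: indicator_def intro!: eventually_mono[OF AE_lborel_singleton[of 0]])
  also have "\<dots> = ennreal (0 - (- exp (- m0\<^sup>2 * 0) / m0\<^sup>2))"
  proof (rule nn_integral_FTC_atLeast)
    show "((\<lambda>u. - exp (- m0\<^sup>2 * u) / m0\<^sup>2) has_real_derivative exp (- m0\<^sup>2 * u)) (at u)" for u
    proof -
      define c where "c = m0\<^sup>2"
      have "c > 0" using m0 by (simp add: c_def)
      then show ?thesis unfolding c_def[symmetric] by (auto intro!: derivative_eq_intros)
    qed
    have "filterlim (\<lambda>u. m0\<^sup>2 * u) at_top at_top"
      using m0 by (intro filterlim_tendsto_pos_mult_at_top[OF tendsto_const]) (auto simp: filterlim_ident)
    then have "filterlim (\<lambda>u. - m0\<^sup>2 * u) at_bot at_top"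
      by (simp add: filterlim_uminus_at_bot)
    from tendsto_divide[OF tendsto_minus[OF filterlim_compose[OF exp_at_bot this]] tendsto_const[of "m0\<^sup>2"]]
    show "((\<lambda>u. - exp (- m0\<^sup>2 * u) / m0\<^sup>2) \<longlongrightarrow> 0) at_top" using m0 by simp
  qed auto
  finally show ?thesis by simp
qed

text \<open>Writing the kernel as \<open>green\<close> puts the condition t > 0 into it; for each
  fixed summation point it is then measurable in time, and there are countably many of these
  points.\<close>

lemma conv_lattice_measurable:
  "(\<lambda>(t, x). if t > 0 then conv_lattice \<delta> (heat_kernel \<delta> m0 t) f x else 0) \<in> borel_measurable (Gam_measure \<delta> :: (real \<times> (real ^ 'd::finite)) measure)"
proof (rule measurable_Gam_iff)
  fix x :: "real ^ 'd" assume x: "x \<in> lattice \<delta>"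
  interpret l: sigma_finite_measure "lattice_measure \<delta> :: (real ^ 'd) measure" by (rule sigma_finite_lattice_measure)
  have s: "snd \<in> (borel :: real measure) \<Otimes>\<^sub>M lattice_measure \<delta> \<rightarrow>\<^sub>M count_space (lattice \<delta> :: (real ^ 'd) set)"
  proof -
    have e: "sets (count_space (lattice \<delta>) :: (real ^ 'd) measure) = sets (lattice_measure \<delta>)"
      by (simp add: sets_lattice_measure)
    show ?thesis unfolding measurable_cong_sets[OF refl e] by (rule measurable_snd)
  qed
  have y: "(\<lambda>w. green \<delta> m0 (fst w, x - y) * f y) \<in> borel_measurable ((borel :: real measure) \<Otimes>\<^sub>M lattice_measure \<delta>)"
    if "y \<in> lattice \<delta>" for y :: "real ^ 'd"
    using measurable_compose[OF measurable_fst green_borel[OF lattice_minus[OF x that]]]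
    by (intro borel_measurable_times) auto
  have "(\<lambda>w. green \<delta> m0 (fst w, x - snd w) * f (snd w)) \<in> borel_measurable ((borel :: real measure) \<Otimes>\<^sub>M lattice_measure \<delta>)"
    using measurable_compose_countable'[where f = "\<lambda>y w. green \<delta> m0 (fst w, x - y) * f y", OF y s countable_lattice] .
  then have "(\<lambda>t. LINT y | lattice_measure \<delta>. green \<delta> m0 (t, x - y) * f y) \<in> borel_measurable borel"
    by (intro l.borel_measurable_lebesgue_integral) (simp add: split_beta')
  moreover have "(\<lambda>t. LINT y | lattice_measure \<delta>. green \<delta> m0 (t, x - y) * f y) = (\<lambda>t. if t > 0 then conv_lattice \<delta> (heat_kernel \<delta> m0 t) f x else 0)"
    by (rule ext) (simp add: green_def conv_lattice_def)
  ultimately show "(\<lambda>t. case (t, x) of (t, x) \<Rightarrow> if t > 0 then conv_lattice \<delta> (heat_kernel \<delta> m0 t) f x else 0) \<in> borel_measurable borel"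
    by simp
qed

text \<open>The kernel has total mass exp (- m0^2 t), so a bounded initial value is forgotten at
  this rate.\<close>

lemma abs_conv_lattice_le:
  fixes x :: "real ^ 'd::finite"
  assumes x: "x \<in> lattice \<delta>" and t: "t \<ge> 0" and f: "\<And>y. y \<in> lattice \<delta> \<Longrightarrow> \<bar>f y\<bar> \<le> C" and C: "C \<ge> 0"
  shows "\<bar>conv_lattice \<delta> (heat_kernel \<delta> m0 t) f x\<bar> \<le> C * exp (- m0\<^sup>2 * t)"
proof -
  have "ennreal (norm (conv_lattice \<delta> (heat_kernel \<delta> m0 t) f x)) \<le> (\<integral>\<^sup>+y. ennreal (norm (heat_kernel \<delta> m0 t (x - y) * f y)) \<partial>lattice_measure \<delta>)"
    unfolding conv_lattice_def
  \<comment> \<open>If the integrand were not integrable, the integral would be 0 by convention and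
    the bound trivial; so integrability need not be shown first.\<close>
  proof (cases "integrable (lattice_measure \<delta>) (\<lambda>y. heat_kernel \<delta> m0 t (x - y) * f y)")
    case True
    then show "ennreal (norm (LINT y|lattice_measure \<delta>. heat_kernel \<delta> m0 t (x - y) * f y)) \<le>
        (\<integral>\<^sup>+y. ennreal (norm (heat_kernel \<delta> m0 t (x - y) * f y)) \<partial>lattice_measure \<delta>)"
      by (rule integral_norm_bound_ennreal)
  qed (simp add: not_integrable_integral_eq)
  also have "\<dots> \<le> (\<integral>\<^sup>+y. ennreal C * ennreal (heat_kernel \<delta> m0 t (x - y)) \<partial>lattice_measure \<delta>)"
  proof (rule nn_integral_mono)
    fix y :: "real ^ 'd" assume "y \<in> space (lattice_measure \<delta>)"
    then have y: "y \<in> lattice \<delta>" by simp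
    have h: "heat_kernel \<delta> m0 t (x - y) \<ge> 0" by (intro heat_kernel_nonneg lattice_minus x y t)
    have "norm (heat_kernel \<delta> m0 t (x - y) * f y) \<le> C * heat_kernel \<delta> m0 t (x - y)"
      using f[OF y] h by (simp add: abs_mult mult.commute mult_right_mono)
    then show "ennreal (norm (heat_kernel \<delta> m0 t (x - y) * f y)) \<le> ennreal C * ennreal (heat_kernel \<delta> m0 t (x - y))"
      using h C by (simp add: ennreal_mult[symmetric] ennreal_leI)
  qed
  also have "\<dots> = ennreal C * (\<integral>\<^sup>+y. ennreal (heat_kernel \<delta> m0 t (x - y)) \<partial>lattice_measure \<delta>)"
    by (rule nn_integral_cmult) (simp add: lattice_measure_def)
  also have "\<dots> = ennreal (C * exp (- m0\<^sup>2 * t))"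
    using nn_integral_heat_kernel[OF t, where 'd = 'd] nn_integral_lattice_reflect[OF x, of "\<lambda>y. ennreal (heat_kernel \<delta> m0 t y)"] C
    by (simp add: ennreal_mult)
  finally show ?thesis using C by simp
qed

text \<open>Lebesgue measure in the time variable is translation invariant; this is what moves the
  roots from time t to time 0 without changing the integrals.\<close>

lemma distr_Gam_shift:
  "distr (Gam_measure \<delta>) (Gam_measure \<delta>) (\<lambda>y. (fst y + c, snd y)) = (Gam_measure \<delta> :: (real \<times> (real ^ 'd::finite)) measure)"
proof -
  interpret l: sigma_finite_measure "lattice_measure \<delta> :: (real ^ 'd) measure" by (rule sigma_finite_lattice_measure)
  let ?L = "lattice_measure \<delta> :: (real ^ 'd) measure"
  have d: "distr lborel lborel (\<lambda>t. t + c) = (lborel :: real measure)"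
    using lborel_distr_plus[of c] by (simp add: add.commute cong: distr_cong)
  have i: "distr ?L ?L (\<lambda>x. x) = ?L" by (rule distr_id)
  have "distr lborel lborel (\<lambda>t. t + c) \<Otimes>\<^sub>M distr ?L ?L (\<lambda>x. x) = distr (lborel \<Otimes>\<^sub>M ?L) (lborel \<Otimes>\<^sub>M ?L) (\<lambda>(t, x). (t + c, x))"
    by (rule pair_measure_distr) (auto simp: i l.sigma_finite_measure_axioms)
  then show ?thesis unfolding d i Gam_measure_def by (simp add: split_beta')
qed

end

section \<open>Moments of Levy noise\<close>

lemma finite_partitions [simp]:
  assumes "finite A" shows "finite {\<pi>. partition_on A \<pi>}"
  using finitely_many_partition_on[OF assms] by simp

text \<open>The new element k either forms a block of its own or joins exactly one block of a
  partition of the rest. The right side is arranged as the outcome of a product rule, with enlarging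
  a block in the role of differentiating its factor.\<close>

lemma sum_partitions_insert:
  fixes c :: "'i set \<Rightarrow> 'a::comm_ring_1"
  assumes A: "finite A" and k: "k \<notin> A"
  shows "(\<Sum>\<rho>\<in>{\<rho>. partition_on (insert k A) \<rho>}. \<Prod>B\<in>\<rho>. c B) =
    (\<Sum>\<pi>\<in>{\<pi>. partition_on A \<pi>}. c {k} * (\<Prod>B\<in>\<pi>. c B) +
       (\<Sum>B\<in>\<pi>. c (insert k B) * (\<Prod>C\<in>\<pi> - {B}. c C)))"
proof -
  let ?P = "{\<pi>. partition_on A \<pi>}"
  let ?R = "{\<rho>. partition_on (insert k A) \<rho>}"
  let ?R1 = "{\<rho> \<in> ?R. {k} \<in> \<rho>}" and ?R2 = "{\<rho> \<in> ?R. {k} \<notin> \<rho>}"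
  have finp: "finite \<pi>" if "\<pi> \<in> ?P" for \<pi>
    using that finite_elements[OF A] by auto
  have finr: "finite \<rho>" if "\<rho> \<in> ?R" for \<rho>
    using that finite_elements[of "insert k A"] A by auto
  have knot: "k \<notin> B" if "\<pi> \<in> ?P" "B \<in> \<pi>" for \<pi> B
    using that k partition_onD1 by blast
  have finR: "finite ?R" using finite_partitions[of "insert k A"] A by blast
  have split: "(\<Sum>\<rho>\<in>?R. \<Prod>B\<in>\<rho>. c B) = (\<Sum>\<rho>\<in>?R1. \<Prod>B\<in>\<rho>. c B) + (\<Sum>\<rho>\<in>?R2. \<Prod>B\<in>\<rho>. c B)"
  proof -
    have "?R = ?R1 \<union> ?R2" by blast
    moreover have "finite ?R1" "finite ?R2" using finR by (auto intro: finite_subset)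
    moreover have "?R1 \<inter> ?R2 = {}" by blast
    ultimately show ?thesis using sum.union_disjoint[of ?R1 ?R2 "\<lambda>\<rho>. \<Prod>B\<in>\<rho>. c B"] by metis
  qed
  have R1: "(\<Sum>\<rho>\<in>?R1. \<Prod>B\<in>\<rho>. c B) = (\<Sum>\<pi>\<in>?P. c {k} * (\<Prod>B\<in>\<pi>. c B))"
  proof (rule sum.reindex_bij_witness[where i = "\<lambda>\<pi>. insert {k} \<pi>" and j = "\<lambda>\<rho>. \<rho> - {{k}}"])
    fix \<rho> assume "\<rho> \<in> ?R1"
    then have \<rho>: "partition_on (insert k A) \<rho>" "{k} \<in> \<rho>" by auto
    show "insert {k} (\<rho> - {{k}}) = \<rho>" using \<rho> by auto
    have "\<Union>(\<rho> - {{k}}) = A"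
    proof -
      have "insert k (\<Union>(\<rho> - {{k}})) = \<Union>\<rho>" using \<rho>(2) by auto
      then have "insert k (\<Union>(\<rho> - {{k}})) = insert k A" using partition_onD1[OF \<rho>(1)] by simp
      moreover have "k \<notin> \<Union>(\<rho> - {{k}})"
      proof
        assume "k \<in> \<Union>(\<rho> - {{k}})"
        then obtain B where B: "B \<in> \<rho>" "B \<noteq> {k}" "k \<in> B" by auto
        then have "B \<inter> {k} = {}" using \<rho>(2) partition_onD2[OF \<rho>(1)] by (intro disjointD)
        then show False using B by simp
      qed
      ultimately show ?thesis using k insert_ident by metis
    qed
    then show "\<rho> - {{k}} \<in> ?P"
      using \<rho> by (auto simp: partition_on_def disjoint_def)
    show "c {k} * (\<Prod>B\<in>\<rho> - {{k}}. c B) = (\<Prod>B\<in>\<rho>. c B)"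
      using \<rho> finr[of \<rho>] by (simp add: prod.remove)
  next
    fix \<pi> assume \<pi>: "\<pi> \<in> ?P"
    then have n: "{k} \<notin> \<pi>" using knot by blast
    then show "insert {k} \<pi> - {{k}} = \<pi>" by simp
    have "\<Union>\<pi> = A" using \<pi> partition_onD1 by blast
    with \<pi> k show "insert {k} \<pi> \<in> ?R1"
      by (auto simp: partition_on_def disjoint_def)
  qed
  let ?S = "Sigma ?P (\<lambda>\<pi>. \<pi>)"
  define blk where "blk = (\<lambda>\<rho>. THE B. B \<in> \<rho> \<and> k \<in> B)"
  have blk_eq: "blk \<rho> = B" if "\<rho> \<in> ?R" "B \<in> \<rho>" "k \<in> B" for \<rho> B
    unfolding blk_def
  proof (rule the_equality)
    show "B \<in> \<rho> \<and> k \<in> B" using that by simp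
    fix C assume "C \<in> \<rho> \<and> k \<in> C"
    then show "C = B" using that partition_onD2[of "insert k A" \<rho>]
      by (auto simp: disjoint_def)
  qed
  have R2: "(\<Sum>\<rho>\<in>?R2. \<Prod>B\<in>\<rho>. c B) = (\<Sum>(\<pi>,B)\<in>?S. c (insert k B) * (\<Prod>C\<in>\<pi> - {B}. c C))"
  proof (rule sum.reindex_bij_witness[where
        i = "\<lambda>(\<pi>,B). insert (insert k B) (\<pi> - {B})" and
        j = "\<lambda>\<rho>. (insert (blk \<rho> - {k}) (\<rho> - {blk \<rho>}), blk \<rho> - {k})"])
    fix \<rho> assume "\<rho> \<in> ?R2"
    then have \<rho>: "partition_on (insert k A) \<rho>" "{k} \<notin> \<rho>" and \<rho>R: "\<rho> \<in> ?R" by auto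
    obtain B where B: "B \<in> \<rho>" "k \<in> B" using partition_onD1[OF \<rho>(1)] by blast
    have b: "blk \<rho> = B" by (rule blk_eq[OF \<rho>R B])
    have disj: "C \<inter> D = {}" if "C \<in> \<rho>" "D \<in> \<rho>" "C \<noteq> D" for C D
      using partition_onD2[OF \<rho>(1)] that by (auto simp: disjoint_def)
    have Bk: "B - {k} \<noteq> {}" using B \<rho>(2) by (metis insert_Diff)
    \<comment> \<open>Without k the block must not coincide with another one, since then reinserting
      k would not restore the partition; disjointness of the blocks excludes this.\<close>
    have notin: "B - {k} \<notin> \<rho>" using Bk B disj[of B "B - {k}"] by auto
    have nk: "k \<notin> C" if "C \<in> \<rho>" "C \<noteq> B" for C using disj[OF that(1) B(1) that(2)] B by blast
    show "(\<lambda>(\<pi>,B). insert (insert k B) (\<pi> - {B})) (insert (blk \<rho> - {k}) (\<rho> - {blk \<rho>}), blk \<rho> - {k}) = \<rho>"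
      using B notin by (auto simp: b insert_absorb)
    have U: "\<Union>\<rho> = insert k A" using partition_onD1[OF \<rho>(1)] by simp
    have "partition_on A (insert (B - {k}) (\<rho> - {B}))"
      unfolding partition_on_def
    proof (intro conjI)
      have "\<Union>\<rho> = B \<union> \<Union>(\<rho> - {B})" using B by auto
      moreover have "k \<notin> \<Union>(\<rho> - {B})" using nk by auto
      ultimately show "\<Union>(insert (B - {k}) (\<rho> - {B})) = A" using U k B by auto
      show "disjoint (insert (B - {k}) (\<rho> - {B}))"
        unfolding disjoint_def using disj B by blast
      show "{} \<notin> insert (B - {k}) (\<rho> - {B})" using Bk partition_onD3[OF \<rho>(1)] by blast
    qed
    then show "(insert (blk \<rho> - {k}) (\<rho> - {blk \<rho>}), blk \<rho> - {k}) \<in> ?S" by (simp add: b)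
    have "insert (B - {k}) (\<rho> - {B}) - {B - {k}} = \<rho> - {B}" using notin by blast
    then show "(case (insert (blk \<rho> - {k}) (\<rho> - {blk \<rho>}), blk \<rho> - {k}) of
        (\<pi>, B) \<Rightarrow> c (insert k B) * (\<Prod>C\<in>\<pi> - {B}. c C)) = (\<Prod>B\<in>\<rho>. c B)"
      using B finr[OF \<rho>R] by (simp add: b insert_absorb prod.remove)
  next
    fix q assume "q \<in> ?S"
    then obtain \<pi> B where q: "q = (\<pi>, B)" and \<pi>: "partition_on A \<pi>" and B: "B \<in> \<pi>" by auto
    have disj: "C \<inter> D = {}" if "C \<in> \<pi>" "D \<in> \<pi>" "C \<noteq> D" for C D
      using partition_onD2[OF \<pi>] that by (auto simp: disjoint_def)
    have kn: "k \<notin> C" if "C \<in> \<pi>" for C using knot \<pi> that by blast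
    have ne: "C \<noteq> {}" if "C \<in> \<pi>" for C using partition_onD3[OF \<pi>] that by blast
    have U: "\<Union>\<pi> = A" using partition_onD1[OF \<pi>] by simp
    let ?\<rho> = "insert (insert k B) (\<pi> - {B})"
    have "partition_on (insert k A) ?\<rho>"
      unfolding partition_on_def
    proof (intro conjI)
      show "\<Union>?\<rho> = insert k A" using U B by blast
      show "disjoint ?\<rho>" unfolding disjoint_def using disj B kn by blast
      show "{} \<notin> ?\<rho>" using ne by blast
    qed
    moreover have "{k} \<notin> ?\<rho>" using kn ne[OF B] kn[OF B] by auto
    ultimately have in2: "?\<rho> \<in> ?R2" by blast
    then show "(case q of (\<pi>,B) \<Rightarrow> insert (insert k B) (\<pi> - {B})) \<in> ?R2" by (simp add: q)
    have b: "blk ?\<rho> = insert k B" using in2 by (intro blk_eq) auto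
    have "insert k B \<notin> \<pi> - {B}" using kn by blast
    then show "(insert (blk (case q of (\<pi>,B) \<Rightarrow> insert (insert k B) (\<pi> - {B})) - {k})
        ((case q of (\<pi>,B) \<Rightarrow> insert (insert k B) (\<pi> - {B})) - {blk (case q of (\<pi>,B) \<Rightarrow> insert (insert k B) (\<pi> - {B}))}),
        blk (case q of (\<pi>,B) \<Rightarrow> insert (insert k B) (\<pi> - {B})) - {k}) = q"
      using B kn[OF B] by (auto simp: q b)
  qed
  have "(\<Sum>(\<pi>,B)\<in>?S. c (insert k B) * (\<Prod>C\<in>\<pi> - {B}. c C)) =
      (\<Sum>\<pi>\<in>?P. \<Sum>B\<in>\<pi>. c (insert k B) * (\<Prod>C\<in>\<pi> - {B}. c C))"
    using finite_partitions[OF A] finp by (subst sum.Sigma) auto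
  then show ?thesis unfolding split R1 R2 by (simp add: sum.distrib)
qed

text \<open>Faa di Bruno's formula for an exponential, one variable at a time: differentiating E
  opens the block {k}, differentiating \<open>c B\<close> adds k to B.\<close>

lemma has_vector_derivative_exp_partition_sum:
  fixes c :: "'i set \<Rightarrow> real \<Rightarrow> complex"
  assumes A: "finite A" "k \<notin> A"
    and E: "(E has_vector_derivative E u * c {k} u) (at u)"
    and c: "\<And>B. B \<subseteq> A \<Longrightarrow> B \<noteq> {} \<Longrightarrow> (c B has_vector_derivative c (insert k B) u) (at u)"
  shows "((\<lambda>u. E u * (\<Sum>\<pi>\<in>{\<pi>. partition_on A \<pi>}. \<Prod>B\<in>\<pi>. c B u)) has_vector_derivative
     E u * (\<Sum>\<pi>\<in>{\<pi>. partition_on (insert k A) \<pi>}. \<Prod>B\<in>\<pi>. c B u)) (at u)"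
proof -
  have P: "((\<lambda>u. \<Prod>B\<in>\<pi>. c B u) has_vector_derivative
      (\<Sum>B\<in>\<pi>. c (insert k B) u * (\<Prod>C\<in>\<pi> - {B}. c C u))) (at u)" if "partition_on A \<pi>" for \<pi>
  proof -
    have "B \<subseteq> A \<and> B \<noteq> {}" if "B \<in> \<pi>" for B
      using that \<open>partition_on A \<pi>\<close> partition_onD1 partition_onD3 by blast
    then have "((\<lambda>u. \<Prod>B\<in>\<pi>. c B u) has_derivative
       (\<lambda>y. \<Sum>B\<in>\<pi>. (y *\<^sub>R c (insert k B) u) * (\<Prod>C\<in>\<pi> - {B}. c C u))) (at u)"
      using c by (intro has_derivative_prod) (simp add: has_vector_derivative_def)
    then show ?thesis by (simp add: has_vector_derivative_def scaleR_sum_right)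
  qed
  have "((\<lambda>u. E u * (\<Sum>\<pi>\<in>{\<pi>. partition_on A \<pi>}. \<Prod>B\<in>\<pi>. c B u)) has_vector_derivative
     E u * (\<Sum>\<pi>\<in>{\<pi>. partition_on A \<pi>}. \<Sum>B\<in>\<pi>. c (insert k B) u * (\<Prod>C\<in>\<pi> - {B}. c C u)) +
     E u * c {k} u * (\<Sum>\<pi>\<in>{\<pi>. partition_on A \<pi>}. \<Prod>B\<in>\<pi>. c B u)) (at u)"
    using P by (intro has_vector_derivative_mult E has_vector_derivative_sum) auto
  then show ?thesis
    by (simp add: sum_partitions_insert[OF A] sum.distrib sum_distrib_left algebra_simps)
qed

text \<open>The mean value inequality on the interval of radius 1 about u0 bounds the difference
  quotients by g, and dominated convergence along an arbitrary null sequence gives the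
  derivative.\<close>

lemma has_vector_derivative_integral_dominated:
  fixes f f' :: "real \<Rightarrow> 'a \<Rightarrow> complex"
  assumes int: "\<And>u. integrable M (f u)"
    and deriv: "\<And>u \<omega>. \<omega> \<in> space M \<Longrightarrow> ((\<lambda>u. f u \<omega>) has_vector_derivative f' u \<omega>) (at u)"
    and bound: "\<And>u \<omega>. \<bar>u - u0\<bar> \<le> 1 \<Longrightarrow> \<omega> \<in> space M \<Longrightarrow> norm (f' u \<omega>) \<le> g \<omega>"
    and g: "integrable M g" and meas: "f' u0 \<in> borel_measurable M"
  shows "((\<lambda>u. \<integral>\<omega>. f u \<omega> \<partial>M) has_vector_derivative (\<integral>\<omega>. f' u0 \<omega> \<partial>M)) (at u0)"
proof -
  have dq: "(F has_vector_derivative D) (at x) \<longleftrightarrow> ((\<lambda>h. (F (x + h) - F x) /\<^sub>R h) \<longlongrightarrow> D) (at 0)"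
    for F :: "real \<Rightarrow> complex" and D x
  proof -
    have "(F has_vector_derivative D) (at x) \<longleftrightarrow>
        ((\<lambda>h. norm (F (x + h) - F x - h *\<^sub>R D) / norm h) \<longlongrightarrow> 0) (at 0)"
      by (simp add: has_vector_derivative_def has_derivative_at bounded_linear_scaleR_left)
    also have "\<dots> \<longleftrightarrow> ((\<lambda>h. norm ((F (x + h) - F x) /\<^sub>R h - D)) \<longlongrightarrow> 0) (at 0)"
    proof (rule tendsto_cong)
      have "norm (F (x + h) - F x - h *\<^sub>R D) / norm h = norm ((F (x + h) - F x) /\<^sub>R h - D)"
        if "h \<noteq> 0" for h
      proof -
        have "(F (x + h) - F x) /\<^sub>R h - D = (F (x + h) - F x - h *\<^sub>R D) /\<^sub>R h"
          using that by (simp add: scaleR_diff_right)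
        then show ?thesis by (simp add: divide_inverse mult.commute)
      qed
      then show "\<forall>\<^sub>F h in at 0. norm (F (x + h) - F x - h *\<^sub>R D) / norm h =
          norm ((F (x + h) - F x) /\<^sub>R h - D)"
        by (auto simp: eventually_at_filter)
    qed
    also have "\<dots> \<longleftrightarrow> ((\<lambda>h. (F (x + h) - F x) /\<^sub>R h) \<longlongrightarrow> D) (at 0)"
      unfolding tendsto_norm_zero_iff by (rule LIM_zero_iff)
    finally show ?thesis .
  qed
  show ?thesis unfolding dq
  proof (subst tendsto_at_iff_sequentially, intro allI impI)
    fix X :: "nat \<Rightarrow> real" assume X: "\<forall>i. X i \<in> UNIV - {0}" and X0: "X \<longlonglongrightarrow> 0"
    then have X1: "X i \<noteq> 0" for i by auto
    \<comment> \<open>The bound is available only within distance 1 of u0, so finitely many terms of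
      the sequence are dropped.\<close>
    from X0 have "\<forall>\<^sub>F i in sequentially. \<bar>X i\<bar> < 1"
      by (auto dest: tendstoD[where e=1] simp: dist_real_def)
    then obtain N where N: "\<And>i. i \<ge> N \<Longrightarrow> \<bar>X i\<bar> \<le> 1"
      unfolding eventually_sequentially by (metis less_imp_le)
    have ptw: "(\<lambda>i. (f (u0 + X i) \<omega> - f u0 \<omega>) /\<^sub>R X i) \<longlonglongrightarrow> f' u0 \<omega>" if "\<omega> \<in> space M" for \<omega>
      using deriv[OF that, of u0] X X0 unfolding dq tendsto_at_iff_sequentially o_def by auto
    have bd: "norm ((f (u0 + X i) \<omega> - f u0 \<omega>) /\<^sub>R X i) \<le> g \<omega>" if "i \<ge> N" "\<omega> \<in> space M" for i \<omega>
    proof -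
      have "norm (f (u0 + X i) \<omega> - f u0 \<omega>) \<le> g \<omega> * norm (u0 + X i - u0)"
      proof (rule differentiable_bound[where S = "{u0 - 1..u0 + 1}" and f' = "\<lambda>u h. h *\<^sub>R f' u \<omega>"])
        show "((\<lambda>u. f u \<omega>) has_derivative (\<lambda>h. h *\<^sub>R f' u \<omega>)) (at u within {u0 - 1..u0 + 1})"
          if "u \<in> {u0 - 1..u0 + 1}" for u
          using deriv[OF \<open>\<omega> \<in> space M\<close>, of u]
          by (simp add: has_vector_derivative_def has_derivative_at_withinI)
        show "onorm (\<lambda>h. h *\<^sub>R f' u \<omega>) \<le> g \<omega>" if "u \<in> {u0 - 1..u0 + 1}" for u
          using bound[of u \<omega>] that \<open>\<omega> \<in> space M\<close>
          by (intro onorm_le) (auto intro!: mult_left_mono simp: mult.commute[of _ "\<bar>_\<bar>"])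
      qed (use N[OF that(1)] in \<open>auto simp: abs_le_iff\<close>)
      then show ?thesis using X1[of i]
        by (simp add: divide_simps mult.commute flip: divide_inverse_commute)
    qed
    have "(\<lambda>i. \<integral>\<omega>. (f (u0 + X (i + N)) \<omega> - f u0 \<omega>) /\<^sub>R X (i + N) \<partial>M) \<longlonglongrightarrow> (\<integral>\<omega>. f' u0 \<omega> \<partial>M)"
    proof (rule integral_dominated_convergence[where w = g])
      show "AE \<omega> in M. (\<lambda>i. (f (u0 + X (i + N)) \<omega> - f u0 \<omega>) /\<^sub>R X (i + N)) \<longlonglongrightarrow> f' u0 \<omega>"
        using LIMSEQ_ignore_initial_segment[OF ptw, of _ N] by (intro AE_I2) blast
      show "AE \<omega> in M. norm ((f (u0 + X (i + N)) \<omega> - f u0 \<omega>) /\<^sub>R X (i + N)) \<le> g \<omega>" for i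
        using bd by (intro AE_I2) auto
    qed (use int meas g in \<open>auto intro!: borel_measurable_integrable\<close>)
    moreover have e: "(\<integral>\<omega>. (f (u0 + X i) \<omega> - f u0 \<omega>) /\<^sub>R X i \<partial>M) =
        ((\<integral>\<omega>. f (u0 + X i) \<omega> \<partial>M) - (\<integral>\<omega>. f u0 \<omega> \<partial>M)) /\<^sub>R X i" for i
      using int by simp
    ultimately have "(\<lambda>i. ((\<integral>\<omega>. f (u0 + X (i + N)) \<omega> \<partial>M) - (\<integral>\<omega>. f u0 \<omega> \<partial>M)) /\<^sub>R X (i + N)) \<longlonglongrightarrow> (\<integral>\<omega>. f' u0 \<omega> \<partial>M)"
      by (simp only: e)
    then show "((\<lambda>h. ((\<integral>\<omega>. f (u0 + h) \<omega> \<partial>M) - (\<integral>\<omega>. f u0 \<omega> \<partial>M)) /\<^sub>R h) \<circ> X) \<longlonglongrightarrow> (\<integral>\<omega>. f' u0 \<omega> \<partial>M)"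
      unfolding o_def by (rule LIMSEQ_offset)
  qed
qed

text \<open>Central differences: the moment bound below compares the difference quotients of the
  characteristic function with their integral representation and applies Fatou's lemma.\<close>

primrec fdiff :: "real \<Rightarrow> nat \<Rightarrow> (real \<Rightarrow> complex) \<Rightarrow> real \<Rightarrow> complex" where
  "fdiff h 0 f x = f x"
| "fdiff h (Suc N) f x = fdiff h N f (x + h) - fdiff h N f x"

lemma has_vector_derivative_fdiff:
  assumes "\<And>u. (f has_vector_derivative f' u) (at u)"
  shows "(fdiff h N f has_vector_derivative fdiff h N f' x) (at x)"
proof (induction N arbitrary: x)
  case (Suc N)
  have E: "fdiff h (Suc N) g = (\<lambda>x. fdiff h N g (x + h) - fdiff h N g x)" for g by (rule ext) simp
  have "((\<lambda>x. fdiff h N f (x + h)) has_vector_derivative 1 *\<^sub>R fdiff h N f' (x + h)) (at x)"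
  proof -
    have "((\<lambda>x. x + h) has_vector_derivative 1) (at x)"
      by (auto intro!: derivative_eq_intros)
    from vector_diff_chain_at[OF this Suc[of "x + h"]] show ?thesis by (simp add: o_def)
  qed
  then show ?case unfolding E using Suc[of x] by (auto intro!: has_vector_derivative_diff)
next
  case 0
  have "fdiff h 0 g = g" for g by (rule ext) simp
  then show ?case using assms by simp
qed

text \<open>By the mean value inequality each difference costs one derivative and gains one factor
  h; all arguments used lie between x and x + N h.\<close>

lemma norm_fdiff_le:
  assumes F: "\<And>n u. (F n has_vector_derivative F (Suc n) u) (at u)"
    and C: "\<And>u. u \<in> {a..b} \<Longrightarrow> norm (F (i + N) u) \<le> C"
    and h: "h \<ge> 0" and x: "x \<ge> a" "x + real N * h \<le> b"
  shows "norm (fdiff h N (F i) x) \<le> C * h ^ N"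
  using C x
proof (induction N arbitrary: i x)
  case (Suc N)
  have "norm (fdiff h N (F i) (x + h) - fdiff h N (F i) x) \<le> C * h ^ N * norm (x + h - x)"
  proof (rule differentiable_bound[where S = "{x..x + h}" and f' = "\<lambda>u y. y *\<^sub>R fdiff h N (F (Suc i)) u"])
    fix u assume u: "u \<in> {x..x + h}"
    show "(fdiff h N (F i) has_derivative (\<lambda>y. y *\<^sub>R fdiff h N (F (Suc i)) u)) (at u within {x..x + h})"
      using has_vector_derivative_fdiff[of "F i" "F (Suc i)" h N u] F
      by (simp add: has_vector_derivative_def has_derivative_at_withinI)
    have "norm (fdiff h N (F (Suc i)) u) \<le> C * h ^ N"
      using u Suc.prems h by (intro Suc.IH) (auto simp: algebra_simps)
    then show "onorm (\<lambda>y. y *\<^sub>R fdiff h N (F (Suc i)) u) \<le> C * h ^ N"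
      by (intro onorm_le) (auto intro!: mult_left_mono simp: mult.commute[of _ "\<bar>_\<bar>"])
  qed (use h in auto)
  then show ?case using h by (simp add: mult_ac)
next
  case 0
  then show ?case using h "0.prems"(1)[of x] by auto
qed

text \<open>The derivatives of the Levy exponent, with those of the jump part already taken under
  the integral. Order 0 is kept apart because only its jump integrand carries the compensating
  -1.\<close>

definition levy_deriv :: "real \<Rightarrow> real \<Rightarrow> real \<Rightarrow> real measure \<Rightarrow> nat \<Rightarrow> real \<Rightarrow> complex" where
  "levy_deriv a \<sigma> z r n t =
     (if n = 0 then levy_exponent a \<sigma> z r t
      else (if n = 1 then \<i> * of_real a - of_real (\<sigma>\<^sup>2 * t) else 0) - (if n = 2 then of_real (\<sigma>\<^sup>2) else 0) +
        of_real z * (CLINT s | r. (\<i> * of_real s) ^ n * exp (\<i> * of_real (s * t))))"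

lemma norm_exp_i_diff_le: "norm (exp (\<i> * of_real x) - exp (\<i> * of_real y)) \<le> \<bar>x - y\<bar>" for x y :: real
proof -
  have "exp (\<i> * of_real x) - exp (\<i> * of_real y) = exp (\<i> * of_real y) * (exp (\<i> * of_real (x - y)) - 1)"
    by (simp add: algebra_simps exp_diff)
  then have "norm (exp (\<i> * of_real x) - exp (\<i> * of_real y)) = norm (exp (\<i> * of_real (x - y)) - 1)"
    by (simp add: norm_mult)
  also have "\<dots> \<le> \<bar>x - y\<bar>"
    using iexp_approx1[of "x - y" 0] by simp
  finally show ?thesis .
qed

section \<open>Smoothness and growth of the Levy exponent\<close>

locale levy_jumps =
  fixes a \<sigma> z :: real and r :: "real measure"
  assumes jump_law: "jump_law r"
begin

abbreviation "\<psi> \<equiv> levy_deriv a \<sigma> z r"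

lemma prob_space_r: "prob_space r" and int_power: "integrable r (\<lambda>s. s ^ n)"
  using jump_law by (auto simp: jump_law_def)

lemma id_measurable_r [measurable]: "(\<lambda>s. s) \<in> borel_measurable r"
  using int_power[of 1] by (simp add: borel_measurable_integrable)

lemma int_abs_power: "integrable r (\<lambda>s. \<bar>s\<bar> ^ n)"
  using integrable_abs[OF int_power[of n]] by (simp add: power_abs)

lemma int_exp: "integrable r (\<lambda>s. (\<i> * of_real s) ^ n * exp (\<i> * of_real (s * t)))"
  by (rule Bochner_Integration.integrable_bound[OF int_abs_power[of n]]) (auto simp: norm_mult norm_power)

lemma psi_0: "\<psi> 0 = levy_exponent a \<sigma> z r"
  by (rule ext) (simp add: levy_deriv_def)

text \<open>Finite moments of the jump law supply the dominating functions \<bar>s\<bar>^(n+1) for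
  differentiation under the integral; this is why all moments of r are assumed finite.\<close>

lemma has_vector_derivative_psi: "(\<psi> n has_vector_derivative \<psi> (Suc n) t) (at t)"
proof -
  interpret r: prob_space r by (rule prob_space_r)
  \<comment> \<open>Subtracting 1 in order 0 lets a single statement cover both the exponent itself
    and its derivatives.\<close>
  have int1: "((\<lambda>t. CLINT s | r. (\<i> * of_real s) ^ n * exp (\<i> * of_real (s * t)) - (if n = 0 then 1 else 0)) has_vector_derivative
       (CLINT s | r. (\<i> * of_real s) ^ Suc n * exp (\<i> * of_real (s * t)))) (at t)" for n t
  proof (rule has_vector_derivative_integral_dominated[where g = "\<lambda>s. \<bar>s\<bar> ^ Suc n"])
    show "integrable r (\<lambda>s. (\<i> * of_real s) ^ n * exp (\<i> * of_real (s * u)) - (if n = 0 then 1 else 0))" for u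
      using int_exp[of n u] by (cases "n = 0") auto
    fix u s
    have "((\<lambda>w. (\<i> * of_real s) ^ n * exp (\<i> * of_real s * w) - (if n = 0 then 1 else 0)) has_field_derivative
        (\<i> * of_real s) ^ n * (\<i> * of_real s * exp (\<i> * of_real s * of_real u))) (at (of_real u))"
      by (auto intro!: derivative_eq_intros)
    from has_vector_derivative_real_field[OF this]
    show "((\<lambda>u. (\<i> * of_real s) ^ n * exp (\<i> * of_real (s * u)) - (if n = 0 then 1 else 0)) has_vector_derivative
        (\<i> * of_real s) ^ Suc n * exp (\<i> * of_real (s * u))) (at u)"
      by (simp add: mult_ac)
  qed (use int_abs_power[of "Suc n"] in \<open>auto simp: norm_mult norm_power\<close>)
  show ?thesis
  proof (cases "n = 0")
    case True
    have "((\<lambda>t. \<i> * of_real (a * t) - of_real (\<sigma>\<^sup>2 * t\<^sup>2 / 2) :: complex) has_vector_derivative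
       \<i> * of_real a - of_real (\<sigma>\<^sup>2 * t)) (at t)"
      by (auto intro!: derivative_eq_intros simp: has_vector_derivative_def scaleR_conv_of_real fun_eq_iff algebra_simps)
    moreover have "((\<lambda>t. of_real z * (CLINT s | r. exp (\<i> * of_real (s * t)) - 1)) has_vector_derivative
        of_real z * (CLINT s | r. (\<i> * of_real s) * exp (\<i> * of_real (s * t)))) (at t)"
      using int1[of 0 t] by (intro has_vector_derivative_mult_right) simp
    ultimately show ?thesis
      unfolding True psi_0 levy_exponent_def[abs_def] levy_deriv_def
      by (auto intro!: has_vector_derivative_add)
  next
    case False
    then have "((\<lambda>t. of_real z * (CLINT s | r. (\<i> * of_real s) ^ n * exp (\<i> * of_real (s * t)))) has_vector_derivative
        of_real z * (CLINT s | r. (\<i> * of_real s) ^ Suc n * exp (\<i> * of_real (s * t)))) (at t)"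
      using int1[of n t] by (intro has_vector_derivative_mult_right) simp
    moreover have "((\<lambda>t. (if n = 1 then \<i> * of_real a - of_real (\<sigma>\<^sup>2 * t) else 0) - (if n = 2 then of_real (\<sigma>\<^sup>2) else 0) :: complex)
       has_vector_derivative - (if Suc n = 2 then of_real (\<sigma>\<^sup>2) else 0)) (at t)"
      by (auto intro!: derivative_eq_intros simp: has_vector_derivative_def scaleR_conv_of_real fun_eq_iff algebra_simps)
    ultimately have "((\<lambda>t. (if n = 1 then \<i> * of_real a - of_real (\<sigma>\<^sup>2 * t) else 0) - (if n = 2 then of_real (\<sigma>\<^sup>2) else 0) +
        of_real z * (CLINT s | r. (\<i> * of_real s) ^ n * exp (\<i> * of_real (s * t)))) has_vector_derivative
        - (if Suc n = 2 then of_real (\<sigma>\<^sup>2) else 0) +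
        of_real z * (CLINT s | r. (\<i> * of_real s) ^ Suc n * exp (\<i> * of_real (s * t)))) (at t)"
      by (intro has_vector_derivative_add) auto
    with False show ?thesis unfolding levy_deriv_def[abs_def] by simp
  qed
qed

lemma continuous_on_psi: "continuous_on A (\<psi> n)"
  using has_vector_derivative_psi
  by (meson continuous_at_imp_continuous_on has_vector_derivative_continuous)

lemma psi_measurable [measurable]: "\<psi> n \<in> borel_measurable borel"
  by (intro borel_measurable_continuous_onI continuous_on_psi)

text \<open>Linear growth comes from the Gaussian term of the first derivative; everything else is
  bounded, the jump part by an absolute moment of r.\<close>

lemma norm_psi_le:
  assumes "n \<ge> 1"
  shows "norm (\<psi> n t) \<le> (\<bar>a\<bar> + \<sigma>\<^sup>2 + \<bar>z\<bar> * (LINT s | r. \<bar>s\<bar> ^ n)) * (1 + \<bar>t\<bar>)"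
proof -
  let ?m = "LINT s | r. \<bar>s\<bar> ^ n"
  have "norm (CLINT s | r. (\<i> * of_real s) ^ n * exp (\<i> * of_real (s * t))) \<le>
     (LINT s | r. norm ((\<i> * of_real s) ^ n * exp (\<i> * of_real (s * t))))"
    by (rule integral_norm_bound)
  also have "\<dots> = ?m" by (simp add: norm_mult norm_power)
  finally have m: "norm (of_real z * (CLINT s | r. (\<i> * of_real s) ^ n * exp (\<i> * of_real (s * t)))) \<le> \<bar>z\<bar> * ?m"
    by (simp add: norm_mult mult_left_mono)
  have m0: "\<bar>z\<bar> * ?m \<ge> 0" by (intro mult_nonneg_nonneg integral_nonneg_AE) auto
  have "norm (\<i> * of_real a - of_real (\<sigma>\<^sup>2 * t) :: complex) \<le> \<bar>a\<bar> + \<sigma>\<^sup>2 * \<bar>t\<bar>"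
    by (rule order_trans[OF norm_triangle_ineq4]) (simp add: norm_mult norm_power abs_mult)
  then have "norm ((if n = 1 then \<i> * of_real a - of_real (\<sigma>\<^sup>2 * t) else 0) - (if n = 2 then of_real (\<sigma>\<^sup>2) else 0) :: complex)
      \<le> (\<bar>a\<bar> + \<sigma>\<^sup>2) * (1 + \<bar>t\<bar>)"
    by (auto simp: algebra_simps norm_power intro: order_trans)
  moreover have "\<bar>z\<bar> * ?m \<le> (\<bar>z\<bar> * ?m) * (1 + \<bar>t\<bar>)"
    using mult_left_mono[of 1 "1 + \<bar>t\<bar>", OF _ m0] by simp
  ultimately have "norm ((if n = 1 then \<i> * of_real a - of_real (\<sigma>\<^sup>2 * t) else 0) - (if n = 2 then of_real (\<sigma>\<^sup>2) else 0) +
      of_real z * (CLINT s | r. (\<i> * of_real s) ^ n * exp (\<i> * of_real (s * t)))) \<le>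
      (\<bar>a\<bar> + \<sigma>\<^sup>2) * (1 + \<bar>t\<bar>) + (\<bar>z\<bar> * ?m) * (1 + \<bar>t\<bar>)"
    using m by (intro order_trans[OF norm_triangle_ineq] add_mono) auto
  then show ?thesis using assms by (simp add: levy_deriv_def distrib_right)
qed

text \<open>The two distances on the right match the definition of the stochastic integral, where
  convergence holds in L1 and in L2: the difference of squares comes from the Gaussian part, the
  drift and the jump part are Lipschitz.\<close>

lemma norm_psi_diff_le:
  "norm (\<psi> 0 u - \<psi> 0 v) \<le> (\<bar>a\<bar> + \<sigma>\<^sup>2 + \<bar>z\<bar> * (LINT s | r. \<bar>s\<bar>)) * (\<bar>u - v\<bar> + \<bar>u\<^sup>2 - v\<^sup>2\<bar>)"
proof -
  interpret r: prob_space r by (rule prob_space_r)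
  let ?m = "LINT s | r. \<bar>s\<bar>"
  have int: "integrable r (\<lambda>s. exp (\<i> * of_real (s * t)) - 1)" for t
    using int_exp[of 0 t] by simp
  have m0: "?m \<ge> 0" by (intro integral_nonneg_AE) auto
  have d: "(CLINT s | r. exp (\<i> * of_real (s * u)) - 1) - (CLINT s | r. exp (\<i> * of_real (s * v)) - 1)
     = (CLINT s | r. exp (\<i> * of_real (s * u)) - exp (\<i> * of_real (s * v)))" (is "?L1 - ?L2 = ?L")
    by (subst Bochner_Integration.integral_diff[symmetric, OF int int]) (simp add: algebra_simps)
  have "norm ?L \<le> (LINT s | r. norm (exp (\<i> * of_real (s * u)) - exp (\<i> * of_real (s * v))))"
    by (rule integral_norm_bound)
  also have "\<dots> \<le> (LINT s | r. \<bar>s\<bar> * \<bar>u - v\<bar>)"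
  proof (rule integral_mono)
    show "integrable r (\<lambda>s. norm (exp (\<i> * of_real (s * u)) - exp (\<i> * of_real (s * v))))"
      using int_exp[of 0] by (intro integrable_norm Bochner_Integration.integrable_diff) simp_all
    show "integrable r (\<lambda>s. \<bar>s\<bar> * \<bar>u - v\<bar>)" using int_abs_power[of 1] by simp
    show "norm (exp (\<i> * of_real (s * u)) - exp (\<i> * of_real (s * v))) \<le> \<bar>s\<bar> * \<bar>u - v\<bar>" for s
      using norm_exp_i_diff_le[of "s * u" "s * v"] by (simp add: abs_mult flip: right_diff_distrib)
  qed
  finally have L: "norm ?L \<le> ?m * \<bar>u - v\<bar>" by simp
  have "\<psi> 0 u - \<psi> 0 v = \<i> * of_real (a * (u - v)) - of_real (\<sigma>\<^sup>2 / 2 * (u\<^sup>2 - v\<^sup>2)) + of_real z * ?L"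
    unfolding psi_0 levy_exponent_def d[symmetric] by (simp add: algebra_simps diff_divide_distrib)
  also have "norm \<dots> \<le> \<bar>a\<bar> * \<bar>u - v\<bar> + \<sigma>\<^sup>2 / 2 * \<bar>u\<^sup>2 - v\<^sup>2\<bar> + \<bar>z\<bar> * (?m * \<bar>u - v\<bar>)"
    using L by (intro order_trans[OF norm_triangle_ineq] add_mono order_trans[OF norm_triangle_ineq4])
      (auto simp: norm_mult abs_mult mult_left_mono norm_power norm_divide simp flip: of_real_diff of_real_power)
  also have "\<dots> \<le> (\<bar>a\<bar> + \<sigma>\<^sup>2 + \<bar>z\<bar> * ?m) * (\<bar>u - v\<bar> + \<bar>u\<^sup>2 - v\<^sup>2\<bar>)"
  proof -
    have "0 \<le> \<bar>a\<bar> * \<bar>u\<^sup>2 - v\<^sup>2\<bar>" "0 \<le> \<sigma>\<^sup>2 * \<bar>u - v\<bar>" "0 \<le> \<bar>z\<bar> * ?m * \<bar>u\<^sup>2 - v\<^sup>2\<bar>" "0 \<le> \<sigma>\<^sup>2 * \<bar>u\<^sup>2 - v\<^sup>2\<bar>"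
      using m0 by auto
    then show ?thesis by (simp add: distrib_left distrib_right mult.assoc)
  qed
  finally show ?thesis .
qed

lemma psi_at_0: "\<psi> 0 0 = 0"
  by (simp add: psi_0 levy_exponent_def)

lemmas [measurable del] = id_measurable_r

lemma psi_cumulant:
  assumes "n \<ge> 1" shows "\<psi> n 0 = \<i> ^ n * of_real (levy_cumulant a \<sigma> z r n)"
proof -
  have "(CLINT s | r. (\<i> * of_real s) ^ n * exp (\<i> * of_real (s * 0))) = (CLINT s | r. \<i> ^ n * of_real (s ^ n))"
    by (simp add: power_mult_distrib)
  also have "\<dots> = \<i> ^ n * (CLINT s | r. of_real (s ^ n))"
    by simp
  also have "(CLINT s | r. of_real (s ^ n)) = complex_of_real (LINT s | r. s ^ n)"
    by (rule integral_complex_of_real)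
  finally show ?thesis using assms
    by (auto simp: levy_deriv_def levy_cumulant_def algebra_simps power2_eq_square)
qed

end

text \<open>Every factor is at most the largest one, whose power is among the summands. This reduces
  mixed moments to absolute moments of single variables.\<close>

lemma prod_abs_le_sum_power:
  fixes f :: "'i \<Rightarrow> real"
  assumes "finite A" "A \<noteq> {}"
  shows "(\<Prod>i\<in>A. \<bar>f i\<bar>) \<le> (\<Sum>i\<in>A. \<bar>f i\<bar> ^ card A)"
proof -
  let ?M = "Max ((\<lambda>i. \<bar>f i\<bar>) ` A)"
  have "?M \<in> (\<lambda>i. \<bar>f i\<bar>) ` A" using assms by (intro Max_in) auto
  then obtain k where k: "k \<in> A" "?M = \<bar>f k\<bar>" by auto
  have "\<bar>f i\<bar> \<le> \<bar>f k\<bar>" if "i \<in> A" for i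
    using that assms by (subst k(2)[symmetric]) (intro Max_ge, auto)
  then have "(\<Prod>i\<in>A. \<bar>f i\<bar>) \<le> (\<Prod>i\<in>A. \<bar>f k\<bar>)" by (intro prod_mono) auto
  also have "\<dots> = \<bar>f k\<bar> ^ card A" by simp
  also have "\<dots> \<le> (\<Sum>i\<in>A. \<bar>f i\<bar> ^ card A)"
    using assms k by (intro member_le_sum) auto
  finally show ?thesis .
qed

section \<open>Mixed moments from a joint characteristic function\<close>

lemma partitions_empty [simp]: "{\<pi>. partition_on {} \<pi>} = {{}}"
  by (auto simp: partition_on_empty)

text \<open>The functions \<open>h i\<close> stand for kernels as functions of the noise variable.
  Integrability together with a common bound makes every product over a nonempty index set
  integrable, which is what the blocks of a partition require.\<close>

locale levy_family = levy_jumps a \<sigma> z r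
  for a \<sigma> z :: real and r :: "real measure" +
  fixes N :: "'a measure" and S :: "'i set" and h :: "'i \<Rightarrow> 'a \<Rightarrow> real" and H :: real
  assumes finite_S: "finite S"
    and h_meas: "\<And>i. i \<in> S \<Longrightarrow> h i \<in> borel_measurable N"
    and h_int: "\<And>i. i \<in> S \<Longrightarrow> integrable N (h i)"
    and h_bound: "\<And>i x. i \<in> S \<Longrightarrow> x \<in> space N \<Longrightarrow> \<bar>h i x\<bar> \<le> H"
begin

definition lin :: "('i \<Rightarrow> real) \<Rightarrow> 'a \<Rightarrow> real" where
  "lin s x = (\<Sum>i\<in>S. s i * h i x)"

text \<open>The mixed partial derivative, once in each variable of B, of the logarithm of the joint
  characteristic function at s. The empty set gives the logarithm itself, and s = 0 gives the joint
  cumulants up to powers of i.\<close>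

definition cum :: "'i set \<Rightarrow> ('i \<Rightarrow> real) \<Rightarrow> complex" where
  "cum B s = (CLINT x | N. \<psi> (card B) (lin s x) * of_real (\<Prod>i\<in>B. h i x))"

lemma lin_meas [measurable]: "lin s \<in> borel_measurable N"
  unfolding lin_def[abs_def] using h_meas by auto

lemma abs_lin_le: "x \<in> space N \<Longrightarrow> \<bar>lin s x\<bar> \<le> (\<Sum>i\<in>S. \<bar>s i\<bar>) * H"
  unfolding lin_def sum_distrib_right
  by (rule order_trans[OF sum_abs]) (auto simp: abs_mult intro!: sum_mono mult_left_mono h_bound)

lemma lin_int: "integrable N (lin s)"
  unfolding lin_def[abs_def] using h_int by (intro Bochner_Integration.integrable_sum) auto

lemma lin_upd: "k \<in> S \<Longrightarrow> lin (s(k := u)) x = u * h k x + (\<Sum>i\<in>S - {k}. s i * h i x)"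
  unfolding lin_def using finite_S by (subst sum.remove[of S k]) (auto intro!: sum.cong)

lemma abs_prod_le:
  assumes "B \<subseteq> S" "k \<in> B" "x \<in> space N"
  shows "\<bar>\<Prod>i\<in>B. h i x\<bar> \<le> \<bar>H\<bar> ^ (card B - 1) * \<bar>h k x\<bar>"
proof -
  have fB: "finite B" using assms finite_S finite_subset by blast
  have *: "\<bar>\<Prod>i\<in>B. h i x\<bar> = \<bar>h k x\<bar> * (\<Prod>i\<in>B - {k}. \<bar>h i x\<bar>)"
    using fB assms by (simp add: prod.remove[of B k] abs_mult abs_prod)
  have "(\<Prod>i\<in>B - {k}. \<bar>h i x\<bar>) \<le> (\<Prod>i\<in>B - {k}. \<bar>H\<bar>)"
    using h_bound assms by (intro prod_mono) (auto intro: order_trans[OF h_bound])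
  also have "\<dots> = \<bar>H\<bar> ^ (card B - 1)" using fB assms by simp
  finally show ?thesis unfolding * mult.commute[of "\<bar>H\<bar> ^ _"] by (rule mult_left_mono) simp
qed

text \<open>For nonempty B one factor is integrable and the others are bounded. For empty B the
  exponent vanishes at 0, so on the bounded range of \<open>lin s\<close> it is at most a multiple
  of the absolute value of \<open>lin s\<close>, which is integrable.\<close>

lemma integrand_int:
  assumes B: "B \<subseteq> S"
  shows "integrable N (\<lambda>x. \<psi> (card B) (lin s x) * of_real (\<Prod>i\<in>B. h i x))"
proof (cases "B = {}")
  case True
  define R where "R = (\<Sum>i\<in>S. \<bar>s i\<bar>) * H"
  define K where "K = \<bar>a\<bar> + \<sigma>\<^sup>2 + \<bar>z\<bar> * (LINT s | r. \<bar>s\<bar>)"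
  have K0: "K \<ge> 0" unfolding K_def by (intro add_nonneg_nonneg mult_nonneg_nonneg integral_nonneg_AE) auto
  have "integrable N (\<lambda>x. \<psi> 0 (lin s x))"
  proof (rule Bochner_Integration.integrable_bound)
    show "integrable N (\<lambda>x. K * (1 + \<bar>R\<bar>) * lin s x)" using lin_int by simp
    show "AE x in N. norm (\<psi> 0 (lin s x)) \<le> norm (K * (1 + \<bar>R\<bar>) * lin s x)"
    proof (rule AE_I2)
      fix x assume "x \<in> space N"
      then have R: "\<bar>lin s x\<bar> \<le> \<bar>R\<bar>" using abs_lin_le[of x s] by (simp add: R_def)
      have "norm (\<psi> 0 (lin s x)) \<le> K * (\<bar>lin s x\<bar> + \<bar>lin s x\<bar> * \<bar>lin s x\<bar>)"
        using norm_psi_diff_le[of "lin s x" 0] by (simp add: psi_at_0 K_def power2_eq_square abs_mult)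
      also have "\<dots> \<le> K * (\<bar>lin s x\<bar> + \<bar>R\<bar> * \<bar>lin s x\<bar>)"
        using R K0 by (intro mult_left_mono add_left_mono mult_right_mono) auto
      finally show "norm (\<psi> 0 (lin s x)) \<le> norm (K * (1 + \<bar>R\<bar>) * lin s x)"
        using K0 by (simp add: abs_mult algebra_simps)
    qed
  qed measurable
  then show ?thesis using True by simp
next
  case False
  then obtain k where k: "k \<in> B" by blast
  have fB: "finite B" using B finite_S finite_subset by blast
  define n where "n = card B"
  have n: "n \<ge> 1" using False fB by (simp add: n_def Suc_le_eq card_gt_0_iff)
  define K where "K = \<bar>a\<bar> + \<sigma>\<^sup>2 + \<bar>z\<bar> * (LINT s | r. \<bar>s\<bar> ^ n)"
  have K0: "K \<ge> 0" unfolding K_def by (intro add_nonneg_nonneg mult_nonneg_nonneg integral_nonneg_AE) auto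
  define R where "R = (\<Sum>i\<in>S. \<bar>s i\<bar>) * H"
  show ?thesis unfolding n_def[symmetric]
  proof (rule Bochner_Integration.integrable_bound)
    show "integrable N (\<lambda>x. K * (1 + \<bar>R\<bar>) * \<bar>H\<bar> ^ (n - 1) * h k x)" using h_int[of k] B k by auto
    show "(\<lambda>x. \<psi> n (lin s x) * of_real (\<Prod>i\<in>B. h i x)) \<in> borel_measurable N"
    proof -
      have [measurable]: "\<And>i. i \<in> B \<Longrightarrow> h i \<in> borel_measurable N" using h_meas B by auto
      show ?thesis by measurable
    qed
    show "AE x in N. norm (\<psi> n (lin s x) * of_real (\<Prod>i\<in>B. h i x)) \<le> norm (K * (1 + \<bar>R\<bar>) * \<bar>H\<bar> ^ (n - 1) * h k x)"
    proof (rule AE_I2)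
      fix x assume x: "x \<in> space N"
      then have R: "\<bar>lin s x\<bar> \<le> \<bar>R\<bar>" using abs_lin_le[of x s] by (simp add: R_def)
      have "norm (\<psi> n (lin s x)) \<le> K * (1 + \<bar>lin s x\<bar>)" using norm_psi_le[OF n] by (simp add: K_def)
      also have "\<dots> \<le> K * (1 + \<bar>R\<bar>)" using R K0 by (intro mult_left_mono) auto
      finally have "norm (\<psi> n (lin s x)) * \<bar>\<Prod>i\<in>B. h i x\<bar> \<le> K * (1 + \<bar>R\<bar>) * (\<bar>H\<bar> ^ (n - 1) * \<bar>h k x\<bar>)"
        using abs_prod_le[OF B k x] K0 by (intro mult_mono) (auto simp: n_def)
      then show "norm (\<psi> n (lin s x) * of_real (\<Prod>i\<in>B. h i x)) \<le> norm (K * (1 + \<bar>R\<bar>) * \<bar>H\<bar> ^ (n - 1) * h k x)"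
        using K0 by (simp only: norm_mult norm_of_real real_norm_def abs_mult) (simp add: power_abs mult_ac)
    qed
  qed
qed

lemma has_vector_derivative_cum:
  assumes B: "B \<subseteq> S" and k: "k \<in> S" "k \<notin> B"
  shows "((\<lambda>u. cum B (s(k := u))) has_vector_derivative cum (insert k B) (s(k := u))) (at u)"
proof -
  have fB: "finite B" using B finite_S finite_subset by blast
  define n where "n = Suc (card B)"
  have cB: "card (insert k B) = n" using fB k by (simp add: n_def)
  have n: "n \<ge> 1" by (simp add: n_def)
  define K where "K = \<bar>a\<bar> + \<sigma>\<^sup>2 + \<bar>z\<bar> * (LINT s | r. \<bar>s\<bar> ^ n)"
  have K0: "K \<ge> 0" unfolding K_def by (intro add_nonneg_nonneg mult_nonneg_nonneg integral_nonneg_AE) auto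
  \<comment> \<open>A bound for the linear combination that holds for all parameters within distance
    1 of u, as domination requires.\<close>
  define R where "R = ((\<Sum>i\<in>S. \<bar>s i\<bar>) + (\<bar>u\<bar> + 1)) * \<bar>H\<bar>"
  have R0: "R \<ge> 0" unfolding R_def by (intro mult_nonneg_nonneg add_nonneg_nonneg sum_nonneg) auto
  have "((\<lambda>u. CLINT x | N. \<psi> (card B) (lin (s(k := u)) x) * of_real (\<Prod>i\<in>B. h i x)) has_vector_derivative
      (CLINT x | N. \<psi> n (lin (s(k := u)) x) * of_real (\<Prod>i\<in>insert k B. h i x))) (at u)"
  proof (rule has_vector_derivative_integral_dominated[where g = "\<lambda>x. K * (1 + R) * \<bar>H\<bar> ^ (n - 1) * \<bar>h k x\<bar>"])
    show "integrable N (\<lambda>x. \<psi> (card B) (lin (s(k := u)) x) * of_real (\<Prod>i\<in>B. h i x))" for u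
      by (rule integrand_int[OF B])
    show "integrable N (\<lambda>x. K * (1 + R) * \<bar>H\<bar> ^ (n - 1) * \<bar>h k x\<bar>)"
      using h_int[OF k(1)] by simp
    show "(\<lambda>x. \<psi> n (lin (s(k := u)) x) * of_real (\<Prod>i\<in>insert k B. h i x)) \<in> borel_measurable N"
    proof -
      have [measurable]: "\<And>i. i \<in> insert k B \<Longrightarrow> h i \<in> borel_measurable N" using h_meas B k by auto
      show ?thesis by measurable
    qed
    show "((\<lambda>u. \<psi> (card B) (lin (s(k := u)) x) * of_real (\<Prod>i\<in>B. h i x)) has_vector_derivative
        \<psi> n (lin (s(k := v)) x) * of_real (\<Prod>i\<in>insert k B. h i x)) (at v)" for v x
    proof -
      have l: "((\<lambda>u. lin (s(k := u)) x) has_vector_derivative h k x) (at v)"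
        unfolding lin_upd[OF k(1)] by (auto intro!: derivative_eq_intros)
      have "((\<lambda>u. \<psi> (card B) (lin (s(k := u)) x)) has_vector_derivative h k x *\<^sub>R \<psi> n (lin (s(k := v)) x)) (at v)"
        using vector_diff_chain_at[OF l has_vector_derivative_psi] by (simp add: o_def n_def)
      from has_vector_derivative_mult_left[OF this, of "of_real (\<Prod>i\<in>B. h i x)"]
      show ?thesis using fB k by (simp add: scaleR_conv_of_real mult_ac)
    qed
    fix v x assume v: "\<bar>v - u\<bar> \<le> 1" and x: "x \<in> space N"
    have "\<bar>lin (s(k := v)) x\<bar> \<le> (\<Sum>i\<in>S. \<bar>(s(k := v)) i\<bar>) * H" by (rule abs_lin_le[OF x])
    also have "\<dots> \<le> (\<Sum>i\<in>S. \<bar>(s(k := v)) i\<bar>) * \<bar>H\<bar>" by (intro mult_left_mono sum_nonneg) auto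
    also have "\<dots> \<le> R" unfolding R_def
    proof (rule mult_right_mono)
      have "(\<Sum>i\<in>S. \<bar>(s(k := v)) i\<bar>) = \<bar>v\<bar> + (\<Sum>i\<in>S - {k}. \<bar>s i\<bar>)"
        using finite_S k by (subst sum.remove[of S k]) (auto intro!: sum.cong)
      also have "(\<Sum>i\<in>S - {k}. \<bar>s i\<bar>) \<le> (\<Sum>i\<in>S. \<bar>s i\<bar>)"
        using finite_S by (intro sum_mono2) auto
      finally show "(\<Sum>i\<in>S. \<bar>(s(k := v)) i\<bar>) \<le> (\<Sum>i\<in>S. \<bar>s i\<bar>) + (\<bar>u\<bar> + 1)" using v by linarith
    qed simp
    finally have R: "\<bar>lin (s(k := v)) x\<bar> \<le> R" .
    have "norm (\<psi> n (lin (s(k := v)) x)) \<le> K * (1 + \<bar>lin (s(k := v)) x\<bar>)" using norm_psi_le[OF n] by (simp add: K_def)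
    also have "\<dots> \<le> K * (1 + R)" using R K0 by (intro mult_left_mono) auto
    finally have "norm (\<psi> n (lin (s(k := v)) x)) * \<bar>\<Prod>i\<in>insert k B. h i x\<bar> \<le> K * (1 + R) * (\<bar>H\<bar> ^ (n - 1) * \<bar>h k x\<bar>)"
      using abs_prod_le[of "insert k B" k x] B k x K0 R0 by (intro mult_mono) (auto simp: cB)
    then show "norm (\<psi> n (lin (s(k := v)) x) * of_real (\<Prod>i\<in>insert k B. h i x)) \<le> K * (1 + R) * \<bar>H\<bar> ^ (n - 1) * \<bar>h k x\<bar>"
      by (simp only: norm_mult norm_of_real mult.assoc)
  qed
  then show ?thesis by (simp only: cum_def cB)
qed

lemma has_vector_derivative_exp_cum:
  assumes "k \<in> S"
  shows "((\<lambda>u. exp (cum {} (s(k := u)))) has_vector_derivative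
    exp (cum {} (s(k := u))) * cum {k} (s(k := u))) (at u)"
  using field_vector_diff_chain_at[OF has_vector_derivative_cum[of "{}" k s u] DERIV_exp] assms
  by (simp add: o_def mult.commute)

lemma cum_0:
  assumes "B \<subseteq> S" "B \<noteq> {}"
  shows "cum B (\<lambda>_. 0) = \<i> ^ card B * of_real (levy_cumulant a \<sigma> z r (card B) * (LINT x | N. (\<Prod>i\<in>B. h i x)))"
proof -
  have fB: "finite B" using assms finite_S finite_subset by blast
  have "card B \<ge> 1" using assms fB by (simp add: Suc_le_eq card_gt_0_iff)
  then have "cum B (\<lambda>_. 0) = (CLINT x | N. \<i> ^ card B * of_real (levy_cumulant a \<sigma> z r (card B)) * of_real (\<Prod>i\<in>B. h i x))"
    by (simp add: cum_def lin_def psi_cumulant)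
  also have "\<dots> = \<i> ^ card B * of_real (levy_cumulant a \<sigma> z r (card B)) * (CLINT x | N. of_real (\<Prod>i\<in>B. h i x))"
    by (rule integral_mult_right_zero)
  also have "(CLINT x | N. of_real (\<Prod>i\<in>B. h i x)) = complex_of_real (LINT x | N. (\<Prod>i\<in>B. h i x))"
    by (rule integral_complex_of_real)
  finally show ?thesis by simp
qed

end

text \<open>All that is known of the variables W is their joint characteristic function; even the
  existence of moments has to be derived from it. Later \<open>h i\<close> is the kernel and
  \<open>W i\<close> the value of G * \<eta> at a point.\<close>

locale levy_variables = levy_family a \<sigma> z r N S h H + P: prob_space P
  for a \<sigma> z r and N :: "'a measure" and S :: "'i set" and h H and P :: "'w measure" +
  fixes W :: "'i \<Rightarrow> 'w \<Rightarrow> real"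
  assumes W_meas: "\<And>i. i \<in> S \<Longrightarrow> W i \<in> borel_measurable P"
    and char_W: "\<And>s. (CLINT \<omega> | P. exp (\<i> * of_real (\<Sum>i\<in>S. s i * W i \<omega>))) = exp (cum {} s)"
begin

end

text \<open>Repeated derivatives in one variable are reduced to mixed ones by taking n + 1 copies of
  g and letting only the coefficient of the last copy be nonzero; the block of the other n copies
  then carries the n-th derivative.\<close>

lemma (in levy_jumps) has_vector_derivative_cum1:
  fixes g :: "'a \<Rightarrow> real"
  assumes g: "g \<in> borel_measurable N" "integrable N g" "\<And>x. x \<in> space N \<Longrightarrow> \<bar>g x\<bar> \<le> H"
  shows "((\<lambda>u. CLINT x | N. \<psi> n (u * g x) * of_real (g x) ^ n) has_vector_derivative
     (CLINT x | N. \<psi> (Suc n) (u * g x) * of_real (g x) ^ Suc n)) (at u)"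
proof -
  interpret F: levy_family a \<sigma> z r N "{..n}" "\<lambda>_. g" H
    by unfold_locales (use g in auto)
  have l: "F.lin ((\<lambda>_. 0)(n := u)) x = u * g x" for u x
    by (subst F.lin_upd) auto
  have i: "insert n {..<n} = {..n}" and sub: "{..<n} \<subseteq> {..n}" by auto
  have "((\<lambda>u. F.cum {..<n} ((\<lambda>_. 0)(n := u))) has_vector_derivative F.cum {..n} ((\<lambda>_. 0)(n := u))) (at u)"
    using F.has_vector_derivative_cum[OF sub, of n "\<lambda>_. 0" u] by (simp add: i)
  then show ?thesis by (simp add: F.cum_def l)
qed

context levy_variables
begin

text \<open>Each difference in the parameter multiplies the integrand by exp (i b V) - 1, which is
  bounded by 2.\<close>

lemma integral_exp_fdiff:
  assumes [measurable]: "V \<in> borel_measurable P"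
  shows "fdiff b n (\<lambda>u. CLINT \<omega> | P. exp (\<i> * of_real (u * V \<omega>))) x =
      (CLINT \<omega> | P. exp (\<i> * of_real (x * V \<omega>)) * (exp (\<i> * of_real (b * V \<omega>)) - 1) ^ n)"
proof (induction n arbitrary: x)
  case (Suc n)
  have int: "integrable P (\<lambda>\<omega>. exp (\<i> * of_real (x * V \<omega>)) * (exp (\<i> * of_real (b * V \<omega>)) - 1) ^ n)" for x
  proof (rule P.integrable_const_bound[where B = "2 ^ n"])
    have "norm (exp (\<i> * of_real (x * V \<omega>)) * (exp (\<i> * of_real (b * V \<omega>)) - 1) ^ n) \<le> 2 ^ n" for \<omega>
    proof -
      have "norm (exp (\<i> * of_real (b * V \<omega>)) - 1) \<le> norm (exp (\<i> * of_real (b * V \<omega>))) + norm (1::complex)"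
        by (rule norm_triangle_ineq4)
      then have "norm (exp (\<i> * of_real (b * V \<omega>)) - 1) \<le> 2" by simp
      then show ?thesis by (simp add: norm_mult norm_power power_mono)
    qed
    then show "AE \<omega> in P. norm (exp (\<i> * of_real (x * V \<omega>)) * (exp (\<i> * of_real (b * V \<omega>)) - 1) ^ n) \<le> 2 ^ n"
      by (rule AE_I2)
  qed measurable
  show ?case
    unfolding fdiff.simps Suc
    by (subst Bochner_Integration.integral_diff[symmetric, OF int int])
      (simp add: algebra_simps exp_add)
qed simp

text \<open>The characteristic function of \<open>W k\<close> is smooth, so its central differences
  of order 2m with step b are at most C b^(2m). Up to sign such a difference is the expectation of
  \<bar>exp (i b W) - 1\<bar>^(2m), a nonnegative quantity. Dividing by b^(2m) and letting b tend to
  0, Fatou's lemma gives the moment. The order is even because only then does the integrand have one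
  sign.\<close>

lemma nn_even_moment_finite:
  assumes k: "k \<in> S"
  shows "(\<integral>\<^sup>+\<omega>. ennreal (W k \<omega> ^ (2 * m)) \<partial>P) < \<infinity>"
proof -
  note [measurable] = W_meas[OF k]
  define c where "c = (\<lambda>n::nat. \<lambda>u. CLINT x | N. \<psi> n (u * h k x) * of_real (h k x) ^ n)"
  have c': "(c n has_vector_derivative c (Suc n) u) (at u)" for n u
    unfolding c_def using h_meas[OF k] h_int[OF k] h_bound[OF k] by (intro has_vector_derivative_cum1)
  \<comment> \<open>The n-th derivative of the characteristic function by Faa di Bruno; with a
    single variable only the sizes of the blocks matter.\<close>
  define F where "F = (\<lambda>(n::nat) u. exp (c 0 u) * (\<Sum>\<pi>\<in>{\<pi>. partition_on {..<n} \<pi>}. \<Prod>B\<in>\<pi>. c (card B) u))"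
  have F': "(F n has_vector_derivative F (Suc n) u) (at u)" for n u
  proof -
    have "((\<lambda>u. exp (c 0 u) * (\<Sum>\<pi>\<in>{\<pi>. partition_on {..<n} \<pi>}. \<Prod>B\<in>\<pi>. c (card B) u)) has_vector_derivative
       exp (c 0 u) * (\<Sum>\<pi>\<in>{\<pi>. partition_on (insert n {..<n}) \<pi>}. \<Prod>B\<in>\<pi>. c (card B) u)) (at u)"
    proof (rule has_vector_derivative_exp_partition_sum)
      show "((\<lambda>u. exp (c 0 u)) has_vector_derivative exp (c 0 u) * c (card {n}) u) (at u)"
        using field_vector_diff_chain_at[OF c'[of 0 u] DERIV_exp] by (simp add: o_def mult.commute)
      show "(c (card B) has_vector_derivative c (card (insert n B)) u) (at u)" if "B \<subseteq> {..<n}" for B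
      proof -
        have "finite B" "n \<notin> B" using that finite_subset by blast+
        then show ?thesis using c' by simp
      qed
    qed auto
    then show ?thesis by (simp add: F_def lessThan_Suc)
  qed
  have F0: "F 0 u = (CLINT \<omega> | P. exp (\<i> * of_real (u * W k \<omega>)))" for u
  proof -
    have "(\<Sum>i\<in>S. ((\<lambda>_. 0)(k := u)) i * W i \<omega>) = u * W k \<omega>" for \<omega>
      using finite_S k by (subst sum.remove[of S k]) auto
    moreover have "lin ((\<lambda>_. 0)(k := u)) x = u * h k x" for x
      by (simp add: lin_upd[OF k])
    ultimately show ?thesis
      using char_W[of "(\<lambda>_. 0)(k := u)"] by (simp add: F_def c_def cum_def partition_on_empty)
  qed
  then have F0': "F 0 = (\<lambda>u. CLINT \<omega> | P. exp (\<i> * of_real (u * W k \<omega>)))" by (rule ext)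
  have "continuous_on {- real m..real m} (F (2 * m))"
    using F' by (meson continuous_at_imp_continuous_on has_vector_derivative_continuous)
  then have "bounded (F (2 * m) ` {- real m..real m})"
    by (intro compact_imp_bounded compact_continuous_image) auto
  then obtain C where C: "\<And>u. u \<in> {- real m..real m} \<Longrightarrow> norm (F (2 * m) u) \<le> C"
    unfolding bounded_iff by (metis imageI)
  \<comment> \<open>Steps of length at most 1 keep all points of the central difference inside
    [-m, m], where the derivative of order 2m is bounded by C.\<close>
  define b where "b = (\<lambda>i. 1 / real (Suc i))"
  have b: "b i > 0" "b i \<le> 1" for i by (auto simp: b_def)
  have b0: "b \<longlonglongrightarrow> 0" unfolding b_def by (rule LIMSEQ_inverse_real_of_nat[unfolded inverse_eq_divide])
  define D where "D = (\<lambda>i \<omega>. (norm (exp (\<i> * of_real (b i * W k \<omega>)) - 1) / b i) ^ (2 * m))"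
  have D_meas [measurable]: "D i \<in> borel_measurable P" for i unfolding D_def by measurable
  have D_lim: "(\<lambda>i. D i \<omega>) \<longlonglongrightarrow> W k \<omega> ^ (2 * m)" for \<omega>
  proof -
    have "((\<lambda>w. exp (\<i> * of_real (W k \<omega>) * w)) has_field_derivative \<i> * of_real (W k \<omega>)) (at (of_real 0))"
      by (auto intro!: derivative_eq_intros)
    then have "((\<lambda>w. (exp (\<i> * of_real (W k \<omega>) * (0 + w)) - exp (\<i> * of_real (W k \<omega>) * 0)) / w) \<longlongrightarrow> \<i> * of_real (W k \<omega>)) (at 0)"
      by (simp only: DERIV_def of_real_0)
    moreover have "filterlim (\<lambda>i. complex_of_real (b i)) (at 0) sequentially"
      using b tendsto_of_real[OF b0, where 'a = complex]
      by (intro filterlim_atI) (auto simp: b_def simp del: of_nat_Suc)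
    ultimately have "(\<lambda>i. (exp (\<i> * of_real (W k \<omega>) * (0 + of_real (b i))) - exp (\<i> * of_real (W k \<omega>) * 0)) / of_real (b i))
        \<longlonglongrightarrow> \<i> * of_real (W k \<omega>)"
      by (rule filterlim_compose)
    then have "(\<lambda>i. norm ((exp (\<i> * of_real (W k \<omega>) * (0 + of_real (b i))) - exp (\<i> * of_real (W k \<omega>) * 0)) / of_real (b i)) ^ (2 * m))
        \<longlonglongrightarrow> norm (\<i> * of_real (W k \<omega>)) ^ (2 * m)"
      by (intro tendsto_power tendsto_norm)
    moreover have "norm (\<i> * of_real (W k \<omega>)) ^ (2 * m) = W k \<omega> ^ (2 * m)"
      by (simp add: norm_mult power_mult)
    moreover have "\<bar>b i\<bar> = b i" for i using b[of i] by simp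
    ultimately show ?thesis by (simp add: D_def norm_divide mult_ac)
  qed
  have D_le: "(\<integral>\<^sup>+\<omega>. ennreal (D i \<omega>) \<partial>P) \<le> ennreal C" for i
  proof -
    have D_bd: "D i \<omega> \<le> (2 / b i) ^ (2 * m)" for \<omega>
    proof -
      have "norm (exp (\<i> * of_real (b i * W k \<omega>)) - 1) \<le> norm (exp (\<i> * of_real (b i * W k \<omega>))) + norm (1::complex)"
        by (rule norm_triangle_ineq4)
      then have "norm (exp (\<i> * of_real (b i * W k \<omega>)) - 1) \<le> 2" by simp
      then show ?thesis unfolding D_def using b[of i] by (intro power_mono divide_right_mono) auto
    qed
    have D_nn: "D i \<omega> \<ge> 0" for \<omega> unfolding D_def using b[of i] by auto
    have D_int: "integrable P (D i)"
      using D_bd D_nn by (intro P.integrable_const_bound[where B = "(2 / b i) ^ (2 * m)"]) auto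
    \<comment> \<open>For e on the unit circle, \<bar>e - 1\<bar>^2 = - (e - 1)^2 / e; the m-th
      power explains both the sign and the starting point - m b of the difference.\<close>
    have alg: "of_real (D i \<omega>) * of_real (b i) ^ (2 * m) =
       (-1) ^ m * (exp (\<i> * of_real (- real m * b i * W k \<omega>)) * (exp (\<i> * of_real (b i * W k \<omega>)) - 1) ^ (2 * m))" for \<omega>
    proof -
      define e where "e = exp (\<i> * complex_of_real (b i * W k \<omega>))"
      have e: "exp (\<i> * of_real (- real m * b i * W k \<omega>)) = (inverse e) ^ m"
        by (simp add: e_def exp_minus[symmetric] exp_of_nat_mult[symmetric] mult_ac)
      have ce: "cnj e = inverse e" by (simp add: e_def exp_cnj exp_minus[symmetric])
      have e0: "e \<noteq> 0" by (simp add: e_def)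
      have "D i \<omega> * b i ^ (2 * m) = norm (e - 1) ^ (2 * m)"
        using b[of i] by (simp add: D_def e_def power_divide)
      then have "of_real (D i \<omega>) * of_real (b i) ^ (2 * m) = (of_real ((norm (e - 1))\<^sup>2) :: complex) ^ m"
        by (simp only: power_mult flip: of_real_power of_real_mult)
      also have "of_real ((norm (e - 1))\<^sup>2) = (e - 1) * (inverse e - 1)"
        using complex_norm_square[of "e - 1"] by (simp add: ce)
      also have "\<dots> = - 1 * inverse e * (e - 1)\<^sup>2" using e0 by (simp add: field_simps power2_eq_square)
      also have "\<dots> ^ m = (-1) ^ m * ((inverse e) ^ m * (e - 1) ^ (2 * m))"
        by (simp only: power_mult_distrib power_mult[of _ 2 m]) (simp only: mult_ac)
      finally show ?thesis unfolding e e_def .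
    qed
    have "of_real ((LINT \<omega> | P. D i \<omega>) * b i ^ (2 * m)) = (CLINT \<omega> | P. of_real (D i \<omega>) * of_real (b i) ^ (2 * m))"
      by simp
    also have "\<dots> = (-1) ^ m * fdiff (b i) (2 * m) (F 0) (- real m * b i)"
      unfolding alg F0' integral_exp_fdiff[OF W_meas[OF k]] by simp
    finally have "norm (complex_of_real ((LINT \<omega> | P. D i \<omega>) * b i ^ (2 * m))) = norm (fdiff (b i) (2 * m) (F 0) (- real m * b i))"
      by (simp only: norm_mult norm_power norm_minus_cancel norm_one power_one mult_1_left)
    also have "\<dots> \<le> C * b i ^ (2 * m)"
    proof (rule norm_fdiff_le[where a = "- real m" and b = "real m"])
      show "(F n has_vector_derivative F (Suc n) u) (at u)" for n u by (rule F')
      show "norm (F (0 + 2 * m) u) \<le> C" if "u \<in> {- real m..real m}" for u using C[OF that] by simp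
      show "- real m \<le> - real m * b i" using b[of i] mult_left_mono[of "b i" 1 "real m"] by simp
      show "- real m * b i + real (2 * m) * b i \<le> real m" using b[of i] mult_left_mono[of "b i" 1 "real m"] by simp
    qed (use b[of i] in simp)
    finally have "(LINT \<omega> | P. D i \<omega>) \<le> C"
      using b[of i] D_nn by (simp add: norm_mult abs_mult norm_power power_abs)
    then show ?thesis using D_int D_nn by (simp add: nn_integral_eq_integral ennreal_leI)
  qed
  have "(\<integral>\<^sup>+\<omega>. ennreal (W k \<omega> ^ (2 * m)) \<partial>P) = (\<integral>\<^sup>+\<omega>. liminf (\<lambda>i. ennreal (D i \<omega>)) \<partial>P)"
  proof (rule nn_integral_cong)
    fix \<omega>
    have "(\<lambda>i. ennreal (D i \<omega>)) \<longlonglongrightarrow> ennreal (W k \<omega> ^ (2 * m))"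
      by (intro tendsto_ennrealI D_lim)
    then show "ennreal (W k \<omega> ^ (2 * m)) = liminf (\<lambda>i. ennreal (D i \<omega>))"
      by (simp add: lim_imp_Liminf)
  qed
  also have "\<dots> \<le> liminf (\<lambda>i. \<integral>\<^sup>+\<omega>. ennreal (D i \<omega>) \<partial>P)"
    by (intro nn_integral_liminf) measurable
  also have "\<dots> \<le> liminf (\<lambda>i. ennreal C)"
    using D_le by (intro Liminf_mono always_eventually) auto
  also have "\<dots> < \<infinity>" by (simp add: Liminf_const)
  finally show ?thesis .
qed

text \<open>Even moments suffice, since t \<le> 1 + t^2.\<close>

lemma integrable_abs_power:
  assumes k: "k \<in> S"
  shows "integrable P (\<lambda>\<omega>. \<bar>W k \<omega>\<bar> ^ n)"
proof (rule Bochner_Integration.integrable_bound)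
  note [measurable] = W_meas[OF k]
  have "integrable P (\<lambda>\<omega>. W k \<omega> ^ (2 * n))"
    using nn_even_moment_finite[OF k, of n] by (intro integrableI_bounded) (auto simp: power_mult)
  then show "integrable P (\<lambda>\<omega>. 1 + W k \<omega> ^ (2 * n))" by simp
  show "AE \<omega> in P. norm (\<bar>W k \<omega>\<bar> ^ n) \<le> norm (1 + W k \<omega> ^ (2 * n))"
  proof (rule AE_I2)
    fix \<omega>
    define t where "t = \<bar>W k \<omega>\<bar> ^ n"
    have "0 \<le> t" by (simp add: t_def)
    moreover have "0 \<le> (t - 1)\<^sup>2" by simp
    ultimately have "t \<le> 1 + t\<^sup>2" by (simp add: power2_eq_square algebra_simps)
    moreover have "t\<^sup>2 = W k \<omega> ^ (2 * n)"
      by (simp add: t_def power_mult[symmetric] mult.commute[of n] power_even_abs)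
    ultimately show "norm (\<bar>W k \<omega>\<bar> ^ n) \<le> norm (1 + W k \<omega> ^ (2 * n))"
      unfolding t_def by (simp add: power_abs)
  qed
qed (use W_meas[OF k] in auto)

lemma integrable_prod_abs:
  assumes A: "A \<subseteq> S"
  shows "integrable P (\<lambda>\<omega>. \<Prod>i\<in>A. \<bar>W i \<omega>\<bar>)"
proof (cases "A = {}")
  case False
  have fA: "finite A" using A finite_S finite_subset by blast
  have m: "(\<lambda>\<omega>. \<Prod>i\<in>A. \<bar>W i \<omega>\<bar>) \<in> borel_measurable P"
    using W_meas A by (intro borel_measurable_prod borel_measurable_abs) auto
  show ?thesis
  proof (rule Bochner_Integration.integrable_bound[OF _ m])
    show "integrable P (\<lambda>\<omega>. \<Sum>i\<in>A. \<bar>W i \<omega>\<bar> ^ card A)"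
      using A by (intro Bochner_Integration.integrable_sum integrable_abs_power) auto
    show "AE \<omega> in P. norm (\<Prod>i\<in>A. \<bar>W i \<omega>\<bar>) \<le> norm (\<Sum>i\<in>A. \<bar>W i \<omega>\<bar> ^ card A)"
      using prod_abs_le_sum_power[OF fA False] by (auto simp: abs_prod intro!: AE_I2 order_trans[OF _ abs_ge_self])
  qed
qed simp

text \<open>By induction on A the identity is differentiated in one more coefficient of s: the left
  side acquires the factor i W_k under the expectation, the right side changes by Faa di Bruno's
  formula, and derivatives are unique. Keeping s general is what makes the induction
  possible.\<close>

lemma expectation_prod_exp:
  assumes "A \<subseteq> S"
  shows "(CLINT \<omega> | P. (\<Prod>i\<in>A. \<i> * of_real (W i \<omega>)) * exp (\<i> * of_real (\<Sum>i\<in>S. s i * W i \<omega>))) =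
    exp (cum {} s) * (\<Sum>\<pi>\<in>{\<pi>. partition_on A \<pi>}. \<Prod>B\<in>\<pi>. cum B s)"
proof -
  have "finite A" using assms finite_S finite_subset by blast
  then show ?thesis using assms
  proof (induction A arbitrary: s rule: finite_induct)
    case empty
    then show ?case using char_W by (simp add: partition_on_empty)
  next
    case (insert k A)
    then have k: "k \<in> S" and A: "A \<subseteq> S" by auto
    have R: "(\<Sum>i\<in>S. (s(k := u)) i * W i \<omega>) = u * W k \<omega> + (\<Sum>i\<in>S - {k}. s i * W i \<omega>)" for u \<omega>
      using finite_S k by (subst sum.remove[of S k]) (auto intro!: sum.cong)
    let ?f = "\<lambda>u \<omega>. (\<Prod>i\<in>A. \<i> * of_real (W i \<omega>)) * exp (\<i> * of_real (\<Sum>i\<in>S. (s(k := u)) i * W i \<omega>))"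
    let ?f' = "\<lambda>u \<omega>. (\<Prod>i\<in>insert k A. \<i> * of_real (W i \<omega>)) * exp (\<i> * of_real (\<Sum>i\<in>S. (s(k := u)) i * W i \<omega>))"
    have meas: "(\<lambda>\<omega>. (\<Prod>i\<in>B. \<i> * of_real (W i \<omega>)) * exp (\<i> * of_real (\<Sum>i\<in>S. s i * W i \<omega>))) \<in> borel_measurable P"
      if "B \<subseteq> S" for B s
    proof -
      have "(\<lambda>\<omega>. \<Sum>i\<in>S. s i * W i \<omega>) \<in> borel_measurable P" using W_meas by auto
      from measurable_compose[OF this, of "\<lambda>v. exp (\<i> * of_real v)" borel]
      have "(\<lambda>\<omega>. exp (\<i> * of_real (\<Sum>i\<in>S. s i * W i \<omega>))) \<in> borel_measurable P" by simp
      moreover have [measurable]: "\<And>i. i \<in> B \<Longrightarrow> W i \<in> borel_measurable P" using W_meas that by auto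
      have "(\<lambda>\<omega>. \<Prod>i\<in>B. \<i> * of_real (W i \<omega>)) \<in> borel_measurable P" by measurable
      ultimately show ?thesis by (intro borel_measurable_times)
    qed
    have nrm: "norm ((\<Prod>i\<in>B. \<i> * of_real (W i \<omega>)) * exp (\<i> * of_real (\<Sum>i\<in>S. s i * W i \<omega>))) = (\<Prod>i\<in>B. \<bar>W i \<omega>\<bar>)" for B s \<omega>
      by (simp add: norm_mult prod_norm[symmetric])
    have "((\<lambda>u. CLINT \<omega> | P. ?f u \<omega>) has_vector_derivative (CLINT \<omega> | P. ?f' u \<omega>)) (at u)" for u
    proof (rule has_vector_derivative_integral_dominated[where g = "\<lambda>\<omega>. \<Prod>i\<in>insert k A. \<bar>W i \<omega>\<bar>"])
      show "integrable P (?f u)" for u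
        by (rule Bochner_Integration.integrable_bound[OF integrable_prod_abs[OF A] meas[OF A]])
          (rule AE_I2, simp only: nrm real_norm_def abs_prod abs_idempotent order_refl)
      show "integrable P (\<lambda>\<omega>. \<Prod>i\<in>insert k A. \<bar>W i \<omega>\<bar>)" using insert.prems by (rule integrable_prod_abs)
      show "?f' u \<in> borel_measurable P" using insert.prems by (rule meas)
      show "norm (?f' u \<omega>) \<le> (\<Prod>i\<in>insert k A. \<bar>W i \<omega>\<bar>)" for u \<omega> by (simp only: nrm order_refl)
      fix u \<omega>
      let ?r = "\<Sum>i\<in>S - {k}. s i * W i \<omega>"
      have "((\<lambda>w. (\<Prod>i\<in>A. \<i> * of_real (W i \<omega>)) * exp (\<i> * (w * of_real (W k \<omega>) + of_real ?r))) has_field_derivative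
          (\<Prod>i\<in>A. \<i> * of_real (W i \<omega>)) * (\<i> * of_real (W k \<omega>) * exp (\<i> * (of_real u * of_real (W k \<omega>) + of_real ?r)))) (at (of_real u))"
        by (auto intro!: derivative_eq_intros)
      from has_vector_derivative_real_field[OF this]
      show "((\<lambda>u. ?f u \<omega>) has_vector_derivative ?f' u \<omega>) (at u)"
        unfolding R using insert.hyps by (simp add: mult_ac)
    qed
    moreover have "((\<lambda>u. CLINT \<omega> | P. ?f u \<omega>) has_vector_derivative
       exp (cum {} (s(k := u))) * (\<Sum>\<pi>\<in>{\<pi>. partition_on (insert k A) \<pi>}. \<Prod>B\<in>\<pi>. cum B (s(k := u)))) (at u)" for u
      unfolding insert.IH[OF A]
    proof (rule has_vector_derivative_exp_partition_sum[OF insert.hyps])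
      show "((\<lambda>u. cum B (s(k := u))) has_vector_derivative cum (insert k B) (s(k := u))) (at u)" if "B \<subseteq> A" for B
        using that A k insert.hyps by (intro has_vector_derivative_cum) auto
    qed (rule has_vector_derivative_exp_cum[OF k])
    ultimately have "(CLINT \<omega> | P. ?f' u \<omega>) =
        exp (cum {} (s(k := u))) * (\<Sum>\<pi>\<in>{\<pi>. partition_on (insert k A) \<pi>}. \<Prod>B\<in>\<pi>. cum B (s(k := u)))" for u
      by (rule vector_derivative_unique_at)
    \<comment> \<open>Updating s at k by its own value gives s back.\<close>
    from this[of "s k"] show ?case by simp
  qed
qed

text \<open>The moment-cumulant formula, obtained at s = 0. Each block contributes i to the power of
  its size; the sizes add up to \<open>card S\<close>, so these powers cancel against the left
  side.\<close>

lemma expectation_prod: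
  "(LINT \<omega> | P. (\<Prod>i\<in>S. W i \<omega>)) =
    (\<Sum>\<pi>\<in>{\<pi>. partition_on S \<pi>}. \<Prod>B\<in>\<pi>. levy_cumulant a \<sigma> z r (card B) * (LINT x | N. (\<Prod>i\<in>B. h i x)))"
proof -
  let ?R = "\<Sum>\<pi>\<in>{\<pi>. partition_on S \<pi>}. \<Prod>B\<in>\<pi>. levy_cumulant a \<sigma> z r (card B) * (LINT x | N. (\<Prod>i\<in>B. h i x))"
  have "\<i> ^ card S * of_real (LINT \<omega> | P. (\<Prod>i\<in>S. W i \<omega>)) = \<i> ^ card S * (CLINT \<omega> | P. of_real (\<Prod>i\<in>S. W i \<omega>))"
    by (subst integral_complex_of_real) simp
  also have "\<dots> = (CLINT \<omega> | P. \<i> ^ card S * of_real (\<Prod>i\<in>S. W i \<omega>))"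
    by (rule integral_mult_right_zero[symmetric])
  also have "\<dots> = (CLINT \<omega> | P. (\<Prod>i\<in>S. \<i> * of_real (W i \<omega>)) * exp (\<i> * of_real (\<Sum>i\<in>S. (\<lambda>_. 0) i * W i \<omega>)))"
    by (simp add: prod.distrib)
  also have "\<dots> = exp (cum {} (\<lambda>_. 0)) * (\<Sum>\<pi>\<in>{\<pi>. partition_on S \<pi>}. \<Prod>B\<in>\<pi>. cum B (\<lambda>_. 0))"
    by (rule expectation_prod_exp) simp
  also have "cum {} (\<lambda>_. 0) = 0" by (simp add: cum_def lin_def psi_at_0)
  also have "exp 0 * (\<Sum>\<pi>\<in>{\<pi>. partition_on S \<pi>}. \<Prod>B\<in>\<pi>. cum B (\<lambda>_. 0)) = (\<Sum>\<pi>\<in>{\<pi>. partition_on S \<pi>}. \<i> ^ card S *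
     of_real (\<Prod>B\<in>\<pi>. levy_cumulant a \<sigma> z r (card B) * (LINT x | N. (\<Prod>i\<in>B. h i x))))"
  proof -
    have "(\<Prod>B\<in>\<pi>. cum B (\<lambda>_. 0)) = \<i> ^ card S * of_real (\<Prod>B\<in>\<pi>. levy_cumulant a \<sigma> z r (card B) * (LINT x | N. (\<Prod>i\<in>B. h i x)))"
      if "partition_on S \<pi>" for \<pi>
    proof -
      have "B \<subseteq> S \<and> B \<noteq> {}" if "B \<in> \<pi>" for B
        using that \<open>partition_on S \<pi>\<close> partition_onD1 partition_onD3 by blast
      then have "(\<Prod>B\<in>\<pi>. cum B (\<lambda>_. 0)) = (\<Prod>B\<in>\<pi>. \<i> ^ card B * of_real (levy_cumulant a \<sigma> z r (card B) * (LINT x | N. (\<Prod>i\<in>B. h i x))))"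
        by (intro prod.cong refl cum_0) auto
      also have "\<dots> = \<i> ^ (\<Sum>B\<in>\<pi>. card B) * of_real (\<Prod>B\<in>\<pi>. levy_cumulant a \<sigma> z r (card B) * (LINT x | N. (\<Prod>i\<in>B. h i x)))"
        by (simp add: prod.distrib power_sum)
      also have "(\<Sum>B\<in>\<pi>. card B) = card S"
        using product_partition[OF that] finite_S finite_elements[OF finite_S that]
        by (metis finite_subset \<open>\<And>B. B \<in> \<pi> \<Longrightarrow> B \<subseteq> S \<and> B \<noteq> {}\<close>)
      finally show ?thesis .
    qed
    then show ?thesis by simp
  qed
  also have "\<dots> = \<i> ^ card S * of_real ?R" by (simp add: sum_distrib_left)
  finally have "complex_of_real (LINT \<omega> | P. (\<Prod>i\<in>S. W i \<omega>)) = of_real ?R"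
    by (simp only: mult_cancel_left) simp
  then show ?thesis by (simp only: of_real_eq_iff)
qed

end

section \<open>Test functions, tempered distributions and the stochastic integral\<close>

lemma time_deriv_lin:
  fixes g h :: "real \<times> (real ^ 'd::finite) \<Rightarrow> real"
  assumes g: "g \<in> schwartz_Gam \<delta>" and h: "h \<in> schwartz_Gam \<delta>" and x: "x \<in> lattice \<delta>"
  shows "time_deriv k (\<lambda>y. c * g y + h y) (t, x) = c * time_deriv k g (t, x) + time_deriv k h (t, x)"
proof -
  have dg: "(deriv ^^ k) (\<lambda>s. g (s, x)) field_differentiable at t" for k t
    using g x by (auto simp: schwartz_Gam_def time_deriv_def real_differentiable_def field_differentiable_def)
  have dh: "(deriv ^^ k) (\<lambda>s. h (s, x)) field_differentiable at t" for k t
    using h x by (auto simp: schwartz_Gam_def time_deriv_def real_differentiable_def field_differentiable_def)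
  have "(deriv ^^ k) (\<lambda>s. c * g (s, x) + h (s, x)) = (\<lambda>t. c * (deriv ^^ k) (\<lambda>s. g (s, x)) t + (deriv ^^ k) (\<lambda>s. h (s, x)) t)"
  proof (induction k)
    case (Suc k)
    have "deriv (\<lambda>t. c * (deriv ^^ k) (\<lambda>s. g (s, x)) t + (deriv ^^ k) (\<lambda>s. h (s, x)) t) t =
        c * deriv ((deriv ^^ k) (\<lambda>s. g (s, x))) t + deriv ((deriv ^^ k) (\<lambda>s. h (s, x))) t" for t
      using dg[of k t] dh[of k t] by (simp add: deriv_add deriv_cmult field_differentiable_mult)
    then show ?case by (intro ext) (simp add: Suc)
  qed simp
  then show ?thesis by (simp add: time_deriv_def)
qed

lemma schwartz_Gam_lin:
  fixes g h :: "real \<times> (real ^ 'd::finite) \<Rightarrow> real"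
  assumes g: "g \<in> schwartz_Gam \<delta>" and h: "h \<in> schwartz_Gam \<delta>"
  shows "(\<lambda>y. c * g y + h y) \<in> schwartz_Gam \<delta>"
proof -
  note td = time_deriv_lin[OF g h]
  have diff: "(\<lambda>s. time_deriv k (\<lambda>y. c * g y + h y) (s, x)) differentiable (at t)" if "x \<in> lattice \<delta>" for x k t
    unfolding td[OF that] using g h that
    by (intro derivative_intros) (auto simp: schwartz_Gam_def)
  have "bdd_above ((\<lambda>x. (1 + (norm x)\<^sup>2) ^ N * \<bar>time_deriv k (\<lambda>y. c * g y + h y) x\<bar>) ` Gam \<delta>)" for k N
  proof -
    have ex: "\<exists>A. \<forall>x\<in>Gam \<delta>. (1 + (norm x)\<^sup>2) ^ N * \<bar>time_deriv k g x\<bar> \<le> A"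
      if "g \<in> schwartz_Gam \<delta>" for g :: "real \<times> (real ^ 'd) \<Rightarrow> real"
      using that by (auto simp: schwartz_Gam_def bdd_above_def)
    obtain A where A: "\<And>x. x \<in> Gam \<delta> \<Longrightarrow> (1 + (norm x)\<^sup>2) ^ N * \<bar>time_deriv k g x\<bar> \<le> A"
      using ex[OF g] by blast
    obtain B where B: "\<And>x. x \<in> Gam \<delta> \<Longrightarrow> (1 + (norm x)\<^sup>2) ^ N * \<bar>time_deriv k h x\<bar> \<le> B"
      using ex[OF h] by blast
    show ?thesis
    proof (rule bdd_aboveI2)
      fix y :: "real \<times> (real ^ 'd)" assume y: "y \<in> Gam \<delta>"
      obtain t x where y': "y = (t, x)" and x: "x \<in> lattice \<delta>" using y by (auto simp: Gam_def)
      let ?w = "(1 + (norm y)\<^sup>2) ^ N"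
      have "?w * \<bar>time_deriv k (\<lambda>y. c * g y + h y) y\<bar> \<le> ?w * (\<bar>c\<bar> * \<bar>time_deriv k g y\<bar> + \<bar>time_deriv k h y\<bar>)"
        unfolding y' td[OF x]
        by (intro mult_left_mono) (auto simp: abs_mult[symmetric] intro: order_trans[OF abs_triangle_ineq])
      also have "\<dots> = \<bar>c\<bar> * (?w * \<bar>time_deriv k g y\<bar>) + ?w * \<bar>time_deriv k h y\<bar>" by (simp add: algebra_simps)
      also have "\<dots> \<le> \<bar>c\<bar> * A + B" using A[OF y] B[OF y] by (intro add_mono mult_left_mono) auto
      finally show "?w * \<bar>time_deriv k (\<lambda>y. c * g y + h y) y\<bar> \<le> \<bar>c\<bar> * A + B" .
    qed
  qed
  with diff show ?thesis using g h by (auto simp: schwartz_Gam_def)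
qed

lemma schwartz_Gam_zero: "(\<lambda>_. 0) \<in> schwartz_Gam \<delta>"
proof -
  have "(deriv ^^ k) (\<lambda>_. 0) = (\<lambda>_. 0::real)" for k by (induction k) auto
  then show ?thesis by (auto simp: schwartz_Gam_def time_deriv_def case_prod_beta)
qed

lemma tempered_zero: "\<xi> \<in> tempered \<delta> \<Longrightarrow> \<xi> (\<lambda>_. 0) = 0"
proof -
  assume "\<xi> \<in> tempered \<delta>"
  then have "\<forall>g\<in>schwartz_Gam \<delta>. \<forall>c. \<xi> (\<lambda>x. c * g x) = c * \<xi> g" by (simp add: tempered_def)
  from bspec[OF this schwartz_Gam_zero] have "\<xi> (\<lambda>x. 0 * 0) = 0 * \<xi> (\<lambda>_. 0)" by (rule spec)
  then show ?thesis by simp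
qed

lemma tempered_lin:
  assumes "\<xi> \<in> tempered \<delta>" "g \<in> schwartz_Gam \<delta>" "h \<in> schwartz_Gam \<delta>"
  shows "\<xi> (\<lambda>y. c * g y + h y) = c * \<xi> g + \<xi> h"
proof -
  have cg: "(\<lambda>y. c * g y) \<in> schwartz_Gam \<delta>"
    using schwartz_Gam_lin[OF assms(2) schwartz_Gam_zero, of c] by simp
  have "\<xi> (\<lambda>y. (\<lambda>y. c * g y) y + h y) = \<xi> (\<lambda>y. c * g y) + \<xi> h"
  proof -
    have "\<forall>g\<in>schwartz_Gam \<delta>. \<forall>h\<in>schwartz_Gam \<delta>. \<xi> (\<lambda>x. g x + h x) = \<xi> g + \<xi> h"
      using assms(1) by (simp add: tempered_def)
    from bspec[OF bspec[OF this cg] assms(3)] show ?thesis .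
  qed
  moreover have "\<xi> (\<lambda>y. c * g y) = c * \<xi> g" using assms by (simp add: tempered_def)
  ultimately show ?thesis by simp
qed

locale levy_noise = lattice_kernel \<delta> m0 + levy_jumps a \<sigma> z r
  for \<delta> m0 a \<sigma> z and r :: "real measure" +
  fixes P :: "((real \<times> (real ^ 'd::finite) \<Rightarrow> real) \<Rightarrow> real) measure"
  assumes noise_law: "levy_noise_law \<delta> a \<sigma> z r P"
begin

sublocale P: prob_space P
  using noise_law by (simp add: levy_noise_law_def)

abbreviation "N \<equiv> restrict_space (Gam_measure \<delta> :: (real \<times> (real ^ 'd)) measure) (Gam_pos \<delta>)"

lemma space_P: "space P = tempered \<delta>"
  using noise_law by (simp add: levy_noise_law_def)

lemma eval_measurable: "g \<in> schwartz_Gam \<delta> \<Longrightarrow> (\<lambda>\<xi>. \<xi> g) \<in> borel_measurable P"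
proof (rule measurableI)
  fix B :: "real set" assume "g \<in> schwartz_Gam \<delta>" "B \<in> sets borel"
  then have "{\<xi> \<in> tempered \<delta>. \<xi> g \<in> B} \<in> sigma_sets (tempered \<delta>)
       {{\<xi> \<in> tempered \<delta>. \<xi> g \<in> B} | g B. g \<in> schwartz_Gam \<delta> \<and> B \<in> sets borel}"
    by (intro sigma_sets.Basic) blast
  then have "{\<xi> \<in> tempered \<delta>. \<xi> g \<in> B} \<in> sets P"
    using noise_law unfolding levy_noise_law_def by simp
  moreover have "(\<lambda>\<xi>. \<xi> g) -` B \<inter> space P = {\<xi> \<in> tempered \<delta>. \<xi> g \<in> B}" by (auto simp: space_P)
  ultimately show "(\<lambda>\<xi>. \<xi> g) -` B \<inter> space P \<in> sets P" by simp
qed simp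

lemma Gam_pos_sets: "Gam_pos \<delta> \<in> sets (Gam_measure \<delta> :: (real \<times> (real ^ 'd)) measure)"
  unfolding Gam_measure_def Gam_pos_def by (intro pair_measureI) (auto simp: sets_lattice_measure)

lemma Gam_pos_sets': "Gam_pos \<delta> \<inter> space (Gam_measure \<delta>) \<in> sets (Gam_measure \<delta> :: (real \<times> (real ^ 'd)) measure)"
  by (rule sets.Int[OF Gam_pos_sets sets.top])

lemma space_N: "space N = Gam_pos \<delta>"
  by (auto simp: space_restrict_space Gam_def Gam_pos_def)

lemma schwartz_measurable:
  assumes g: "g \<in> schwartz_Gam \<delta>"
  shows "g \<in> borel_measurable N"
proof (rule measurable_restrict_space1, rule measurable_Gam_iff)
  fix x :: "real ^ 'd" assume x: "x \<in> lattice \<delta>"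
  have "(\<lambda>s. time_deriv 0 g (s, x)) differentiable (at t)" for t
    using g x unfolding schwartz_Gam_def by blast
  then have "continuous_on UNIV (\<lambda>s. g (s, x))"
    by (intro continuous_at_imp_continuous_on ballI differentiable_imp_continuous_within) (simp add: time_deriv_def)
  then show "(\<lambda>s. g (s, x)) \<in> borel_measurable borel" by (rule borel_measurable_continuous_onI)
qed

lemma char_schwartz:
  assumes "g \<in> schwartz_Gam \<delta>"
  shows "(CLINT \<xi> | P. exp (\<i> * of_real (\<xi> g))) = exp (CLINT x | N. \<psi> 0 (g x))"
proof -
  have "(CLINT x | N. \<psi> 0 (g x)) = (CLINT x : Gam_pos \<delta> | Gam_measure \<delta>. levy_exponent a \<sigma> z r (g x))"
    unfolding psi_0 set_lebesgue_integral_def by (rule integral_restrict_space[OF Gam_pos_sets'])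
  then show ?thesis using noise_law assms unfolding levy_noise_law_def by simp
qed

text \<open>The defining data of a stochastic integral with the approximating sequence made
  explicit, so that sequences can be combined linearly. Set integrals over the positive half become
  integrals over a restricted space.\<close>

definition approximates ::
    "(nat \<Rightarrow> real \<times> (real ^ 'd) \<Rightarrow> real) \<Rightarrow> (real \<times> (real ^ 'd) \<Rightarrow> real) \<Rightarrow> (((real \<times> (real ^ 'd) \<Rightarrow> real) \<Rightarrow> real) \<Rightarrow> real) \<Rightarrow> bool" where
  "approximates g h Y \<longleftrightarrow> (\<forall>k. g k \<in> schwartz_Gam \<delta>) \<and>
     (\<lambda>k. \<integral>\<^sup>+x. ennreal \<bar>g k x - h x\<bar> \<partial>N) \<longlonglongrightarrow> 0 \<and>
     (\<lambda>k. \<integral>\<^sup>+x. ennreal ((g k x - h x)\<^sup>2) \<partial>N) \<longlonglongrightarrow> 0 \<and>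
     (\<lambda>k. \<integral>\<^sup>+\<xi>. ennreal ((\<xi> (g k) - Y \<xi>)\<^sup>2) \<partial>P) \<longlonglongrightarrow> 0"

lemma stochastic_integral_iff:
  "stochastic_integral \<delta> P h Y \<longleftrightarrow> Y \<in> borel_measurable P \<and> (\<exists>g. approximates g h Y)"
proof -
  have "(\<integral>\<^sup>+x. f x \<partial>N) = (\<integral>\<^sup>+x\<in>Gam_pos \<delta>. f x \<partial>Gam_measure \<delta>)" for f
    by (rule nn_integral_restrict_space[OF Gam_pos_sets'])
  then show ?thesis unfolding stochastic_integral_def approximates_def by simp
qed

lemma nn_integral_lin:
  "f \<in> borel_measurable M \<Longrightarrow> g \<in> borel_measurable M \<Longrightarrow>
    (\<integral>\<^sup>+x. ennreal c * f x + ennreal d * g x \<partial>M) = ennreal c * (\<integral>\<^sup>+x. f x \<partial>M) + ennreal d * (\<integral>\<^sup>+x. g x \<partial>M)"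
  by (simp add: nn_integral_add nn_integral_cmult)

lemma tendsto_0_nn_le:
  fixes f :: "nat \<Rightarrow> ennreal"
  assumes "\<And>k. f k \<le> ennreal c * u k + ennreal d * v k" "u \<longlonglongrightarrow> 0" "v \<longlonglongrightarrow> 0"
  shows "f \<longlonglongrightarrow> 0"
proof (rule tendsto_sandwich[OF _ _ tendsto_const])
  have "(\<lambda>k. ennreal c * u k + ennreal d * v k) \<longlonglongrightarrow> ennreal c * 0 + ennreal d * 0"
    by (intro tendsto_add ennreal_tendsto_cmult assms) auto
  then show "(\<lambda>k. ennreal c * u k + ennreal d * v k) \<longlonglongrightarrow> 0" by simp
qed (use assms(1) in auto)

text \<open>The error of the combination is the combination of the errors, on the side of the noise
  because tempered distributions are linear. The triangle inequality handles L1, and the square of a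
  sum is at most twice the sum of the squares.\<close>

lemma approximates_lin:
  assumes g: "approximates g h Y" and g': "approximates g' h' Y'"
    and [measurable]: "h \<in> borel_measurable N" "h' \<in> borel_measurable N" "Y \<in> borel_measurable P" "Y' \<in> borel_measurable P"
  shows "approximates (\<lambda>k y. c * g k y + g' k y) (\<lambda>y. c * h y + h' y) (\<lambda>\<xi>. c * Y \<xi> + Y' \<xi>)"
proof -
  have gs: "g k \<in> schwartz_Gam \<delta>" "g' k \<in> schwartz_Gam \<delta>" for k using g g' by (auto simp: approximates_def)
  note [measurable] = schwartz_measurable[OF gs(1)] schwartz_measurable[OF gs(2)] eval_measurable[OF gs(1)] eval_measurable[OF gs(2)]
  have ab: "ennreal \<bar>c * u + u' - (c * v + v')\<bar> \<le> ennreal \<bar>c\<bar> * ennreal \<bar>u - v\<bar> + ennreal 1 * ennreal \<bar>u' - v'\<bar>" for u u' v v'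
  proof -
    have "\<bar>c * u + u' - (c * v + v')\<bar> = \<bar>c * (u - v) + (u' - v')\<bar>" by (simp add: algebra_simps)
    also have "\<dots> \<le> \<bar>c\<bar> * \<bar>u - v\<bar> + \<bar>u' - v'\<bar>" by (simp add: abs_mult[symmetric] abs_triangle_ineq)
    finally show ?thesis by (simp add: ennreal_mult[symmetric] ennreal_plus[symmetric] ennreal_leI del: ennreal_plus)
  qed
  have sq: "ennreal ((c * u + u' - (c * v + v'))\<^sup>2) \<le> ennreal (2 * c\<^sup>2) * ennreal ((u - v)\<^sup>2) + ennreal 2 * ennreal ((u' - v')\<^sup>2)" for u u' v v'
  proof -
    have "(c * u + u' - (c * v + v'))\<^sup>2 = (c * (u - v) + (u' - v'))\<^sup>2" by (simp add: algebra_simps)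
    also have "\<dots> \<le> 2 * (c * (u - v))\<^sup>2 + 2 * (u' - v')\<^sup>2"
      using zero_le_power2[of "c * (u - v) - (u' - v')"] by (simp add: power2_eq_square algebra_simps)
    also have "\<dots> = 2 * c\<^sup>2 * (u - v)\<^sup>2 + 2 * (u' - v')\<^sup>2" by (simp add: power_mult_distrib)
    finally have "ennreal ((c * u + u' - (c * v + v'))\<^sup>2) \<le> ennreal (2 * c\<^sup>2 * (u - v)\<^sup>2 + 2 * (u' - v')\<^sup>2)"
      by (rule ennreal_leI)
    also have "\<dots> = ennreal (2 * c\<^sup>2) * ennreal ((u - v)\<^sup>2) + ennreal 2 * ennreal ((u' - v')\<^sup>2)"
      by (subst (1 2) ennreal_mult[symmetric]) (auto simp: ennreal_plus)
    finally show ?thesis .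
  qed
  show ?thesis unfolding approximates_def
  proof (intro conjI allI)
    show "(\<lambda>y. c * g k y + g' k y) \<in> schwartz_Gam \<delta>" for k by (intro schwartz_Gam_lin gs)
    show "(\<lambda>k. \<integral>\<^sup>+x. ennreal \<bar>c * g k x + g' k x - (c * h x + h' x)\<bar> \<partial>N) \<longlonglongrightarrow> 0"
    proof (rule tendsto_0_nn_le)
      show "(\<integral>\<^sup>+x. ennreal \<bar>c * g k x + g' k x - (c * h x + h' x)\<bar> \<partial>N) \<le>
         ennreal \<bar>c\<bar> * (\<integral>\<^sup>+x. ennreal \<bar>g k x - h x\<bar> \<partial>N) + ennreal 1 * (\<integral>\<^sup>+x. ennreal \<bar>g' k x - h' x\<bar> \<partial>N)" for k
        by (subst nn_integral_lin[symmetric]) (auto intro!: nn_integral_mono ab[simplified])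
    qed (use g g' in \<open>auto simp: approximates_def\<close>)
    show "(\<lambda>k. \<integral>\<^sup>+x. ennreal ((c * g k x + g' k x - (c * h x + h' x))\<^sup>2) \<partial>N) \<longlonglongrightarrow> 0"
    proof (rule tendsto_0_nn_le)
      show "(\<integral>\<^sup>+x. ennreal ((c * g k x + g' k x - (c * h x + h' x))\<^sup>2) \<partial>N) \<le>
         ennreal (2 * c\<^sup>2) * (\<integral>\<^sup>+x. ennreal ((g k x - h x)\<^sup>2) \<partial>N) + ennreal 2 * (\<integral>\<^sup>+x. ennreal ((g' k x - h' x)\<^sup>2) \<partial>N)" for k
        by (subst nn_integral_lin[symmetric]) (auto intro!: nn_integral_mono sq[simplified])
    qed (use g g' in \<open>auto simp: approximates_def\<close>)
    show "(\<lambda>k. \<integral>\<^sup>+\<xi>. ennreal ((\<xi> (\<lambda>y. c * g k y + g' k y) - (c * Y \<xi> + Y' \<xi>))\<^sup>2) \<partial>P) \<longlonglongrightarrow> 0"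
    proof (rule tendsto_0_nn_le)
      show "(\<integral>\<^sup>+\<xi>. ennreal ((\<xi> (\<lambda>y. c * g k y + g' k y) - (c * Y \<xi> + Y' \<xi>))\<^sup>2) \<partial>P) \<le>
         ennreal (2 * c\<^sup>2) * (\<integral>\<^sup>+\<xi>. ennreal ((\<xi> (g k) - Y \<xi>)\<^sup>2) \<partial>P) + ennreal 2 * (\<integral>\<^sup>+\<xi>. ennreal ((\<xi> (g' k) - Y' \<xi>)\<^sup>2) \<partial>P)" for k
      proof -
        have "(\<integral>\<^sup>+\<xi>. ennreal ((\<xi> (\<lambda>y. c * g k y + g' k y) - (c * Y \<xi> + Y' \<xi>))\<^sup>2) \<partial>P) =
            (\<integral>\<^sup>+\<xi>. ennreal ((c * \<xi> (g k) + \<xi> (g' k) - (c * Y \<xi> + Y' \<xi>))\<^sup>2) \<partial>P)"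
          by (rule nn_integral_cong) (simp add: space_P tempered_lin[OF _ gs])
        also have "\<dots> \<le> ennreal (2 * c\<^sup>2) * (\<integral>\<^sup>+\<xi>. ennreal ((\<xi> (g k) - Y \<xi>)\<^sup>2) \<partial>P) + ennreal 2 * (\<integral>\<^sup>+\<xi>. ennreal ((\<xi> (g' k) - Y' \<xi>)\<^sup>2) \<partial>P)"
          using eval_measurable[OF gs(1)] eval_measurable[OF gs(2)] assms(5,6)
          by (subst nn_integral_lin[symmetric]) (auto intro!: nn_integral_mono sq[simplified] measurable_compose[OF _ measurable_ennreal])
        finally show ?thesis .
      qed
    qed (use g g' in \<open>auto simp: approximates_def\<close>)
  qed
qed

text \<open>A joint characteristic function is evaluated at linear combinations, so one
  approximating sequence is needed for the combination rather than one for each summand.\<close>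

lemma approximates_sum:
  assumes "finite S" and g: "\<And>i. i \<in> S \<Longrightarrow> \<exists>g. approximates g (h i) (Y i)"
    and m: "\<And>i. i \<in> S \<Longrightarrow> h i \<in> borel_measurable N" "\<And>i. i \<in> S \<Longrightarrow> Y i \<in> borel_measurable P"
  shows "\<exists>g. approximates g (\<lambda>y. \<Sum>i\<in>S. s i * h i y) (\<lambda>\<xi>. \<Sum>i\<in>S. s i * Y i \<xi>)"
  using assms
proof (induction S rule: finite_induct)
  case empty
  have "(\<integral>\<^sup>+\<xi>. ennreal ((\<xi> (\<lambda>_. 0) - 0)\<^sup>2) \<partial>P) = (\<integral>\<^sup>+\<xi>. 0 \<partial>P)"
    by (rule nn_integral_cong) (simp add: space_P tempered_zero)
  then have "approximates (\<lambda>_ _. 0) (\<lambda>_. 0) (\<lambda>_. 0)"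
    unfolding approximates_def by (simp add: schwartz_Gam_zero)
  then show ?case by auto
next
  case (insert i S)
  obtain g where "approximates g (h i) (Y i)" using insert.prems by blast
  moreover obtain g' where "approximates g' (\<lambda>y. \<Sum>i\<in>S. s i * h i y) (\<lambda>\<xi>. \<Sum>i\<in>S. s i * Y i \<xi>)"
    using insert by auto
  ultimately have "approximates (\<lambda>k y. s i * g k y + g' k y) (\<lambda>y. s i * h i y + (\<Sum>i\<in>S. s i * h i y)) (\<lambda>\<xi>. s i * Y i \<xi> + (\<Sum>i\<in>S. s i * Y i \<xi>))"
    using insert.prems by (intro approximates_lin borel_measurable_sum borel_measurable_times) auto
  then show ?case using insert.hyps by auto
qed

text \<open>Both sides of the formula for test functions pass to the limit: the right one by the L1
  and L2 convergence of \<open>g k\<close>, the left one because exp (i x) is Lipschitz and mean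
  square convergence controls the first absolute moment.\<close>

lemma char_approximates:
  assumes g: "approximates g h Y" and [measurable]: "Y \<in> borel_measurable P"
    and h: "h \<in> borel_measurable N" "integrable N h" "\<And>x. x \<in> space N \<Longrightarrow> \<bar>h x\<bar> \<le> H"
  shows "(CLINT \<xi> | P. exp (\<i> * of_real (Y \<xi>))) = exp (CLINT x | N. \<psi> 0 (h x))"
proof -
  have gs: "g k \<in> schwartz_Gam \<delta>" for k using g by (auto simp: approximates_def)
  note [measurable] = schwartz_measurable[OF gs] eval_measurable[OF gs] h(1)
  define K where "K = \<bar>a\<bar> + \<sigma>\<^sup>2 + \<bar>z\<bar> * (LINT s | r. \<bar>s\<bar>)"
  have K0: "K \<ge> 0" unfolding K_def by (intro add_nonneg_nonneg mult_nonneg_nonneg integral_nonneg_AE) auto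
  have H0: "\<bar>h x\<bar> \<le> \<bar>H\<bar>" if "x \<in> space N" for x using h(3)[OF that] by simp
  \<comment> \<open>Writing u^2 - v^2 = (u - v)^2 + 2 v (u - v) makes the estimate depend on a bound
    for the limit v alone; the approximating functions need not be uniformly bounded.\<close>
  have pd: "norm (\<psi> 0 (u) - \<psi> 0 v) \<le> K * (1 + 2 * R) * \<bar>u - v\<bar> + K * (u - v)\<^sup>2" if "\<bar>v\<bar> \<le> R" for u v R
  proof -
    have "\<bar>u\<^sup>2 - v\<^sup>2\<bar> = \<bar>(u - v)\<^sup>2 + 2 * v * (u - v)\<bar>" by (simp add: power2_eq_square algebra_simps)
    also have "\<dots> \<le> (u - v)\<^sup>2 + 2 * \<bar>v\<bar> * \<bar>u - v\<bar>"
      by (rule order_trans[OF abs_triangle_ineq]) (simp add: abs_mult)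
    also have "\<dots> \<le> (u - v)\<^sup>2 + 2 * R * \<bar>u - v\<bar>" using that by (intro add_left_mono mult_right_mono) auto
    finally have "K * (\<bar>u - v\<bar> + \<bar>u\<^sup>2 - v\<^sup>2\<bar>) \<le> K * (\<bar>u - v\<bar> + ((u - v)\<^sup>2 + 2 * R * \<bar>u - v\<bar>))"
      using K0 by (intro mult_left_mono add_left_mono) auto
    then show ?thesis using norm_psi_diff_le[of u v] unfolding K_def[symmetric] by (simp add: algebra_simps)
  qed
  have hpsi: "integrable N (\<lambda>x. \<psi> 0 (h x))"
  proof -
    interpret F: levy_family a \<sigma> z r N "{()}" "\<lambda>_. h" H by unfold_locales (use h in auto)
    show ?thesis using F.integrand_int[of "{}" "\<lambda>_. 1"] by (simp add: F.lin_def)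
  qed
  have D1: "(\<lambda>k. \<integral>\<^sup>+x. ennreal \<bar>g k x - h x\<bar> \<partial>N) \<longlonglongrightarrow> 0" and D2: "(\<lambda>k. \<integral>\<^sup>+x. ennreal ((g k x - h x)\<^sup>2) \<partial>N) \<longlonglongrightarrow> 0"
    and D3: "(\<lambda>k. \<integral>\<^sup>+\<xi>. ennreal ((\<xi> (g k) - Y \<xi>)\<^sup>2) \<partial>P) \<longlonglongrightarrow> 0" using g by (auto simp: approximates_def)
  have cK: "0 \<le> K * (1 + 2 * \<bar>H\<bar>)" using K0 by simp
  define e where "e = (\<lambda>k. \<integral>\<^sup>+x. ennreal (norm (\<psi> 0 (g k x) - \<psi> 0 (h x))) \<partial>N)"
  have e0: "e \<longlonglongrightarrow> 0"
  proof (rule tendsto_0_nn_le[OF _ D1 D2])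
    fix k
    have "e k \<le> (\<integral>\<^sup>+x. ennreal (K * (1 + 2 * \<bar>H\<bar>)) * ennreal \<bar>g k x - h x\<bar> + ennreal K * ennreal ((g k x - h x)\<^sup>2) \<partial>N)"
      unfolding e_def
    proof (rule nn_integral_mono)
      fix x assume "x \<in> space N"
      from pd[OF H0[OF this], of "g k x"]
      show "ennreal (norm (\<psi> 0 (g k x) - \<psi> 0 (h x))) \<le> ennreal (K * (1 + 2 * \<bar>H\<bar>)) * ennreal \<bar>g k x - h x\<bar> + ennreal K * ennreal ((g k x - h x)\<^sup>2)"
        using K0 cK by (simp add: ennreal_mult[symmetric] ennreal_plus[symmetric] ennreal_leI del: ennreal_plus)
    qed
    also have "\<dots> = ennreal (K * (1 + 2 * \<bar>H\<bar>)) * (\<integral>\<^sup>+x. ennreal \<bar>g k x - h x\<bar> \<partial>N) + ennreal K * (\<integral>\<^sup>+x. ennreal ((g k x - h x)\<^sup>2) \<partial>N)"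
      using h(1) by (intro nn_integral_lin) auto
    finally show "e k \<le> \<dots>" .
  qed
  have "(\<lambda>k. CLINT x | N. \<psi> 0 (g k x)) \<longlonglongrightarrow> (CLINT x | N. \<psi> 0 (h x))"
  proof (rule LIM_zero_cancel, rule tendstoI)
    fix eps :: real assume eps: "eps > 0"
    have "\<forall>\<^sub>F k in sequentially. e k < ennreal eps"
      using e0 eps by (intro order_tendstoD) auto
    then show "\<forall>\<^sub>F k in sequentially. dist ((CLINT x | N. \<psi> 0 (g k x)) - (CLINT x | N. \<psi> 0 (h x))) 0 < eps"
    proof eventually_elim
      case (elim k)
      \<comment> \<open>Integrability along the sequence is inferred from the finiteness of
        \<open>e k\<close> and the integrability of the limit.\<close>
      have di: "integrable N (\<lambda>x. \<psi> 0 (g k x) - \<psi> 0 (h x))"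
        using elim by (intro integrableI_bounded) (auto simp: e_def intro: less_trans)
      then have gi: "integrable N (\<lambda>x. \<psi> 0 (g k x))"
        using Bochner_Integration.integrable_add[OF di hpsi] by simp
      have "ennreal (norm (CLINT x | N. \<psi> 0 (g k x) - \<psi> 0 (h x))) \<le> e k"
        unfolding e_def by (rule integral_norm_bound_ennreal[OF di])
      also have "\<dots> < ennreal eps" by (rule elim)
      finally have "norm (CLINT x | N. \<psi> 0 (g k x) - \<psi> 0 (h x)) < eps" using eps by (simp add: ennreal_less_iff)
      then show ?case using gi hpsi by (simp add: dist_norm)
    qed
  qed
  then have L1: "(\<lambda>k. exp (CLINT x | N. \<psi> 0 (g k x))) \<longlonglongrightarrow> exp (CLINT x | N. \<psi> 0 (h x))"
    by (intro tendsto_exp)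
  have L2: "(\<lambda>k. CLINT \<xi> | P. exp (\<i> * of_real (\<xi> (g k)))) \<longlonglongrightarrow> (CLINT \<xi> | P. exp (\<i> * of_real (Y \<xi>)))"
  proof (rule LIM_zero_cancel, rule tendstoI)
    fix eps :: real assume eps: "eps > 0"
    \<comment> \<open>Half of the final bound 2 b comes from the constant in \<bar>x\<bar> \<le> b +
      x^2 / b, the other half from a mean square below b^2; and 2 b is smaller than eps.\<close>
    define b where "b = eps / 3"
    have b: "b > 0" using eps by (simp add: b_def)
    have "\<forall>\<^sub>F k in sequentially. (\<integral>\<^sup>+\<xi>. ennreal ((\<xi> (g k) - Y \<xi>)\<^sup>2) \<partial>P) < ennreal (b * b)"
      using D3 b by (intro order_tendstoD) auto
    then show "\<forall>\<^sub>F k in sequentially. dist ((CLINT \<xi> | P. exp (\<i> * of_real (\<xi> (g k)))) - (CLINT \<xi> | P. exp (\<i> * of_real (Y \<xi>)))) 0 < eps"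
    proof eventually_elim
      case (elim k)
      have i1: "integrable P (\<lambda>\<xi>. exp (\<i> * of_real (\<xi> (g k))))" and i2: "integrable P (\<lambda>\<xi>. exp (\<i> * of_real (Y \<xi>)))"
        by (auto intro!: P.integrable_const_bound[where B = 1])
      have "ennreal (norm (CLINT \<xi> | P. exp (\<i> * of_real (\<xi> (g k))) - exp (\<i> * of_real (Y \<xi>))))
          \<le> (\<integral>\<^sup>+\<xi>. ennreal (norm (exp (\<i> * of_real (\<xi> (g k))) - exp (\<i> * of_real (Y \<xi>)))) \<partial>P)"
        by (intro integral_norm_bound_ennreal Bochner_Integration.integrable_diff i1 i2)
      also have "\<dots> \<le> (\<integral>\<^sup>+\<xi>. ennreal b + ennreal (1 / b) * ennreal ((\<xi> (g k) - Y \<xi>)\<^sup>2) \<partial>P)"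
      proof (rule nn_integral_mono)
        fix \<xi>
        let ?x = "\<xi> (g k) - Y \<xi>"
        have "\<bar>?x\<bar> \<le> b + 1 / b * ?x\<^sup>2"
        proof -
          have "0 \<le> (\<bar>?x\<bar> - b)\<^sup>2" by simp
          then have "2 * b * \<bar>?x\<bar> \<le> b * b + ?x\<^sup>2" by (simp add: power2_eq_square algebra_simps flip: abs_mult)
          moreover have "0 \<le> b * \<bar>?x\<bar>" using b by simp
          ultimately have "b * \<bar>?x\<bar> \<le> b * b + ?x\<^sup>2" by simp
          then show ?thesis using b by (simp add: field_simps power2_eq_square)
        qed
        then have "norm (exp (\<i> * of_real (\<xi> (g k))) - exp (\<i> * of_real (Y \<xi>))) \<le> b + 1 / b * ?x\<^sup>2"
          using norm_exp_i_diff_le[of "\<xi> (g k)" "Y \<xi>"] by linarith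
        then show "ennreal (norm (exp (\<i> * of_real (\<xi> (g k))) - exp (\<i> * of_real (Y \<xi>)))) \<le> ennreal b + ennreal (1 / b) * ennreal (?x\<^sup>2)"
          using b by (simp add: ennreal_mult[symmetric] ennreal_plus[symmetric] ennreal_leI del: ennreal_plus)
      qed
      also have "\<dots> = ennreal b + ennreal (1 / b) * (\<integral>\<^sup>+\<xi>. ennreal ((\<xi> (g k) - Y \<xi>)\<^sup>2) \<partial>P)"
        using nn_integral_lin[of "\<lambda>_. 1" P "\<lambda>\<xi>. ennreal ((\<xi> (g k) - Y \<xi>)\<^sup>2)" b "1 / b"]
        by (simp add: P.emeasure_space_1)
      also have "\<dots> \<le> ennreal b + ennreal (1 / b) * ennreal (b * b)"
        using elim by (intro add_left_mono mult_left_mono) auto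
      also have "\<dots> = ennreal (2 * b)"
        using b by (simp add: ennreal_mult[symmetric] ennreal_plus[symmetric] del: ennreal_plus)
      finally have "norm (CLINT \<xi> | P. exp (\<i> * of_real (\<xi> (g k))) - exp (\<i> * of_real (Y \<xi>))) \<le> 2 * b"
        using b by simp
      then show ?case using i1 i2 eps by (simp add: dist_norm b_def)
    qed
  qed
  show ?thesis using L1 L2 unfolding char_schwartz[OF gs] by (metis LIMSEQ_unique)
qed

end

section \<open>The field G * \<eta>: joint law and uniform moment bounds\<close>

locale noise_field = levy_noise \<delta> m0 a \<sigma> z r P
  for \<delta> m0 a \<sigma> z r and P :: "((real \<times> (real ^ 'd::finite) \<Rightarrow> real) \<Rightarrow> real) measure" +
  fixes Y :: "((real \<times> (real ^ 'd) \<Rightarrow> real) \<Rightarrow> real) \<Rightarrow> real \<times> (real ^ 'd) \<Rightarrow> real"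
  assumes Y: "noise_convolution \<delta> m0 P Y"
begin

definition kmax :: real where "kmax = 1 / \<delta> ^ CARD('d)"

lemma green_restricted:
  assumes w: "w \<in> Gam \<delta>"
  shows "(\<lambda>y. green \<delta> m0 (w - y)) \<in> borel_measurable N" "integrable N (\<lambda>y. green \<delta> m0 (w - y))"
    "\<And>y. y \<in> space N \<Longrightarrow> \<bar>green \<delta> m0 (w - y)\<bar> \<le> kmax" "(LINT y | N. \<bar>green \<delta> m0 (w - y)\<bar>) \<le> 1 / m0\<^sup>2"
proof -
  have GN: "y \<in> Gam \<delta>" if "y \<in> space N" for y using that unfolding space_N by (auto simp: Gam_def Gam_pos_def)
  show bd: "\<bar>green \<delta> m0 (w - y)\<bar> \<le> kmax" if "y \<in> space N" for y
    using green_nonneg[OF Gam_minus[OF w GN[OF that]]] green_le[OF Gam_minus[OF w GN[OF that]]] by (simp add: kmax_def)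
  have m: "(\<lambda>y. green \<delta> m0 (w - y)) \<in> borel_measurable (Gam_measure \<delta>)"
    using measurable_Pair2[OF green_diff_measurable, of w] w by simp
  then show mN: "(\<lambda>y. green \<delta> m0 (w - y)) \<in> borel_measurable N" by (rule measurable_restrict_space1)
  have "(\<integral>\<^sup>+y. ennreal \<bar>green \<delta> m0 (w - y)\<bar> \<partial>N) = (\<integral>\<^sup>+y. ennreal \<bar>green \<delta> m0 (w - y)\<bar> * indicator (Gam_pos \<delta>) y \<partial>Gam_measure \<delta>)"
    by (rule nn_integral_restrict_space[OF Gam_pos_sets'])
  also have "\<dots> \<le> (\<integral>\<^sup>+y. ennreal (green \<delta> m0 (w - y)) \<partial>Gam_measure \<delta>)"
    using green_nonneg[OF Gam_minus[OF w]] by (intro nn_integral_mono) (auto simp: indicator_def)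
  also have "\<dots> = ennreal (1 / m0\<^sup>2)" by (rule nn_integral_green[OF w])
  finally have le: "(\<integral>\<^sup>+y. ennreal \<bar>green \<delta> m0 (w - y)\<bar> \<partial>N) \<le> ennreal (1 / m0\<^sup>2)" .
  then show int: "integrable N (\<lambda>y. green \<delta> m0 (w - y))"
    using mN by (intro integrableI_bounded) (auto intro: le_less_trans)
  show "(LINT y | N. \<bar>green \<delta> m0 (w - y)\<bar>) \<le> 1 / m0\<^sup>2"
    using le nn_integral_eq_integral[OF integrable_abs[OF int]] by simp
qed

lemma Y_measurable: "w \<in> Gam \<delta> \<Longrightarrow> (\<lambda>\<xi>. Y \<xi> w) \<in> borel_measurable P"
  and Y_joint: "(\<lambda>(\<xi>, x). Y \<xi> x) \<in> borel_measurable (P \<Otimes>\<^sub>M Gam_measure \<delta>)"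
  using Y by (auto simp: noise_convolution_def stochastic_integral_def)

text \<open>Finite combinations of values of Y are stochastic integrals of the same combinations of
  kernels, which identifies the joint characteristic function.\<close>

lemma levy_variables_Y:
  fixes S :: "'i set"
  assumes S: "finite S" "\<And>i. i \<in> S \<Longrightarrow> w i \<in> Gam \<delta>"
  shows "levy_variables a \<sigma> z r N S (\<lambda>i y. green \<delta> m0 (w i - y)) kmax P (\<lambda>i \<xi>. Y \<xi> (w i))"
proof -
  interpret F: levy_family a \<sigma> z r N S "\<lambda>i y. green \<delta> m0 (w i - y)" kmax
    by unfold_locales (use S green_restricted in auto)
  show ?thesis
  proof unfold_locales
    fix s
    have ex: "\<exists>g. approximates g (\<lambda>y. green \<delta> m0 (w i - y)) (\<lambda>\<xi>. Y \<xi> (w i))" if "i \<in> S" for i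
      using Y S(2)[OF that] by (auto simp: noise_convolution_def stochastic_integral_iff)
    obtain g where g: "approximates g (\<lambda>y. \<Sum>i\<in>S. s i * green \<delta> m0 (w i - y)) (\<lambda>\<xi>. \<Sum>i\<in>S. s i * Y \<xi> (w i))"
      using approximates_sum[of S "\<lambda>i y. green \<delta> m0 (w i - y)" "\<lambda>i \<xi>. Y \<xi> (w i)" s] S ex green_restricted(1) Y_measurable by blast
    have "(\<lambda>\<xi>. \<Sum>i\<in>S. s i * Y \<xi> (w i)) \<in> borel_measurable P"
      using S Y_measurable by (intro borel_measurable_sum borel_measurable_times) auto
    from char_approximates[OF _ this F.lin_meas F.lin_int F.abs_lin_le, of g s] g
    show "(CLINT \<omega> | P. exp (\<i> * of_real (\<Sum>i\<in>S. s i * Y \<omega> (w i)))) = exp (F.cum {} s)"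
      by (simp add: F.cum_def F.lin_def[abs_def])
  qed (use S Y_measurable in auto)
qed

lemma expectation_prod_Y:
  assumes "finite S" "\<And>i. i \<in> S \<Longrightarrow> w i \<in> Gam \<delta>"
  shows "integrable P (\<lambda>\<xi>. \<Prod>i\<in>S. Y \<xi> (w i))"
    "(LINT \<xi> | P. (\<Prod>i\<in>S. Y \<xi> (w i))) = (\<Sum>\<pi>\<in>{\<pi>. partition_on S \<pi>}. \<Prod>B\<in>\<pi>. levy_cumulant a \<sigma> z r (card B) *
       (LINT y | Gam_measure \<delta>. indicator (Gam_pos \<delta>) y * (\<Prod>i\<in>B. green \<delta> m0 (w i - y))))"
proof -
  interpret V: levy_variables a \<sigma> z r N S "\<lambda>i y. green \<delta> m0 (w i - y)" kmax P "\<lambda>i \<xi>. Y \<xi> (w i)"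
    by (rule levy_variables_Y[OF assms])
  have m: "(\<lambda>\<xi>. \<Prod>i\<in>S. Y \<xi> (w i)) \<in> borel_measurable P"
    using assms Y_measurable by (intro borel_measurable_prod) auto
  show "integrable P (\<lambda>\<xi>. \<Prod>i\<in>S. Y \<xi> (w i))"
    by (rule Bochner_Integration.integrable_bound[OF V.integrable_prod_abs[OF order_refl] m])
      (simp add: abs_prod)
  have "(LINT y | N. f y) = (LINT y | Gam_measure \<delta>. indicator (Gam_pos \<delta>) y * f y)" for f :: "_ \<Rightarrow> real"
    using integral_restrict_space[OF Gam_pos_sets', of f] by simp
  then show "(LINT \<xi> | P. (\<Prod>i\<in>S. Y \<xi> (w i))) = (\<Sum>\<pi>\<in>{\<pi>. partition_on S \<pi>}. \<Prod>B\<in>\<pi>. levy_cumulant a \<sigma> z r (card B) *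
       (LINT y | Gam_measure \<delta>. indicator (Gam_pos \<delta>) y * (\<Prod>i\<in>B. green \<delta> m0 (w i - y))))"
    using V.expectation_prod by simp
qed

text \<open>The moment formula at n coincident points. In every block all kernels but one are
  bounded by \<open>kmax\<close> and the remaining one integrates to at most 1 / m0^2, independently
  of w.\<close>

lemma even_moment_bound:
  "\<exists>C. \<forall>w\<in>Gam \<delta>. (LINT \<xi> | P. (Y \<xi> w) ^ n) \<le> C"
proof -
  let ?P = "{\<pi>. partition_on {..<n} \<pi>}"
  define C where "C = (\<Sum>\<pi>\<in>?P. \<Prod>B\<in>\<pi>. \<bar>levy_cumulant a \<sigma> z r (card B)\<bar> * (\<bar>kmax\<bar> ^ (card B - 1) * (1 / m0\<^sup>2)))"
  have "(LINT \<xi> | P. (Y \<xi> w) ^ n) \<le> C" if w: "w \<in> Gam \<delta>" for w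
  proof -
    interpret V: levy_variables a \<sigma> z r N "{..<n}" "\<lambda>i y. green \<delta> m0 (w - y)" kmax P "\<lambda>i \<xi>. Y \<xi> w"
      by (rule levy_variables_Y) (use w in auto)
    have "(LINT \<xi> | P. (Y \<xi> w) ^ n) = (\<Sum>\<pi>\<in>?P. \<Prod>B\<in>\<pi>. levy_cumulant a \<sigma> z r (card B) * (LINT y | N. (\<Prod>i\<in>B. green \<delta> m0 (w - y))))"
      using V.expectation_prod by simp
    also have "\<dots> \<le> C" unfolding C_def
    proof (rule sum_mono)
      fix \<pi> assume "\<pi> \<in> ?P"
      then have \<pi>: "partition_on {..<n} \<pi>" by simp
      have "\<bar>levy_cumulant a \<sigma> z r (card B) * (LINT y | N. (\<Prod>i\<in>B. green \<delta> m0 (w - y)))\<bar> \<le>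
          \<bar>levy_cumulant a \<sigma> z r (card B)\<bar> * (\<bar>kmax\<bar> ^ (card B - 1) * (1 / m0\<^sup>2))" if "B \<in> \<pi>" for B
      proof -
        have B: "B \<subseteq> {..<n}" "B \<noteq> {}" using \<pi> that partition_onD1 partition_onD3 by blast+
        then obtain k where k: "k \<in> B" by blast
        have "\<bar>LINT y | N. (\<Prod>i\<in>B. green \<delta> m0 (w - y))\<bar> \<le> (LINT y | N. \<bar>\<Prod>i\<in>B. green \<delta> m0 (w - y)\<bar>)"
          by (rule integral_abs_bound)
        also have "\<dots> \<le> (LINT y | N. \<bar>kmax\<bar> ^ (card B - 1) * \<bar>green \<delta> m0 (w - y)\<bar>)"
        proof (rule integral_mono_AE')
          show "integrable N (\<lambda>y. \<bar>kmax\<bar> ^ (card B - 1) * \<bar>green \<delta> m0 (w - y)\<bar>)"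
            using green_restricted(2)[OF w] by simp
        qed (use V.abs_prod_le[OF B(1) k] in \<open>auto intro!: AE_I2\<close>)
        also have "\<dots> \<le> \<bar>kmax\<bar> ^ (card B - 1) * (1 / m0\<^sup>2)"
          using green_restricted(4)[OF w] by (simp del: times_divide_eq_right add: mult_left_mono)
        finally show ?thesis unfolding abs_mult by (intro mult_left_mono) auto
      qed
      then have "(\<Prod>B\<in>\<pi>. \<bar>levy_cumulant a \<sigma> z r (card B) * (LINT y | N. (\<Prod>i\<in>B. green \<delta> m0 (w - y)))\<bar>) \<le>
          (\<Prod>B\<in>\<pi>. \<bar>levy_cumulant a \<sigma> z r (card B)\<bar> * (\<bar>kmax\<bar> ^ (card B - 1) * (1 / m0\<^sup>2)))"
        by (intro prod_mono) auto
      then show "(\<Prod>B\<in>\<pi>. levy_cumulant a \<sigma> z r (card B) * (LINT y | N. (\<Prod>i\<in>B. green \<delta> m0 (w - y)))) \<le>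
          (\<Prod>B\<in>\<pi>. \<bar>levy_cumulant a \<sigma> z r (card B)\<bar> * (\<bar>kmax\<bar> ^ (card B - 1) * (1 / m0\<^sup>2)))"
        unfolding abs_prod[symmetric] by linarith
    qed
    finally show ?thesis .
  qed
  then show ?thesis by blast
qed

text \<open>Uniformity in the points matters: they will be positions of leaves, hence integration
  variables. A product is bounded by powers of its factors and these by even moments; the leading 1
  in the constant covers the empty product.\<close>

lemma moment_bound:
  "\<exists>C. \<forall>(S :: 'i set) w. finite S \<longrightarrow> card S = n \<longrightarrow> (\<forall>i\<in>S. w i \<in> Gam \<delta>) \<longrightarrow>
     (\<integral>\<^sup>+\<xi>. (\<Prod>i\<in>S. ennreal \<bar>Y \<xi> (w i)\<bar>) \<partial>P) \<le> ennreal C"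
proof -
  obtain C where C: "\<And>w. w \<in> Gam \<delta> \<Longrightarrow> (LINT \<xi> | P. (Y \<xi> w) ^ (2 * n)) \<le> C"
    using even_moment_bound by blast
  have "(\<integral>\<^sup>+\<xi>. (\<Prod>i\<in>S. ennreal \<bar>Y \<xi> (w i)\<bar>) \<partial>P) \<le> ennreal (1 + real n * (1 + C))"
    if S: "finite S" "card S = n" "\<And>i. i \<in> S \<Longrightarrow> w i \<in> Gam \<delta>" for S :: "'i set" and w
  proof (cases "S = {}")
    case False
    interpret V: levy_variables a \<sigma> z r N S "\<lambda>i y. green \<delta> m0 (w i - y)" kmax P "\<lambda>i \<xi>. Y \<xi> (w i)"
      by (rule levy_variables_Y[OF S(1,3)])
    have sq: "t ^ n \<le> 1 + t ^ (2 * n)" if "t \<ge> 0" for t :: real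
    proof -
      define u where "u = t ^ n"
      have "t ^ (2 * n) = u\<^sup>2" by (simp add: u_def power_mult[symmetric] mult.commute)
      moreover have "0 \<le> (u - 1)\<^sup>2" "0 \<le> u" using that by (auto simp: u_def)
      ultimately show ?thesis unfolding u_def[symmetric] by (simp add: power2_eq_square algebra_simps)
    qed
    have int: "integrable P (\<lambda>\<xi>. (Y \<xi> (w i)) ^ (2 * n))" if "i \<in> S" for i
      using V.integrable_abs_power[OF that, of "2 * n"] by (simp add: power_even_abs)
    have "(\<integral>\<^sup>+\<xi>. (\<Prod>i\<in>S. ennreal \<bar>Y \<xi> (w i)\<bar>) \<partial>P) \<le> (\<integral>\<^sup>+\<xi>. ennreal (\<Sum>i\<in>S. 1 + (Y \<xi> (w i)) ^ (2 * n)) \<partial>P)"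
    proof (rule nn_integral_mono)
      fix \<xi>
      have "(\<Prod>i\<in>S. \<bar>Y \<xi> (w i)\<bar>) \<le> (\<Sum>i\<in>S. \<bar>Y \<xi> (w i)\<bar> ^ n)"
        using prod_abs_le_sum_power[OF S(1) False] S(2) by simp
      also have "\<dots> \<le> (\<Sum>i\<in>S. 1 + \<bar>Y \<xi> (w i)\<bar> ^ (2 * n))" by (intro sum_mono sq) auto
      finally show "(\<Prod>i\<in>S. ennreal \<bar>Y \<xi> (w i)\<bar>) \<le> ennreal (\<Sum>i\<in>S. 1 + (Y \<xi> (w i)) ^ (2 * n))"
        by (simp add: prod_ennreal ennreal_leI power_even_abs)
    qed
    also have "\<dots> = ennreal (LINT \<xi> | P. (\<Sum>i\<in>S. 1 + (Y \<xi> (w i)) ^ (2 * n)))"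
      using int by (intro nn_integral_eq_integral) (auto intro!: AE_I2 sum_nonneg add_nonneg_nonneg simp: power_mult)
    also have "(LINT \<xi> | P. (\<Sum>i\<in>S. 1 + (Y \<xi> (w i)) ^ (2 * n))) = (\<Sum>i\<in>S. 1 + (LINT \<xi> | P. (Y \<xi> (w i)) ^ (2 * n)))"
      using int by (simp add: P.prob_space)
    also have "\<dots> \<le> (\<Sum>i\<in>S. 1 + C)" using C S(3) by (intro sum_mono) auto
    also have "\<dots> \<le> 1 + real n * (1 + C)" using S(2) by simp
    finally show ?thesis by (simp add: ennreal_leI)
  next
    case True
    then show ?thesis using S(2) by (simp add: P.emeasure_space_1)
  qed
  then show ?thesis by (intro exI[of _ "1 + real n * (1 + C)"]) auto
qed

end

section \<open>Integrals over trees\<close>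

context product_sigma_finite
begin

lemma nn_integral_prod_disjoint:
  assumes "finite J" and S: "\<And>k. k \<in> J \<Longrightarrow> finite (S k)" "disjoint_family_on S J"
    and g: "\<And>k. k \<in> J \<Longrightarrow> g k \<in> borel_measurable (PiM (S k) M)"
  shows "(\<integral>\<^sup>+y. (\<Prod>k\<in>J. g k (restrict y (S k))) \<partial>PiM (\<Union>k\<in>J. S k) M) = (\<Prod>k\<in>J. \<integral>\<^sup>+y. g k y \<partial>PiM (S k) M)"
  using assms
proof (induction J rule: finite_induct)
  case empty
  then show ?case by (simp add: PiM_empty nn_integral_count_space_finite)
next
  case (insert j J)
  let ?U = "\<Union>k\<in>J. S k"
  have fU: "finite ?U" using insert by auto
  have dj: "S j \<inter> ?U = {}" using insert.prems(2) insert.hyps(2) by (auto simp: disjoint_family_on_def)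
  have dJ: "disjoint_family_on S J" using insert.prems(2) by (rule disjoint_family_on_mono[rotated]) auto
  interpret I: finite_product_sigma_finite M "S j" by unfold_locales (use insert in auto)
  interpret U: finite_product_sigma_finite M "?U" by unfold_locales (use fU in auto)
  have gm: "(\<lambda>y. g k (restrict y (S k))) \<in> borel_measurable (PiM V M)" if "k \<in> insert j J" "S k \<subseteq> V" for k V
    by (rule measurable_compose[OF measurable_restrict_subset[OF that(2)] insert.prems(3)[OF that(1)]])
  have "(\<integral>\<^sup>+y. (\<Prod>k\<in>insert j J. g k (restrict y (S k))) \<partial>PiM (\<Union>k\<in>insert j J. S k) M) =
      (\<integral>\<^sup>+y. (\<Prod>k\<in>insert j J. g k (restrict y (S k))) \<partial>PiM (S j \<union> ?U) M)" by simp
  also have "\<dots> = (\<integral>\<^sup>+x. (\<integral>\<^sup>+y. (\<Prod>k\<in>insert j J. g k (restrict (merge (S j) ?U (x, y)) (S k))) \<partial>PiM ?U M) \<partial>PiM (S j) M)"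
    using insert.prems(1) fU by (intro product_nn_integral_fold dj borel_measurable_prod_ennreal gm) auto
  also have "\<dots> = (\<integral>\<^sup>+x. (\<integral>\<^sup>+y. g j x * (\<Prod>k\<in>J. g k (restrict y (S k))) \<partial>PiM ?U M) \<partial>PiM (S j) M)"
  proof (intro nn_integral_cong)
    fix x y assume x: "x \<in> space (PiM (S j) M)" and y: "y \<in> space (PiM ?U M)"
    have "restrict (merge (S j) ?U (x, y)) (S j) = x"
      using x by (auto simp: merge_def space_PiM PiE_def extensional_def fun_eq_iff restrict_def)
    moreover have "restrict (merge (S j) ?U (x, y)) (S k) = restrict y (S k)" if "k \<in> J" for k
      using that dj by (auto simp: merge_def restrict_def fun_eq_iff)
    ultimately show "(\<Prod>k\<in>insert j J. g k (restrict (merge (S j) ?U (x, y)) (S k))) = g j x * (\<Prod>k\<in>J. g k (restrict y (S k)))"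
      using insert.hyps by simp
  qed
  also have "\<dots> = (\<integral>\<^sup>+x. g j x * (\<integral>\<^sup>+y. (\<Prod>k\<in>J. g k (restrict y (S k))) \<partial>PiM ?U M) \<partial>PiM (S j) M)"
    by (intro nn_integral_cong nn_integral_cmult borel_measurable_prod_ennreal gm) auto
  also have "\<dots> = (\<integral>\<^sup>+x. g j x \<partial>PiM (S j) M) * (\<integral>\<^sup>+y. (\<Prod>k\<in>J. g k (restrict y (S k))) \<partial>PiM ?U M)"
    using insert.prems(3)[of j] by (intro nn_integral_multc) auto
  also have "(\<integral>\<^sup>+y. (\<Prod>k\<in>J. g k (restrict y (S k))) \<partial>PiM ?U M) = (\<Prod>k\<in>J. \<integral>\<^sup>+y. g k y \<partial>PiM (S k) M)"
    using insert dJ by (intro insert.IH) auto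
  finally show ?case using insert.hyps by simp
qed

text \<open>Absolute integrability of the product follows from the Tonelli version, so Fubini
  applies. Subtrees of an inner vertex, trees of a family and components of a graph are all
  separated in this way; \<open>restrict\<close> expresses that a factor depends on its own
  coordinates only.\<close>

lemma integral_prod_disjoint:
  fixes g :: "'k \<Rightarrow> ('i \<Rightarrow> 'a) \<Rightarrow> real"
  assumes "finite J" and S: "\<And>k. k \<in> J \<Longrightarrow> finite (S k)" "disjoint_family_on S J"
    and g: "\<And>k. k \<in> J \<Longrightarrow> integrable (PiM (S k) M) (g k)"
  shows "integrable (PiM (\<Union>k\<in>J. S k) M) (\<lambda>y. \<Prod>k\<in>J. g k (restrict y (S k)))"
    and "(LINT y | PiM (\<Union>k\<in>J. S k) M. (\<Prod>k\<in>J. g k (restrict y (S k)))) = (\<Prod>k\<in>J. LINT y | PiM (S k) M. g k y)"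
proof -
  have "integrable (PiM (\<Union>k\<in>J. S k) M) (\<lambda>y. \<Prod>k\<in>J. g k (restrict y (S k))) \<and>
    (LINT y | PiM (\<Union>k\<in>J. S k) M. (\<Prod>k\<in>J. g k (restrict y (S k)))) = (\<Prod>k\<in>J. LINT y | PiM (S k) M. g k y)"
    using assms
  proof (induction J rule: finite_induct)
    case empty
    interpret finite_measure "PiM {} M"
      by (rule finite_measureI) (simp add: PiM_empty)
    show ?case by (simp add: PiM_empty lebesgue_integral_count_space_finite integrable_count_space)
  next
    case (insert j J)
    let ?U = "\<Union>k\<in>J. S k"
    have fU: "finite ?U" using insert by auto
    have dj: "S j \<inter> ?U = {}" using insert.prems(2) insert.hyps(2) by (auto simp: disjoint_family_on_def)
    have dJ: "disjoint_family_on S J" using insert.prems(2) by (rule disjoint_family_on_mono[rotated]) auto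
    have IH: "integrable (PiM ?U M) (\<lambda>y. \<Prod>k\<in>J. g k (restrict y (S k)))"
      "(LINT y | PiM ?U M. (\<Prod>k\<in>J. g k (restrict y (S k)))) = (\<Prod>k\<in>J. LINT y | PiM (S k) M. g k y)"
    proof -
      have "integrable (PiM ?U M) (\<lambda>y. \<Prod>k\<in>J. g k (restrict y (S k))) \<and>
         (LINT y | PiM ?U M. (\<Prod>k\<in>J. g k (restrict y (S k)))) = (\<Prod>k\<in>J. LINT y | PiM (S k) M. g k y)"
        by (rule insert.IH[OF _ dJ]) (blast intro: insert.prems)+
      then show "integrable (PiM ?U M) (\<lambda>y. \<Prod>k\<in>J. g k (restrict y (S k)))"
        "(LINT y | PiM ?U M. (\<Prod>k\<in>J. g k (restrict y (S k)))) = (\<Prod>k\<in>J. LINT y | PiM (S k) M. g k y)" by blast+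
    qed
    have gm: "(\<lambda>y. g k (restrict y (S k))) \<in> borel_measurable (PiM V M)" if "k \<in> insert j J" "S k \<subseteq> V" for k V
      using insert.prems(3)[OF that(1)]
      by (intro measurable_compose[OF measurable_restrict_subset[OF that(2)] borel_measurable_integrable])
    have int: "integrable (PiM (S j \<union> ?U) M) (\<lambda>y. \<Prod>k\<in>insert j J. g k (restrict y (S k)))"
    proof (rule integrableI_bounded)
      show "(\<lambda>y. \<Prod>k\<in>insert j J. g k (restrict y (S k))) \<in> borel_measurable (PiM (S j \<union> ?U) M)"
        by (intro borel_measurable_prod gm) auto
      have "(\<integral>\<^sup>+y. ennreal (norm (\<Prod>k\<in>insert j J. g k (restrict y (S k)))) \<partial>PiM (S j \<union> ?U) M) =
         (\<integral>\<^sup>+y. (\<Prod>k\<in>insert j J. ennreal \<bar>g k (restrict y (S k))\<bar>) \<partial>PiM (\<Union>k\<in>insert j J. S k) M)"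
        by (simp add: abs_prod prod_ennreal del: prod.insert)
      also have "\<dots> = (\<Prod>k\<in>insert j J. \<integral>\<^sup>+y. ennreal \<bar>g k y\<bar> \<partial>PiM (S k) M)"
        using insert by (intro nn_integral_prod_disjoint[of "insert j J" S "\<lambda>k y. ennreal \<bar>g k y\<bar>"]) auto
      also have "\<dots> < \<infinity>"
        using insert.prems(3) insert.hyps(1)
        by (auto simp: integrable_iff_bounded less_top[symmetric] ennreal_prod_eq_top simp del: prod.insert)
      finally show "(\<integral>\<^sup>+y. ennreal (norm (\<Prod>k\<in>insert j J. g k (restrict y (S k)))) \<partial>PiM (S j \<union> ?U) M) < \<infinity>" .
    qed
    have "(LINT y | PiM (S j \<union> ?U) M. (\<Prod>k\<in>insert j J. g k (restrict y (S k)))) =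
       (LINT x | PiM (S j) M. (LINT y | PiM ?U M. (\<Prod>k\<in>insert j J. g k (restrict (merge (S j) ?U (x, y)) (S k)))))"
      using insert.prems(1) fU int by (intro product_integral_fold dj) auto
    also have "\<dots> = (LINT x | PiM (S j) M. (LINT y | PiM ?U M. g j x * (\<Prod>k\<in>J. g k (restrict y (S k)))))"
    proof (intro Bochner_Integration.integral_cong refl)
      fix x y assume x: "x \<in> space (PiM (S j) M)" and y: "y \<in> space (PiM ?U M)"
      have "restrict (merge (S j) ?U (x, y)) (S j) = x"
        using x by (auto simp: merge_def space_PiM PiE_def extensional_def fun_eq_iff restrict_def)
      moreover have "restrict (merge (S j) ?U (x, y)) (S k) = restrict y (S k)" if "k \<in> J" for k
        using that dj by (auto simp: merge_def restrict_def fun_eq_iff)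
      ultimately show "(\<Prod>k\<in>insert j J. g k (restrict (merge (S j) ?U (x, y)) (S k))) = g j x * (\<Prod>k\<in>J. g k (restrict y (S k)))"
        using insert.hyps by simp
    qed
    also have "\<dots> = (LINT x | PiM (S j) M. g j x) * (\<Prod>k\<in>J. LINT y | PiM (S k) M. g k y)"
      by (simp only: integral_mult_right_zero IH(2) integral_mult_left_zero)
    also have "\<dots> = (\<Prod>k\<in>insert j J. LINT y | PiM (S k) M. g k y)"
      using insert.hyps by simp
    finally show ?case using int unfolding UN_insert by blast
  qed
  then show "integrable (PiM (\<Union>k\<in>J. S k) M) (\<lambda>y. \<Prod>k\<in>J. g k (restrict y (S k)))"
    "(LINT y | PiM (\<Union>k\<in>J. S k) M. (\<Prod>k\<in>J. g k (restrict y (S k)))) = (\<Prod>k\<in>J. LINT y | PiM (S k) M. g k y)"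
    by auto
qed

end

section \<open>Vertices of a tree and integrals over their positions\<close>

lemma size_nth_less: "k < length ts \<Longrightarrow> size (ts ! k :: ptree) < Suc (size_list size ts)"
  by (meson le_imp_less_Suc nth_mem order_refl size_list_estimation')

text \<open>Addresses of vertices of a tree which itself hangs at position \<open>w\<close> in the \<open>i\<close>-th tree of a graph.\<close>

function inner_at :: "ptree \<Rightarrow> nat \<Rightarrow> nat list \<Rightarrow> address set" where
  "inner_at Leaf1 i w = {}"
| "inner_at Leaf2 i w = {}"
| "inner_at (Inner ts) i w = insert (i, w) (\<Union>k\<in>{..<length ts}. inner_at (ts ! k) i (w @ [k]))"
  by pat_completeness auto
termination by (relation "Wellfounded.measure (\<lambda>(T, i, w). size T)") (auto simp: size_nth_less)

function leaves1_at :: "ptree \<Rightarrow> nat \<Rightarrow> nat list \<Rightarrow> address set" where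
  "leaves1_at Leaf1 i w = {(i, w)}"
| "leaves1_at Leaf2 i w = {}"
| "leaves1_at (Inner ts) i w = (\<Union>k\<in>{..<length ts}. leaves1_at (ts ! k) i (w @ [k]))"
  by pat_completeness auto
termination by (relation "Wellfounded.measure (\<lambda>(T, i, w). size T)") (auto simp: size_nth_less)

function leaves2_at :: "ptree \<Rightarrow> nat \<Rightarrow> nat list \<Rightarrow> address set" where
  "leaves2_at Leaf1 i w = {}"
| "leaves2_at Leaf2 i w = {(i, w)}"
| "leaves2_at (Inner ts) i w = (\<Union>k\<in>{..<length ts}. leaves2_at (ts ! k) i (w @ [k]))"
  by pat_completeness auto
termination by (relation "Wellfounded.measure (\<lambda>(T, i, w). size T)") (auto simp: size_nth_less)

lemma finite_at [simp]: "finite (inner_at T i w)" "finite (leaves1_at T i w)" "finite (leaves2_at T i w)"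
  by (induction T i w rule: inner_at.induct) auto

lemma at_prefix:
  "(i', v) \<in> inner_at T i w \<Longrightarrow> i' = i \<and> (\<exists>u. v = w @ u)"
  "(i', v) \<in> leaves1_at T i w \<Longrightarrow> i' = i \<and> (\<exists>u. v = w @ u)"
  "(i', v) \<in> leaves2_at T i w \<Longrightarrow> i' = i \<and> (\<exists>u. v = w @ u)"
  by (induction T i w rule: inner_at.induct) fastforce+

lemma at_disjoint:
  "disjoint_family_on (\<lambda>k. inner_at (ts k) i (w @ [k])) A"
  "disjoint_family_on (\<lambda>k. leaves1_at (ts k) i (w @ [k])) A"
  "disjoint_family_on (\<lambda>k. leaves2_at (ts k) i (w @ [k])) A"
  by (auto simp: disjoint_family_on_def dest!: at_prefix)

lemma not_in_inner_at: "(i, w) \<notin> inner_at T i (w @ [k])"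
  by (auto dest: at_prefix)

lemma roots_disjoint:
  "disjoint_family_on (\<lambda>i. inner_at (T i) i []) A"
  "disjoint_family_on (\<lambda>i. leaves1_at (T i) i []) A"
  "disjoint_family_on (\<lambda>i. leaves2_at (T i) i []) A"
  by (auto simp: disjoint_family_on_def dest!: at_prefix)

text \<open>The position of the neighbour towards the root, for points of any type and with the root
  positions x kept apart from the variables y; \<open>position\<close> is tied to the
  lattice.\<close>

fun parent_pos :: "(nat \<Rightarrow> 'a) \<Rightarrow> (vertex \<Rightarrow> 'a) \<Rightarrow> address \<Rightarrow> 'a" where
  "parent_pos x y (i, w) = (if w = [] then x i else y (Tree_Vertex (i, butlast w)))"

function tree_integrand :: "('a \<Rightarrow> 'a \<Rightarrow> real) \<Rightarrow> ('a \<Rightarrow> real) \<Rightarrow> ('a \<Rightarrow> real) \<Rightarrow>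
    ptree \<Rightarrow> nat \<Rightarrow> nat list \<Rightarrow> 'a \<Rightarrow> (vertex \<Rightarrow> 'a) \<Rightarrow> real" where
  "tree_integrand K \<phi>1 \<phi>2 Leaf1 i w x y = \<phi>1 x"
| "tree_integrand K \<phi>1 \<phi>2 Leaf2 i w x y = \<phi>2 x"
| "tree_integrand K \<phi>1 \<phi>2 (Inner ts) i w x y = K x (y (Tree_Vertex (i, w))) *
     (\<Prod>k\<in>{..<length ts}. tree_integrand K \<phi>1 \<phi>2 (ts ! k) i (w @ [k]) (y (Tree_Vertex (i, w))) y)"
  by pat_completeness auto
termination by (relation "Wellfounded.measure (\<lambda>(K, p, q, T, i, w, x, y). size T)") (auto simp: size_nth_less)

text \<open>Iterated integrals, as they arise from the recursion for the solution, in contrast to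
  \<open>tree_integrand\<close>, which is to be integrated over all inner vertices at once.\<close>

function tree_val :: "'a measure \<Rightarrow> ('a \<Rightarrow> 'a \<Rightarrow> real) \<Rightarrow> ('a \<Rightarrow> real) \<Rightarrow> ('a \<Rightarrow> real) \<Rightarrow> ptree \<Rightarrow> 'a \<Rightarrow> real" where
  "tree_val M K \<phi>1 \<phi>2 Leaf1 x = \<phi>1 x"
| "tree_val M K \<phi>1 \<phi>2 Leaf2 x = \<phi>2 x"
| "tree_val M K \<phi>1 \<phi>2 (Inner ts) x = (LINT y | M. K x y * (\<Prod>k\<in>{..<length ts}. tree_val M K \<phi>1 \<phi>2 (ts ! k) y))"
  by pat_completeness auto
termination by (relation "Wellfounded.measure (\<lambda>(M, K, p, q, T, x). size T)") (auto simp: size_nth_less)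

text \<open>Extended real values are always defined; finiteness at a point is the criterion under
  which the iterated and the joint integral agree there.\<close>

function tree_abs :: "'a measure \<Rightarrow> ('a \<Rightarrow> 'a \<Rightarrow> real) \<Rightarrow> ('a \<Rightarrow> real) \<Rightarrow> ('a \<Rightarrow> real) \<Rightarrow> ptree \<Rightarrow> 'a \<Rightarrow> ennreal" where
  "tree_abs M K \<phi>1 \<phi>2 Leaf1 x = ennreal \<bar>\<phi>1 x\<bar>"
| "tree_abs M K \<phi>1 \<phi>2 Leaf2 x = ennreal \<bar>\<phi>2 x\<bar>"
| "tree_abs M K \<phi>1 \<phi>2 (Inner ts) x = (\<integral>\<^sup>+y. ennreal \<bar>K x y\<bar> * (\<Prod>k\<in>{..<length ts}. tree_abs M K \<phi>1 \<phi>2 (ts ! k) y) \<partial>M)"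
  by pat_completeness auto
termination by (relation "Wellfounded.measure (\<lambda>(M, K, p, q, T, x). size T)") (auto simp: size_nth_less)

text \<open>Unfolds the recursion into one factor per vertex, the form in which factors can be
  regrouped across trees.\<close>

lemma tree_integrand_prod:
  assumes "x0 = parent_pos x y (i, w)"
  shows "tree_integrand K \<phi>1 \<phi>2 T i w x0 y =
    (\<Prod>u\<in>inner_at T i w. K (parent_pos x y u) (y (Tree_Vertex u))) *
    (\<Prod>u\<in>leaves1_at T i w. \<phi>1 (parent_pos x y u)) * (\<Prod>u\<in>leaves2_at T i w. \<phi>2 (parent_pos x y u))"
  using assms
proof (induction T i w arbitrary: x0 rule: inner_at.induct)
  case (3 ts i w)
  let ?v = "y (Tree_Vertex (i, w))"
  have IH: "tree_integrand K \<phi>1 \<phi>2 (ts ! k) i (w @ [k]) ?v y =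
      (\<Prod>u\<in>inner_at (ts ! k) i (w @ [k]). K (parent_pos x y u) (y (Tree_Vertex u))) *
      (\<Prod>u\<in>leaves1_at (ts ! k) i (w @ [k]). \<phi>1 (parent_pos x y u)) * (\<Prod>u\<in>leaves2_at (ts ! k) i (w @ [k]). \<phi>2 (parent_pos x y u))"
    if "k \<in> {..<length ts}" for k
    using that by (intro 3) auto
  have U: "(\<Prod>u\<in>(\<Union>k\<in>{..<length ts}. S k). f u) = (\<Prod>k\<in>{..<length ts}. \<Prod>u\<in>S k. f u)"
    if "\<And>k. finite (S k)" "disjoint_family_on S {..<length ts}" for S :: "nat \<Rightarrow> address set" and f :: "address \<Rightarrow> real"
    using that by (intro prod.UNION_disjoint) (auto simp: disjoint_family_on_def)
  have "(i, w) \<notin> (\<Union>k\<in>{..<length ts}. inner_at (ts ! k) i (w @ [k]))"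
    using not_in_inner_at by blast
  then show ?case
    using 3(2) by (simp add: IH U at_disjoint prod.distrib mult_ac)
qed auto

lemma tree_integrand_cong:
  assumes "\<And>u. u \<in> inner_at T i w \<Longrightarrow> y (Tree_Vertex u) = y' (Tree_Vertex u)"
  shows "tree_integrand K \<phi>1 \<phi>2 T i w x y = tree_integrand K \<phi>1 \<phi>2 T i w x y'"
  using assms
proof (induction T i w arbitrary: x rule: inner_at.induct)
  case (3 ts i w)
  have "tree_integrand K \<phi>1 \<phi>2 (ts ! k) i (w @ [k]) v y = tree_integrand K \<phi>1 \<phi>2 (ts ! k) i (w @ [k]) v y'"
    if "k \<in> {..<length ts}" for k v using that 3(2) by (intro 3(1)) auto
  moreover have "y (Tree_Vertex (i, w)) = y' (Tree_Vertex (i, w))" using 3(2) by simp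
  ultimately show ?case by simp
qed auto

lemma at_parent:
  "(i', v) \<in> inner_at T i w \<Longrightarrow> v = w \<or> (i', butlast v) \<in> inner_at T i w"
  "(i', v) \<in> leaves1_at T i w \<Longrightarrow> v = w \<or> (i', butlast v) \<in> inner_at T i w"
  "(i', v) \<in> leaves2_at T i w \<Longrightarrow> v = w \<or> (i', butlast v) \<in> inner_at T i w"
proof (induction T i w rule: inner_at.induct)
  case (3 ts i w)
  { case 1
    then show ?case using 3(1) at_prefix(1) by fastforce }
  { case 2
    then show ?case using 3(2) at_prefix(2) by fastforce }
  { case 3
    then show ?case using \<open>\<And>x. x \<in> {..<length ts} \<Longrightarrow> (i', v) \<in> leaves2_at (ts ! x) i (w @ [x]) \<Longrightarrow> v = w @ [x] \<or> (i', butlast v) \<in> inner_at (ts ! x) i (w @ [x])\<close>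
       at_prefix(3) by fastforce }
qed auto

text \<open>What the tree estimates take from the Green function: nonnegativity, a bound b for the
  edges that are estimated pointwise, and a mass bound \<kappa> for those that are
  integrated.\<close>

locale tree_kernel = sigma_finite_measure M for M :: "'a measure" +
  fixes K :: "'a \<Rightarrow> 'a \<Rightarrow> real" and \<kappa> b :: real
  assumes K_nonneg: "x \<in> space M \<Longrightarrow> y \<in> space M \<Longrightarrow> K x y \<ge> 0"
    and K_le: "x \<in> space M \<Longrightarrow> y \<in> space M \<Longrightarrow> K x y \<le> b"
    and K_meas: "(\<lambda>(x, y). K x y) \<in> borel_measurable (M \<Otimes>\<^sub>M M)"
    and K_int: "x \<in> space M \<Longrightarrow> (\<integral>\<^sup>+y. ennreal (K x y) \<partial>M) \<le> ennreal \<kappa>"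
begin

sublocale product_sigma_finite "\<lambda>_ :: vertex. M"
  by unfold_locales

lemma K_compose: "f \<in> Q \<rightarrow>\<^sub>M M \<Longrightarrow> g \<in> Q \<rightarrow>\<^sub>M M \<Longrightarrow> (\<lambda>q. K (f q) (g q)) \<in> borel_measurable Q"
  using measurable_compose[OF measurable_Pair K_meas, of f Q g] by simp

lemma tree_integrand_measurable:
  assumes \<phi>: "\<phi>1 \<in> borel_measurable M" "\<phi>2 \<in> borel_measurable M"
    and X: "X \<in> Q \<rightarrow>\<^sub>M M" and Z: "\<And>u. u \<in> inner_at T i w \<Longrightarrow> (\<lambda>q. Z q (Tree_Vertex u)) \<in> Q \<rightarrow>\<^sub>M M"
  shows "(\<lambda>q. tree_integrand K \<phi>1 \<phi>2 T i w (X q) (Z q)) \<in> borel_measurable Q"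
  using X Z
proof (induction T i w arbitrary: X rule: inner_at.induct)
  case (1 i w)
  then show ?case using measurable_compose[OF _ \<phi>(1)] by simp
next
  case (2 i w)
  then show ?case using measurable_compose[OF _ \<phi>(2)] by simp
next
  case (3 ts i w)
  have v: "(\<lambda>q. Z q (Tree_Vertex (i, w))) \<in> Q \<rightarrow>\<^sub>M M" by (rule 3(3)) simp
  have "(\<lambda>q. tree_integrand K \<phi>1 \<phi>2 (ts ! k) i (w @ [k]) (Z q (Tree_Vertex (i, w))) (Z q)) \<in> borel_measurable Q"
    if "k \<in> {..<length ts}" for k
    by (rule 3(1)[OF that v]) (rule 3(3), use that in auto)
  then show ?case unfolding tree_integrand.simps
    by (intro borel_measurable_times K_compose 3(2) v borel_measurable_prod)
qed

lemma tree_val_measurable: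
  assumes \<phi>: "\<phi>1 \<in> borel_measurable M" "\<phi>2 \<in> borel_measurable M"
  shows "(\<lambda>x. tree_val M K \<phi>1 \<phi>2 T x) \<in> borel_measurable M"
proof (induction T rule: ptree.induct)
  case (Inner ts)
  have "(\<lambda>x. tree_val M K \<phi>1 \<phi>2 (ts ! k) x) \<in> borel_measurable M" if "k < length ts" for k
    using that by (intro Inner nth_mem)
  then have "(\<lambda>q. K (fst q) (snd q) * (\<Prod>k\<in>{..<length ts}. tree_val M K \<phi>1 \<phi>2 (ts ! k) (snd q))) \<in> borel_measurable (M \<Otimes>\<^sub>M M)"
    by (intro borel_measurable_times K_compose measurable_fst measurable_snd borel_measurable_prod)
      (auto intro: measurable_compose[OF measurable_snd])
  then show ?case unfolding tree_val.simps
    by (intro borel_measurable_lebesgue_integral) (simp add: split_beta')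
qed (use \<phi> in simp_all)

lemma tree_abs_measurable:
  assumes \<phi>: "\<phi>1 \<in> borel_measurable M" "\<phi>2 \<in> borel_measurable M"
  shows "(\<lambda>x. tree_abs M K \<phi>1 \<phi>2 T x) \<in> borel_measurable M"
proof (induction T rule: ptree.induct)
  case (Inner ts)
  have "(\<lambda>x. tree_abs M K \<phi>1 \<phi>2 (ts ! k) x) \<in> borel_measurable M" if "k < length ts" for k
    using that by (intro Inner nth_mem)
  then have "(\<lambda>q. ennreal \<bar>K (fst q) (snd q)\<bar> * (\<Prod>k\<in>{..<length ts}. tree_abs M K \<phi>1 \<phi>2 (ts ! k) (snd q))) \<in> borel_measurable (M \<Otimes>\<^sub>M M)"
    using K_compose[OF measurable_fst measurable_snd]
    by (intro borel_measurable_times_ennreal borel_measurable_prod_ennreal)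
      (auto intro: measurable_compose[OF measurable_snd])
  then show ?case unfolding tree_abs.simps
    by (intro borel_measurable_nn_integral) (simp add: split_beta')
qed (use \<phi> in simp_all)

lemma Inner_split:
  assumes v_def: "v = Tree_Vertex (i, w)" and S_def: "S = (\<lambda>k. Tree_Vertex ` inner_at (ts ! k) i (w @ [k]))"
  shows "Tree_Vertex ` inner_at (Inner ts) i w = insert v (\<Union>k\<in>{..<length ts}. S k)"
    "v \<notin> (\<Union>k\<in>{..<length ts}. S k)" "disjoint_family_on S {..<length ts}" "finite (S k)"
    "(\<And>u. u \<in> S k \<Longrightarrow> y' u = y u) \<Longrightarrow> y' v = y0 \<Longrightarrow> k < length ts \<Longrightarrow>
      tree_integrand K \<phi>1 \<phi>2 (ts ! k) i (w @ [k]) x y' = tree_integrand K \<phi>1 \<phi>2 (ts ! k) i (w @ [k]) x (restrict y (S k))"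
proof -
  show "Tree_Vertex ` inner_at (Inner ts) i w = insert v (\<Union>k\<in>{..<length ts}. S k)"
    by (auto simp: v_def S_def)
  show "v \<notin> (\<Union>k\<in>{..<length ts}. S k)" using not_in_inner_at by (fastforce simp: v_def S_def)
  show "disjoint_family_on S {..<length ts}"
    using at_disjoint(1)[of "\<lambda>k. ts ! k" i w "{..<length ts}"] by (fastforce simp: S_def disjoint_family_on_def)
  show "finite (S k)" by (simp add: S_def)
  show "(\<And>u. u \<in> S k \<Longrightarrow> y' u = y u) \<Longrightarrow> y' v = y0 \<Longrightarrow> k < length ts \<Longrightarrow>
      tree_integrand K \<phi>1 \<phi>2 (ts ! k) i (w @ [k]) x y' = tree_integrand K \<phi>1 \<phi>2 (ts ! k) i (w @ [k]) x (restrict y (S k))"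
    by (rule tree_integrand_cong) (auto simp: S_def)
qed

text \<open>Tonelli, peeling off the topmost inner vertex: given its position, the subtrees depend
  on disjoint sets of variables.\<close>

lemma nn_integral_tree_integrand:
  assumes \<phi>: "\<phi>1 \<in> borel_measurable M" "\<phi>2 \<in> borel_measurable M" and x: "x \<in> space M"
  shows "(\<integral>\<^sup>+y. ennreal \<bar>tree_integrand K \<phi>1 \<phi>2 T i w x y\<bar> \<partial>PiM (Tree_Vertex ` inner_at T i w) (\<lambda>_. M)) = tree_abs M K \<phi>1 \<phi>2 T x"
  using x
proof (induction T i w arbitrary: x rule: inner_at.induct)
  case (3 ts i w)
  define v where "v = Tree_Vertex (i, w)"
  define S where "S = (\<lambda>k. Tree_Vertex ` inner_at (ts ! k) i (w @ [k]))"
  note sp = Inner_split[OF v_def S_def]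
  let ?U = "\<Union>k\<in>{..<length ts}. S k"
  let ?g = "\<lambda>k y0 y. ennreal \<bar>tree_integrand K \<phi>1 \<phi>2 (ts ! k) i (w @ [k]) y0 y\<bar>"
  have fU: "finite ?U" using sp(4) by auto
  have gm: "?g k y0 \<in> borel_measurable (PiM (S k) (\<lambda>_. M))" if "y0 \<in> space M" for k y0
    using that
    by (intro measurable_compose[OF _ measurable_ennreal] borel_measurable_abs tree_integrand_measurable \<phi> measurable_const)
      (auto simp: S_def intro!: measurable_component_singleton)
  have "(\<integral>\<^sup>+y. ennreal \<bar>tree_integrand K \<phi>1 \<phi>2 (Inner ts) i w x y\<bar> \<partial>PiM (insert v ?U) (\<lambda>_. M)) =
      (\<integral>\<^sup>+y0. (\<integral>\<^sup>+y. ennreal \<bar>tree_integrand K \<phi>1 \<phi>2 (Inner ts) i w x (y(v := y0))\<bar> \<partial>PiM ?U (\<lambda>_. M)) \<partial>M)"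
    using 3(2) unfolding sp(1)[symmetric]
    by (subst sp(1), intro product_nn_integral_insert_rev fU sp(2) measurable_compose[OF _ measurable_ennreal]
        borel_measurable_abs tree_integrand_measurable \<phi> measurable_const)
      (auto simp: v_def S_def intro!: measurable_component_singleton)
  also have "\<dots> = (\<integral>\<^sup>+y0. ennreal \<bar>K x y0\<bar> * (\<Prod>k\<in>{..<length ts}. tree_abs M K \<phi>1 \<phi>2 (ts ! k) y0) \<partial>M)"
  proof (rule nn_integral_cong)
    fix y0 assume y0: "y0 \<in> space M"
    have eq: "ennreal \<bar>tree_integrand K \<phi>1 \<phi>2 (Inner ts) i w x (y(v := y0))\<bar> =
        ennreal \<bar>K x y0\<bar> * (\<Prod>k\<in>{..<length ts}. ?g k y0 (restrict y (S k)))" for y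
    proof -
      have "tree_integrand K \<phi>1 \<phi>2 (ts ! k) i (w @ [k]) y0 (y(v := y0)) = tree_integrand K \<phi>1 \<phi>2 (ts ! k) i (w @ [k]) y0 (restrict y (S k))"
        if "k \<in> {..<length ts}" for k
        using sp(2) that by (intro sp(5)) auto
      then have "tree_integrand K \<phi>1 \<phi>2 (Inner ts) i w x (y(v := y0)) =
          K x y0 * (\<Prod>k\<in>{..<length ts}. tree_integrand K \<phi>1 \<phi>2 (ts ! k) i (w @ [k]) y0 (restrict y (S k)))"
        by (simp add: v_def)
      then show ?thesis by (simp add: abs_mult abs_prod ennreal_mult prod_ennreal prod_nonneg)
    qed
    have "(\<integral>\<^sup>+y. ennreal \<bar>tree_integrand K \<phi>1 \<phi>2 (Inner ts) i w x (y(v := y0))\<bar> \<partial>PiM ?U (\<lambda>_. M)) =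
       ennreal \<bar>K x y0\<bar> * (\<integral>\<^sup>+y. (\<Prod>k\<in>{..<length ts}. ?g k y0 (restrict y (S k))) \<partial>PiM ?U (\<lambda>_. M))"
      unfolding eq
      by (intro nn_integral_cmult borel_measurable_prod_ennreal measurable_compose[OF measurable_restrict_subset gm] y0) auto
    also have "(\<integral>\<^sup>+y. (\<Prod>k\<in>{..<length ts}. ?g k y0 (restrict y (S k))) \<partial>PiM ?U (\<lambda>_. M)) =
       (\<Prod>k\<in>{..<length ts}. \<integral>\<^sup>+y. ?g k y0 y \<partial>PiM (S k) (\<lambda>_. M))"
      by (intro nn_integral_prod_disjoint sp gm y0) auto
    also have "\<dots> = (\<Prod>k\<in>{..<length ts}. tree_abs M K \<phi>1 \<phi>2 (ts ! k) y0)"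
      unfolding S_def by (intro prod.cong refl 3(1) y0)
    finally show "(\<integral>\<^sup>+y. ennreal \<bar>tree_integrand K \<phi>1 \<phi>2 (Inner ts) i w x (y(v := y0))\<bar> \<partial>PiM ?U (\<lambda>_. M)) =
       ennreal \<bar>K x y0\<bar> * (\<Prod>k\<in>{..<length ts}. tree_abs M K \<phi>1 \<phi>2 (ts ! k) y0)" .
  qed
  finally show ?case unfolding sp(1) by simp
qed (simp_all add: PiM_empty nn_integral_count_space_finite)

text \<open>Fubini along the tree. Finiteness of \<open>tree_abs\<close> at x does not make it
  finite for the subtrees at almost every intermediate point, because an infinite value may be
  hidden by a vanishing factor; such points need separate treatment.\<close>

lemma integral_tree_integrand:
  assumes \<phi>: "\<phi>1 \<in> borel_measurable M" "\<phi>2 \<in> borel_measurable M" and x: "x \<in> space M" and fin: "tree_abs M K \<phi>1 \<phi>2 T x < \<infinity>"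
  shows "integrable (PiM (Tree_Vertex ` inner_at T i w) (\<lambda>_. M)) (tree_integrand K \<phi>1 \<phi>2 T i w x) \<and>
    (LINT y | PiM (Tree_Vertex ` inner_at T i w) (\<lambda>_. M). tree_integrand K \<phi>1 \<phi>2 T i w x y) = tree_val M K \<phi>1 \<phi>2 T x \<and>
    ennreal \<bar>tree_val M K \<phi>1 \<phi>2 T x\<bar> \<le> tree_abs M K \<phi>1 \<phi>2 T x"
proof -
  have int: "integrable (PiM (Tree_Vertex ` inner_at T i w) (\<lambda>_. M)) (tree_integrand K \<phi>1 \<phi>2 T i w x)"
    if "x \<in> space M" "tree_abs M K \<phi>1 \<phi>2 T x < \<infinity>" for T i w x
  proof (rule integrableI_bounded)
    show "tree_integrand K \<phi>1 \<phi>2 T i w x \<in> borel_measurable (PiM (Tree_Vertex ` inner_at T i w) (\<lambda>_. M))"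
      using that by (intro tree_integrand_measurable \<phi> measurable_const) (auto intro!: measurable_component_singleton)
  qed (use nn_integral_tree_integrand[OF \<phi> that(1), of T i w] that(2) in simp)
  have bound: "ennreal \<bar>tree_val M K \<phi>1 \<phi>2 T x\<bar> \<le> tree_abs M K \<phi>1 \<phi>2 T x"
    if "x \<in> space M" "tree_abs M K \<phi>1 \<phi>2 T x < \<infinity>"
      "(LINT y | PiM (Tree_Vertex ` inner_at T i w) (\<lambda>_. M). tree_integrand K \<phi>1 \<phi>2 T i w x y) = tree_val M K \<phi>1 \<phi>2 T x" for T i w x
    using integral_norm_bound_ennreal[OF int[OF that(1,2), of i w]] nn_integral_tree_integrand[OF \<phi> that(1), of T i w] that(3) by simp
  have "(LINT y | PiM (Tree_Vertex ` inner_at T i w) (\<lambda>_. M). tree_integrand K \<phi>1 \<phi>2 T i w x y) = tree_val M K \<phi>1 \<phi>2 T x"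
    using x fin
  proof (induction T i w arbitrary: x rule: inner_at.induct)
    case (3 ts i w)
    define v where "v = Tree_Vertex (i, w)"
    define S where "S = (\<lambda>k. Tree_Vertex ` inner_at (ts ! k) i (w @ [k]))"
    note sp = Inner_split[OF v_def S_def]
    let ?U = "\<Union>k\<in>{..<length ts}. S k"
    let ?g = "\<lambda>k y0 y. tree_integrand K \<phi>1 \<phi>2 (ts ! k) i (w @ [k]) y0 y"
    have fU: "finite ?U" using sp(4) by auto
    have IH: "(LINT y | PiM (S k) (\<lambda>_. M). ?g k y0 y) = tree_val M K \<phi>1 \<phi>2 (ts ! k) y0"
      if "k \<in> {..<length ts}" "y0 \<in> space M" "tree_abs M K \<phi>1 \<phi>2 (ts ! k) y0 < \<infinity>" for k y0
      unfolding S_def using that by (intro 3(1)) auto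
    interpret U: finite_product_sigma_finite "\<lambda>_. M" ?U by unfold_locales (rule fU)
    define G where "G = (\<lambda>y0. LINT y | PiM ?U (\<lambda>_. M). K x y0 * (\<Prod>k\<in>{..<length ts}. ?g k y0 (restrict y (S k))))"
    define G' where "G' = (\<lambda>y0. K x y0 * (\<Prod>k\<in>{..<length ts}. tree_val M K \<phi>1 \<phi>2 (ts ! k) y0))"
    have Kx: "(\<lambda>y0. K x y0) \<in> borel_measurable M" using 3(2) by (intro K_compose measurable_const) auto
    have Gm: "G \<in> borel_measurable M"
      unfolding G_def
    proof (rule U.borel_measurable_lebesgue_integral)
      have "(\<lambda>q. K x (fst q) * (\<Prod>k\<in>{..<length ts}. ?g k (fst q) (restrict (snd q) (S k)))) \<in> borel_measurable (M \<Otimes>\<^sub>M PiM ?U (\<lambda>_. M))"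
        by (intro borel_measurable_times measurable_compose[OF measurable_fst Kx] borel_measurable_prod tree_integrand_measurable \<phi> measurable_fst)
          (auto simp: S_def intro!: measurable_compose[OF measurable_snd] measurable_component_singleton)
      then show "(\<lambda>(y0, y). K x y0 * (\<Prod>k\<in>{..<length ts}. ?g k y0 (restrict y (S k)))) \<in> borel_measurable (M \<Otimes>\<^sub>M PiM ?U (\<lambda>_. M))"
        by (simp add: split_beta')
    qed
    have G'm: "G' \<in> borel_measurable M"
      unfolding G'_def by (intro borel_measurable_times Kx borel_measurable_prod tree_val_measurable \<phi>)
    have "(LINT y | PiM (insert v ?U) (\<lambda>_. M). tree_integrand K \<phi>1 \<phi>2 (Inner ts) i w x y) =
       (LINT y | PiM ({v} \<union> ?U) (\<lambda>_. M). tree_integrand K \<phi>1 \<phi>2 (Inner ts) i w x y)" by simp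
    also have "\<dots> = (LINT z | PiM {v} (\<lambda>_. M). (LINT y | PiM ?U (\<lambda>_. M). tree_integrand K \<phi>1 \<phi>2 (Inner ts) i w x (merge {v} ?U (z, y))))"
    proof (rule product_integral_fold)
      show "integrable (PiM ({v} \<union> ?U) (\<lambda>_. M)) (tree_integrand K \<phi>1 \<phi>2 (Inner ts) i w x)"
        using int[OF 3(2,3), of i w] unfolding sp(1) by (simp del: tree_integrand.simps)
    qed (use sp(2) fU in auto)
    also have "\<dots> = (LINT z | PiM {v} (\<lambda>_. M). G (z v))"
      unfolding G_def
    proof (intro Bochner_Integration.integral_cong refl)
      fix z y :: "vertex \<Rightarrow> 'a"
      have "merge {v} ?U (z, y) v = z v" by (simp add: merge_def)
      moreover have "?g k (z v) (merge {v} ?U (z, y)) = ?g k (z v) (restrict y (S k))" if "k \<in> {..<length ts}" for k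
        using sp(2) that by (intro sp(5)) (auto simp: merge_def)
      ultimately show "tree_integrand K \<phi>1 \<phi>2 (Inner ts) i w x (merge {v} ?U (z, y)) = K x (z v) * (\<Prod>k\<in>{..<length ts}. ?g k (z v) (restrict y (S k)))"
        by (simp add: v_def)
    qed
    also have "\<dots> = (LINT y0 | M. G y0)" by (rule product_integral_singleton[OF Gm])
    also have "\<dots> = (LINT y0 | M. G' y0)"
    proof (rule integral_cong_AE[OF Gm G'm])
      have "(\<integral>\<^sup>+y. ennreal \<bar>K x y\<bar> * (\<Prod>k\<in>{..<length ts}. tree_abs M K \<phi>1 \<phi>2 (ts ! k) y) \<partial>M) \<noteq> \<infinity>"
        using 3(3) by simp
      moreover have "(\<lambda>y. ennreal \<bar>K x y\<bar> * (\<Prod>k\<in>{..<length ts}. tree_abs M K \<phi>1 \<phi>2 (ts ! k) y)) \<in> borel_measurable M"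
        using Kx by (intro borel_measurable_times_ennreal borel_measurable_prod_ennreal tree_abs_measurable \<phi>) auto
      ultimately have "AE y in M. ennreal \<bar>K x y\<bar> * (\<Prod>k\<in>{..<length ts}. tree_abs M K \<phi>1 \<phi>2 (ts ! k) y) \<noteq> \<infinity>"
        by (intro nn_integral_noteq_infinite)
      then show "AE y0 in M. G y0 = G' y0"
      proof (rule AE_mp, intro AE_I2 impI)
        fix y0 assume y0: "y0 \<in> space M" and ne: "ennreal \<bar>K x y0\<bar> * (\<Prod>k\<in>{..<length ts}. tree_abs M K \<phi>1 \<phi>2 (ts ! k) y0) \<noteq> \<infinity>"
        \<comment> \<open>In the extended reals 0 times infinity is 0, so a finite product leaves
          three possibilities: the kernel vanishes, some subtree vanishes, or all subtrees are
          finite. In the first two both sides are 0.\<close>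
        consider "K x y0 = 0" | k where "k < length ts" "tree_abs M K \<phi>1 \<phi>2 (ts ! k) y0 = 0"
          | "\<forall>k<length ts. tree_abs M K \<phi>1 \<phi>2 (ts ! k) y0 < \<infinity>"
        proof (cases "K x y0 = 0 \<or> (\<exists>k<length ts. tree_abs M K \<phi>1 \<phi>2 (ts ! k) y0 = 0)")
          case False
          then have "(\<Prod>k\<in>{..<length ts}. tree_abs M K \<phi>1 \<phi>2 (ts ! k) y0) \<noteq> \<infinity>"
            using ne by (auto simp: ennreal_mult_eq_top_iff)
          then have "\<forall>k<length ts. tree_abs M K \<phi>1 \<phi>2 (ts ! k) y0 < \<infinity>"
            using False by (auto simp: ennreal_prod_eq_top less_top)
          then show ?thesis using that by blast
        qed (use that in blast)
        then show "G y0 = G' y0"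
        proof cases
          case 1
          then show ?thesis by (simp add: G_def G'_def)
        next
          \<comment> \<open>The joint integrand vanishes almost everywhere, since its absolute
            integral is a product with a zero factor; the iterated one contains the vanishing value
            of the subtree.\<close>
          case (2 k)
          have "tree_val M K \<phi>1 \<phi>2 (ts ! k) y0 = 0"
            using bound[OF y0 _ IH[OF _ y0, of k, unfolded S_def]] 2 by simp
          then have "G' y0 = 0" using 2(1) by (auto simp: G'_def)
          have fin: "tree_abs M K \<phi>1 \<phi>2 (ts ! k) y0 < \<infinity>" using 2 by simp
          have "(\<integral>\<^sup>+y. (\<Prod>k\<in>{..<length ts}. ennreal \<bar>?g k y0 (restrict y (S k))\<bar>) \<partial>PiM ?U (\<lambda>_. M)) =
             (\<Prod>k\<in>{..<length ts}. \<integral>\<^sup>+y. ennreal \<bar>?g k y0 y\<bar> \<partial>PiM (S k) (\<lambda>_. M))"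
            by (intro nn_integral_prod_disjoint[of _ S "\<lambda>k y. ennreal \<bar>?g k y0 y\<bar>"] sp measurable_compose[OF _ measurable_ennreal] borel_measurable_abs
                tree_integrand_measurable \<phi> measurable_const y0) (auto simp: S_def intro!: measurable_component_singleton)
          also have "\<dots> = (\<Prod>k\<in>{..<length ts}. tree_abs M K \<phi>1 \<phi>2 (ts ! k) y0)"
            unfolding S_def by (intro prod.cong refl nn_integral_tree_integrand \<phi> y0)
          also have "\<dots> = 0" using 2 by auto
          finally have z: "(\<integral>\<^sup>+y. (\<Prod>k\<in>{..<length ts}. ennreal \<bar>?g k y0 (restrict y (S k))\<bar>) \<partial>PiM ?U (\<lambda>_. M)) = 0" .
          from z have "AE y in PiM ?U (\<lambda>_. M). (\<Prod>k\<in>{..<length ts}. ennreal \<bar>?g k y0 (restrict y (S k))\<bar>) = 0"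
          proof (subst (asm) nn_integral_0_iff_AE)
            have "(\<lambda>y. ennreal \<bar>?g k y0 y\<bar>) \<in> borel_measurable (PiM (S k) (\<lambda>_. M))" for k
              by (intro measurable_compose[OF _ measurable_ennreal] borel_measurable_abs tree_integrand_measurable \<phi> measurable_const y0)
                (auto simp: S_def intro!: measurable_component_singleton)
            then show "(\<lambda>y. \<Prod>k\<in>{..<length ts}. ennreal \<bar>?g k y0 (restrict y (S k))\<bar>) \<in> borel_measurable (PiM ?U (\<lambda>_. M))"
              by (intro borel_measurable_prod_ennreal measurable_compose[OF measurable_restrict_subset]) auto
          qed
          then have "AE y in PiM ?U (\<lambda>_. M). K x y0 * (\<Prod>k\<in>{..<length ts}. ?g k y0 (restrict y (S k))) = 0"
            by eventually_elim (auto simp: prod_zero_iff)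
          then have "G y0 = 0" unfolding G_def by (rule integral_eq_zero_AE)
          with \<open>G' y0 = 0\<close> show ?thesis by simp
        next
          case 3
          have "(LINT y | PiM ?U (\<lambda>_. M). (\<Prod>k\<in>{..<length ts}. ?g k y0 (restrict y (S k)))) = (\<Prod>k\<in>{..<length ts}. LINT y | PiM (S k) (\<lambda>_. M). ?g k y0 y)"
            using 3 int[OF y0] by (intro integral_prod_disjoint sp) (auto simp: S_def)
          also have "\<dots> = (\<Prod>k\<in>{..<length ts}. tree_val M K \<phi>1 \<phi>2 (ts ! k) y0)"
            using 3 y0 by (intro prod.cong refl IH) auto
          finally show ?thesis by (simp add: G_def G'_def)
        qed
      qed
    qed
    finally show ?case unfolding sp(1) by (simp add: G'_def)
  qed (simp_all add: PiM_empty lebesgue_integral_count_space_finite)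
  with int[OF x fin, of i w] bound[OF x fin this] show ?thesis by blast
qed

end

section \<open>Families of trees with numbered roots\<close>

definition inners :: "nat set \<Rightarrow> (nat \<Rightarrow> ptree) \<Rightarrow> address set" where
  "inners A T = (\<Union>i\<in>A. inner_at (T i) i [])"

definition leaves1s :: "nat set \<Rightarrow> (nat \<Rightarrow> ptree) \<Rightarrow> address set" where
  "leaves1s A T = (\<Union>i\<in>A. leaves1_at (T i) i [])"

definition leaves2s :: "nat set \<Rightarrow> (nat \<Rightarrow> ptree) \<Rightarrow> address set" where
  "leaves2s A T = (\<Union>i\<in>A. leaves2_at (T i) i [])"

lemma finite_inners [simp]: "finite A \<Longrightarrow> finite (inners A T)"
  and finite_leaves1s [simp]: "finite A \<Longrightarrow> finite (leaves1s A T)"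
  and finite_leaves2s [simp]: "finite A \<Longrightarrow> finite (leaves2s A T)"
  by (auto simp: inners_def leaves1s_def leaves2s_def)

text \<open>A parent sits either at a root position or at the variable of an inner vertex.
  Measurability, restriction to the listed variables and the change of variables all rest on
  this.\<close>

lemma parent_in_inners:
  assumes "(i, w) \<in> inners A T \<union> leaves1s A T \<union> leaves2s A T"
  shows "i \<in> A" "w = [] \<or> (i, butlast w) \<in> inners A T"
proof -
  obtain j where j: "j \<in> A" and m: "(i, w) \<in> inner_at (T j) j [] \<or> (i, w) \<in> leaves1_at (T j) j [] \<or> (i, w) \<in> leaves2_at (T j) j []"
    using assms by (auto simp: inners_def leaves1s_def leaves2s_def)
  then have "i = j" using at_prefix by blast
  with j show "i \<in> A" by simp
  show "w = [] \<or> (i, butlast w) \<in> inners A T"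
    using m j at_parent[of i w "T j" j "[]"] by (auto simp: inners_def)
qed

lemma prod_tree_integrand:
  assumes "finite A"
  shows "(\<Prod>i\<in>A. tree_integrand K \<phi>1 \<phi>2 (T i) i [] (x i) y) =
    (\<Prod>u\<in>inners A T. K (parent_pos x y u) (y (Tree_Vertex u))) *
    (\<Prod>u\<in>leaves1s A T. \<phi>1 (parent_pos x y u)) * (\<Prod>u\<in>leaves2s A T. \<phi>2 (parent_pos x y u))"
proof -
  have U: "(\<Prod>u\<in>(\<Union>i\<in>A. S i). f u) = (\<Prod>i\<in>A. \<Prod>u\<in>S i. f u)"
    if "\<And>i. finite (S i)" "disjoint_family_on S A" for S :: "nat \<Rightarrow> address set" and f :: "address \<Rightarrow> real"
    using that assms by (intro prod.UNION_disjoint) (auto simp: disjoint_family_on_def)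
  have "tree_integrand K \<phi>1 \<phi>2 (T i) i [] (x i) y =
    (\<Prod>u\<in>inner_at (T i) i []. K (parent_pos x y u) (y (Tree_Vertex u))) *
    (\<Prod>u\<in>leaves1_at (T i) i []. \<phi>1 (parent_pos x y u)) * (\<Prod>u\<in>leaves2_at (T i) i []. \<phi>2 (parent_pos x y u))" for i
    by (rule tree_integrand_prod) simp
  then show ?thesis
    unfolding inners_def leaves1s_def leaves2s_def by (simp add: U roots_disjoint prod.distrib)
qed

context tree_kernel
begin

lemma parent_pos_measurable:
  assumes u: "u \<in> inners A T \<union> leaves1s A T \<union> leaves2s A T" and x: "x ` A \<subseteq> space M"
    and Z: "\<And>u. u \<in> inners A T \<Longrightarrow> (\<lambda>q. Z q (Tree_Vertex u)) \<in> Q \<rightarrow>\<^sub>M M"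
  shows "(\<lambda>q. parent_pos x (Z q) u) \<in> Q \<rightarrow>\<^sub>M M"
proof (cases u)
  case (Pair i w)
  with parent_in_inners[of i w A T] u have "i \<in> A" "w = [] \<or> (i, butlast w) \<in> inners A T" by auto
  then show ?thesis using Pair x Z by (cases "w = []") (auto intro: measurable_const)
qed

lemma parent_pos_space:
  assumes u: "u \<in> inners A T \<union> leaves1s A T \<union> leaves2s A T" and x: "x ` A \<subseteq> space M"
    and y: "y \<in> space (PiM V (\<lambda>_. M))" "Tree_Vertex ` inners A T \<subseteq> V"
  shows "parent_pos x y u \<in> space M"
proof -
  have "(\<lambda>y. parent_pos x y u) \<in> PiM V (\<lambda>_. M) \<rightarrow>\<^sub>M M"
    using y(2) by (intro parent_pos_measurable[OF u x]) (auto intro: measurable_component_singleton)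
  from measurable_space[OF this y(1)] show ?thesis .
qed

text \<open>With leaves of value 1 every inner vertex contributes at most \<kappa>, whatever the
  position of its parent.\<close>

lemma tree_abs_bound: "\<exists>C\<ge>0. \<forall>x\<in>space M. tree_abs M K (\<lambda>_. 1) (\<lambda>_. 1) T x \<le> ennreal C"
proof (induction T rule: ptree.induct)
  case (Inner ts)
  then have "\<forall>k. \<exists>C\<ge>0. k < length ts \<longrightarrow> (\<forall>x\<in>space M. tree_abs M K (\<lambda>_. 1) (\<lambda>_. 1) (ts ! k) x \<le> ennreal C)"
    by (metis nth_mem order_refl)
  then obtain C where C: "\<And>k. C k \<ge> 0" "\<And>k x. k < length ts \<Longrightarrow> x \<in> space M \<Longrightarrow> tree_abs M K (\<lambda>_. 1) (\<lambda>_. 1) (ts ! k) x \<le> ennreal (C k)"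
    by metis
  define p where "p = (\<Prod>k\<in>{..<length ts}. C k)"
  have p: "p \<ge> 0" unfolding p_def using C by (intro prod_nonneg) auto
  show ?case
  \<comment> \<open>The locale fixes no sign for \<kappa>, hence the maximum with 0.\<close>
  proof (intro exI[of _ "max 0 \<kappa> * p"] conjI ballI)
    show "0 \<le> max 0 \<kappa> * p" using p by simp
    fix x assume x: "x \<in> space M"
    have Kx: "(\<lambda>y. K x y) \<in> borel_measurable M" using x by (intro K_compose measurable_const) auto
    have "tree_abs M K (\<lambda>_. 1) (\<lambda>_. 1) (Inner ts) x \<le> (\<integral>\<^sup>+y. ennreal (K x y) * ennreal p \<partial>M)"
      unfolding tree_abs.simps
    proof (intro nn_integral_mono mult_mono)
      fix y assume y: "y \<in> space M"
      show "ennreal \<bar>K x y\<bar> \<le> ennreal (K x y)" using K_nonneg[OF x y] by simp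
      have "(\<Prod>k\<in>{..<length ts}. tree_abs M K (\<lambda>_. 1) (\<lambda>_. 1) (ts ! k) y) \<le> (\<Prod>k\<in>{..<length ts}. ennreal (C k))"
        using C(2) y by (intro prod_mono_ennreal) auto
      then show "(\<Prod>k\<in>{..<length ts}. tree_abs M K (\<lambda>_. 1) (\<lambda>_. 1) (ts ! k) y) \<le> ennreal p"
        using C(1) by (simp add: p_def prod_ennreal)
    qed auto
    also have "\<dots> = (\<integral>\<^sup>+y. ennreal (K x y) \<partial>M) * ennreal p" using Kx by (intro nn_integral_multc) auto
    also have "\<dots> \<le> ennreal (max 0 \<kappa>) * ennreal p"
      using K_int[OF x] by (intro mult_right_mono) (auto intro: order_trans simp: ennreal_leI)
    also have "\<dots> = ennreal (max 0 \<kappa> * p)" using p by (simp add: ennreal_mult)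
    finally show "tree_abs M K (\<lambda>_. 1) (\<lambda>_. 1) (Inner ts) x \<le> ennreal (max 0 \<kappa> * p)" .
  qed
qed (auto intro!: exI[of _ 1])

text \<open>The edges between inner vertices and towards the roots, without leaves. Expected noise
  leaves, leaves of type two and integrated empty vertices are all bounded by constants, so this
  product is the common majorant.\<close>

definition kprod :: "nat set \<Rightarrow> (nat \<Rightarrow> ptree) \<Rightarrow> (nat \<Rightarrow> 'a) \<Rightarrow> (vertex \<Rightarrow> 'a) \<Rightarrow> real" where
  "kprod A T x y = (\<Prod>u\<in>inners A T. K (parent_pos x y u) (y (Tree_Vertex u)))"

lemma kprod_measurable:
  assumes x: "x ` A \<subseteq> space M"
    and Z: "\<And>u. u \<in> inners A T \<Longrightarrow> (\<lambda>q. Z q (Tree_Vertex u)) \<in> Q \<rightarrow>\<^sub>M M"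
  shows "(\<lambda>q. kprod A T x (Z q)) \<in> borel_measurable Q"
  unfolding kprod_def using x Z
  by (intro borel_measurable_prod K_compose parent_pos_measurable[where A = A and T = T]) auto

lemma kprod_nonneg:
  assumes x: "x ` A \<subseteq> space M" and y: "y \<in> space (PiM V (\<lambda>_. M))" "Tree_Vertex ` inners A T \<subseteq> V"
  shows "kprod A T x y \<ge> 0"
  unfolding kprod_def
proof (intro prod_nonneg K_nonneg)
  fix u assume u: "u \<in> inners A T"
  show "parent_pos x y u \<in> space M" using u by (intro parent_pos_space[OF _ x y]) auto
  show "y (Tree_Vertex u) \<in> space M" using u y by (auto simp: space_PiM PiE_def Pi_def)
qed

lemma nn_integral_kprod:
  assumes A: "finite A" and x: "x ` A \<subseteq> space M"
  shows "(\<integral>\<^sup>+y. ennreal (kprod A T x y) \<partial>PiM (Tree_Vertex ` inners A T) (\<lambda>_. M)) < \<infinity>"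
proof -
  define S where "S = (\<lambda>i. Tree_Vertex ` inner_at (T i) i [])"
  have U: "Tree_Vertex ` inners A T = (\<Union>i\<in>A. S i)" by (auto simp: inners_def S_def)
  have fS: "finite (S i)" for i by (simp add: S_def)
  have dS: "disjoint_family_on S A" using roots_disjoint(1)[of T A] by (fastforce simp: S_def disjoint_family_on_def)
  let ?g = "\<lambda>i y. ennreal \<bar>tree_integrand K (\<lambda>_. 1) (\<lambda>_. 1) (T i) i [] (x i) y\<bar>"
  have "(\<integral>\<^sup>+y. ennreal (kprod A T x y) \<partial>PiM (Tree_Vertex ` inners A T) (\<lambda>_. M)) =
     (\<integral>\<^sup>+y. (\<Prod>i\<in>A. ?g i (restrict y (S i))) \<partial>PiM (Tree_Vertex ` inners A T) (\<lambda>_. M))"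
  proof (rule nn_integral_cong)
    fix y assume y: "y \<in> space (PiM (Tree_Vertex ` inners A T) (\<lambda>_. M))"
    have "tree_integrand K (\<lambda>_. 1) (\<lambda>_. 1) (T i) i [] (x i) (restrict y (S i)) = tree_integrand K (\<lambda>_. 1) (\<lambda>_. 1) (T i) i [] (x i) y" for i
      by (rule tree_integrand_cong) (simp add: S_def)
    then have "(\<Prod>i\<in>A. ?g i (restrict y (S i))) = ennreal \<bar>\<Prod>i\<in>A. tree_integrand K (\<lambda>_. 1) (\<lambda>_. 1) (T i) i [] (x i) y\<bar>"
      by (simp add: abs_prod prod_ennreal)
    also have "(\<Prod>i\<in>A. tree_integrand K (\<lambda>_. 1) (\<lambda>_. 1) (T i) i [] (x i) y) = kprod A T x y"
      by (subst prod_tree_integrand[OF A]) (simp add: kprod_def)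
    finally show "ennreal (kprod A T x y) = (\<Prod>i\<in>A. ?g i (restrict y (S i)))"
      unfolding abs_of_nonneg[OF kprod_nonneg[OF x y order_refl]] by (rule sym)
  qed
  also have "\<dots> = (\<Prod>i\<in>A. \<integral>\<^sup>+y. ?g i y \<partial>PiM (S i) (\<lambda>_. M))"
    unfolding U
  proof (rule nn_integral_prod_disjoint[OF A fS dS])
    show "?g i \<in> borel_measurable (PiM (S i) (\<lambda>_. M))" if "i \<in> A" for i
      by (intro measurable_compose[OF _ measurable_ennreal] borel_measurable_abs tree_integrand_measurable measurable_const)
        (use x that in \<open>auto simp: S_def intro!: measurable_component_singleton\<close>)
  qed
  also have "\<dots> = (\<Prod>i\<in>A. tree_abs M K (\<lambda>_. 1) (\<lambda>_. 1) (T i) (x i))"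
    unfolding S_def by (intro prod.cong refl nn_integral_tree_integrand) (use x in auto)
  also have "\<dots> < \<infinity>"
  proof -
    have "tree_abs M K (\<lambda>_. 1) (\<lambda>_. 1) (T i) (x i) < \<infinity>" if "i \<in> A" for i
    proof -
      have xi: "x i \<in> space M" using x that by blast
      obtain C where C: "\<forall>x\<in>space M. tree_abs M K (\<lambda>_. 1) (\<lambda>_. 1) (T i) x \<le> ennreal C"
        using tree_abs_bound[of "T i"] by blast
      show ?thesis by (rule le_less_trans[OF bspec[OF C xi]]) simp
    qed
    then show ?thesis using A by (auto simp: less_top[symmetric] ennreal_prod_eq_top)
  qed
  finally show ?thesis .
qed

lemma integrable_kprod:
  assumes A: "finite A" and x: "x ` A \<subseteq> space M"
  shows "integrable (PiM (Tree_Vertex ` inners A T) (\<lambda>_. M)) (kprod A T x)"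
proof (rule integrableI_bounded)
  show "kprod A T x \<in> borel_measurable (PiM (Tree_Vertex ` inners A T) (\<lambda>_. M))"
    using x by (rule kprod_measurable) (auto intro!: measurable_component_singleton)
  have "(\<integral>\<^sup>+y. ennreal (norm (kprod A T x y)) \<partial>PiM (Tree_Vertex ` inners A T) (\<lambda>_. M)) =
     (\<integral>\<^sup>+y. ennreal (kprod A T x y) \<partial>PiM (Tree_Vertex ` inners A T) (\<lambda>_. M))"
    using kprod_nonneg[OF x _ order_refl] by (intro nn_integral_cong) simp
  then show "(\<integral>\<^sup>+y. ennreal (norm (kprod A T x y)) \<partial>PiM (Tree_Vertex ` inners A T) (\<lambda>_. M)) < \<infinity>"
    using nn_integral_kprod[OF A x] by simp
qed

end

text \<open>The noise enters only through its moment formula and a bound of the moments that is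
  uniform in the points. F is the value of a leaf of type two, D the region of the empty vertices,
  and \<open>c l\<close> the factor of an empty vertex with l legs.\<close>

locale noise_tree_kernel = tree_kernel M K \<kappa> b + P: prob_space P
  for M :: "'a measure" and K \<kappa> b and P :: "'w measure" +
  fixes Y :: "'w \<Rightarrow> 'a \<Rightarrow> real" and F :: "'a \<Rightarrow> real" and CF :: real and D :: "'a set" and c :: "nat \<Rightarrow> real"
  assumes Y_joint: "(\<lambda>(\<omega>, x). Y \<omega> x) \<in> borel_measurable (P \<Otimes>\<^sub>M M)"
    and F_meas: "F \<in> borel_measurable M" and F_bound: "\<And>x. x \<in> space M \<Longrightarrow> \<bar>F x\<bar> \<le> CF" and CF: "CF \<ge> 0"
    and D: "D \<in> sets M"
    and Y_moment: "\<And>(S :: address set) w. finite S \<Longrightarrow> (\<And>u. u \<in> S \<Longrightarrow> w u \<in> space M) \<Longrightarrow>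
      (LINT \<omega> | P. (\<Prod>u\<in>S. Y \<omega> (w u))) = (\<Sum>\<pi>\<in>{\<pi>. partition_on S \<pi>}. \<Prod>B\<in>\<pi>. c (card B) *
         (LINT y | M. indicator D y * (\<Prod>u\<in>B. K (w u) y)))"
    and Y_bound: "\<And>n. \<exists>C. \<forall>(S :: address set) w. finite S \<longrightarrow> card S = n \<longrightarrow> (\<forall>u\<in>S. w u \<in> space M) \<longrightarrow>
      (\<integral>\<^sup>+\<omega>. (\<Prod>u\<in>S. ennreal \<bar>Y \<omega> (w u)\<bar>) \<partial>P) \<le> ennreal C"
begin

lemma Y_compose: "f \<in> Q \<rightarrow>\<^sub>M P \<Longrightarrow> g \<in> Q \<rightarrow>\<^sub>M M \<Longrightarrow> (\<lambda>q. Y (f q) (g q)) \<in> borel_measurable Q"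
  using measurable_compose[OF measurable_Pair Y_joint, of f Q g] by simp

lemma Y_meas: "\<omega> \<in> space P \<Longrightarrow> Y \<omega> \<in> borel_measurable M"
  using Y_compose[of "\<lambda>_. \<omega>" M "\<lambda>x. x"] by simp

definition fprod :: "nat set \<Rightarrow> (nat \<Rightarrow> ptree) \<Rightarrow> (nat \<Rightarrow> 'a) \<Rightarrow> (vertex \<Rightarrow> 'a) \<Rightarrow> real" where
  "fprod A T x y = kprod A T x y * (\<Prod>u\<in>leaves2s A T. F (parent_pos x y u))"

lemma fprod_measurable:
  assumes x: "x ` A \<subseteq> space M"
    and Z: "\<And>u. u \<in> inners A T \<Longrightarrow> (\<lambda>q. Z q (Tree_Vertex u)) \<in> Q \<rightarrow>\<^sub>M M"
  shows "(\<lambda>q. fprod A T x (Z q)) \<in> borel_measurable Q"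
  unfolding fprod_def using x Z
  by (intro borel_measurable_times kprod_measurable borel_measurable_prod measurable_compose[OF _ F_meas]
      parent_pos_measurable[where A = A and T = T]) auto

lemma abs_fprod_le:
  assumes x: "x ` A \<subseteq> space M" and y: "y \<in> space (PiM V (\<lambda>_. M))" "Tree_Vertex ` inners A T \<subseteq> V"
  shows "\<bar>fprod A T x y\<bar> \<le> kprod A T x y * CF ^ card (leaves2s A T)"
proof -
  have "(\<Prod>u\<in>leaves2s A T. \<bar>F (parent_pos x y u)\<bar>) \<le> (\<Prod>u\<in>leaves2s A T. CF)"
    by (intro prod_mono conjI abs_ge_zero F_bound parent_pos_space[OF _ x y]) auto
  then show ?thesis using kprod_nonneg[OF x y] by (auto simp: fprod_def abs_mult abs_prod intro: mult_left_mono)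
qed

definition noise_integrand :: "nat set \<Rightarrow> (nat \<Rightarrow> ptree) \<Rightarrow> (nat \<Rightarrow> 'a) \<Rightarrow> 'w \<Rightarrow> (vertex \<Rightarrow> 'a) \<Rightarrow> real" where
  "noise_integrand A T x \<omega> y = fprod A T x y * (\<Prod>u\<in>leaves1s A T. Y \<omega> (parent_pos x y u))"

lemma noise_integrand_measurable:
  assumes x: "x ` A \<subseteq> space M"
  shows "(\<lambda>(\<omega>, y). noise_integrand A T x \<omega> y) \<in> borel_measurable (P \<Otimes>\<^sub>M PiM (Tree_Vertex ` inners A T) (\<lambda>_. M))"
proof -
  have Z: "(\<lambda>q. snd q (Tree_Vertex u)) \<in> P \<Otimes>\<^sub>M PiM (Tree_Vertex ` inners A T) (\<lambda>_. M) \<rightarrow>\<^sub>M M" if "u \<in> inners A T" for u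
    using that by (intro measurable_compose[OF measurable_snd measurable_component_singleton]) auto
  have "(\<lambda>q. noise_integrand A T x (fst q) (snd q)) \<in> borel_measurable (P \<Otimes>\<^sub>M PiM (Tree_Vertex ` inners A T) (\<lambda>_. M))"
    unfolding noise_integrand_def
    by (intro borel_measurable_times fprod_measurable x Z borel_measurable_prod Y_compose measurable_fst
        parent_pos_measurable[where A = A and T = T]) auto
  then show ?thesis by (simp add: split_beta')
qed

text \<open>Tonelli allows the expectation to be taken first, at fixed positions y; there the
  uniform moment bound applies, and the product of tree edges that remains is integrable.\<close>

lemma nn_integral_noise_integrand:
  assumes A: "finite A" and x: "x ` A \<subseteq> space M"
  shows "(\<integral>\<^sup>+\<omega>. (\<integral>\<^sup>+y. ennreal \<bar>noise_integrand A T x \<omega> y\<bar> \<partial>PiM (Tree_Vertex ` inners A T) (\<lambda>_. M)) \<partial>P) < \<infinity>"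
proof -
  let ?V = "PiM (Tree_Vertex ` inners A T) (\<lambda>_. M)"
  interpret V: finite_product_sigma_finite "\<lambda>_. M" "Tree_Vertex ` inners A T" by unfold_locales (use A in simp)
  interpret PV: pair_sigma_finite P ?V by unfold_locales
  obtain C where C: "\<And>S :: address set. \<And>w. finite S \<Longrightarrow> card S = card (leaves1s A T) \<Longrightarrow> (\<forall>u\<in>S. w u \<in> space M) \<Longrightarrow>
      (\<integral>\<^sup>+\<omega>. (\<Prod>u\<in>S. ennreal \<bar>Y \<omega> (w u)\<bar>) \<partial>P) \<le> ennreal C" using Y_bound[of "card (leaves1s A T)"] by blast
  let ?l = "CF ^ card (leaves2s A T)"
  have "(\<integral>\<^sup>+\<omega>. (\<integral>\<^sup>+y. ennreal \<bar>noise_integrand A T x \<omega> y\<bar> \<partial>?V) \<partial>P) = (\<integral>\<^sup>+y. (\<integral>\<^sup>+\<omega>. ennreal \<bar>noise_integrand A T x \<omega> y\<bar> \<partial>P) \<partial>?V)"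
    using noise_integrand_measurable[OF x, of T] by (intro PV.Fubini'[symmetric]) (auto simp: split_beta')
  also have "\<dots> \<le> (\<integral>\<^sup>+y. ennreal (kprod A T x y) * ennreal (?l * max 0 C) \<partial>?V)"
  proof (rule nn_integral_mono)
    fix y assume y: "y \<in> space ?V"
    have pm: "(\<lambda>\<omega>. Y \<omega> (parent_pos x y u)) \<in> borel_measurable P" if "u \<in> leaves1s A T" for u
      using that by (intro Y_compose measurable_ident measurable_const parent_pos_space[OF _ x y]) auto
    have "(\<integral>\<^sup>+\<omega>. ennreal \<bar>noise_integrand A T x \<omega> y\<bar> \<partial>P) =
        (\<integral>\<^sup>+\<omega>. ennreal \<bar>fprod A T x y\<bar> * (\<Prod>u\<in>leaves1s A T. ennreal \<bar>Y \<omega> (parent_pos x y u)\<bar>) \<partial>P)"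
      by (intro nn_integral_cong) (simp add: noise_integrand_def abs_mult abs_prod ennreal_mult prod_ennreal prod_nonneg)
    also have "\<dots> = ennreal \<bar>fprod A T x y\<bar> * (\<integral>\<^sup>+\<omega>. (\<Prod>u\<in>leaves1s A T. ennreal \<bar>Y \<omega> (parent_pos x y u)\<bar>) \<partial>P)"
      using pm by (intro nn_integral_cmult borel_measurable_prod_ennreal) auto
    also have "\<dots> \<le> ennreal (kprod A T x y * ?l) * ennreal (max 0 C)"
    proof (intro mult_mono)
      show "ennreal \<bar>fprod A T x y\<bar> \<le> ennreal (kprod A T x y * ?l)"
        by (intro ennreal_leI abs_fprod_le[OF x y]) auto
      have "(\<integral>\<^sup>+\<omega>. (\<Prod>u\<in>leaves1s A T. ennreal \<bar>Y \<omega> (parent_pos x y u)\<bar>) \<partial>P) \<le> ennreal C"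
        using A by (intro C ballI parent_pos_space[OF _ x y]) auto
      also have "\<dots> \<le> ennreal (max 0 C)" by (simp add: ennreal_leI)
      finally show "(\<integral>\<^sup>+\<omega>. (\<Prod>u\<in>leaves1s A T. ennreal \<bar>Y \<omega> (parent_pos x y u)\<bar>) \<partial>P) \<le> ennreal (max 0 C)" .
    qed auto
    also have "\<dots> = ennreal (kprod A T x y * ?l * max 0 C)"
      using CF kprod_nonneg[OF x y order_refl] by (intro ennreal_mult[symmetric]) auto
    also have "\<dots> = ennreal (kprod A T x y) * ennreal (?l * max 0 C)"
      unfolding mult.assoc using CF kprod_nonneg[OF x y order_refl] by (intro ennreal_mult) auto
    finally show "(\<integral>\<^sup>+\<omega>. ennreal \<bar>noise_integrand A T x \<omega> y\<bar> \<partial>P) \<le> ennreal (kprod A T x y) * ennreal (?l * max 0 C)" .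
  qed
  also have "\<dots> = (\<integral>\<^sup>+y. ennreal (kprod A T x y) \<partial>?V) * ennreal (?l * max 0 C)"
    using borel_measurable_integrable[OF integrable_kprod[OF A x]] by (intro nn_integral_multc) auto
  also have "\<dots> < \<infinity>" using nn_integral_kprod[OF A x] by (simp add: ennreal_mult_less_top)
  finally show ?thesis .
qed

lemma integrable_noise_integrand:
  assumes A: "finite A" and x: "x ` A \<subseteq> space M"
  shows "integrable (P \<Otimes>\<^sub>M PiM (Tree_Vertex ` inners A T) (\<lambda>_. M)) (\<lambda>(\<omega>, y). noise_integrand A T x \<omega> y)"
proof -
  let ?V = "PiM (Tree_Vertex ` inners A T) (\<lambda>_. M)"
  interpret V: finite_product_sigma_finite "\<lambda>_. M" "Tree_Vertex ` inners A T" by unfold_locales (use A in simp)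
  note m = noise_integrand_measurable[OF x, of T]
  have "(\<integral>\<^sup>+q. ennreal \<bar>noise_integrand A T x (fst q) (snd q)\<bar> \<partial>(P \<Otimes>\<^sub>M ?V)) =
     (\<integral>\<^sup>+\<omega>. (\<integral>\<^sup>+y. ennreal \<bar>noise_integrand A T x \<omega> y\<bar> \<partial>?V) \<partial>P)"
    using m by (subst V.nn_integral_fst[symmetric]) (auto simp: split_beta')
  also have "\<dots> < \<infinity>" by (rule nn_integral_noise_integrand[OF A x])
  finally show ?thesis using m by (intro integrableI_bounded) (auto simp: split_beta')
qed

text \<open>A single tree is treated as a family with the only root 0. Finite expectation gives
  finiteness for almost every path; the null set depends on x and T.\<close>

lemma AE_tree_abs_finite:
  assumes x: "x \<in> space M"
  shows "AE \<omega> in P. tree_abs M K (Y \<omega>) F T x < \<infinity>"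
proof -
  let ?V = "PiM (Tree_Vertex ` inners {0} (\<lambda>_. T)) (\<lambda>_. M)"
  interpret V: finite_product_sigma_finite "\<lambda>_. M" "Tree_Vertex ` inners {0} (\<lambda>_. T)" by unfold_locales simp
  have x0: "(\<lambda>_. x) ` {0::nat} \<subseteq> space M" using x by simp
  note m = noise_integrand_measurable[OF x0, of "\<lambda>_. T"]
  have "AE \<omega> in P. (\<integral>\<^sup>+y. ennreal \<bar>noise_integrand {0} (\<lambda>_. T) (\<lambda>_. x) \<omega> y\<bar> \<partial>?V) \<noteq> \<infinity>"
  proof (rule nn_integral_PInf_AE)
    show "(\<lambda>\<omega>. \<integral>\<^sup>+y. ennreal \<bar>noise_integrand {0} (\<lambda>_. T) (\<lambda>_. x) \<omega> y\<bar> \<partial>?V) \<in> borel_measurable P"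
      using m x by (intro V.borel_measurable_nn_integral) (auto simp: split_beta')
    show "(\<integral>\<^sup>+\<omega>. (\<integral>\<^sup>+y. ennreal \<bar>noise_integrand {0} (\<lambda>_. T) (\<lambda>_. x) \<omega> y\<bar> \<partial>?V) \<partial>P) \<noteq> \<infinity>"
      using nn_integral_noise_integrand[OF _ x0, of "\<lambda>_. T"] by simp
  qed
  then show ?thesis
  proof (rule AE_mp, intro AE_I2 impI)
    fix \<omega> assume \<omega>: "\<omega> \<in> space P" and ne: "(\<integral>\<^sup>+y. ennreal \<bar>noise_integrand {0} (\<lambda>_. T) (\<lambda>_. x) \<omega> y\<bar> \<partial>?V) \<noteq> \<infinity>"
    have "tree_integrand K (Y \<omega>) F T 0 [] x y = noise_integrand {0} (\<lambda>_. T) (\<lambda>_. x) \<omega> y" for y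
      using prod_tree_integrand[of "{0}" K "Y \<omega>" F "\<lambda>_. T" "\<lambda>_. x" y]
      by (simp add: noise_integrand_def fprod_def kprod_def mult_ac)
    then have "tree_abs M K (Y \<omega>) F T x = (\<integral>\<^sup>+y. ennreal \<bar>noise_integrand {0} (\<lambda>_. T) (\<lambda>_. x) \<omega> y\<bar> \<partial>?V)"
      using nn_integral_tree_integrand[OF Y_meas[OF \<omega>] F_meas x, of T 0 "[]"] by (simp add: inners_def)
    then show "tree_abs M K (Y \<omega>) F T x < \<infinity>" using ne by (simp add: less_top)
  qed
qed

lemma prod_tree_val:
  assumes A: "finite A" and x: "x ` A \<subseteq> space M" and \<omega>: "\<omega> \<in> space P"
    and fin: "\<And>i. i \<in> A \<Longrightarrow> tree_abs M K (Y \<omega>) F (T i) (x i) < \<infinity>"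
  shows "(\<Prod>i\<in>A. tree_val M K (Y \<omega>) F (T i) (x i)) = (LINT y | PiM (Tree_Vertex ` inners A T) (\<lambda>_. M). noise_integrand A T x \<omega> y)"
proof -
  define S where "S = (\<lambda>i. Tree_Vertex ` inner_at (T i) i [])"
  have U: "Tree_Vertex ` inners A T = (\<Union>i\<in>A. S i)" by (auto simp: inners_def S_def)
  have fS: "finite (S i)" for i by (simp add: S_def)
  have dS: "disjoint_family_on S A" using roots_disjoint(1)[of T A] by (fastforce simp: S_def disjoint_family_on_def)
  let ?g = "\<lambda>i y. tree_integrand K (Y \<omega>) F (T i) i [] (x i) y"
  have ti: "integrable (PiM (S i) (\<lambda>_. M)) (?g i)"
      "(LINT y | PiM (S i) (\<lambda>_. M). ?g i y) = tree_val M K (Y \<omega>) F (T i) (x i)" if "i \<in> A" for i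
    using integral_tree_integrand[OF Y_meas[OF \<omega>] F_meas _ fin[OF that], of i "[]"] x that by (auto simp: S_def)
  have "(\<Prod>i\<in>A. tree_val M K (Y \<omega>) F (T i) (x i)) = (\<Prod>i\<in>A. LINT y | PiM (S i) (\<lambda>_. M). ?g i y)"
    using ti by (intro prod.cong refl) auto
  also have "\<dots> = (LINT y | PiM (Tree_Vertex ` inners A T) (\<lambda>_. M). (\<Prod>i\<in>A. ?g i (restrict y (S i))))"
    unfolding U using ti by (intro integral_prod_disjoint(2)[symmetric] A fS dS) auto
  also have "\<dots> = (LINT y | PiM (Tree_Vertex ` inners A T) (\<lambda>_. M). noise_integrand A T x \<omega> y)"
  proof (intro Bochner_Integration.integral_cong refl)
    fix y
    have "?g i (restrict y (S i)) = ?g i y" for i by (rule tree_integrand_cong) (simp add: S_def)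
    then show "(\<Prod>i\<in>A. ?g i (restrict y (S i))) = noise_integrand A T x \<omega> y"
      by (simp add: prod_tree_integrand[OF A] noise_integrand_def fprod_def kprod_def mult_ac)
  qed
  finally show ?thesis .
qed

end

section \<open>Values of graphs and expectations of products of trees\<close>

context noise_tree_kernel
begin

definition block_factor :: "(nat \<Rightarrow> 'a) \<Rightarrow> (vertex \<Rightarrow> 'a) \<Rightarrow> address set \<Rightarrow> 'a \<Rightarrow> real" where
  "block_factor x y B z = indicator D z * (\<Prod>u\<in>B. K (parent_pos x y u) z)"

definition value_integrand :: "nat set \<Rightarrow> (nat \<Rightarrow> ptree) \<Rightarrow> (nat \<Rightarrow> 'a) \<Rightarrow> address set set \<Rightarrow> (vertex \<Rightarrow> 'a) \<Rightarrow> real" where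
  "value_integrand A T x I y = fprod A T x y * (\<Prod>B\<in>I. block_factor x y B (y (Empty_Vertex B)))"

definition value_verts :: "nat set \<Rightarrow> (nat \<Rightarrow> ptree) \<Rightarrow> address set set \<Rightarrow> vertex set" where
  "value_verts A T I = Tree_Vertex ` inners A T \<union> Empty_Vertex ` I"

text \<open>The bare integral of a graph; cumulants, vertex factors and signs are added later in
  \<open>graph_weight\<close>.\<close>

definition graph_val :: "nat set \<Rightarrow> (nat \<Rightarrow> ptree) \<Rightarrow> (nat \<Rightarrow> 'a) \<Rightarrow> address set set \<Rightarrow> real" where
  "graph_val A T x I = (LINT y | PiM (value_verts A T I) (\<lambda>_. M). value_integrand A T x I y)"

lemma block_factor_measurable:
  assumes x: "x ` A \<subseteq> space M" and B: "B \<subseteq> leaves1s A T"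
    and Z: "\<And>u. u \<in> inners A T \<Longrightarrow> (\<lambda>q. Z q (Tree_Vertex u)) \<in> Q \<rightarrow>\<^sub>M M" and g: "g \<in> Q \<rightarrow>\<^sub>M M"
  shows "(\<lambda>q. block_factor x (Z q) B (g q)) \<in> borel_measurable Q"
  unfolding block_factor_def
proof (intro borel_measurable_times borel_measurable_prod K_compose g)
  show "(\<lambda>q. indicator D (g q) :: real) \<in> borel_measurable Q"
    by (rule measurable_compose[OF g borel_measurable_indicator[OF D]])
  show "(\<lambda>q. parent_pos x (Z q) u) \<in> Q \<rightarrow>\<^sub>M M" if "u \<in> B" for u
    using that B Z by (intro parent_pos_measurable[where A = A and T = T and x = x and Z = Z, OF _ x]) auto
qed

lemma block_factor_nonneg:
  assumes x: "x ` A \<subseteq> space M" and B: "B \<subseteq> leaves1s A T"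
    and y: "y \<in> space (PiM V (\<lambda>_. M))" "Tree_Vertex ` inners A T \<subseteq> V" and z: "z \<in> space M"
  shows "block_factor x y B z \<ge> 0"
  unfolding block_factor_def
  by (intro mult_nonneg_nonneg prod_nonneg K_nonneg z parent_pos_space[OF _ x y]) (use B in auto)

text \<open>One leg of the block is integrated at the cost \<kappa>, the others are bounded by b;
  this is where blocks have to be nonempty.\<close>

lemma nn_integral_block_factor:
  assumes A: "finite A" and x: "x ` A \<subseteq> space M" and B: "B \<subseteq> leaves1s A T" "B \<noteq> {}"
    and y: "y \<in> space (PiM V (\<lambda>_. M))" "Tree_Vertex ` inners A T \<subseteq> V"
  shows "(\<integral>\<^sup>+z. ennreal (block_factor x y B z) \<partial>M) \<le> ennreal (\<bar>b\<bar> ^ (card B - 1) * \<bar>\<kappa>\<bar>)"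
proof -
  have fB: "finite B" using A B finite_subset finite_leaves1s by blast
  obtain k where k: "k \<in> B" using B by blast
  have ps: "parent_pos x y u \<in> space M" if "u \<in> B" for u using that B by (intro parent_pos_space[OF _ x y]) auto
  have Kk: "(\<lambda>z. K (parent_pos x y k) z) \<in> borel_measurable M" using ps[OF k] by (intro K_compose measurable_const) auto
  have "(\<integral>\<^sup>+z. ennreal (block_factor x y B z) \<partial>M) \<le> (\<integral>\<^sup>+z. ennreal (\<bar>b\<bar> ^ (card B - 1)) * ennreal (K (parent_pos x y k) z) \<partial>M)"
  proof (rule nn_integral_mono)
    fix z assume z: "z \<in> space M"
    have nn: "K (parent_pos x y u) z \<ge> 0" "K (parent_pos x y u) z \<le> \<bar>b\<bar>" if "u \<in> B" for u
      using K_nonneg[OF ps[OF that] z] K_le[OF ps[OF that] z] by auto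
    have "block_factor x y B z \<le> (\<Prod>u\<in>B. K (parent_pos x y u) z)"
      using nn by (auto simp: block_factor_def indicator_def intro!: prod_nonneg)
    also have "\<dots> = K (parent_pos x y k) z * (\<Prod>u\<in>B - {k}. K (parent_pos x y u) z)"
      using fB k by (rule prod.remove)
    also have "\<dots> \<le> K (parent_pos x y k) z * (\<Prod>u\<in>B - {k}. \<bar>b\<bar>)"
      using nn k by (intro mult_left_mono prod_mono) auto
    also have "\<dots> = \<bar>b\<bar> ^ (card B - 1) * K (parent_pos x y k) z" using fB k by simp
    finally show "ennreal (block_factor x y B z) \<le> ennreal (\<bar>b\<bar> ^ (card B - 1)) * ennreal (K (parent_pos x y k) z)"
      using nn[OF k] by (simp add: ennreal_mult[symmetric] ennreal_leI)
  qed
  also have "\<dots> = ennreal (\<bar>b\<bar> ^ (card B - 1)) * (\<integral>\<^sup>+z. ennreal (K (parent_pos x y k) z) \<partial>M)"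
    using Kk by (intro nn_integral_cmult) auto
  also have "\<dots> \<le> ennreal (\<bar>b\<bar> ^ (card B - 1)) * ennreal \<bar>\<kappa>\<bar>"
    using K_int[OF ps[OF k]] by (intro mult_left_mono) (auto intro: order_trans simp: ennreal_leI)
  also have "\<dots> = ennreal (\<bar>b\<bar> ^ (card B - 1) * \<bar>\<kappa>\<bar>)" by (simp add: ennreal_mult)
  finally show ?thesis .
qed

text \<open>Once the tree vertices are fixed, each empty vertex occurs in its own factor only, so
  the integral over the empty vertices is a product. This is the form that the moment formula
  produces.\<close>

lemma graph_val_fold:
  assumes A: "finite A" and x: "x ` A \<subseteq> space M" and I: "finite I" "\<And>B. B \<in> I \<Longrightarrow> B \<subseteq> leaves1s A T" "{} \<notin> I"
  shows "integrable (PiM (value_verts A T I) (\<lambda>_. M)) (value_integrand A T x I)"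
    "integrable (PiM (Tree_Vertex ` inners A T) (\<lambda>_. M)) (\<lambda>y. fprod A T x y * (\<Prod>B\<in>I. LINT z | M. block_factor x y B z))"
    "graph_val A T x I = (LINT y | PiM (Tree_Vertex ` inners A T) (\<lambda>_. M). fprod A T x y * (\<Prod>B\<in>I. LINT z | M. block_factor x y B z))"
proof -
  let ?TV = "Tree_Vertex ` inners A T" and ?EV = "Empty_Vertex ` I"
  let ?V = "PiM ?TV (\<lambda>_. M)" and ?W = "PiM (value_verts A T I) (\<lambda>_. M)"
  let ?l = "CF ^ card (leaves2s A T)"
  define q where "q = (\<Prod>B\<in>I. \<bar>b\<bar> ^ (card B - 1) * \<bar>\<kappa>\<bar>)"
  have q0: "q \<ge> 0" unfolding q_def by (intro prod_nonneg) auto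
  have dj: "?TV \<inter> ?EV = {}" by auto
  have fTV: "finite ?TV" "finite ?EV" using A I by auto
  have injE: "inj_on Empty_Vertex I" by (auto simp: inj_on_def)
  \<comment> \<open>The product measure is indexed by vertices, so the block factors are made into a
    function of the vertex, with the dummy value 1 elsewhere.\<close>
  define f where "f = (\<lambda>y v. case v of Empty_Vertex B \<Rightarrow> block_factor x y B | _ \<Rightarrow> (\<lambda>_. 1))"
  have fE: "f y (Empty_Vertex B) = block_factor x y B" for y B by (simp add: f_def)
  have re: "(\<Prod>v\<in>?EV. g v) = (\<Prod>B\<in>I. g (Empty_Vertex B))" for g :: "vertex \<Rightarrow> real" by (simp add: prod.reindex[OF injE])
  have re': "(\<Prod>v\<in>?EV. g v) = (\<Prod>B\<in>I. g (Empty_Vertex B))" for g :: "vertex \<Rightarrow> ennreal" by (simp add: prod.reindex[OF injE])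
  have comp: "(\<lambda>y. y v) \<in> ?W \<rightarrow>\<^sub>M M" if "v \<in> value_verts A T I" for v using that by (rule measurable_component_singleton)
  have m: "value_integrand A T x I \<in> borel_measurable ?W"
    unfolding value_integrand_def[abs_def]
    by (intro borel_measurable_times fprod_measurable x borel_measurable_prod block_factor_measurable[OF x I(2)] comp)
      (auto simp: value_verts_def)
  have bm: "block_factor x y B \<in> borel_measurable M" if "B \<in> I" "y \<in> space ?V" for y B
    using that by (intro block_factor_measurable[OF x I(2)] measurable_const) (auto simp: space_PiM PiE_def Pi_def)
  have bnn: "block_factor x y B z \<ge> 0" if "B \<in> I" "y \<in> space ?V" "z \<in> space M" for y B z
    using block_factor_nonneg[OF x I(2)[OF that(1)] that(2) order_refl that(3)] .
  have bint: "(\<integral>\<^sup>+z. ennreal (block_factor x y B z) \<partial>M) \<le> ennreal (\<bar>b\<bar> ^ (card B - 1) * \<bar>\<kappa>\<bar>)" if "B \<in> I" "y \<in> space ?V" for y B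
    using that I(3) by (intro nn_integral_block_factor[OF A x I(2) _ _ order_refl]) auto
  have mg: "value_integrand A T x I (merge ?TV ?EV (y, z)) = fprod A T x y * (\<Prod>v\<in>?EV. f y v (z v))" for y z
  proof -
    have pp: "parent_pos x (merge ?TV ?EV (y, z)) u = parent_pos x y u" if "u \<in> inners A T \<union> leaves1s A T \<union> leaves2s A T" for u
    proof (cases u)
      case (Pair i w)
      with parent_in_inners[of i w A T] that show ?thesis by (auto simp: merge_def)
    qed
    have 1: "fprod A T x (merge ?TV ?EV (y, z)) = fprod A T x y"
      unfolding fprod_def kprod_def
    proof (intro arg_cong2[where f = times] prod.cong refl arg_cong2[where f = K] arg_cong[where f = F] pp)
      show "merge ?TV ?EV (y, z) (Tree_Vertex u) = y (Tree_Vertex u)" if "u \<in> inners A T" for u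
        using that by (simp add: merge_def)
    qed auto
    have 2: "block_factor x (merge ?TV ?EV (y, z)) B (merge ?TV ?EV (y, z) (Empty_Vertex B)) = block_factor x y B (z (Empty_Vertex B))" if "B \<in> I" for B
    proof -
      have "merge ?TV ?EV (y, z) (Empty_Vertex B) = z (Empty_Vertex B)" using that by (auto simp: merge_def)
      then show ?thesis unfolding block_factor_def
        using pp I(2)[OF that] by (auto intro!: prod.cong)
    qed
    show ?thesis unfolding value_integrand_def 1 re fE using 2 by simp
  qed
  interpret E: product_sigma_finite "\<lambda>_ :: vertex. M" by unfold_locales
  have inner_nn: "(\<integral>\<^sup>+z. ennreal \<bar>\<Prod>v\<in>?EV. f y v (z v)\<bar> \<partial>PiM ?EV (\<lambda>_. M)) \<le> ennreal q" if y: "y \<in> space ?V" for y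
  proof -
    have "(\<integral>\<^sup>+z. ennreal \<bar>\<Prod>v\<in>?EV. f y v (z v)\<bar> \<partial>PiM ?EV (\<lambda>_. M)) = (\<integral>\<^sup>+z. (\<Prod>v\<in>?EV. ennreal \<bar>f y v (z v)\<bar>) \<partial>PiM ?EV (\<lambda>_. M))"
      by (simp add: abs_prod prod_ennreal)
    also have "\<dots> = (\<Prod>v\<in>?EV. \<integral>\<^sup>+z. ennreal \<bar>f y v z\<bar> \<partial>M)"
      using bm y fTV by (intro product_nn_integral_prod) (auto simp: f_def)
    also have "\<dots> = (\<Prod>B\<in>I. \<integral>\<^sup>+z. ennreal (block_factor x y B z) \<partial>M)"
      unfolding re' fE using bnn y by (intro prod.cong refl nn_integral_cong) auto
    also have "\<dots> \<le> (\<Prod>B\<in>I. ennreal (\<bar>b\<bar> ^ (card B - 1) * \<bar>\<kappa>\<bar>))"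
      using bint y by (intro prod_mono_ennreal) auto
    also have "\<dots> = ennreal q" unfolding q_def by (intro prod_ennreal) auto
    finally show ?thesis .
  qed
  have ik: "integrable ?V (\<lambda>y. kprod A T x y * ?l * q)" using integrable_kprod[OF A x] by simp
  have W: "?W = PiM (?TV \<union> ?EV) (\<lambda>_. M)" by (simp add: value_verts_def)
  show int: "integrable ?W (value_integrand A T x I)"
  proof (rule integrableI_bounded[OF m])
    have "(\<integral>\<^sup>+y. ennreal (norm (value_integrand A T x I y)) \<partial>?W) =
       (\<integral>\<^sup>+y. (\<integral>\<^sup>+z. ennreal (norm (value_integrand A T x I (merge ?TV ?EV (y, z)))) \<partial>PiM ?EV (\<lambda>_. M)) \<partial>?V)"
      using m dj fTV unfolding W by (intro product_nn_integral_fold) auto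
    also have "\<dots> \<le> (\<integral>\<^sup>+y. ennreal (kprod A T x y * ?l * q) \<partial>?V)"
    proof (rule nn_integral_mono)
      fix y assume y: "y \<in> space ?V"
      have "(\<integral>\<^sup>+z. ennreal (norm (value_integrand A T x I (merge ?TV ?EV (y, z)))) \<partial>PiM ?EV (\<lambda>_. M)) =
         (\<integral>\<^sup>+z. ennreal \<bar>fprod A T x y\<bar> * ennreal \<bar>\<Prod>v\<in>?EV. f y v (z v)\<bar> \<partial>PiM ?EV (\<lambda>_. M))"
        unfolding mg by (simp add: abs_mult ennreal_mult)
      also have "\<dots> = ennreal \<bar>fprod A T x y\<bar> * (\<integral>\<^sup>+z. ennreal \<bar>\<Prod>v\<in>?EV. f y v (z v)\<bar> \<partial>PiM ?EV (\<lambda>_. M))"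
      proof (rule nn_integral_cmult)
        have "(\<lambda>z. f y v (z v)) \<in> borel_measurable (PiM ?EV (\<lambda>_. M))" if v: "v \<in> ?EV" for v
        proof -
          obtain B where B: "B \<in> I" "v = Empty_Vertex B" using v by auto
          have "(\<lambda>z. z (Empty_Vertex B)) \<in> PiM ?EV (\<lambda>_. M) \<rightarrow>\<^sub>M M"
            using B by (intro measurable_component_singleton) auto
          from measurable_compose[OF this bm[OF B(1) y]] show ?thesis unfolding B fE .
        qed
        then show "(\<lambda>z. ennreal \<bar>\<Prod>v\<in>?EV. f y v (z v)\<bar>) \<in> borel_measurable (PiM ?EV (\<lambda>_. M))"
          by (intro measurable_compose[OF _ measurable_ennreal] borel_measurable_abs borel_measurable_prod)
      qed
      also have "\<dots> \<le> ennreal (kprod A T x y * ?l) * ennreal q"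
        by (intro mult_mono ennreal_leI abs_fprod_le[OF x y order_refl] inner_nn y) auto
      also have "\<dots> = ennreal (kprod A T x y * ?l * q)"
        using q0 CF kprod_nonneg[OF x y order_refl] by (intro ennreal_mult[symmetric]) auto
      finally show "(\<integral>\<^sup>+z. ennreal (norm (value_integrand A T x I (merge ?TV ?EV (y, z)))) \<partial>PiM ?EV (\<lambda>_. M)) \<le> ennreal (kprod A T x y * ?l * q)" .
    qed
    also have "\<dots> < \<infinity>"
    proof -
      have "(\<integral>\<^sup>+y. ennreal (kprod A T x y * ?l * q) \<partial>?V) = (\<integral>\<^sup>+y. ennreal (norm (kprod A T x y * ?l * q)) \<partial>?V)"
        using q0 CF kprod_nonneg[OF x _ order_refl] by (intro nn_integral_cong) simp
      then show ?thesis using ik[unfolded integrable_iff_bounded] by (simp only:)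
    qed
    finally show "(\<integral>\<^sup>+y. ennreal (norm (value_integrand A T x I y)) \<partial>?W) < \<infinity>" .
  qed
  have bi: "integrable M (block_factor x y B)" if "B \<in> I" "y \<in> space ?V" for y B
  proof (rule integrableI_bounded[OF bm[OF that]])
    have "(\<integral>\<^sup>+z. ennreal (norm (block_factor x y B z)) \<partial>M) = (\<integral>\<^sup>+z. ennreal (block_factor x y B z) \<partial>M)"
      using bnn[OF that] by (intro nn_integral_cong) simp
    also have "\<dots> < \<infinity>" using bint[OF that] by (rule le_less_trans) simp
    finally show "(\<integral>\<^sup>+z. ennreal (norm (block_factor x y B z)) \<partial>M) < \<infinity>" .
  qed
  show "integrable ?V (\<lambda>y. fprod A T x y * (\<Prod>B\<in>I. LINT z | M. block_factor x y B z))"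
  proof (rule Bochner_Integration.integrable_bound[OF ik])
    have "(\<lambda>p. block_factor x (fst p) B (snd p)) \<in> borel_measurable (?V \<Otimes>\<^sub>M M)" if "B \<in> I" for B
      by (intro block_factor_measurable[OF x I(2)[OF that]] measurable_snd measurable_compose[OF measurable_fst measurable_component_singleton]) auto
    then have "(\<lambda>y. LINT z | M. block_factor x y B z) \<in> borel_measurable ?V" if "B \<in> I" for B
      using that by (intro borel_measurable_lebesgue_integral) (simp add: split_beta')
    then show "(\<lambda>y. fprod A T x y * (\<Prod>B\<in>I. LINT z | M. block_factor x y B z)) \<in> borel_measurable ?V"
      by (intro borel_measurable_times borel_measurable_prod fprod_measurable x) (auto intro: measurable_component_singleton)
    show "AE y in ?V. norm (fprod A T x y * (\<Prod>B\<in>I. LINT z | M. block_factor x y B z)) \<le> norm (kprod A T x y * ?l * q)"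
    proof (rule AE_I2)
      fix y assume y: "y \<in> space ?V"
      have "(\<Prod>B\<in>I. \<bar>LINT z | M. block_factor x y B z\<bar>) \<le> q"
        unfolding q_def
      proof (intro prod_mono conjI abs_ge_zero)
        fix B assume B: "B \<in> I"
        have nn: "0 \<le> (LINT z | M. block_factor x y B z)" using bnn[OF B y] by (intro integral_nonneg_AE AE_I2)
        have "ennreal (LINT z | M. block_factor x y B z) \<le> ennreal (\<bar>b\<bar> ^ (card B - 1) * \<bar>\<kappa>\<bar>)"
          using bint[OF B y] bnn[OF B y] by (subst nn_integral_eq_integral[symmetric, OF bi[OF B y]]) (auto intro!: AE_I2)
        then show "\<bar>LINT z | M. block_factor x y B z\<bar> \<le> \<bar>b\<bar> ^ (card B - 1) * \<bar>\<kappa>\<bar>" using nn by simp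
      qed
      then have "\<bar>fprod A T x y\<bar> * (\<Prod>B\<in>I. \<bar>LINT z | M. block_factor x y B z\<bar>) \<le> (kprod A T x y * ?l) * q"
        using abs_fprod_le[OF x y order_refl] by (intro mult_mono) (auto intro: prod_nonneg order_trans[OF abs_ge_zero])
      then show "norm (fprod A T x y * (\<Prod>B\<in>I. LINT z | M. block_factor x y B z)) \<le> norm (kprod A T x y * ?l * q)"
        unfolding real_norm_def abs_mult[of "fprod A T x y"] abs_prod by (rule order_trans[OF _ abs_ge_self])
    qed
  qed
  have "graph_val A T x I = (LINT y | ?V. (LINT z | PiM ?EV (\<lambda>_. M). value_integrand A T x I (merge ?TV ?EV (y, z))))"
    using int dj fTV unfolding graph_val_def W by (intro product_integral_fold) auto
  also have "\<dots> = (LINT y | ?V. fprod A T x y * (\<Prod>B\<in>I. LINT z | M. block_factor x y B z))"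
  proof (intro Bochner_Integration.integral_cong refl)
    fix y assume y: "y \<in> space ?V"
    have "(LINT z | PiM ?EV (\<lambda>_. M). (\<Prod>v\<in>?EV. f y v (z v))) = (\<Prod>v\<in>?EV. LINT z | M. f y v z)"
      using bi y fTV by (intro product_integral_prod) (auto simp: f_def)
    then show "(LINT z | PiM ?EV (\<lambda>_. M). value_integrand A T x I (merge ?TV ?EV (y, z))) = fprod A T x y * (\<Prod>B\<in>I. LINT z | M. block_factor x y B z)"
      unfolding mg by (simp only: integral_mult_right_zero re fE)
  qed
  finally show "graph_val A T x I = (LINT y | ?V. fprod A T x y * (\<Prod>B\<in>I. LINT z | M. block_factor x y B z))" .
qed

lemma partition_leaves:
  assumes "finite A" "partition_on (leaves1s A T) I"
  shows "finite I" "\<And>B. B \<in> I \<Longrightarrow> B \<subseteq> leaves1s A T" "{} \<notin> I"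
  using finite_elements[OF finite_leaves1s[OF assms(1)] assms(2)] partition_onD1[OF assms(2)] partition_onD3[OF assms(2)] by auto

text \<open>Fubini exchanges the expectation with the integral over tree vertices; at fixed
  positions the expectation of the leaves is given by the moment formula, whose blocks become the
  empty vertices.\<close>

lemma expectation_noise_integral:
  assumes A: "finite A" and x: "x ` A \<subseteq> space M"
  shows "integrable P (\<lambda>\<omega>. LINT y | PiM (Tree_Vertex ` inners A T) (\<lambda>_. M). noise_integrand A T x \<omega> y)"
    "(LINT \<omega> | P. (LINT y | PiM (Tree_Vertex ` inners A T) (\<lambda>_. M). noise_integrand A T x \<omega> y)) =
      (\<Sum>I\<in>{I. partition_on (leaves1s A T) I}. (\<Prod>B\<in>I. c (card B)) * graph_val A T x I)"
proof -
  let ?V = "PiM (Tree_Vertex ` inners A T) (\<lambda>_. M)"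
  interpret V: finite_product_sigma_finite "\<lambda>_. M" "Tree_Vertex ` inners A T" by unfold_locales (use A in simp)
  interpret PV: pair_sigma_finite P ?V by unfold_locales
  note int = integrable_noise_integrand[OF A x, of T]
  show "integrable P (\<lambda>\<omega>. LINT y | ?V. noise_integrand A T x \<omega> y)"
    using PV.integrable_fst'[OF int] by simp
  have "(LINT \<omega> | P. (LINT y | ?V. noise_integrand A T x \<omega> y)) = (LINT y | ?V. (LINT \<omega> | P. noise_integrand A T x \<omega> y))"
    using PV.Fubini_integral[OF int] by simp
  also have "\<dots> = (LINT y | ?V. (\<Sum>I\<in>{I. partition_on (leaves1s A T) I}. (\<Prod>B\<in>I. c (card B)) * (fprod A T x y * (\<Prod>B\<in>I. LINT z | M. block_factor x y B z))))"
  proof (intro Bochner_Integration.integral_cong refl)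
    fix y assume y: "y \<in> space ?V"
    have "(LINT \<omega> | P. noise_integrand A T x \<omega> y) = fprod A T x y * (LINT \<omega> | P. (\<Prod>u\<in>leaves1s A T. Y \<omega> (parent_pos x y u)))"
      unfolding noise_integrand_def by (rule integral_mult_right_zero)
    also have "(LINT \<omega> | P. (\<Prod>u\<in>leaves1s A T. Y \<omega> (parent_pos x y u))) =
        (\<Sum>I\<in>{I. partition_on (leaves1s A T) I}. \<Prod>B\<in>I. c (card B) * (LINT z | M. block_factor x y B z))"
      unfolding block_factor_def using A by (intro Y_moment parent_pos_space[OF _ x y]) auto
    finally show "(LINT \<omega> | P. noise_integrand A T x \<omega> y) =
       (\<Sum>I\<in>{I. partition_on (leaves1s A T) I}. (\<Prod>B\<in>I. c (card B)) * (fprod A T x y * (\<Prod>B\<in>I. LINT z | M. block_factor x y B z)))"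
      by (simp only: prod.distrib sum_distrib_left mult_ac)
  qed
  also have "\<dots> = (\<Sum>I\<in>{I. partition_on (leaves1s A T) I}. LINT y | ?V. (\<Prod>B\<in>I. c (card B)) * (fprod A T x y * (\<Prod>B\<in>I. LINT z | M. block_factor x y B z)))"
  proof (rule Bochner_Integration.integral_sum)
    fix I assume "I \<in> {I. partition_on (leaves1s A T) I}"
    then have "partition_on (leaves1s A T) I" by simp
    from graph_val_fold(2)[OF A x partition_leaves[OF A this]]
    show "integrable ?V (\<lambda>y. (\<Prod>B\<in>I. c (card B)) * (fprod A T x y * (\<Prod>B\<in>I. LINT z | M. block_factor x y B z)))"
      by (rule integrable_mult_right)
  qed
  also have "\<dots> = (\<Sum>I\<in>{I. partition_on (leaves1s A T) I}. (\<Prod>B\<in>I. c (card B)) * graph_val A T x I)"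
  proof (intro sum.cong refl)
    fix I assume "I \<in> {I. partition_on (leaves1s A T) I}"
    then have "partition_on (leaves1s A T) I" by simp
    from graph_val_fold(3)[OF A x partition_leaves[OF A this]]
    show "(LINT y | ?V. (\<Prod>B\<in>I. c (card B)) * (fprod A T x y * (\<Prod>B\<in>I. LINT z | M. block_factor x y B z))) = (\<Prod>B\<in>I. c (card B)) * graph_val A T x I"
      by (simp only: integral_mult_right_zero)
  qed
  finally show "(LINT \<omega> | P. (LINT y | ?V. noise_integrand A T x \<omega> y)) =
      (\<Sum>I\<in>{I. partition_on (leaves1s A T) I}. (\<Prod>B\<in>I. c (card B)) * graph_val A T x I)" .
qed

end

section \<open>The solution as a sum over trees\<close>

text \<open>Expanding a power of a sum produces ordered lists; this matches the convention that
  different lists of subtrees with the same number i \<ge> 1 of inner vertices give different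
  trees.\<close>

lemma sum_lists_prod_list:
  fixes g :: "'t \<Rightarrow> real"
  assumes "finite C"
  shows "finite {us. length us = l \<and> set us \<subseteq> C} \<and>
    (\<Sum>us\<in>{us. length us = l \<and> set us \<subseteq> C}. prod_list (map g us)) = (\<Sum>t\<in>C. g t) ^ l"
proof (induction l)
  case 0
  have "{us. length us = 0 \<and> set us \<subseteq> C} = {[]}" by auto
  then show ?case by simp
next
  case (Suc l)
  let ?L = "\<lambda>l. {us. length us = l \<and> set us \<subseteq> C}"
  have e: "?L (Suc l) = (\<lambda>(t, us). t # us) ` (C \<times> ?L l)"
    by (auto simp: length_Suc_conv image_iff)
  have inj: "inj_on (\<lambda>(t, us). t # us) (C \<times> ?L l)" by (auto simp: inj_on_def)
  have "(\<Sum>us\<in>?L (Suc l). prod_list (map g us)) = (\<Sum>(t, us)\<in>C \<times> ?L l. g t * prod_list (map g us))"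
    unfolding e by (subst sum.reindex[OF inj]) (auto simp: case_prod_beta)
  also have "\<dots> = (\<Sum>t\<in>C. g t) ^ Suc l"
    using Suc by (simp add: sum.cartesian_product[symmetric] sum_product[symmetric])
  finally show ?case using Suc assms unfolding e by auto
qed

text \<open>The number of inner vertices of a tree with sort key k. Keys 0 and 1 both belong to
  leaves, and truncated subtraction sends both to 0.\<close>

definition key_count :: "nat \<Rightarrow> nat" where "key_count k = k - 1"

definition key_class :: "nat \<Rightarrow> nat \<Rightarrow> ptree set" where
  "key_class p k = {t. admissible p t \<and> sort_key t = k}"

lemma inner_count_sort_key: "inner_count t = key_count (sort_key t)"
  by (cases t) (auto simp: key_count_def)

text \<open>Lists of children with keys below k, with length q and total order s left free for an
  induction on k. For k = j + 1, q = p and s = j - 1 they are the child lists of the trees of order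
  j.\<close>

definition forests :: "nat \<Rightarrow> nat \<Rightarrow> nat \<Rightarrow> nat \<Rightarrow> ptree list set" where
  "forests p k q s = {ts. length ts = q \<and> sorted (map sort_key ts) \<and> (\<forall>t\<in>set ts. admissible p t \<and> sort_key t < k) \<and>
     sum_list (map inner_count ts) = s}"

text \<open>The combinatorial part is the vertex factor without p!, restricted to keys below
  k.\<close>

definition forest_weight :: "(ptree \<Rightarrow> real) \<Rightarrow> nat \<Rightarrow> ptree list \<Rightarrow> real" where
  "forest_weight g k ts = (\<Prod>i<k. 1 / fact (length (filter (\<lambda>t. sort_key t = i) ts))) * prod_list (map g ts)"

lemma key_class_0: "key_class p 0 = {Leaf1}" and key_class_1: "key_class p (Suc 0) = {Leaf2}"
proof -
  have "sort_key t = 0 \<longleftrightarrow> t = Leaf1" "sort_key t = Suc 0 \<longleftrightarrow> t = Leaf2" for t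
    by (cases t; simp)+
  then show "key_class p 0 = {Leaf1}" "key_class p (Suc 0) = {Leaf2}" by (auto simp: key_class_def)
qed

lemma key_class_Suc: "j \<ge> 1 \<Longrightarrow> key_class p (Suc j) = trees p j"
proof -
  assume j: "j \<ge> 1"
  have "sort_key t = Suc j \<longleftrightarrow> inner_count t = j" for t using j by (cases t) auto
  then show ?thesis by (auto simp: key_class_def trees_def)
qed

lemma trees_0: "trees p 0 = {Leaf1, Leaf2}"
proof (rule set_eqI)
  show "t \<in> trees p 0 \<longleftrightarrow> t \<in> {Leaf1, Leaf2}" for t by (cases t) (auto simp: trees_def)
qed

lemma Inner_in_trees_iff:
  "Inner ts \<in> trees p j \<longleftrightarrow> j \<ge> 1 \<and> length ts = p \<and> sorted (map sort_key ts) \<and> (\<forall>t\<in>set ts. admissible p t) \<and>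
     sum_list (map inner_count ts) = j - 1"
  by (auto simp: trees_def)

lemma trees_Inner:
  assumes "j \<ge> 1" shows "trees p j = Inner ` {ts. Inner ts \<in> trees p j}"
proof -
  have "\<exists>ts. T = Inner ts" if "T \<in> trees p j" for T
    using that assms by (cases T) (auto simp: trees_def)
  then show ?thesis by auto
qed

lemma child_count_le: "t \<in> set ts \<Longrightarrow> inner_count t \<le> sum_list (map inner_count ts)"
  by (induction ts) auto

lemma finite_trees: "finite (trees p j)"
proof (induction j rule: less_induct)
  case (less j)
  show ?case
  proof (cases "j = 0")
    case False
    have "{ts. Inner ts \<in> trees p j} \<subseteq> {ts. set ts \<subseteq> (\<Union>i\<in>{..<j}. trees p i) \<and> length ts = p}"
    proof safe
      fix ts t assume "Inner ts \<in> trees p j" "t \<in> set ts"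
      then have "admissible p t" "inner_count t \<le> j - 1"
        using child_count_le[of t ts] by (auto simp: Inner_in_trees_iff)
      then show "t \<in> (\<Union>i\<in>{..<j}. trees p i)" using False by (auto simp: trees_def)
    qed (auto simp: Inner_in_trees_iff)
    moreover have "finite {ts. set ts \<subseteq> (\<Union>i\<in>{..<j}. trees p i) \<and> length ts = p}"
      using less by (intro finite_lists_length_eq) auto
    ultimately have "finite {ts. Inner ts \<in> trees p j}" by (rule finite_subset)
    then show ?thesis using False by (subst trees_Inner) auto
  qed (simp add: trees_0)
qed

lemma finite_key_class: "finite (key_class p k)"
proof (cases k)
  case (Suc j)
  then show ?thesis by (cases "j = 0") (auto simp: key_class_1 key_class_Suc finite_trees)
qed (simp add: key_class_0)

lemma forests_0: "forests p 0 q s = (if q = 0 \<and> s = 0 then {[]} else {})"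
  by (auto simp: forests_def)

text \<open>A sorted list with keys at most k is uniquely a list with smaller keys followed by its
  elements of key k, and these form an arbitrary list from \<open>key_class p k\<close>.\<close>

lemma forests_Suc:
  "bij_betw (\<lambda>(l, vs, us). vs @ us)
    (SIGMA l:{l. l \<le> q \<and> l * key_count k \<le> s}. forests p k (q - l) (s - l * key_count k) \<times> {us. length us = l \<and> set us \<subseteq> key_class p k})
    (forests p (Suc k) q s)"
proof (rule bij_betw_byWitness[where f' = "\<lambda>ts. (length (filter (\<lambda>t. sort_key t = k) ts), filter (\<lambda>t. sort_key t < k) ts, filter (\<lambda>t. sort_key t = k) ts)"])
  have ic: "sum_list (map inner_count us) = length us * key_count k" if "set us \<subseteq> key_class p k" for us
    using that by (induction us) (auto simp: key_class_def inner_count_sort_key)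
  let ?D = "SIGMA l:{l. l \<le> q \<and> l * key_count k \<le> s}. forests p k (q - l) (s - l * key_count k) \<times> {us. length us = l \<and> set us \<subseteq> key_class p k}"
  let ?w = "\<lambda>ts. (length (filter (\<lambda>t. sort_key t = k) ts), filter (\<lambda>t. sort_key t < k) ts, filter (\<lambda>t. sort_key t = k) ts)"
  show "\<forall>a\<in>?D. ?w (case a of (l, vs, us) \<Rightarrow> vs @ us) = a"
  proof (rule ballI)
    fix a assume "a \<in> ?D"
    then obtain vs us where vs: "vs \<in> forests p k (q - length us) (s - length us * key_count k)" and us: "set us \<subseteq> key_class p k"
      and a: "a = (length us, vs, us)" by auto
    have "filter (\<lambda>t. sort_key t < k) vs = vs" "filter (\<lambda>t. sort_key t = k) vs = []"
      "filter (\<lambda>t. sort_key t < k) us = []" "filter (\<lambda>t. sort_key t = k) us = us"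
      using vs us by (auto simp: forests_def key_class_def filter_id_conv filter_empty_conv)
    then show "?w (case a of (l, vs, us) \<Rightarrow> vs @ us) = a" by (simp add: a)
  qed
  have split: "filter (\<lambda>t. sort_key t < k) ts @ filter (\<lambda>t. sort_key t = k) ts = ts"
    if "sorted (map sort_key ts)" "\<forall>t\<in>set ts. sort_key t < Suc k" for ts
    using that
  proof (induction ts)
    case (Cons t ts)
    show ?case
    proof (cases "sort_key t < k")
      \<comment> \<open>Sortedness forces all later keys to be k as well, so the list consists of
        its second part alone.\<close>
      case False
      then have "sort_key t = k" using Cons.prems by auto
      moreover have "\<forall>t'\<in>set ts. sort_key t' = k" using Cons.prems calculation by fastforce
      then have "filter (\<lambda>t. sort_key t < k) ts = []" "filter (\<lambda>t. sort_key t = k) ts = ts"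
        by (auto simp: filter_id_conv filter_empty_conv)
      ultimately show ?thesis by simp
    qed (use Cons in simp)
  qed simp
  show "\<forall>a'\<in>forests p (Suc k) q s. (case ?w a' of (l, vs, us) \<Rightarrow> vs @ us) = a'"
    using split by (auto simp: forests_def)
  show "(\<lambda>(l, vs, us). vs @ us) ` ?D \<subseteq> forests p (Suc k) q s"
  proof (rule image_subsetI)
    fix a assume "a \<in> ?D"
    then obtain vs us where l: "length us \<le> q" "length us * key_count k \<le> s" and
      vs: "vs \<in> forests p k (q - length us) (s - length us * key_count k)" and us: "set us \<subseteq> key_class p k"
      and a: "a = (length us, vs, us)" by auto
    have "sorted (map sort_key us)" using us by (induction us) (auto simp: key_class_def)
    then show "(case a of (l, vs, us) \<Rightarrow> vs @ us) \<in> forests p (Suc k) q s"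
      using l vs us ic[OF us] by (fastforce simp: a forests_def sorted_append key_class_def)
  qed
  show "?w ` forests p (Suc k) q s \<subseteq> ?D"
  proof (rule image_subsetI)
    fix ts assume ts: "ts \<in> forests p (Suc k) q s"
    define v u where vu: "v = filter (\<lambda>t. sort_key t < k) ts" "u = filter (\<lambda>t. sort_key t = k) ts"
    have e: "v @ u = ts" unfolding vu using ts by (intro split) (auto simp: forests_def)
    have u: "set u \<subseteq> key_class p k" using ts by (auto simp: vu forests_def key_class_def)
    have "length v + length u = q" using ts arg_cong[OF e, of length] by (simp add: forests_def)
    moreover have "sum_list (map inner_count v) + length u * key_count k = s"
      using ts arg_cong[OF e, of "\<lambda>ts. sum_list (map inner_count ts)"] ic[OF u] by (simp add: forests_def)
    moreover have "sorted (map sort_key v)" using ts by (auto simp: vu forests_def sorted_filter)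
    moreover have "\<forall>t\<in>set v. admissible p t \<and> sort_key t < k" using ts by (auto simp: vu forests_def)
    ultimately have "(length u, v, u) \<in> ?D" using u by (auto simp: forests_def)
    then show "?w ts \<in> ?D" by (simp add: vu)
  qed
qed

lemma finite_forests: "finite (forests p k q s)"
proof (induction k arbitrary: q s)
  case (Suc k)
  have "finite {l. l \<le> q \<and> l * key_count k \<le> s}" by (rule finite_subset[of _ "{..q}"]) auto
  then have "finite (SIGMA l:{l. l \<le> q \<and> l * key_count k \<le> s}. forests p k (q - l) (s - l * key_count k) \<times> {us. length us = l \<and> set us \<subseteq> key_class p k})"
    using Suc sum_lists_prod_list[OF finite_key_class] by (intro finite_SigmaI finite_cartesian_product) auto
  then show ?case using bij_betw_finite[OF forests_Suc] by blast
qed (simp add: forests_0)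

lemma forest_sum_Suc:
  "(\<Sum>ts\<in>forests p (Suc k) q s. forest_weight g (Suc k) ts) =
    (\<Sum>l\<in>{l. l \<le> q \<and> l * key_count k \<le> s}. (\<Sum>vs\<in>forests p k (q - l) (s - l * key_count k). forest_weight g k vs) *
       ((\<Sum>t\<in>key_class p k. g t) ^ l / fact l))"
proof -
  let ?R = "\<lambda>l. forests p k (q - l) (s - l * key_count k)" and ?U = "\<lambda>l. {us. length us = l \<and> set us \<subseteq> key_class p k}"
  let ?I = "{l. l \<le> q \<and> l * key_count k \<le> s}"
  have fI: "finite ?I" by (rule finite_subset[of _ "{..q}"]) auto
  have "(\<Sum>ts\<in>forests p (Suc k) q s. forest_weight g (Suc k) ts) =
      (\<Sum>(l, vs, us)\<in>(SIGMA l:?I. ?R l \<times> ?U l). forest_weight g (Suc k) (vs @ us))"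
    by (subst sum.reindex_bij_betw[OF forests_Suc, symmetric]) (simp add: case_prod_beta)
  also have "\<dots> = (\<Sum>(l, vs, us)\<in>(SIGMA l:?I. ?R l \<times> ?U l). forest_weight g k vs * (prod_list (map g us) / fact l))"
  proof (rule sum.cong[OF refl], clarify)
    fix vs us assume vs: "vs \<in> ?R (length us)" and us: "set us \<subseteq> key_class p k"
    have "filter (\<lambda>t. sort_key t = i) us = []" if "i < k" for i
      using us that by (auto simp: key_class_def filter_empty_conv)
    moreover have "filter (\<lambda>t. sort_key t = k) vs = []" "filter (\<lambda>t. sort_key t = k) us = us"
      using vs us by (auto simp: forests_def key_class_def filter_id_conv filter_empty_conv)
    ultimately show "forest_weight g (Suc k) (vs @ us) = forest_weight g k vs * (prod_list (map g us) / fact (length us))"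
      by (simp add: forest_weight_def)
  qed
  also have "\<dots> = (\<Sum>l\<in>?I. \<Sum>(vs, us)\<in>?R l \<times> ?U l. forest_weight g k vs * (prod_list (map g us) / fact l))"
    using fI finite_forests sum_lists_prod_list[OF finite_key_class]
    by (subst sum.Sigma) (auto simp: case_prod_beta)
  also have "\<dots> = (\<Sum>l\<in>?I. (\<Sum>vs\<in>?R l. forest_weight g k vs) * ((\<Sum>us\<in>?U l. prod_list (map g us)) / fact l))"
    by (simp add: sum.cartesian_product[symmetric] sum_product sum_divide_distrib)
  also have "\<dots> = (\<Sum>l\<in>?I. (\<Sum>vs\<in>?R l. forest_weight g k vs) * ((\<Sum>t\<in>key_class p k. g t) ^ l / fact l))"
    using sum_lists_prod_list[OF finite_key_class[of p k], of _ g] by simp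
  finally show ?thesis .
qed

text \<open>The sets \<open>multiplicities\<close> with total number and total order as free
  parameters, so that the same recursion holds as for forests.\<close>

definition mult_set :: "nat \<Rightarrow> nat \<Rightarrow> nat \<Rightarrow> (nat \<Rightarrow> nat) set" where
  "mult_set j q s = {\<nu>. (\<forall>i\<ge>j. \<nu> i = 0) \<and> (\<Sum>i<j. \<nu> i) = q \<and> (\<Sum>i<j. i * \<nu> i) = s}"

lemma mult_set_Suc:
  "bij_betw (\<lambda>(l, \<nu>). \<nu>(j := l)) (SIGMA l:{l. l \<le> q \<and> l * j \<le> s}. mult_set j (q - l) (s - l * j)) (mult_set (Suc j) q s)"
proof (rule bij_betw_byWitness[where f' = "\<lambda>\<nu>. (\<nu> j, \<nu>(j := 0))"])
  have e: "(\<Sum>i<j. (\<nu>(j := l)) i) = (\<Sum>i<j. \<nu> i)" "(\<Sum>i<j. i * (\<nu>(j := l)) i) = (\<Sum>i<j. i * \<nu> i)" for \<nu> :: "nat \<Rightarrow> nat" and l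
    by (intro sum.cong; simp)+
  show "\<forall>a\<in>(SIGMA l:{l. l \<le> q \<and> l * j \<le> s}. mult_set j (q - l) (s - l * j)). (\<lambda>\<nu>. (\<nu> j, \<nu>(j := 0))) (case a of (l, \<nu>) \<Rightarrow> \<nu>(j := l)) = a"
    by (auto simp: mult_set_def fun_eq_iff)
  show "\<forall>a'\<in>mult_set (Suc j) q s. (case (a' j, a'(j := 0)) of (l, \<nu>) \<Rightarrow> \<nu>(j := l)) = a'" by (auto simp: fun_eq_iff)
  show "(\<lambda>(l, \<nu>). \<nu>(j := l)) ` (SIGMA l:{l. l \<le> q \<and> l * j \<le> s}. mult_set j (q - l) (s - l * j)) \<subseteq> mult_set (Suc j) q s"
    using e by (auto simp: mult_set_def)
  show "(\<lambda>\<nu>. (\<nu> j, \<nu>(j := 0))) ` mult_set (Suc j) q s \<subseteq> (SIGMA l:{l. l \<le> q \<and> l * j \<le> s}. mult_set j (q - l) (s - l * j))"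
  proof (rule image_subsetI)
    fix \<nu> assume "\<nu> \<in> mult_set (Suc j) q s"
    then have z: "\<forall>i\<ge>Suc j. \<nu> i = 0" and a: "(\<Sum>i<j. \<nu> i) + \<nu> j = q" "(\<Sum>i<j. i * \<nu> i) + j * \<nu> j = s" by (auto simp: mult_set_def)
    have "\<forall>i\<ge>j. (\<nu>(j := 0)) i = 0" using z by (auto simp: le_Suc_eq Suc_le_eq)
    then show "(\<nu> j, \<nu>(j := 0)) \<in> (SIGMA l:{l. l \<le> q \<and> l * j \<le> s}. mult_set j (q - l) (s - l * j))"
      using a e[of \<nu> 0] by (auto simp: mult_set_def mult.commute[of j])
  qed
qed

lemma mult_set_0: "mult_set 0 q s = (if q = 0 \<and> s = 0 then {\<lambda>_. 0} else {})"
  by (auto simp: mult_set_def)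

lemma finite_mult_set: "finite (mult_set j q s)"
proof (induction j arbitrary: q s)
  case (Suc j)
  have "finite {l. l \<le> q \<and> l * j \<le> s}" by (rule finite_subset[of _ "{..q}"]) auto
  then have "finite (SIGMA l:{l. l \<le> q \<and> l * j \<le> s}. mult_set j (q - l) (s - l * j))" using Suc by (intro finite_SigmaI) auto
  then show ?case using bij_betw_finite[OF mult_set_Suc] by blast
qed (simp add: mult_set_0)

lemma mult_sum_Suc:
  fixes X :: "nat \<Rightarrow> real"
  shows "(\<Sum>\<nu>\<in>mult_set (Suc j) q s. \<Prod>i<Suc j. X i ^ \<nu> i / fact (\<nu> i)) =
    (\<Sum>l\<in>{l. l \<le> q \<and> l * j \<le> s}. (\<Sum>\<nu>\<in>mult_set j (q - l) (s - l * j). \<Prod>i<j. X i ^ \<nu> i / fact (\<nu> i)) * (X j ^ l / fact l))"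
proof -
  let ?I = "{l. l \<le> q \<and> l * j \<le> s}"
  have fI: "finite ?I" by (rule finite_subset[of _ "{..q}"]) auto
  have "(\<Sum>\<nu>\<in>mult_set (Suc j) q s. \<Prod>i<Suc j. X i ^ \<nu> i / fact (\<nu> i)) =
      (\<Sum>(l, \<nu>)\<in>(SIGMA l:?I. mult_set j (q - l) (s - l * j)). \<Prod>i<Suc j. X i ^ (\<nu>(j := l)) i / fact ((\<nu>(j := l)) i))"
    by (subst sum.reindex_bij_betw[OF mult_set_Suc, symmetric]) (simp add: case_prod_beta)
  also have "\<dots> = (\<Sum>(l, \<nu>)\<in>(SIGMA l:?I. mult_set j (q - l) (s - l * j)). (\<Prod>i<j. X i ^ \<nu> i / fact (\<nu> i)) * (X j ^ l / fact l))"
    by (intro sum.cong refl) (auto intro!: prod.cong)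
  also have "\<dots> = (\<Sum>l\<in>?I. \<Sum>\<nu>\<in>mult_set j (q - l) (s - l * j). (\<Prod>i<j. X i ^ \<nu> i / fact (\<nu> i)) * (X j ^ l / fact l))"
    using fI finite_mult_set by (subst sum.Sigma) auto
  finally show ?thesis by (simp only: sum_distrib_right)
qed

text \<open>Both sides satisfy the same recursion in j. The shift from j to \<open>Suc j\<close>
  arises because keys 0 and 1, the two kinds of leaves, share order 0; merging them in the base case
  is the binomial theorem.\<close>

lemma forest_sum_eq_mult_sum:
  fixes g :: "ptree \<Rightarrow> real"
  assumes "j \<ge> 1"
  shows "(\<Sum>ts\<in>forests p (Suc j) q s. forest_weight g (Suc j) ts) =
    (\<Sum>\<nu>\<in>mult_set j q s. \<Prod>i<j. (\<Sum>T\<in>trees p i. g T) ^ \<nu> i / fact (\<nu> i))"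
  using assms
proof (induction j arbitrary: q s rule: dec_induct)
  case base
  have kc: "key_count 0 = 0" "key_count (Suc 0) = 0" by (auto simp: key_count_def)
  have I: "{l::nat. l \<le> q} = {..q}" for q by auto
  have W1: "(\<Sum>ts\<in>forests p (Suc 0) q s. forest_weight g (Suc 0) ts) = (if s = 0 then g Leaf1 ^ q / fact q else 0)" for q s
  proof -
    have "(\<Sum>vs\<in>forests p 0 (q - l) s. forest_weight g 0 vs) = (if l = q \<and> s = 0 then 1 else 0)" if "l \<le> q" for l
      using that by (auto simp: forests_0 forest_weight_def)
    then have "(\<Sum>ts\<in>forests p (Suc 0) q s. forest_weight g (Suc 0) ts) = (\<Sum>l\<in>{..q}. if l = q \<and> s = 0 then g Leaf1 ^ l / fact l else 0)"
      unfolding forest_sum_Suc kc by (simp add: I key_class_0) (intro sum.cong; simp)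
    then show ?thesis by (auto simp: sum.delta)
  qed
  have N0: "(\<Sum>\<nu>\<in>mult_set (Suc 0) q s. \<Prod>i<Suc 0. X i ^ \<nu> i / fact (\<nu> i)) = (if s = 0 then X 0 ^ q / fact q else 0)" for X :: "nat \<Rightarrow> real"
  proof -
    have "(\<Sum>\<nu>\<in>mult_set 0 (q - l) s. \<Prod>i<0. X i ^ \<nu> i / fact (\<nu> i)) = (if l = q \<and> s = 0 then 1 else 0)" if "l \<le> q" for l
      using that by (auto simp: mult_set_0)
    then have "(\<Sum>\<nu>\<in>mult_set (Suc 0) q s. \<Prod>i<Suc 0. X i ^ \<nu> i / fact (\<nu> i)) = (\<Sum>l\<in>{..q}. if l = q \<and> s = 0 then X 0 ^ l / fact l else 0)"
      unfolding mult_sum_Suc by (simp add: I) (intro sum.cong; simp)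
    then show ?thesis by (auto simp: sum.delta)
  qed
  have "(\<Sum>ts\<in>forests p (Suc (Suc 0)) q s. forest_weight g (Suc (Suc 0)) ts) =
     (\<Sum>l\<le>q. (if s = 0 then g Leaf1 ^ (q - l) / fact (q - l) else 0) * (g Leaf2 ^ l / fact l))"
    unfolding forest_sum_Suc[where k = "Suc 0"] kc by (simp add: W1 I key_class_1)
  also have "\<dots> = (if s = 0 then (g Leaf1 + g Leaf2) ^ q / fact q else 0)"
  proof -
    have "(g Leaf2 + g Leaf1) ^ q = (\<Sum>l\<le>q. real (q choose l) * g Leaf2 ^ l * g Leaf1 ^ (q - l))" by (rule binomial_ring)
    also have "\<dots> = (\<Sum>l\<le>q. fact q * (g Leaf1 ^ (q - l) / fact (q - l) * (g Leaf2 ^ l / fact l)))"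
      by (intro sum.cong refl) (simp add: binomial_fact field_simps)
    also have "\<dots> = fact q * (\<Sum>l\<le>q. g Leaf1 ^ (q - l) / fact (q - l) * (g Leaf2 ^ l / fact l))"
      by (simp only: sum_distrib_left)
    finally have "(g Leaf2 + g Leaf1) ^ q / fact q = (\<Sum>l\<le>q. g Leaf1 ^ (q - l) / fact (q - l) * (g Leaf2 ^ l / fact l))"
      by simp
    then show ?thesis by (simp add: add.commute)
  qed
  finally show ?case using N0[of "\<lambda>i. \<Sum>T\<in>trees p i. g T"] by (simp add: trees_0)
next
  case (step j)
  have kc: "key_count (Suc j) = j" by (simp add: key_count_def)
  show ?case
    unfolding forest_sum_Suc[where k = "Suc j"] mult_sum_Suc kc using step by (simp add: key_class_Suc)
qed

text \<open>The multinomial expansion of X^p at a vertex, written as a sum over child lists instead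
  of multiplicities: the factor p! turns the weights of forests into vertex factors.\<close>

lemma multinomial_trees:
  fixes g :: "ptree \<Rightarrow> real"
  assumes j: "j \<ge> 1"
  shows "(\<Sum>\<nu>\<in>multiplicities p j. fact p / (\<Prod>i<j. fact (\<nu> i)) * (\<Prod>i<j. (\<Sum>T\<in>trees p i. g T) ^ \<nu> i)) =
    (\<Sum>ts\<in>{ts. Inner ts \<in> trees p j}. vertex_factor p ts * prod_list (map g ts))"
proof -
  have "multiplicities p j = mult_set j p (j - 1)" by (simp add: multiplicities_def mult_set_def)
  then have "(\<Sum>\<nu>\<in>multiplicities p j. fact p / (\<Prod>i<j. fact (\<nu> i)) * (\<Prod>i<j. (\<Sum>T\<in>trees p i. g T) ^ \<nu> i)) =
     fact p * (\<Sum>\<nu>\<in>mult_set j p (j - 1). \<Prod>i<j. (\<Sum>T\<in>trees p i. g T) ^ \<nu> i / fact (\<nu> i))"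
    by (simp add: sum_distrib_left prod_dividef)
  also have "\<dots> = fact p * (\<Sum>ts\<in>forests p (Suc j) p (j - 1). forest_weight g (Suc j) ts)"
    by (simp only: forest_sum_eq_mult_sum[OF j])
  also have "forests p (Suc j) p (j - 1) = {ts. Inner ts \<in> trees p j}"
  proof -
    have "sort_key t < Suc j" if "t \<in> set ts" "sum_list (map inner_count ts) = j - 1" for t ts
    proof -
      have "inner_count t < j" using child_count_le[OF that(1)] that(2) j by simp
      then show ?thesis by (cases t) auto
    qed
    then show ?thesis using j by (auto simp: forests_def Inner_in_trees_iff)
  qed
  also have "fact p * (\<Sum>ts\<in>{ts. Inner ts \<in> trees p j}. forest_weight g (Suc j) ts) =
     (\<Sum>ts\<in>{ts. Inner ts \<in> trees p j}. vertex_factor p ts * prod_list (map g ts))"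
    unfolding sum_distrib_left
  proof (intro sum.cong refl)
    fix ts assume "ts \<in> {ts. Inner ts \<in> trees p j}"
    then have ic: "inner_count (Inner ts) = j" and s: "sum_list (map inner_count ts) = j - 1" by (auto simp: trees_def)
    let ?n = "\<lambda>i. length (filter (\<lambda>t. sort_key t = i) ts)" and ?m = "\<lambda>i. length (filter (\<lambda>t. inner_count t = i) ts)"
    have k0: "(sort_key t = 0) = (t = Leaf1)" and k1: "(sort_key t = Suc 0) = (t = Leaf2)" for t
      by (cases t; simp)+
    have c: "count_list ts Leaf1 = ?n 0" "count_list ts Leaf2 = ?n (Suc 0)"
      by (induction ts) (simp_all add: k0 k1)
    have m: "?n (Suc i) = ?m i" if "i \<ge> 1" for i
    proof -
      have "(sort_key t = Suc i) = (inner_count t = i)" for t using that by (cases t) auto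
      then show ?thesis by simp
    qed
    \<comment> \<open>The children have j - 1 inner vertices altogether, so none has j, and the last
      factorial in the vertex factor is 0! = 1.\<close>
    have mj: "?m j = 0"
    proof -
      have "inner_count t \<noteq> j" if "t \<in> set ts" for t using child_count_le[OF that] s j by linarith
      then show ?thesis by (simp add: filter_empty_conv)
    qed
    obtain j' where j': "j = Suc j'" using j by (cases j) auto
    have "(\<Prod>i<Suc j. fact (?n i) :: real) = fact (?n 0) * fact (?n (Suc 0)) * (\<Prod>i<j'. fact (?n (Suc (Suc i))))"
      unfolding j' by (simp add: prod.lessThan_Suc_shift mult_ac del: prod.lessThan_Suc)
    also have "(\<Prod>i<j'. fact (?n (Suc (Suc i))) :: real) = (\<Prod>i=1..j'. fact (?m i))"
      by (rule prod.reindex_bij_witness[where i = "\<lambda>i. i - 1" and j = Suc]) (use m in auto)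
    also have "\<dots> = (\<Prod>i=1..j. fact (?m i))" using mj by (simp add: j')
    finally have P: "(\<Prod>i<Suc j. fact (?n i) :: real) = fact (?n 0) * fact (?n (Suc 0)) * (\<Prod>i=1..j. fact (?m i))" .
    have "forest_weight g (Suc j) ts = 1 / (\<Prod>i<Suc j. fact (?n i)) * prod_list (map g ts)"
      by (simp only: forest_weight_def prod_dividef prod.neutral_const)
    then show "fact p * forest_weight g (Suc j) ts = vertex_factor p ts * prod_list (map g ts)"
      unfolding P vertex_factor_def c ic by simp
  qed
  finally show ?thesis .
qed

section \<open>Truncated moments and connected components\<close>

text \<open>Two roots are linked if some block contains leaves of both trees. Only first components
  of addresses enter, since each tree is connected by itself.\<close>

definition linked :: "('i \<times> 'v) set set \<Rightarrow> ('i \<times> 'i) set" where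
  "linked I = {(i, j). \<exists>C\<in>I. i \<in> fst ` C \<and> j \<in> fst ` C}"

definition conn :: "'i set \<Rightarrow> ('i \<times> 'v) set set \<Rightarrow> bool" where
  "conn A I \<longleftrightarrow> (\<forall>i\<in>A. \<forall>j\<in>A. (i, j) \<in> (linked I)\<^sup>*)"

definition parts :: "('i \<times> 'v) set \<Rightarrow> 'i set \<Rightarrow> ('i \<times> 'v) set set set" where
  "parts L B = {I. partition_on {u \<in> L. fst u \<in> B} I}"

lemma finite_parts: "finite L \<Longrightarrow> finite (parts L B)"
  unfolding parts_def by (intro finitely_many_partition_on) simp

lemma linked_sym: "sym ((linked I)\<^sup>*)"
  by (intro sym_rtrancl) (auto simp: sym_def linked_def)

text \<open>A block links all the roots that it touches, hence lies over a single class of the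
  equivalence generated by \<open>linked I\<close>. Collecting the blocks over each class gives a
  connected partition of the leaves there.\<close>

lemma component_decomposition:
  assumes L: "fst ` L \<subseteq> A" and I: "I \<in> parts L A"
  defines "E \<equiv> {(i, j). i \<in> A \<and> j \<in> A \<and> (i, j) \<in> (linked I)\<^sup>*}"
  defines "J \<equiv> \<lambda>B. {C \<in> I. fst ` C \<subseteq> B}"
  shows "partition_on A (A // E)" "\<And>B. B \<in> A // E \<Longrightarrow> J B \<in> parts L B \<and> conn B (J B)" "(\<Union>B\<in>A // E. J B) = I"
proof -
  have pI: "partition_on L I" using I L by (auto simp: parts_def intro: back_subst[of "\<lambda>L. partition_on L I"])
  have C: "C \<noteq> {}" "C \<subseteq> L" "fst ` C \<subseteq> A" if "C \<in> I" for C
    using that pI L partition_onD1[OF pI] partition_onD3[OF pI] by auto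
  have link: "(fst u, fst v) \<in> (linked I)\<^sup>*" if "C \<in> I" "u \<in> C" "v \<in> C" for C u v
    using that by (intro r_into_rtrancl) (auto simp: linked_def)
  have eq: "equiv A E"
  proof (rule equivI)
    show "refl_on A E" by (auto simp: refl_on_def E_def)
    show "sym E"
    proof (rule symI)
      fix i j assume "(i, j) \<in> E"
      then show "(j, i) \<in> E" using symD[OF linked_sym, of i j I] by (simp add: E_def)
    qed
    show "trans E" by (auto simp: trans_def E_def intro: rtrancl_trans)
    show "E \<subseteq> A \<times> A" by (auto simp: E_def)
  qed
  then show "partition_on A (A // E)" by (rule partition_on_quotient)
  have cls: "fst ` C \<subseteq> B" if "B \<in> A // E" "C \<in> I" "u \<in> C" "fst u \<in> B" for B C u
  proof
    fix j assume "j \<in> fst ` C"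
    then obtain v where v: "v \<in> C" "j = fst v" by auto
    have "(fst u, j) \<in> E" using link[OF that(2,3) v(1)] C(3)[OF that(2)] that(3) v by (auto simp: E_def)
    then show "j \<in> B" using that(1,4) eq by (meson in_quotient_imp_closed)
  qed
  have rel: "(i, j) \<in> (linked I)\<^sup>*" if "B \<in> A // E" "i \<in> B" "j \<in> B" for B i j
    using quotient_eq_iff[OF eq that(1,1,2,3)] by (simp add: E_def)
  show "J B \<in> parts L B \<and> conn B (J B)" if B: "B \<in> A // E" for B
  proof
    have BA: "B \<subseteq> A" using B eq in_quotient_imp_subset by blast
    have "\<Union>(J B) = {u \<in> L. fst u \<in> B}"
    proof (intro set_eqI iffI)
      fix u assume "u \<in> \<Union>(J B)"
      then show "u \<in> {u \<in> L. fst u \<in> B}" using C by (auto simp: J_def)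
    next
      fix u assume u: "u \<in> {u \<in> L. fst u \<in> B}"
      then obtain D where D: "D \<in> I" "u \<in> D" using partition_onD1[OF pI] by auto
      then have "D \<in> J B" using cls[OF B D] u by (simp add: J_def)
      then show "u \<in> \<Union>(J B)" using D by blast
    qed
    moreover have "disjoint (J B)" using partition_onD2[OF pI] by (rule pairwise_subset) (auto simp: J_def)
    moreover have "{} \<notin> J B" using C(1) by (auto simp: J_def)
    ultimately show "J B \<in> parts L B" by (simp add: parts_def partition_on_def)
    show "conn B (J B)" unfolding conn_def
    proof (intro ballI)
      fix i j assume i: "i \<in> B" and j: "j \<in> B"
      \<comment> \<open>The chain of links is shown to stay inside the class, so that only blocks
        over B are used.\<close>
      have "k \<in> B \<and> (i, k) \<in> (linked (J B))\<^sup>*" if "(i, k) \<in> (linked I)\<^sup>*" for k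
        using that
      proof (induction rule: rtrancl_induct)
        case (step k l)
        then obtain D where D: "D \<in> I" "k \<in> fst ` D" "l \<in> fst ` D" by (auto simp: linked_def)
        then have "fst ` D \<subseteq> B" using cls[OF B D(1)] step.IH by auto
        then have "D \<in> J B" "l \<in> B" using D by (auto simp: J_def)
        then have "(k, l) \<in> linked (J B)" using D by (auto simp: linked_def)
        then show ?case using step.IH \<open>l \<in> B\<close> by (meson rtrancl.rtrancl_into_rtrancl)
      qed (use i in auto)
      then show "(i, j) \<in> (linked (J B))\<^sup>*" using rel[OF B i j] by blast
    qed
  qed
  show "(\<Union>B\<in>A // E. J B) = I"
  proof (intro set_eqI iffI)
    fix D assume D: "D \<in> I"
    obtain u where u: "u \<in> D" using C(1)[OF D] by blast
    have "fst u \<in> A" using C(3)[OF D] u by auto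
    then obtain B where B: "B \<in> A // E" "fst u \<in> B" using Union_quotient[OF eq] by blast
    have "fst ` D \<subseteq> B" by (rule cls[OF B(1) D u B(2)])
    then show "D \<in> (\<Union>B\<in>A // E. J B)" using B D by (auto simp: J_def)
  qed (auto simp: J_def)
qed

text \<open>The inverse construction. Blocks from \<open>J B\<close> stay over B, so linked roots
  never leave B, while connectedness of \<open>J B\<close> links all roots of B; the classes are
  therefore exactly the given ones.\<close>

lemma component_composition:
  assumes L: "fst ` L \<subseteq> A" and \<pi>: "partition_on A \<pi>" and J: "\<And>B. B \<in> \<pi> \<Longrightarrow> J B \<in> parts L B \<and> conn B (J B)"
  defines "I \<equiv> \<Union>B\<in>\<pi>. J B"
  shows "I \<in> parts L A" "A // {(i, j). i \<in> A \<and> j \<in> A \<and> (i, j) \<in> (linked I)\<^sup>*} = \<pi>"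
    "\<And>B. B \<in> \<pi> \<Longrightarrow> {C \<in> I. fst ` C \<subseteq> B} = J B" "disjoint_family_on J \<pi>"
proof -
  have U: "\<Union>\<pi> = A" using partition_onD1[OF \<pi>] by simp
  have dj: "B = B'" if "B \<in> \<pi>" "B' \<in> \<pi>" "i \<in> B" "i \<in> B'" for B B' i
    using partition_onD2[OF \<pi>] that by (auto simp: disjoint_def)
  have pJ: "partition_on {u \<in> L. fst u \<in> B} (J B)" if "B \<in> \<pi>" for B using J[OF that] by (simp add: parts_def)
  have JC: "C \<noteq> {}" "C \<subseteq> L" "fst ` C \<subseteq> B" if "B \<in> \<pi>" "C \<in> J B" for B C
    using partition_onD1[OF pJ[OF that(1)]] partition_onD3[OF pJ[OF that(1)]] that(2) by auto
  have uniq: "B = B'" if h: "B \<in> \<pi>" "B' \<in> \<pi>" "C \<in> J B" "fst ` C \<subseteq> B'" for B B' C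
  proof -
    obtain u where "u \<in> C" using JC(1)[OF h(1,3)] by blast
    then have "fst u \<in> B" "fst u \<in> B'" using JC(3)[OF h(1,3)] h(4) by auto
    then show ?thesis by (rule dj[OF h(1,2)])
  qed
  show "disjoint_family_on J \<pi>"
    unfolding disjoint_family_on_def
  proof (intro ballI impI)
    fix B B' assume B: "B \<in> \<pi>" "B' \<in> \<pi>" "B \<noteq> B'"
    show "J B \<inter> J B' = {}"
    proof (rule ccontr)
      assume "J B \<inter> J B' \<noteq> {}"
      then obtain C where C: "C \<in> J B" "C \<in> J B'" by blast
      show False using uniq[OF B(1,2) C(1) JC(3)[OF B(2) C(2)]] B(3) by simp
    qed
  qed
  show "{C \<in> I. fst ` C \<subseteq> B} = J B" if h: "B \<in> \<pi>" for B
  proof (intro set_eqI iffI)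
    fix C assume "C \<in> {C \<in> I. fst ` C \<subseteq> B}"
    then obtain B' where B': "B' \<in> \<pi>" "C \<in> J B'" "fst ` C \<subseteq> B" by (auto simp: I_def)
    have "B' = B" by (rule uniq[OF B'(1) h B'(2,3)])
    then show "C \<in> J B" using B'(2) by simp
  next
    fix C assume "C \<in> J B"
    then show "C \<in> {C \<in> I. fst ` C \<subseteq> B}" using JC(3)[OF h] h unfolding I_def by blast
  qed
  have "\<Union>I = {u \<in> L. fst u \<in> A}"
  proof -
    have "\<Union>I = (\<Union>B\<in>\<pi>. {u \<in> L. fst u \<in> B})" using partition_onD1[OF pJ] by (auto simp: I_def)
    then show ?thesis using U by auto
  qed
  moreover have "disjoint I"
    unfolding disjoint_def
  proof (intro ballI impI)
    fix C D assume "C \<in> I" "D \<in> I" and ne: "C \<noteq> D"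
    then obtain B B' where B: "B \<in> \<pi>" "C \<in> J B" "B' \<in> \<pi>" "D \<in> J B'" by (auto simp: I_def)
    show "C \<inter> D = {}"
    proof (cases "B = B'")
      case True
      then show ?thesis using partition_onD2[OF pJ[OF B(1)]] B ne by (auto simp: disjoint_def)
    next
      case False
      then show ?thesis using JC(3)[OF B(1,2)] JC(3)[OF B(3,4)] dj[OF B(1,3)] by blast
    qed
  qed
  moreover have "{} \<notin> I" using JC(1) by (auto simp: I_def)
  ultimately show "I \<in> parts L A" by (simp add: parts_def partition_on_def)
  have "{(i, j). i \<in> A \<and> j \<in> A \<and> (i, j) \<in> (linked I)\<^sup>*} = {(i, j). \<exists>B\<in>\<pi>. i \<in> B \<and> j \<in> B}"
  proof (intro set_eqI iffI; clarify)
    fix i j assume i: "i \<in> A" and r: "(i, j) \<in> (linked I)\<^sup>*"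
    obtain B where B: "B \<in> \<pi>" "i \<in> B" using i U by blast
    have "j \<in> B" using r
    proof (induction rule: rtrancl_induct)
      case (step k l)
      then obtain C where C: "C \<in> I" "k \<in> fst ` C" "l \<in> fst ` C" by (auto simp: linked_def)
      then obtain B' where B': "B' \<in> \<pi>" "C \<in> J B'" by (auto simp: I_def)
      then have "B' = B" using JC(3)[OF B'] C step.IH B by (intro dj[of B' B k]) auto
      then show ?case using JC(3)[OF B'] C by auto
    qed (rule B)
    then show "\<exists>B\<in>\<pi>. i \<in> B \<and> j \<in> B" using B by blast
  next
    fix i j B assume B: "B \<in> \<pi>" "i \<in> B" "j \<in> B"
    have "linked (J B) \<subseteq> linked I" using B by (auto simp: linked_def I_def)
    then have "(i, j) \<in> (linked I)\<^sup>*" using J[OF B(1)] B rtrancl_mono unfolding conn_def by blast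
    then show "i \<in> A \<and> j \<in> A \<and> (i, j) \<in> (linked I)\<^sup>*" using B U by blast
  qed
  then show "A // {(i, j). i \<in> A \<and> j \<in> A \<and> (i, j) \<in> (linked I)\<^sup>*} = \<pi>"
    by (simp add: partition_on_eq_quotient[OF \<pi>])
qed

text \<open>Every partition of the leaves splits uniquely into connected pieces over the classes of linked roots.\<close>

lemma sum_parts_eq_sum_components:
  fixes w :: "'i set \<Rightarrow> ('i \<times> 'v) set set \<Rightarrow> 'c::comm_ring_1"
  assumes A: "finite A" and fL: "finite L" and L: "fst ` L \<subseteq> A"
    and w: "\<And>\<pi> J. partition_on A \<pi> \<Longrightarrow> (\<And>B. B \<in> \<pi> \<Longrightarrow> J B \<in> parts L B) \<Longrightarrow> disjoint_family_on J \<pi> \<Longrightarrow>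
      w A (\<Union>B\<in>\<pi>. J B) = (\<Prod>B\<in>\<pi>. w B (J B))"
  shows "(\<Sum>I\<in>parts L A. w A I) = (\<Sum>\<pi>\<in>{\<pi>. partition_on A \<pi>}. \<Prod>B\<in>\<pi>. \<Sum>I\<in>{I \<in> parts L B. conn B I}. w B I)"
proof -
  let ?P = "{\<pi>. partition_on A \<pi>}" and ?C = "\<lambda>B. {I \<in> parts L B. conn B I}"
  let ?S = "SIGMA \<pi>:?P. PiE \<pi> ?C"
  let ?E = "\<lambda>I. A // {(i, j). i \<in> A \<and> j \<in> A \<and> (i, j) \<in> (linked I)\<^sup>*}"
  have fP: "finite ?P" using finitely_many_partition_on[OF A] by simp
  have fpi: "finite \<pi>" if "\<pi> \<in> ?P" for \<pi> using that finite_elements[OF A] by auto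
  have fC: "finite (?C B)" for B using finite_parts[OF fL] by simp
  have "(\<Sum>\<pi>\<in>?P. \<Prod>B\<in>\<pi>. \<Sum>I\<in>?C B. w B I) = (\<Sum>\<pi>\<in>?P. \<Sum>J\<in>PiE \<pi> ?C. \<Prod>B\<in>\<pi>. w B (J B))"
    using fpi fC by (intro sum.cong refl prod_sum_PiE) auto
  also have "\<dots> = (\<Sum>(\<pi>, J)\<in>?S. \<Prod>B\<in>\<pi>. w B (J B))"
    using fP fpi fC by (intro sum.Sigma ballI finite_PiE) auto
  also have "\<dots> = (\<Sum>I\<in>parts L A. w A I)"
  proof (rule sum.reindex_bij_witness[where j = "\<lambda>(\<pi>, J). \<Union>B\<in>\<pi>. J B" and i = "\<lambda>I. (?E I, restrict (\<lambda>B. {C \<in> I. fst ` C \<subseteq> B}) (?E I))"])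
    fix a assume "a \<in> ?S"
    then obtain \<pi> J where a: "a = (\<pi>, J)" and \<pi>: "partition_on A \<pi>" and J: "J \<in> PiE \<pi> ?C" by auto
    have Jp: "J B \<in> parts L B \<and> conn B (J B)" if "B \<in> \<pi>" for B using J that by (auto dest: PiE_mem)
    note cc = component_composition[OF L \<pi> Jp]
    have "restrict (\<lambda>B. {C \<in> (\<Union>B\<in>\<pi>. J B). fst ` C \<subseteq> B}) \<pi> = J"
      using cc(3) J by (intro ext) (auto simp: restrict_def PiE_def extensional_def)
    then show "(?E (case a of (\<pi>, J) \<Rightarrow> \<Union>B\<in>\<pi>. J B), restrict (\<lambda>B. {C \<in> (case a of (\<pi>, J) \<Rightarrow> \<Union>B\<in>\<pi>. J B). fst ` C \<subseteq> B}) (?E (case a of (\<pi>, J) \<Rightarrow> \<Union>B\<in>\<pi>. J B))) = a"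
      by (simp only: a prod.case cc(2))
    show "(case a of (\<pi>, J) \<Rightarrow> \<Union>B\<in>\<pi>. J B) \<in> parts L A" using cc(1) by (simp add: a)
    show "w A (case a of (\<pi>, J) \<Rightarrow> \<Union>B\<in>\<pi>. J B) = (case a of (\<pi>, J) \<Rightarrow> \<Prod>B\<in>\<pi>. w B (J B))"
      using w[OF \<pi> _ cc(4)] Jp by (simp add: a)
  next
    fix I assume I: "I \<in> parts L A"
    note cd = component_decomposition[OF L I]
    show "(case (?E I, restrict (\<lambda>B. {C \<in> I. fst ` C \<subseteq> B}) (?E I)) of (\<pi>, J) \<Rightarrow> \<Union>B\<in>\<pi>. J B) = I"
      using cd(3) by simp
    show "(?E I, restrict (\<lambda>B. {C \<in> I. fst ` C \<subseteq> B}) (?E I)) \<in> ?S"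
      using cd(1,2) by auto
  qed
  finally show ?thesis by simp
qed

text \<open>All blocks of a partition other than the one-block partition are proper subsets, so by
  induction on the size the defining relation has a single solution. Finding the truncated moments
  thus means guessing K.\<close>

lemma truncated_unique:
  fixes M K :: "'i set \<Rightarrow> 'c::comm_ring_1"
  assumes "finite A" "A \<noteq> {}"
    and MK: "\<And>B. B \<subseteq> A \<Longrightarrow> B \<noteq> {} \<Longrightarrow> M B = (\<Sum>\<pi>\<in>{\<pi>. partition_on B \<pi>}. \<Prod>C\<in>\<pi>. K C)"
  shows "truncated M A = K A"
  using assms
proof (induction "card A" arbitrary: A rule: less_induct)
  case less
  let ?S = "{I. partition_on A I \<and> I \<noteq> {A}}"
  have eq: "{I. partition_on A I} = insert {A} ?S"
    using partition_on_space[OF less.prems(2)] by auto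
  have fin: "finite ?S" using finitely_many_partition_on[OF less.prems(1)] by (rule finite_subset[rotated]) auto
  have t: "truncated M B = K B" if I: "I \<in> ?S" and B: "B \<in> I" for I B
  proof -
    have pI: "partition_on A I" using I by simp
    have BA: "B \<subseteq> A" using B partition_onD1[OF pI] by blast
    have ne: "B \<noteq> {}" using B partition_onD3[OF pI] by (metis)
    have "B \<noteq> A"
    proof
      assume BA': "B = A"
      have "C = A" if C: "C \<in> I" for C
      proof (rule ccontr)
        assume "C \<noteq> A"
        then have "C \<inter> A = {}" using partition_onD2[OF pI] B C BA' by (auto simp: disjoint_def)
        moreover have "C \<subseteq> A" "C \<noteq> {}" using C partition_onD1[OF pI] partition_onD3[OF pI] by auto
        ultimately show False by blast
      qed
      then have "I \<subseteq> {A}" by (intro subsetI) simp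
      moreover have "A \<in> I" using B BA' by simp
      ultimately have "I = {A}" by blast
      then show False using I by simp
    qed
    then have "B \<subset> A" using BA by (simp add: psubset_eq)
    then have cB: "card B < card A" by (rule psubset_card_mono[OF less.prems(1)])
    have fB: "finite B" by (rule finite_subset[OF BA less.prems(1)])
    have "M B' = (\<Sum>\<pi>\<in>{\<pi>. partition_on B' \<pi>}. \<Prod>C\<in>\<pi>. K C)" if "B' \<subseteq> B" "B' \<noteq> {}" for B'
      by (rule less.prems(3)[OF order_trans[OF that(1) BA] that(2)])
    then show ?thesis by (rule less.hyps[OF cB fB ne])
  qed
  have "truncated M A = M A - (\<Sum>I\<in>?S. \<Prod>B\<in>I. truncated M B)"
    using less.prems(1) by (subst truncated.simps) simp
  also have "(\<Sum>I\<in>?S. \<Prod>B\<in>I. truncated M B) = (\<Sum>I\<in>?S. \<Prod>B\<in>I. K B)"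
    using t by (intro sum.cong prod.cong refl) auto
  also have "M A = (\<Sum>\<pi>\<in>{\<pi>. partition_on A \<pi>}. \<Prod>C\<in>\<pi>. K C)" using less.prems by (intro less.prems(3)) auto
  also have "\<dots> = K A + (\<Sum>I\<in>?S. \<Prod>B\<in>I. K B)" unfolding eq using fin by (subst sum.insert) auto
  finally show ?case by simp
qed

section \<open>Products of power series as sums over families of trees\<close>

definition tree_families :: "nat \<Rightarrow> nat set \<Rightarrow> nat \<Rightarrow> (nat \<Rightarrow> ptree) set" where
  "tree_families p A m = {T \<in> PiE A (\<lambda>_. {T. admissible p T}). (\<Sum>i\<in>A. inner_count (T i)) = m}"

lemma finite_tree_families:
  assumes "finite A" shows "finite (tree_families p A m)"
proof (rule finite_subset)
  show "tree_families p A m \<subseteq> PiE A (\<lambda>_. \<Union>j\<le>m. trees p j)"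
  proof
    fix T assume T: "T \<in> tree_families p A m"
    have "T i \<in> (\<Union>j\<le>m. trees p j)" if "i \<in> A" for i
    proof -
      have "inner_count (T i) \<le> (\<Sum>i\<in>A. inner_count (T i))" using assms that by (intro member_le_sum) auto
      then show ?thesis using T that by (auto simp: tree_families_def trees_def)
    qed
    then show "T \<in> PiE A (\<lambda>_. \<Union>j\<le>m. trees p j)" using T by (auto simp: tree_families_def)
  qed
  show "finite (PiE A (\<lambda>_. \<Union>j\<le>m. trees p j))" using assms finite_trees by (intro finite_PiE) auto
qed

lemma tree_families_union:
  assumes "finite A" "finite B" "A \<inter> B = {}"
  shows "bij_betw (\<lambda>T. (\<Sum>i\<in>A. inner_count (T i), restrict T A, restrict T B))
    (tree_families p (A \<union> B) m) (SIGMA k:{0..m}. tree_families p A k \<times> tree_families p B (m - k))"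
proof (rule bij_betw_byWitness[where f' = "\<lambda>(k, S, T). merge A B (S, T)"])
  have s: "(\<Sum>i\<in>A \<union> B. f i) = (\<Sum>i\<in>A. f i) + (\<Sum>i\<in>B. f i)" for f :: "nat \<Rightarrow> nat"
    using assms by (intro sum.union_disjoint)
  have sA: "(\<Sum>i\<in>A. inner_count (merge A B (S, T) i)) = (\<Sum>i\<in>A. inner_count (S i))" for S T
    by (intro sum.cong) (auto simp: merge_def)
  have sB: "(\<Sum>i\<in>B. inner_count (merge A B (S, T) i)) = (\<Sum>i\<in>B. inner_count (T i))" for S T
    using assms(3) by (intro sum.cong) (auto simp: merge_def)
  show "\<forall>T\<in>tree_families p (A \<union> B) m. (case (\<Sum>i\<in>A. inner_count (T i), restrict T A, restrict T B) of (k, S, T) \<Rightarrow> merge A B (S, T)) = T"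
    by (auto simp: tree_families_def merge_def fun_eq_iff PiE_def extensional_def)
  show "\<forall>a\<in>SIGMA k:{0..m}. tree_families p A k \<times> tree_families p B (m - k).
       (\<Sum>i\<in>A. inner_count ((case a of (k, S, T) \<Rightarrow> merge A B (S, T)) i), restrict (case a of (k, S, T) \<Rightarrow> merge A B (S, T)) A,
        restrict (case a of (k, S, T) \<Rightarrow> merge A B (S, T)) B) = a"
    using assms(3) by (auto simp: sA) (auto simp: tree_families_def merge_def fun_eq_iff PiE_def extensional_def)
  show "(\<lambda>T. (\<Sum>i\<in>A. inner_count (T i), restrict T A, restrict T B)) ` tree_families p (A \<union> B) m \<subseteq>
      (SIGMA k:{0..m}. tree_families p A k \<times> tree_families p B (m - k))"
    using s by (auto simp: tree_families_def)
  show "(\<lambda>(k, S, T). merge A B (S, T)) ` (SIGMA k:{0..m}. tree_families p A k \<times> tree_families p B (m - k)) \<subseteq> tree_families p (A \<union> B) m"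
  proof (rule image_subsetI)
    fix a assume "a \<in> (SIGMA k:{0..m}. tree_families p A k \<times> tree_families p B (m - k))"
    then obtain k S T where a: "a = (k, S, T)" "k \<le> m" "S \<in> tree_families p A k" "T \<in> tree_families p B (m - k)" by auto
    then have "(\<Sum>i\<in>A \<union> B. inner_count (merge A B (S, T) i)) = m" unfolding s sA sB by (auto simp: tree_families_def)
    moreover have "merge A B (S, T) \<in> PiE (A \<union> B) (\<lambda>_. {T. admissible p T})"
      using a by (auto simp: tree_families_def merge_def PiE_def extensional_def Pi_def)
    ultimately show "(case a of (k, S, T) \<Rightarrow> merge A B (S, T)) \<in> tree_families p (A \<union> B) m" by (simp add: a tree_families_def)
  qed
qed

text \<open>The Cauchy product distributes the total order m over the groups of roots, just as a
  family on a disjoint union splits into its restrictions.\<close>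

lemma fps_nth_prod_tree_families:
  fixes \<kappa> :: "'k \<Rightarrow> (nat \<Rightarrow> ptree) \<Rightarrow> real"
  assumes "finite J" "\<And>k. k \<in> J \<Longrightarrow> finite (S k)" "disjoint_family_on S J"
  shows "fps_nth (\<Prod>k\<in>J. Abs_fps (\<lambda>m. \<Sum>T\<in>tree_families p (S k) m. \<kappa> k T)) m =
    (\<Sum>T\<in>tree_families p (\<Union>k\<in>J. S k) m. \<Prod>k\<in>J. \<kappa> k (restrict T (S k)))"
  using assms
proof (induction J arbitrary: m rule: finite_induct)
  case empty
  have "tree_families p {} m = (if m = 0 then {\<lambda>_. undefined} else {})" by (auto simp: tree_families_def)
  then show ?case by simp
next
  case (insert j J)
  let ?U = "\<Union>k\<in>J. S k"
  have fU: "finite ?U" "finite (S j)" using insert by auto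
  have dj: "S j \<inter> ?U = {}" using insert.prems(2) insert.hyps(2) by (auto simp: disjoint_family_on_def)
  have dJ: "disjoint_family_on S J" using insert.prems(2) by (rule disjoint_family_on_mono[rotated]) auto
  let ?R = "\<lambda>T. \<Prod>k\<in>J. \<kappa> k (restrict T (S k))"
  have "fps_nth (\<Prod>k\<in>insert j J. Abs_fps (\<lambda>m. \<Sum>T\<in>tree_families p (S k) m. \<kappa> k T)) m =
     (\<Sum>k=0..m. (\<Sum>T\<in>tree_families p (S j) k. \<kappa> j T) * (\<Sum>T\<in>tree_families p ?U (m - k). ?R T))"
    unfolding prod.insert[OF insert.hyps] fps_mult_nth fps_nth_Abs_fps
    by (intro sum.cong refl arg_cong2[where f = times] insert.IH[OF _ dJ] insert.prems(1)) auto
  also have "\<dots> = (\<Sum>k=0..m. \<Sum>(T, T')\<in>tree_families p (S j) k \<times> tree_families p ?U (m - k). \<kappa> j T * ?R T')"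
    by (simp add: sum_product sum.cartesian_product)
  also have "\<dots> = (\<Sum>(k, T, T')\<in>(SIGMA k:{0..m}. tree_families p (S j) k \<times> tree_families p ?U (m - k)). \<kappa> j T * ?R T')"
    using fU finite_tree_families by (subst sum.Sigma) (auto simp: case_prod_beta)
  also have "\<dots> = (\<Sum>T\<in>tree_families p (S j \<union> ?U) m. \<kappa> j (restrict T (S j)) * ?R (restrict T ?U))"
    by (subst sum.reindex_bij_betw[OF tree_families_union[OF fU(2,1) dj], symmetric]) simp
  also have "\<dots> = (\<Sum>T\<in>tree_families p (\<Union>k\<in>insert j J. S k) m. \<Prod>k\<in>insert j J. \<kappa> k (restrict T (S k)))"
  proof (intro sum.cong)
    fix T :: "nat \<Rightarrow> ptree"
    have "restrict (restrict T ?U) (S k) = restrict T (S k)" if "k \<in> J" for k using that by (auto simp: restrict_def fun_eq_iff)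
    then show "\<kappa> j (restrict T (S j)) * ?R (restrict T ?U) = (\<Prod>k\<in>insert j J. \<kappa> k (restrict T (S k)))"
      using insert.hyps by (simp del: restrict_restrict)
  qed simp
  finally show ?case .
qed

lemma fps_nth_prod_trees:
  fixes \<kappa> :: "nat \<Rightarrow> ptree \<Rightarrow> real"
  assumes "finite A"
  shows "fps_nth (\<Prod>i\<in>A. Abs_fps (\<lambda>m. \<Sum>t\<in>trees p m. \<kappa> i t)) m = (\<Sum>T\<in>tree_families p A m. \<Prod>i\<in>A. \<kappa> i (T i))"
proof -
  have "(\<Sum>t\<in>trees p m. \<kappa> i t) = (\<Sum>T\<in>tree_families p {i} m. \<kappa> i (T i))" for i m
    by (rule sum.reindex_bij_witness[where i = "\<lambda>T. T i" and j = "\<lambda>t. \<lambda>k\<in>{i}. t"])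
      (auto simp: tree_families_def trees_def PiE_def extensional_def fun_eq_iff)
  then have "fps_nth (\<Prod>i\<in>A. Abs_fps (\<lambda>m. \<Sum>t\<in>trees p m. \<kappa> i t)) m = fps_nth (\<Prod>i\<in>A. Abs_fps (\<lambda>m. \<Sum>T\<in>tree_families p {i} m. \<kappa> i (T i))) m"
    by simp
  also have "\<dots> = (\<Sum>T\<in>tree_families p (\<Union>i\<in>A. {i}) m. \<Prod>i\<in>A. \<kappa> i (restrict T {i} i))"
    using assms by (intro fps_nth_prod_tree_families) (auto simp: disjoint_family_on_def)
  finally show ?thesis by simp
qed

section \<open>The solution as a random sum over trees\<close>

fun tree_factor :: "nat \<Rightarrow> ptree \<Rightarrow> real" where
  "tree_factor p Leaf1 = 1"
| "tree_factor p Leaf2 = 1"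
| "tree_factor p (Inner ts) = vertex_factor p ts * prod_list (map (tree_factor p) ts)"

lemma prod_list_map_nth: "prod_list (map g ts) = (\<Prod>k\<in>{..<length ts}. g (ts ! k) :: real)"
proof -
  have "(\<Prod>k\<in>{..<length ts}. g (ts ! k)) = prod_list (map (\<lambda>k. g (ts ! k)) [0..<length ts])"
    by (subst prod.distinct_set_conv_list[symmetric]) (auto simp: lessThan_atLeast0)
  also have "map (\<lambda>k. g (ts ! k)) [0..<length ts] = map g ts" by (rule nth_equalityI) auto
  finally show ?thesis by simp
qed

lemma prod_list_map_mult: "prod_list (map (\<lambda>t. f t * g t :: real) ts) = prod_list (map f ts) * prod_list (map g ts)"
  by (induction ts) (auto simp: mult_ac)

text \<open>The recursion is assumed for every path, with integrals that may fail to exist and are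
  then 0; the expansion in trees is only an almost sure statement and is proved below.\<close>

locale noise_tree_solution = noise_tree_kernel M K \<kappa> b P Y F CF D c
  for M :: "'a measure" and K \<kappa> b and P :: "'w measure" and Y F CF D c +
  fixes p :: nat and X :: "'w \<Rightarrow> nat \<Rightarrow> 'a \<Rightarrow> real"
  assumes X_0: "\<And>\<omega> x. x \<in> space M \<Longrightarrow> X \<omega> 0 x = Y \<omega> x + F x"
    and X_Suc: "\<And>\<omega> x j. j \<ge> 1 \<Longrightarrow> X \<omega> j x = (LINT y | M. K x y *
      (\<Sum>\<nu>\<in>multiplicities p j. fact p / (\<Prod>i<j. fact (\<nu> i)) * (\<Prod>i<j. X \<omega> i y ^ \<nu> i)))"
begin

text \<open>Measurability has to be joint in path and point because the recursion integrates over
  points; it is what permits replacing X by its expansion almost everywhere under an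
  integral.\<close>

lemma X_joint: "(\<lambda>q. X (fst q) j (snd q)) \<in> borel_measurable (P \<Otimes>\<^sub>M M)"
proof (induction j rule: less_induct)
  case (less j)
  show ?case
  proof (cases "j = 0")
    case True
    have "(\<lambda>q. Y (fst q) (snd q) + F (snd q)) \<in> borel_measurable (P \<Otimes>\<^sub>M M)"
      by (intro borel_measurable_add Y_compose measurable_fst measurable_snd measurable_compose[OF measurable_snd F_meas])
    also have "?this \<longleftrightarrow> ?thesis" unfolding True
      by (intro measurable_cong) (auto simp: space_pair_measure X_0)
    finally show ?thesis .
  next
    case False
    let ?g = "\<lambda>q y. K (snd q) y * (\<Sum>\<nu>\<in>multiplicities p j. fact p / (\<Prod>i<j. fact (\<nu> i)) * (\<Prod>i<j. X (fst q) i y ^ \<nu> i))"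
    have c: "(\<lambda>q. X (fst (fst q)) i (snd q)) \<in> borel_measurable ((P \<Otimes>\<^sub>M M) \<Otimes>\<^sub>M M)" if "i \<in> {..<j}" for i
    proof -
      have "(\<lambda>q. (fst (fst q), snd q)) \<in> (P \<Otimes>\<^sub>M M) \<Otimes>\<^sub>M M \<rightarrow>\<^sub>M P \<Otimes>\<^sub>M M"
        by (intro measurable_Pair measurable_snd measurable_compose[OF measurable_fst measurable_fst])
      from measurable_compose[OF this less.IH[of i]] that show ?thesis by simp
    qed
    have "(\<lambda>q. K (snd (fst q)) (snd q)) \<in> borel_measurable ((P \<Otimes>\<^sub>M M) \<Otimes>\<^sub>M M)"
      by (intro K_compose measurable_snd measurable_compose[OF measurable_fst measurable_snd])
    then have "(\<lambda>(q, y). ?g q y) \<in> borel_measurable ((P \<Otimes>\<^sub>M M) \<Otimes>\<^sub>M M)"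
      unfolding split_beta' fst_conv snd_conv
      by (intro borel_measurable_times borel_measurable_sum borel_measurable_const borel_measurable_prod borel_measurable_power c)
    from borel_measurable_lebesgue_integral[OF this] show ?thesis
      using False by (subst X_Suc) auto
  qed
qed

lemma X_meas: "\<omega> \<in> space P \<Longrightarrow> (\<lambda>y. X \<omega> j y) \<in> borel_measurable M"
  using measurable_compose[OF measurable_Pair X_joint, of "\<lambda>_. \<omega>" M "\<lambda>x. x" j] by simp

lemma X_meas': "x \<in> space M \<Longrightarrow> (\<lambda>\<omega>. X \<omega> j x) \<in> borel_measurable P"
  using measurable_compose[OF measurable_Pair X_joint, of "\<lambda>\<omega>. \<omega>" P "\<lambda>_. x" j] by simp

lemma tree_abs_joint: "(\<lambda>q. tree_abs M K (Y (fst q)) F T (snd q)) \<in> borel_measurable (P \<Otimes>\<^sub>M M)"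
proof (induction T rule: ptree.induct)
  case Leaf1
  have "(\<lambda>q. Y (fst q) (snd q)) \<in> borel_measurable (P \<Otimes>\<^sub>M M)" by (intro Y_compose measurable_fst measurable_snd)
  then show ?case by simp
next
  case Leaf2
  have "(\<lambda>q. F (snd q)) \<in> borel_measurable (P \<Otimes>\<^sub>M M)" by (rule measurable_compose[OF measurable_snd F_meas])
  then show ?case by simp
next
  case (Inner ts)
  have c: "(\<lambda>q. tree_abs M K (Y (fst (fst q))) F (ts ! k) (snd q)) \<in> borel_measurable ((P \<Otimes>\<^sub>M M) \<Otimes>\<^sub>M M)" if "k \<in> {..<length ts}" for k
  proof -
    have "(\<lambda>q. (fst (fst q), snd q)) \<in> (P \<Otimes>\<^sub>M M) \<Otimes>\<^sub>M M \<rightarrow>\<^sub>M P \<Otimes>\<^sub>M M"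
      by (intro measurable_Pair measurable_snd measurable_compose[OF measurable_fst measurable_fst])
    from measurable_compose[OF this Inner[of "ts ! k"]] that show ?thesis by simp
  qed
  have "(\<lambda>q. K (snd (fst q)) (snd q)) \<in> borel_measurable ((P \<Otimes>\<^sub>M M) \<Otimes>\<^sub>M M)"
    by (intro K_compose measurable_snd measurable_compose[OF measurable_fst measurable_snd])
  then have "(\<lambda>(q, y). ennreal \<bar>K (snd q) y\<bar> * (\<Prod>k\<in>{..<length ts}. tree_abs M K (Y (fst q)) F (ts ! k) y)) \<in> borel_measurable ((P \<Otimes>\<^sub>M M) \<Otimes>\<^sub>M M)"
    unfolding split_beta' fst_conv snd_conv
    by (intro borel_measurable_times_ennreal borel_measurable_prod_ennreal c measurable_compose[OF _ measurable_ennreal] borel_measurable_abs)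
  from borel_measurable_nn_integral[OF this] show ?case by simp
qed

text \<open>All trees at once: there are countably many, so at a given point almost every path is
  good.\<close>

definition good :: "'w \<Rightarrow> 'a \<Rightarrow> bool" where
  "good \<omega> x \<longleftrightarrow> (\<forall>j. \<forall>T\<in>trees p j. tree_abs M K (Y \<omega>) F T x < \<infinity>)"

lemma AE_good: "x \<in> space M \<Longrightarrow> AE \<omega> in P. good \<omega> x"
  unfolding good_def AE_all_countable
  by (intro allI AE_finite_allI finite_trees AE_tree_abs_finite)

text \<open>Joint measurability of \<open>tree_abs\<close> allows the two almost-everywhere
  quantifiers to be exchanged. The expansion at x integrates over intermediate points y on one path,
  hence this order of the quantifiers.\<close>

lemma AE_AE_good: "AE \<omega> in P. AE y in M. good \<omega> y"
proof -
  interpret PM: pair_sigma_finite P M by unfold_locales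
  have "AE \<omega> in P. AE y in M. tree_abs M K (Y \<omega>) F T y < \<infinity>" for T
  proof (subst PM.AE_commute)
    show "{q \<in> space (P \<Otimes>\<^sub>M M). tree_abs M K (Y (fst q)) F T (snd q) < \<infinity>} \<in> sets (P \<Otimes>\<^sub>M M)"
      using tree_abs_joint[of T] by measurable
    show "AE y in M. AE \<omega> in P. tree_abs M K (Y \<omega>) F T y < \<infinity>" by (rule AE_I2) (rule AE_tree_abs_finite)
  qed
  then have "AE \<omega> in P. \<forall>j. \<forall>T\<in>trees p j. AE y in M. tree_abs M K (Y \<omega>) F T y < \<infinity>"
    unfolding AE_all_countable by (intro allI AE_finite_allI finite_trees)
  then show ?thesis
  proof eventually_elim
    case (elim \<omega>)
    then show ?case unfolding good_def AE_all_countable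
      by (intro allI AE_finite_allI finite_trees) auto
  qed
qed

text \<open>\<open>tree_abs\<close> of the whole tree at x is the integral of the majorant.
  Integrability of each term is what lets the finite sum over trees be taken out of the
  integral.\<close>

lemma tree_term_integrable:
  assumes \<omega>: "\<omega> \<in> space P" and ae: "AE y in M. good \<omega> y" and x: "x \<in> space M" and g: "good \<omega> x"
    and ts: "Inner ts \<in> trees p j"
  shows "integrable M (\<lambda>y. K x y * (\<Prod>k\<in>{..<length ts}. tree_val M K (Y \<omega>) F (ts ! k) y))"
proof (rule integrableI_bounded)
  note Ym = Y_meas[OF \<omega>]
  have "(\<lambda>y. K x y) \<in> borel_measurable M" using x by (intro K_compose measurable_const) auto
  then show "(\<lambda>y. K x y * (\<Prod>k\<in>{..<length ts}. tree_val M K (Y \<omega>) F (ts ! k) y)) \<in> borel_measurable M"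
    by (intro borel_measurable_times borel_measurable_prod tree_val_measurable Ym F_meas)
  have "(\<integral>\<^sup>+y. ennreal (norm (K x y * (\<Prod>k\<in>{..<length ts}. tree_val M K (Y \<omega>) F (ts ! k) y))) \<partial>M) \<le>
      (\<integral>\<^sup>+y. ennreal \<bar>K x y\<bar> * (\<Prod>k\<in>{..<length ts}. tree_abs M K (Y \<omega>) F (ts ! k) y) \<partial>M)"
  proof (rule nn_integral_mono_AE, use ae AE_space in eventually_elim)
    case (elim y)
    have "ennreal \<bar>tree_val M K (Y \<omega>) F (ts ! k) y\<bar> \<le> tree_abs M K (Y \<omega>) F (ts ! k) y" if k: "k < length ts" for k
    proof -
      have "ts ! k \<in> trees p (inner_count (ts ! k))"
        using ts k by (auto simp: Inner_in_trees_iff trees_def)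
      then have "tree_abs M K (Y \<omega>) F (ts ! k) y < \<infinity>" using elim(1) unfolding good_def by blast
      from integral_tree_integrand[OF Ym F_meas elim(2) this] show ?thesis by blast
    qed
    then have "(\<Prod>k\<in>{..<length ts}. ennreal \<bar>tree_val M K (Y \<omega>) F (ts ! k) y\<bar>) \<le> (\<Prod>k\<in>{..<length ts}. tree_abs M K (Y \<omega>) F (ts ! k) y)"
      by (intro prod_mono_ennreal) auto
    then show ?case by (auto simp: abs_mult abs_prod ennreal_mult prod_ennreal[symmetric] prod_nonneg intro!: mult_left_mono)
  qed
  also have "\<dots> < \<infinity>" using g ts unfolding good_def by (auto simp flip: tree_abs.simps(3))
  finally show "(\<integral>\<^sup>+y. ennreal (norm (K x y * (\<Prod>k\<in>{..<length ts}. tree_val M K (Y \<omega>) F (ts ! k) y))) \<partial>M) < \<infinity>" .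
qed

text \<open>Induction on the order. In the recursion only almost every y matters, and there the
  lower orders have already been expanded; \<open>multinomial_trees\<close> then turns
  multiplicities into lists of subtrees.\<close>

lemma X_eq_sum_trees:
  assumes \<omega>: "\<omega> \<in> space P" and ae: "AE y in M. good \<omega> y" and x: "x \<in> space M" and g: "good \<omega> x"
  shows "X \<omega> j x = (\<Sum>T\<in>trees p j. tree_factor p T * tree_val M K (Y \<omega>) F T x)"
  using x g
proof (induction j arbitrary: x rule: less_induct)
  case (less j)
  note Ym = Y_meas[OF \<omega>]
  show ?case
  proof (cases "j = 0")
    case True
    then show ?thesis using less.prems by (simp add: X_0 trees_0)
  next
    case False
    then have j: "j \<ge> 1" by simp
    let ?v = "\<lambda>T y. tree_val M K (Y \<omega>) F T y"
    let ?h = "\<lambda>ts y. K x y * (\<Prod>k\<in>{..<length ts}. ?v (ts ! k) y)"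
    let ?S = "{ts. Inner ts \<in> trees p j}"
    have Km: "(\<lambda>y. K x y) \<in> borel_measurable M" using less.prems by (intro K_compose measurable_const) auto
    have inj: "inj_on Inner ?S" by (auto simp: inj_on_def)
    have fS: "finite ?S" using finite_trees[of p j] trees_Inner[OF j] inj by (metis finite_imageD)
    note ti = tree_term_integrable[OF \<omega> ae less.prems]
    have "X \<omega> j x = (LINT y | M. (\<Sum>ts\<in>?S. tree_factor p (Inner ts) * ?h ts y))"
      unfolding X_Suc[OF j]
    proof (rule integral_cong_AE)
      show "(\<lambda>y. K x y * (\<Sum>\<nu>\<in>multiplicities p j. fact p / (\<Prod>i<j. fact (\<nu> i)) * (\<Prod>i<j. X \<omega> i y ^ \<nu> i))) \<in> borel_measurable M"
        by (intro borel_measurable_times borel_measurable_sum borel_measurable_const borel_measurable_prod borel_measurable_power Km X_meas \<omega>)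
      show "(\<lambda>y. \<Sum>ts\<in>?S. tree_factor p (Inner ts) * ?h ts y) \<in> borel_measurable M"
        by (intro borel_measurable_times borel_measurable_sum borel_measurable_const borel_measurable_prod Km tree_val_measurable Ym F_meas)
      show "AE y in M. K x y * (\<Sum>\<nu>\<in>multiplicities p j. fact p / (\<Prod>i<j. fact (\<nu> i)) * (\<Prod>i<j. X \<omega> i y ^ \<nu> i)) =
          (\<Sum>ts\<in>?S. tree_factor p (Inner ts) * ?h ts y)"
        using ae AE_space
      proof eventually_elim
        case (elim y)
        have "X \<omega> i y = (\<Sum>T\<in>trees p i. tree_factor p T * ?v T y)" if "i \<in> {..<j}" for i
          using that elim by (intro less.IH) auto
        then have "(\<Sum>\<nu>\<in>multiplicities p j. fact p / (\<Prod>i<j. fact (\<nu> i)) * (\<Prod>i<j. X \<omega> i y ^ \<nu> i)) =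
            (\<Sum>\<nu>\<in>multiplicities p j. fact p / (\<Prod>i<j. fact (\<nu> i)) * (\<Prod>i<j. (\<Sum>T\<in>trees p i. tree_factor p T * ?v T y) ^ \<nu> i))"
          by simp
        also have "\<dots> = (\<Sum>ts\<in>?S. vertex_factor p ts * prod_list (map (\<lambda>T. tree_factor p T * ?v T y) ts))"
          by (rule multinomial_trees[OF j])
        also have "\<dots> = (\<Sum>ts\<in>?S. tree_factor p (Inner ts) * (\<Prod>k\<in>{..<length ts}. ?v (ts ! k) y))"
          by (simp only: prod_list_map_mult tree_factor.simps prod_list_map_nth[of "\<lambda>T. ?v T y"] mult_ac)
        finally show ?case by (simp only: sum_distrib_left mult_ac)
      qed
    qed
    also have "\<dots> = (\<Sum>ts\<in>?S. tree_factor p (Inner ts) * ?v (Inner ts) x)"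
      by (subst Bochner_Integration.integral_sum)
        (auto intro!: ti integrable_mult_right simp del: tree_factor.simps simp: integral_mult_right_zero)
    also have "\<dots> = (\<Sum>T\<in>trees p j. tree_factor p T * ?v T x)"
      by (subst trees_Inner[OF j], subst sum.reindex[OF inj]) (simp del: tree_factor.simps tree_val.simps)
    finally show ?thesis .
  qed
qed

end

section \<open>Multiplicativity over components and the truncated series\<close>

lemma inners_index: "(i, w) \<in> inners A T \<Longrightarrow> i \<in> A"
  and leaves1s_index: "(i, w) \<in> leaves1s A T \<Longrightarrow> i \<in> A"
  and leaves2s_index: "(i, w) \<in> leaves2s A T \<Longrightarrow> i \<in> A"
  using parent_in_inners[of i w A T] by auto

lemma leaves1s_subset: "B \<subseteq> A \<Longrightarrow> {u \<in> leaves1s A T. fst u \<in> B} = leaves1s B T"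
  by (auto simp: leaves1s_def dest: at_prefix)

lemma inners_cong: "(\<And>i. i \<in> A \<Longrightarrow> T i = T' i) \<Longrightarrow> inners A T = inners A T'"
  and leaves1s_cong: "(\<And>i. i \<in> A \<Longrightarrow> T i = T' i) \<Longrightarrow> leaves1s A T = leaves1s A T'"
  and leaves2s_cong: "(\<And>i. i \<in> A \<Longrightarrow> T i = T' i) \<Longrightarrow> leaves2s A T = leaves2s A T'"
  by (simp_all add: inners_def leaves1s_def leaves2s_def)

lemma inners_UN: "inners (\<Union>\<pi>) T = (\<Union>B\<in>\<pi>. inners B T)"
  and leaves2s_UN: "leaves2s (\<Union>\<pi>) T = (\<Union>B\<in>\<pi>. leaves2s B T)"
  by (auto simp: inners_def leaves2s_def)

lemma inners_disjoint: "disjoint \<pi> \<Longrightarrow> disjoint_family_on (\<lambda>B. inners B T) \<pi>"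
  and leaves2s_disjoint: "disjoint \<pi> \<Longrightarrow> disjoint_family_on (\<lambda>B. leaves2s B T) \<pi>"
  by (auto simp: disjoint_family_on_def disjoint_def dest!: inners_index leaves2s_index)

lemma parent_pos_restrict:
  assumes "u \<in> inners A T \<union> leaves1s A T \<union> leaves2s A T" "Tree_Vertex ` inners A T \<subseteq> V"
  shows "parent_pos x (restrict y V) u = parent_pos x y u"
proof (cases u)
  case (Pair i w)
  then show ?thesis using parent_in_inners[of i w A T] assms by (auto simp: restrict_def)
qed

lemma fps_nth_prod_measurable:
  fixes G :: "'i \<Rightarrow> 'w \<Rightarrow> real fps"
  assumes "finite A" "\<And>i m. i \<in> A \<Longrightarrow> (\<lambda>\<omega>. fps_nth (G i \<omega>) m) \<in> borel_measurable P"
  shows "(\<lambda>\<omega>. fps_nth (\<Prod>i\<in>A. G i \<omega>) m) \<in> borel_measurable P"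
  using assms
proof (induction A arbitrary: m rule: finite_induct)
  case (insert i A)
  show ?case unfolding prod.insert[OF insert.hyps] fps_mult_nth
    by (intro borel_measurable_sum borel_measurable_times insert.IH insert.prems) auto
qed simp

context noise_tree_solution
begin

text \<open>The sign comes from the powers of - \<lambda>, one for each inner vertex.\<close>

definition graph_weight :: "(nat \<Rightarrow> 'a) \<Rightarrow> nat set \<Rightarrow> (nat \<Rightarrow> ptree) \<Rightarrow> address set set \<Rightarrow> real" where
  "graph_weight x A T I = (\<Prod>i\<in>A. (- 1) ^ inner_count (T i) * tree_factor p (T i)) * ((\<Prod>C\<in>I. c (card C)) * graph_val A T x I)"

lemma value_integrand_restrict:
  assumes I: "\<And>B. B \<in> I \<Longrightarrow> B \<subseteq> leaves1s A T"
  shows "value_integrand A T x I (restrict y (value_verts A T I)) = value_integrand A T x I y"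
proof -
  let ?V = "value_verts A T I"
  have V: "Tree_Vertex ` inners A T \<subseteq> ?V" "Empty_Vertex ` I \<subseteq> ?V" by (auto simp: value_verts_def)
  have pp: "parent_pos x (restrict y ?V) u = parent_pos x y u" if "u \<in> inners A T \<union> leaves1s A T \<union> leaves2s A T" for u
    using parent_pos_restrict[OF that V(1)] .
  have "kprod A T x (restrict y ?V) = kprod A T x y"
    unfolding kprod_def using pp V(1) by (intro prod.cong refl) (auto simp: image_subset_iff)
  moreover have "(\<Prod>u\<in>leaves2s A T. F (parent_pos x (restrict y ?V) u)) = (\<Prod>u\<in>leaves2s A T. F (parent_pos x y u))"
    using pp by (intro prod.cong refl) auto
  moreover have "block_factor x (restrict y ?V) B (restrict y ?V (Empty_Vertex B)) = block_factor x y B (y (Empty_Vertex B))" if "B \<in> I" for B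
  proof -
    have "restrict y ?V (Empty_Vertex B) = y (Empty_Vertex B)" using V(2) that by (simp add: image_subset_iff)
    then show ?thesis using pp I[OF that] unfolding block_factor_def
      by (intro arg_cong2[where f = times] prod.cong refl) auto
  qed
  ultimately show ?thesis unfolding value_integrand_def fprod_def by simp
qed

text \<open>Trees and blocks over different classes of roots share no integration variable, so the
  integrand is a product of functions of disjoint sets of coordinates.\<close>

lemma graph_val_mult:
  assumes A: "finite A" and x: "x ` A \<subseteq> space M" and \<pi>: "partition_on A \<pi>"
    and J: "\<And>B. B \<in> \<pi> \<Longrightarrow> partition_on (leaves1s B T) (J B)" and dJ: "disjoint_family_on J \<pi>"
  shows "graph_val A T x (\<Union>B\<in>\<pi>. J B) = (\<Prod>B\<in>\<pi>. graph_val B T x (J B))"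
proof -
  let ?I = "\<Union>B\<in>\<pi>. J B" and ?S = "\<lambda>B. value_verts B T (J B)"
  have U: "\<Union>\<pi> = A" and dp: "disjoint \<pi>" using partition_onD1[OF \<pi>] partition_onD2[OF \<pi>] by auto
  have f\<pi>: "finite \<pi>" using finite_elements[OF A \<pi>] .
  have B: "finite B" "x ` B \<subseteq> space M" if "B \<in> \<pi>" for B
    using that U A x by (auto intro: finite_subset[OF Union_upper])
  note pl = partition_leaves[OF B(1) J]
  have V: "value_verts A T ?I = (\<Union>B\<in>\<pi>. ?S B)"
    using inners_UN[of \<pi> T] U by (auto simp: value_verts_def)
  have fS: "finite (?S B)" if "B \<in> \<pi>" for B using B[OF that] pl(1)[OF that that] by (simp add: value_verts_def)
  have dS: "disjoint_family_on ?S \<pi>"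
    unfolding disjoint_family_on_def
  proof (intro ballI impI)
    fix B B' assume B: "B \<in> \<pi>" "B' \<in> \<pi>" "B \<noteq> B'"
    have "inners B T \<inter> inners B' T = {}" "J B \<inter> J B' = {}"
      using inners_disjoint[OF dp, of T] dJ B unfolding disjoint_family_on_def by simp_all
    then show "?S B \<inter> ?S B' = {}" by (auto simp: value_verts_def)
  qed
  have int: "integrable (PiM (?S B) (\<lambda>_. M)) (value_integrand B T x (J B))" if "B \<in> \<pi>" for B
    using B[OF that] pl[OF that that] by (intro graph_val_fold(1)) auto
  have k: "kprod A T x y = (\<Prod>B\<in>\<pi>. kprod B T x y)" for y
    unfolding kprod_def U[symmetric] inners_UN using f\<pi> B inners_disjoint[OF dp, of T]
    by (intro prod.UNION_disjoint) (auto simp: disjoint_family_on_def)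
  have l: "(\<Prod>u\<in>leaves2s A T. F (parent_pos x y u)) = (\<Prod>B\<in>\<pi>. \<Prod>u\<in>leaves2s B T. F (parent_pos x y u))" for y
    unfolding U[symmetric] leaves2s_UN using f\<pi> B leaves2s_disjoint[OF dp, of T]
    by (intro prod.UNION_disjoint) (auto simp: disjoint_family_on_def)
  have bb: "(\<Prod>C\<in>?I. block_factor x y C (y (Empty_Vertex C))) = (\<Prod>B\<in>\<pi>. \<Prod>C\<in>J B. block_factor x y C (y (Empty_Vertex C)))" for y
    using f\<pi> pl(1) dJ by (intro prod.UNION_disjoint) (auto simp: disjoint_family_on_def)
  have "value_integrand A T x ?I y = (\<Prod>B\<in>\<pi>. value_integrand B T x (J B) (restrict y (?S B)))" for y
  proof -
    have "(\<Prod>B\<in>\<pi>. value_integrand B T x (J B) (restrict y (?S B))) = (\<Prod>B\<in>\<pi>. value_integrand B T x (J B) y)"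
      using pl(2) by (intro prod.cong refl value_integrand_restrict) auto
    then show ?thesis unfolding value_integrand_def fprod_def k l bb by (simp add: prod.distrib)
  qed
  then have "graph_val A T x ?I = (LINT y | PiM (\<Union>B\<in>\<pi>. ?S B) (\<lambda>_. M). (\<Prod>B\<in>\<pi>. value_integrand B T x (J B) (restrict y (?S B))))"
    unfolding graph_val_def V by (intro Bochner_Integration.integral_cong refl)
  also have "\<dots> = (\<Prod>B\<in>\<pi>. LINT y | PiM (?S B) (\<lambda>_. M). value_integrand B T x (J B) y)"
    by (rule integral_prod_disjoint(2)[OF f\<pi> fS dS int])
  finally show ?thesis by (simp add: graph_val_def)
qed

lemma graph_weight_mult:
  assumes A: "finite A" and x: "x ` A \<subseteq> space M" and \<pi>: "partition_on A \<pi>"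
    and J: "\<And>B. B \<in> \<pi> \<Longrightarrow> partition_on (leaves1s B T) (J B)" and dJ: "disjoint_family_on J \<pi>"
  shows "graph_weight x A T (\<Union>B\<in>\<pi>. J B) = (\<Prod>B\<in>\<pi>. graph_weight x B T (J B))"
proof -
  have U: "\<Union>\<pi> = A" and dp: "disjoint \<pi>" using partition_onD1[OF \<pi>] partition_onD2[OF \<pi>] by auto
  have f\<pi>: "finite \<pi>" using finite_elements[OF A \<pi>] .
  have fB: "finite B" if "B \<in> \<pi>" for B using that U A by (auto intro: finite_subset[OF Union_upper])
  have "(\<Prod>i\<in>A. g i) = (\<Prod>B\<in>\<pi>. \<Prod>i\<in>B. g i)" for g :: "nat \<Rightarrow> real"
    unfolding U[symmetric] using fB dp by (intro prod.Union_disjoint[unfolded comp_def]) (auto simp: disjoint_def)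
  moreover have "(\<Prod>C\<in>(\<Union>B\<in>\<pi>. J B). c (card C)) = (\<Prod>B\<in>\<pi>. \<Prod>C\<in>J B. c (card C))"
    using f\<pi> partition_leaves(1)[OF fB J] dJ by (intro prod.UNION_disjoint) (auto simp: disjoint_family_on_def)
  ultimately show ?thesis unfolding graph_weight_def
    using graph_val_mult[where T = T and J = J, OF A x \<pi> J dJ] by (simp add: prod.distrib)
qed

lemma graph_weight_cong:
  assumes "\<And>i. i \<in> A \<Longrightarrow> T i = T' i"
  shows "graph_weight x A T I = graph_weight x A T' I"
proof -
  have e: "inners A T = inners A T'" "leaves2s A T = leaves2s A T'" by (intro inners_cong leaves2s_cong assms; assumption)+
  have "value_integrand A T x I = value_integrand A T' x I"
    unfolding value_integrand_def fprod_def kprod_def e ..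
  moreover have "(\<Prod>i\<in>A. (- 1) ^ inner_count (T i) * tree_factor p (T i)) = (\<Prod>i\<in>A. (- 1) ^ inner_count (T' i) * tree_factor p (T' i))"
    using assms by (intro prod.cong refl) simp
  ultimately show ?thesis unfolding graph_weight_def graph_val_def value_verts_def e by simp
qed

definition X_series :: "'w \<Rightarrow> 'a \<Rightarrow> real fps" where
  "X_series \<omega> x = Abs_fps (\<lambda>j. (- 1) ^ j * X \<omega> j x)"

text \<open>For almost every path all roots are good, and the coefficient of the product is then a
  finite sum over families of trees; each summand has the expectation computed before.\<close>

lemma moment_eq_sum_graphs:
  assumes A: "finite A" and x: "x ` A \<subseteq> space M"
  shows "fps_nth (moment_series P (\<lambda>i \<omega>. X_series \<omega> (x i)) A) m =
    (\<Sum>T\<in>tree_families p A m. \<Sum>I\<in>{I. partition_on (leaves1s A T) I}. graph_weight x A T I)"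
proof -
  let ?s = "\<lambda>T. \<Prod>i\<in>A. (- 1) ^ inner_count (T i) * tree_factor p (T i)"
  let ?V = "\<lambda>T. PiM (Tree_Vertex ` inners A T) (\<lambda>_. M)"
  let ?E = "\<lambda>T \<omega>. LINT y | ?V T. noise_integrand A T x \<omega> y"
  have xi: "x i \<in> space M" if "i \<in> A" for i using x that by auto
  have ei: "integrable P (\<lambda>\<omega>. ?s T * ?E T \<omega>)" for T
    by (intro integrable_mult_right expectation_noise_integral(1) A x)
  have "AE \<omega> in P. \<forall>i\<in>A. good \<omega> (x i)"
    by (intro AE_finite_allI A AE_good xi)
  then have ae: "AE \<omega> in P. fps_nth (\<Prod>i\<in>A. X_series \<omega> (x i)) m = (\<Sum>T\<in>tree_families p A m. ?s T * ?E T \<omega>)"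
    using AE_AE_good AE_space
  proof eventually_elim
    case (elim \<omega>)
    let ?k = "\<lambda>i t. (- 1) ^ inner_count t * tree_factor p t * tree_val M K (Y \<omega>) F t (x i)"
    have "X_series \<omega> (x i) = Abs_fps (\<lambda>m. \<Sum>t\<in>trees p m. ?k i t)" if "i \<in> A" for i
      using elim that X_eq_sum_trees[OF elim(3,2) xi]
      by (auto simp: X_series_def fps_eq_iff sum_distrib_left trees_def mult_ac intro!: sum.cong)
    then have "fps_nth (\<Prod>i\<in>A. X_series \<omega> (x i)) m = fps_nth (\<Prod>i\<in>A. Abs_fps (\<lambda>m. \<Sum>t\<in>trees p m. ?k i t)) m"
      by simp
    also have "\<dots> = (\<Sum>T\<in>tree_families p A m. \<Prod>i\<in>A. ?k i (T i))" by (rule fps_nth_prod_trees[OF A])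
    also have "\<dots> = (\<Sum>T\<in>tree_families p A m. ?s T * ?E T \<omega>)"
    proof (intro sum.cong refl)
      fix T assume T: "T \<in> tree_families p A m"
      have "tree_abs M K (Y \<omega>) F (T i) (x i) < \<infinity>" if i: "i \<in> A" for i
      proof -
        have "T i \<in> trees p (inner_count (T i))" using T i by (auto simp: tree_families_def trees_def)
        then show ?thesis using elim(1) i unfolding good_def by blast
      qed
      from prod_tree_val[OF A x elim(3) this]
      show "(\<Prod>i\<in>A. ?k i (T i)) = ?s T * ?E T \<omega>" by (simp add: prod.distrib)
    qed
    finally show ?case .
  qed
  have "fps_nth (moment_series P (\<lambda>i \<omega>. X_series \<omega> (x i)) A) m = (LINT \<omega> | P. (\<Sum>T\<in>tree_families p A m. ?s T * ?E T \<omega>))"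
    unfolding moment_series_def fps_nth_Abs_fps
  proof (rule integral_cong_AE[OF _ _ ae])
    show "(\<lambda>\<omega>. fps_nth (\<Prod>i\<in>A. X_series \<omega> (x i)) m) \<in> borel_measurable P"
      unfolding X_series_def
      by (intro fps_nth_prod_measurable A) (auto simp: fps_nth_Abs_fps intro!: borel_measurable_times X_meas' xi)
    show "(\<lambda>\<omega>. \<Sum>T\<in>tree_families p A m. ?s T * ?E T \<omega>) \<in> borel_measurable P"
      using ei by (intro borel_measurable_sum borel_measurable_integrable)
  qed
  also have "\<dots> = (\<Sum>T\<in>tree_families p A m. ?s T * (LINT \<omega> | P. ?E T \<omega>))"
    using ei by (subst Bochner_Integration.integral_sum) auto
  also have "\<dots> = (\<Sum>T\<in>tree_families p A m. \<Sum>I\<in>{I. partition_on (leaves1s A T) I}. graph_weight x A T I)"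
    by (simp only: expectation_noise_integral(2)[OF A x] graph_weight_def sum_distrib_left)
  finally show ?thesis .
qed

text \<open>The candidate that \<open>truncated_unique\<close> is to identify with the truncated
  moments.\<close>

definition truncated_series :: "(nat \<Rightarrow> 'a) \<Rightarrow> nat set \<Rightarrow> real fps" where
  "truncated_series x A = Abs_fps (\<lambda>m. \<Sum>T\<in>tree_families p A m.
     \<Sum>I\<in>{I. partition_on (leaves1s A T) I \<and> conn A I}. graph_weight x A T I)"

text \<open>For each family of trees the partitions of its leaves are sorted by their classes of
  linked roots. After exchanging the sums, the families on A split into independent families on the
  classes, which is a product of power series.\<close>

lemma moment_eq_sum_truncated_series:
  assumes A: "finite A" and x: "x ` A \<subseteq> space M"
  shows "moment_series P (\<lambda>i \<omega>. X_series \<omega> (x i)) A = (\<Sum>\<pi>\<in>{\<pi>. partition_on A \<pi>}. \<Prod>B\<in>\<pi>. truncated_series x B)"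
proof (rule fps_ext)
  fix m
  let ?C = "\<lambda>B T. \<Sum>I\<in>{I. partition_on (leaves1s B T) I \<and> conn B I}. graph_weight x B T I"
  have "fps_nth (moment_series P (\<lambda>i \<omega>. X_series \<omega> (x i)) A) m =
      (\<Sum>T\<in>tree_families p A m. \<Sum>I\<in>parts (leaves1s A T) A. graph_weight x A T I)"
    unfolding moment_eq_sum_graphs[OF assms] by (simp add: parts_def leaves1s_subset)
  also have "\<dots> = (\<Sum>T\<in>tree_families p A m. \<Sum>\<pi>\<in>{\<pi>. partition_on A \<pi>}. \<Prod>B\<in>\<pi>. ?C B T)"
  proof (intro sum.cong refl)
    fix T
    have L: "fst ` leaves1s A T \<subseteq> A" by (auto dest: leaves1s_index)
    have pt: "parts (leaves1s A T) B = {I. partition_on (leaves1s B T) I}" if "partition_on A \<pi>" "B \<in> \<pi>" for B \<pi>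
    proof -
      have "B \<subseteq> A" using partition_onD1[OF that(1)] that(2) by blast
      then show ?thesis by (simp add: parts_def leaves1s_subset)
    qed
    have "(\<Sum>I\<in>parts (leaves1s A T) A. graph_weight x A T I) =
        (\<Sum>\<pi>\<in>{\<pi>. partition_on A \<pi>}. \<Prod>B\<in>\<pi>. \<Sum>I\<in>{I \<in> parts (leaves1s A T) B. conn B I}. graph_weight x B T I)"
    proof (rule sum_parts_eq_sum_components[OF A _ L])
      fix \<pi> J assume h: "partition_on A \<pi>" "\<And>B. B \<in> \<pi> \<Longrightarrow> J B \<in> parts (leaves1s A T) B" "disjoint_family_on J \<pi>"
      show "graph_weight x A T (\<Union>B\<in>\<pi>. J B) = (\<Prod>B\<in>\<pi>. graph_weight x B T (J B))"
      proof (rule graph_weight_mult[OF A x h(1) _ h(3)])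
        show "partition_on (leaves1s B T) (J B)" if "B \<in> \<pi>" for B using h(2)[OF that] pt[OF h(1) that] by simp
      qed
    qed (use A in simp)
    also have "\<dots> = (\<Sum>\<pi>\<in>{\<pi>. partition_on A \<pi>}. \<Prod>B\<in>\<pi>. ?C B T)"
      by (intro sum.cong prod.cong refl) (simp add: pt)
    finally show "(\<Sum>I\<in>parts (leaves1s A T) A. graph_weight x A T I) = (\<Sum>\<pi>\<in>{\<pi>. partition_on A \<pi>}. \<Prod>B\<in>\<pi>. ?C B T)" .
  qed
  also have "\<dots> = (\<Sum>\<pi>\<in>{\<pi>. partition_on A \<pi>}. \<Sum>T\<in>tree_families p A m. \<Prod>B\<in>\<pi>. ?C B T)"
    by (rule sum.swap)
  also have "\<dots> = (\<Sum>\<pi>\<in>{\<pi>. partition_on A \<pi>}. fps_nth (\<Prod>B\<in>\<pi>. truncated_series x B) m)"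
  proof (intro sum.cong refl)
    fix \<pi> assume "\<pi> \<in> {\<pi>. partition_on A \<pi>}"
    then have \<pi>: "partition_on A \<pi>" by simp
    have U: "\<Union>\<pi> = A" and dp: "disjoint \<pi>" using partition_onD1[OF \<pi>] partition_onD2[OF \<pi>] by auto
    have f\<pi>: "finite \<pi>" using finite_elements[OF A \<pi>] .
    have fB: "finite B" if "B \<in> \<pi>" for B using that U A by (auto intro: finite_subset[OF Union_upper])
    have dj: "disjoint_family_on (\<lambda>B. B) \<pi>" using dp by (auto simp: disjoint_family_on_def disjoint_def)
    have "fps_nth (\<Prod>B\<in>\<pi>. truncated_series x B) m = (\<Sum>T\<in>tree_families p (\<Union>B\<in>\<pi>. B) m. \<Prod>B\<in>\<pi>. ?C B (restrict T B))"
      unfolding truncated_series_def by (rule fps_nth_prod_tree_families[OF f\<pi> fB dj])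
    also have "\<dots> = (\<Sum>T\<in>tree_families p A m. \<Prod>B\<in>\<pi>. ?C B T)"
    proof (rule sum.cong, simp add: U, rule prod.cong, rule refl)
      fix T :: "nat \<Rightarrow> ptree" and B :: "nat set"
      have "leaves1s B (restrict T B) = leaves1s B T" by (rule leaves1s_cong) simp
      moreover have "graph_weight x B (restrict T B) I = graph_weight x B T I" for I by (rule graph_weight_cong) simp
      ultimately show "?C B (restrict T B) = ?C B T" by simp
    qed
    finally show "(\<Sum>T\<in>tree_families p A m. \<Prod>B\<in>\<pi>. ?C B T) = fps_nth (\<Prod>B\<in>\<pi>. truncated_series x B) m" by simp
  qed
  finally show "fps_nth (moment_series P (\<lambda>i \<omega>. X_series \<omega> (x i)) A) m =
      fps_nth (\<Sum>\<pi>\<in>{\<pi>. partition_on A \<pi>}. \<Prod>B\<in>\<pi>. truncated_series x B) m"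
    by (simp add: fps_sum_nth)
qed

lemma truncated_moment_series:
  assumes A: "finite A" "A \<noteq> {}" and x: "x ` A \<subseteq> space M"
  shows "truncated (moment_series P (\<lambda>i \<omega>. X_series \<omega> (x i))) A = truncated_series x A"
proof (rule truncated_unique[OF A])
  fix B assume "B \<subseteq> A"
  then show "moment_series P (\<lambda>i \<omega>. X_series \<omega> (x i)) B = (\<Sum>\<pi>\<in>{\<pi>. partition_on B \<pi>}. \<Prod>C\<in>\<pi>. truncated_series x C)"
    using A x by (intro moment_eq_sum_truncated_series) (auto intro: finite_subset)
qed

end

section \<open>Generalized Parisi--Wu graphs\<close>

text \<open>Edges end in vertices of the graph, so a walk that starts in the vertex set never leaves
  it, and the restricted closure \<open>rtrancl_on\<close> may be replaced by the ordinary
  one.\<close>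

lemma connected_iff:
  assumes "\<And>e. e \<in> arcs G \<Longrightarrow> tail G e \<in> verts G \<and> head G e \<in> verts G"
  shows "Digraph_Component.connected G \<longleftrightarrow> verts G \<noteq> {} \<and>
    (\<forall>u\<in>verts G. \<forall>v\<in>verts G. (u, v) \<in> (\<Union>e\<in>arcs G. {(tail G e, head G e), (head G e, tail G e)})\<^sup>*)"
proof -
  let ?E = "\<Union>e\<in>arcs G. {(tail G e, head G e), (head G e, tail G e)}"
  have "(u, v) \<in> rtrancl_on (verts G) ?E \<longleftrightarrow> (u, v) \<in> ?E\<^sup>*" if u: "u \<in> verts G" for u v
  proof
    show "(u, v) \<in> ?E\<^sup>*" if "(u, v) \<in> rtrancl_on (verts G) ?E"
      using that by (induction rule: rtrancl_on_induct) (auto intro: rtrancl.rtrancl_into_rtrancl)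
    show "(u, v) \<in> rtrancl_on (verts G) ?E" if "(u, v) \<in> ?E\<^sup>*"
      using that
    proof (induction rule: rtrancl_induct)
      case (step v w)
      then obtain e where "e \<in> arcs G" "w = tail G e \<or> w = head G e" by auto
      then have "w \<in> verts G" using assms[of e] by metis
      then show ?case by (rule rtrancl_on_into_rtrancl_on[OF step.IH step.hyps(2)])
    qed (use u in auto)
  qed
  moreover have "verts (with_proj (mk_symmetric G)) = verts G" by (simp add: mk_symmetric_def)
  moreover have "arcs_ends (with_proj (mk_symmetric G)) = ?E" by (simp add: mk_symmetric_def)
  ultimately show ?thesis
    unfolding Digraph_Component.connected_def strongly_connected_def reachable_def
    by (simp only: cong: ball_cong conj_cong)
qed

lemma subtree_at_butlast: "subtree_at T w \<noteq> None \<Longrightarrow> subtree_at T (butlast w) \<noteq> None"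
  by (induction T w rule: subtree_at.induct) (auto split: if_splits)

lemma addresses_butlast: "(i, w) \<in> addresses Ts \<Longrightarrow> (i, butlast w) \<in> addresses Ts"
  using subtree_at_butlast by (fastforce simp: addresses_def)

lemma block_of_partition:
  assumes "partition_on L I"
  shows "u \<in> L \<Longrightarrow> block_of I u \<in> I \<and> u \<in> block_of I u" "C \<in> I \<Longrightarrow> u \<in> C \<Longrightarrow> block_of I u = C"
proof -
  show *: "block_of I u = C" if "C \<in> I" "u \<in> C" for C u
    unfolding block_of_def
  proof (rule the_equality)
    show "D = C" if "D \<in> I \<and> u \<in> D" for D
      using partition_onD2[OF assms] that \<open>C \<in> I\<close> \<open>u \<in> C\<close> by (auto simp: disjoint_def)
  qed (use that in auto)
  assume "u \<in> L"
  then obtain C where "C \<in> I" "u \<in> C" using partition_onD1[OF assms] by auto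
  with *[OF this] show "block_of I u \<in> I \<and> u \<in> block_of I u" by simp
qed

text \<open>The indices of the trees that a vertex touches; an empty vertex touches every tree with
  a leaf in its block. The map carries walks in the graph to chains of links between roots.\<close>

fun vertex_roots :: "vertex \<Rightarrow> nat set" where
  "vertex_roots (Root i) = {i}"
| "vertex_roots (Tree_Vertex u) = {fst u}"
| "vertex_roots (Empty_Vertex B) = fst ` B"

lemma leaves1_addresses: "leaves1 Ts \<subseteq> addresses Ts"
  by (auto simp: leaves1_def addresses_def)

text \<open>Inside a tree every vertex is joined to its root, so the graph is connected as soon as
  the roots are, and different trees communicate only through empty vertices. For the empty list the
  left side would fail and the right side hold.\<close>

lemma connected_pw_graph_iff:
  assumes I: "partition_on (leaves1 Ts) I" and Ts: "Ts \<noteq> []"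
  shows "Digraph_Component.connected (pw_graph Ts I) \<longleftrightarrow> conn {..<length Ts} I"
proof -
  let ?G = "pw_graph Ts I"
  let ?E = "\<Union>e\<in>arcs ?G. {(tail ?G e, head ?G e), (head ?G e, tail ?G e)}"
  have par: "parent u \<in> verts ?G" if "u \<in> addresses Ts" for u
    using that addresses_butlast by (cases u) (auto simp: pw_graph_def addresses_def)
  have te: "(parent u, Tree_Vertex u) \<in> ?E" if "u \<in> addresses Ts" for u
    using that by (intro UN_I[of "Tree_Edge u"]) (auto simp: pw_graph_def)
  have ne: "(Tree_Vertex u, Empty_Vertex C) \<in> ?E" if "C \<in> I" "u \<in> C" for u C
  proof -
    have "u \<in> leaves1 Ts" using that partition_onD1[OF I] by auto
    then show ?thesis using block_of_partition(2)[OF I that]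
      by (intro UN_I[of "Noise_Edge u"]) (auto simp: pw_graph_def)
  qed
  have E_cases: "(\<exists>u\<in>addresses Ts. (a = parent u \<and> b = Tree_Vertex u) \<or> (b = parent u \<and> a = Tree_Vertex u)) \<or>
      (\<exists>C\<in>I. \<exists>u\<in>C. (a = Tree_Vertex u \<and> b = Empty_Vertex C) \<or> (b = Tree_Vertex u \<and> a = Empty_Vertex C))"
    if ab: "(a, b) \<in> ?E" for a b
  proof -
    obtain e where e: "e \<in> arcs ?G" "(a = tail ?G e \<and> b = head ?G e) \<or> (b = tail ?G e \<and> a = head ?G e)"
      using ab by auto
    show ?thesis
    proof (cases e)
      case (Tree_Edge u)
      then show ?thesis using e by (auto simp: pw_graph_def)
    next
      case (Noise_Edge u)
      then have "u \<in> leaves1 Ts" using e by (auto simp: pw_graph_def)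
      from block_of_partition(1)[OF I this] show ?thesis using e Noise_Edge by (auto simp: pw_graph_def)
    qed
  qed
  have wf: "tail ?G e \<in> verts ?G \<and> head ?G e \<in> verts ?G" if "e \<in> arcs ?G" for e
  proof (cases e)
    case (Tree_Edge u)
    then show ?thesis using that par by (auto simp: pw_graph_def)
  next
    case (Noise_Edge u)
    then have "u \<in> leaves1 Ts" using that by (auto simp: pw_graph_def)
    then show ?thesis using block_of_partition(1)[OF I] leaves1_addresses[of Ts] Noise_Edge by (auto simp: pw_graph_def)
  qed
  have symE: "sym (?E\<^sup>*)" by (rule sym_rtrancl) (auto simp: sym_def)
  have rt: "(Tree_Vertex (i, w), Root i) \<in> ?E\<^sup>*" if "(i, w) \<in> addresses Ts" for i w
    using that
  proof (induction w rule: rev_induct)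
    case Nil
    then have "(Root i, Tree_Vertex (i, [])) \<in> ?E\<^sup>*" using te[OF Nil] by (intro r_into_rtrancl) simp
    then show ?case by (rule symD[OF symE])
  next
    case (snoc k w)
    have "(Tree_Vertex (i, w), Tree_Vertex (i, w @ [k])) \<in> ?E\<^sup>*" using te[OF snoc.prems] by (intro r_into_rtrancl) simp
    then have "(Tree_Vertex (i, w @ [k]), Tree_Vertex (i, w)) \<in> ?E\<^sup>*" by (rule symD[OF symE])
    also have "(Tree_Vertex (i, w), Root i) \<in> ?E\<^sup>*" using addresses_butlast[OF snoc.prems] by (intro snoc.IH) simp
    finally show ?case .
  qed
  have et: "(Empty_Vertex C, Root (fst u)) \<in> ?E\<^sup>*" if "C \<in> I" "u \<in> C" for C u
  proof -
    have "u \<in> addresses Ts" using that partition_onD1[OF I] leaves1_addresses[of Ts] by auto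
    then have "(Tree_Vertex u, Root (fst u)) \<in> ?E\<^sup>*" using rt[of "fst u" "snd u"] by simp
    with symD[OF symE r_into_rtrancl[OF ne[OF that]]] show ?thesis by (rule rtrancl_trans)
  qed
  have vs: "v \<in> verts ?G \<longleftrightarrow> (\<exists>i<length Ts. v = Root i) \<or> (\<exists>u\<in>addresses Ts. v = Tree_Vertex u) \<or> (\<exists>C\<in>I. v = Empty_Vertex C)" for v
    by (auto simp: pw_graph_def)
  show ?thesis
  proof
    assume "Digraph_Component.connected ?G"
    then have c: "(u, v) \<in> ?E\<^sup>*" if "u \<in> verts ?G" "v \<in> verts ?G" for u v
      using connected_iff[OF wf] that by blast
    show "conn {..<length Ts} I" unfolding conn_def
    proof (intro ballI)
      fix i j assume ij: "i \<in> {..<length Ts}" "j \<in> {..<length Ts}"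
      \<comment> \<open>Projects an edge to indices of trees: a tree edge stays within one tree, and
        a noise edge joins a leaf to the block containing it.\<close>
      have link: "(k, l) \<in> (linked I)\<^sup>*" if ab: "(a, b) \<in> ?E" and k: "k \<in> vertex_roots a" and l: "l \<in> vertex_roots b" for a b k l
      proof -
        consider (tree) u where "(a = parent u \<and> b = Tree_Vertex u) \<or> (b = parent u \<and> a = Tree_Vertex u)"
          | (noise) C u where "C \<in> I" "u \<in> C" "(a = Tree_Vertex u \<and> b = Empty_Vertex C) \<or> (b = Tree_Vertex u \<and> a = Empty_Vertex C)"
          using E_cases[OF ab] by blast
        then show ?thesis
        proof cases
          case (tree u)
          then have "k = l" using k l by (cases u) (auto split: if_splits)
          then show ?thesis by simp
        next
          case (noise C u)
          then have "k \<in> fst ` C" "l \<in> fst ` C" using k l by auto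
          then have "(k, l) \<in> linked I" using noise(1) unfolding linked_def by blast
          then show ?thesis by simp
        qed
      qed
      have ner: "vertex_roots a \<noteq> {}" if ab: "(a, b) \<in> ?E" for a b
      proof -
        have "vertex_roots (parent u) \<noteq> {}" for u by (cases u) auto
        then show ?thesis using E_cases[OF ab] by auto
      qed
      have "\<forall>k\<in>vertex_roots v. (i, k) \<in> (linked I)\<^sup>*" if "(Root i, v) \<in> ?E\<^sup>*" for v
        using that
      proof (induction rule: rtrancl_induct)
        case (step v w)
        obtain k where k: "k \<in> vertex_roots v" using ner[OF step(2)] by blast
        show ?case using link[OF step(2) k] step(3) k
          by (meson rtrancl_trans)
      qed simp
      from this[OF c[of "Root i" "Root j"]] show "(i, j) \<in> (linked I)\<^sup>*" using ij by (simp add: vs)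
    qed
  next
    assume cn: "conn {..<length Ts} I"
    have lk: "(Root i, Root j) \<in> ?E\<^sup>*" if "(i, j) \<in> (linked I)\<^sup>*" for i j
      using that
    proof (induction rule: rtrancl_induct)
      case (step j k)
      then obtain C u v where C: "C \<in> I" "u \<in> C" "j = fst u" "v \<in> C" "k = fst v" by (auto simp: linked_def)
      have "(Root j, Empty_Vertex C) \<in> ?E\<^sup>*" using symD[OF symE et[OF C(1,2)]] C by simp
      moreover have "(Empty_Vertex C, Root k) \<in> ?E\<^sup>*" using et[OF C(1,4)] C by simp
      ultimately show ?case using step.IH by (meson rtrancl_trans)
    qed simp
    have root: "\<exists>i<length Ts. (v, Root i) \<in> ?E\<^sup>*" if v: "v \<in> verts ?G" for v
      using v unfolding vs
    proof (elim disjE exE bexE conjE)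
      fix u assume "u \<in> addresses Ts" "v = Tree_Vertex u"
      then show ?thesis using rt[of "fst u" "snd u"] by (cases u) (auto simp: addresses_def)
    next
      fix C assume C: "C \<in> I" "v = Empty_Vertex C"
      then obtain u where u: "u \<in> C" using partition_onD3[OF I] by (metis ex_in_conv)
      then have "u \<in> leaves1 Ts" using C partition_onD1[OF I] by auto
      then have "fst u < length Ts" by (auto simp: leaves1_def)
      then show ?thesis using et[OF C(1) u] C by auto
    qed auto
    have "(u, v) \<in> ?E\<^sup>*" if uv: "u \<in> verts ?G" "v \<in> verts ?G" for u v
    proof -
      obtain i j where ij: "i < length Ts" "j < length Ts" "(u, Root i) \<in> ?E\<^sup>*" "(v, Root j) \<in> ?E\<^sup>*"
        using root uv by blast
      have "(Root i, Root j) \<in> ?E\<^sup>*" using cn ij by (intro lk) (auto simp: conn_def)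
      then show ?thesis using ij(3) symD[OF symE ij(4)] by (meson rtrancl_trans)
    qed
    moreover have "Root 0 \<in> verts ?G" using Ts by (simp add: vs)
    ultimately show "Digraph_Component.connected ?G" using connected_iff[OF wf] by blast
  qed
qed

section \<open>Recursive and address-based descriptions of graphs and their values\<close>

lemma at_eq_subtree_at:
  "inner_at T i w = {(i, w @ u) | u. \<exists>ts. subtree_at T u = Some (Inner ts)}"
  "leaves1_at T i w = {(i, w @ u) | u. subtree_at T u = Some Leaf1}"
  "leaves2_at T i w = {(i, w @ u) | u. subtree_at T u = Some Leaf2}"
proof (induction T i w rule: inner_at.induct)
  case (3 ts i w)
  have split: "{(i, w @ u) | u. Q (subtree_at (Inner ts) u)} =
      (if Q (Some (Inner ts)) then {(i, w)} else {}) \<union> (\<Union>k\<in>{..<length ts}. {(i, (w @ [k]) @ u) | u. Q (subtree_at (ts ! k) u)})"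
    if "\<not> Q None" for Q
  proof (intro set_eqI iffI)
    fix a assume "a \<in> {(i, w @ u) | u. Q (subtree_at (Inner ts) u)}"
    then obtain u where u: "a = (i, w @ u)" "Q (subtree_at (Inner ts) u)" by auto
    then show "a \<in> (if Q (Some (Inner ts)) then {(i, w)} else {}) \<union> (\<Union>k\<in>{..<length ts}. {(i, (w @ [k]) @ u) | u. Q (subtree_at (ts ! k) u)})"
      using that by (cases u) (auto split: if_splits)
  next
    fix a assume "a \<in> (if Q (Some (Inner ts)) then {(i, w)} else {}) \<union> (\<Union>k\<in>{..<length ts}. {(i, (w @ [k]) @ u) | u. Q (subtree_at (ts ! k) u)})"
    then consider "Q (Some (Inner ts))" "a = (i, w)" | k u where "k < length ts" "a = (i, w @ k # u)" "Q (subtree_at (ts ! k) u)"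
      by (auto split: if_splits)
    then show "a \<in> {(i, w @ u) | u. Q (subtree_at (Inner ts) u)}"
    proof cases
      case 1
      then show ?thesis by (intro CollectI exI[of _ "[]"]) auto
    next
      case 2
      then show ?thesis by (intro CollectI exI[of _ "k # u"]) auto
    qed
  qed
  { case 1 show ?case using 3(1) split[of "\<lambda>s. \<exists>ts. s = Some (Inner ts)"] by simp }
  { case 2 show ?case using 3(2) split[of "\<lambda>s. s = Some Leaf1"] by simp }
  { case 3 show ?case using \<open>\<And>x. x \<in> {..<length ts} \<Longrightarrow> leaves2_at (ts ! x) i (w @ [x]) = _\<close> split[of "\<lambda>s. s = Some Leaf2"] by simp }
qed (auto elim: subtree_at.elims)

lemma addresses_families:
  assumes "\<forall>i<length Ts. T i = Ts ! i"
  shows "inner_addresses Ts = inners {..<length Ts} T" "leaves1 Ts = leaves1s {..<length Ts} T" "leaves2 Ts = leaves2s {..<length Ts} T"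
    "addresses Ts = inners {..<length Ts} T \<union> leaves1s {..<length Ts} T \<union> leaves2s {..<length Ts} T"
proof -
  show e: "inner_addresses Ts = inners {..<length Ts} T" "leaves1 Ts = leaves1s {..<length Ts} T" "leaves2 Ts = leaves2s {..<length Ts} T"
    using assms by (auto simp: inner_addresses_def leaves1_def leaves2_def inners_def leaves1s_def leaves2s_def at_eq_subtree_at)
  have "addresses Ts = inner_addresses Ts \<union> leaves1 Ts \<union> leaves2 Ts"
  proof (intro set_eqI iffI)
    fix a assume "a \<in> addresses Ts"
    then obtain i w S where a: "a = (i, w)" "i < length Ts" "subtree_at (Ts ! i) w = Some S" by (auto simp: addresses_def)
    then show "a \<in> inner_addresses Ts \<union> leaves1 Ts \<union> leaves2 Ts"
      by (cases S) (auto simp: inner_addresses_def leaves1_def leaves2_def)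
  qed (auto simp: addresses_def inner_addresses_def leaves1_def leaves2_def)
  then show "addresses Ts = inners {..<length Ts} T \<union> leaves1s {..<length Ts} T \<union> leaves2s {..<length Ts} T" by (simp add: e)
qed

text \<open>The lookup g is arbitrary so that the induction can pass to subtrees, whose addresses
  carry the prefix w.\<close>

lemma tree_factor_eq_prod:
  assumes "\<And>u ts. subtree_at T u = Some (Inner ts) \<Longrightarrow> g (w @ u) = ts"
  shows "tree_factor p T = (\<Prod>a\<in>inner_at T i w. vertex_factor p (g (snd a)))"
  using assms
proof (induction T i w rule: inner_at.induct)
  case (3 ts i w)
  have "g w = ts" using 3(2)[of "[]"] by simp
  have IH: "tree_factor p (ts ! k) = (\<Prod>a\<in>inner_at (ts ! k) i (w @ [k]). vertex_factor p (g (snd a)))" if k: "k \<in> {..<length ts}" for k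
  proof (rule 3(1)[OF k])
    show "g ((w @ [k]) @ u) = us" if "subtree_at (ts ! k) u = Some (Inner us)" for u us
      using 3(2)[of "k # u" us] that k by simp
  qed
  have "(i, w) \<notin> (\<Union>k\<in>{..<length ts}. inner_at (ts ! k) i (w @ [k]))" using not_in_inner_at by blast
  moreover have "(\<Prod>a\<in>(\<Union>k\<in>{..<length ts}. inner_at (ts ! k) i (w @ [k])). vertex_factor p (g (snd a))) =
      (\<Prod>k\<in>{..<length ts}. \<Prod>a\<in>inner_at (ts ! k) i (w @ [k]). vertex_factor p (g (snd a)))"
    using at_disjoint(1)[of "\<lambda>k. ts ! k" i w "{..<length ts}"]
    by (intro prod.UNION_disjoint) (auto simp: disjoint_family_on_def)
  ultimately show ?case using IH \<open>g w = ts\<close> by (simp add: prod_list_map_nth)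
qed auto

lemma prod_vertex_factors:
  "(\<Prod>u\<in>inner_addresses Ts. vertex_factor p (children_at Ts u)) = (\<Prod>i<length Ts. tree_factor p (Ts ! i))"
proof -
  have "(\<Prod>u\<in>inner_addresses Ts. vertex_factor p (children_at Ts u)) =
      (\<Prod>i<length Ts. \<Prod>u\<in>inner_at (Ts ! i) i []. vertex_factor p (children_at Ts u))"
    unfolding addresses_families(1)[of Ts "\<lambda>i. Ts ! i", simplified] inners_def
    using roots_disjoint(1)[of "\<lambda>i. Ts ! i" "{..<length Ts}"]
    by (intro prod.UNION_disjoint) (auto simp: disjoint_family_on_def)
  also have "\<dots> = (\<Prod>i<length Ts. tree_factor p (Ts ! i))"
  proof (intro prod.cong refl)
    fix i assume "i \<in> {..<length Ts}"
    have "tree_factor p (Ts ! i) = (\<Prod>a\<in>inner_at (Ts ! i) i []. vertex_factor p (children_at Ts (i, snd a)))"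
      by (rule tree_factor_eq_prod) simp
    also have "\<dots> = (\<Prod>u\<in>inner_at (Ts ! i) i []. vertex_factor p (children_at Ts u))"
      by (intro prod.cong refl) (auto dest: at_prefix)
    finally show "(\<Prod>u\<in>inner_at (Ts ! i) i []. vertex_factor p (children_at Ts u)) = tree_factor p (Ts ! i)" ..
  qed
  finally show ?thesis .
qed

lemma position_parent: "position x y (parent u) = parent_pos (\<lambda>i. (0, x i)) y u"
  by (cases u) auto

text \<open>Without leaves of type two the addresses outside \<open>leaves1\<close> are the inner
  vertices, and the noise edges can be grouped by the block of their leaf. This is the form in which
  the limit of the translated integrals appears.\<close>

lemma graph_value_eq:
  fixes \<delta> :: real and x :: "nat \<Rightarrow> real ^ 'd"
  assumes T: "\<forall>i<length Ts. T i = Ts ! i" and I: "partition_on (leaves1 Ts) I" and l2: "leaves2 Ts = {}"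
  defines "V \<equiv> Tree_Vertex ` inners {..<length Ts} T \<union> Empty_Vertex ` I"
  shows "graph_value \<delta> m0 p c x (Ts, I) = (\<Prod>i<length Ts. tree_factor p (T i)) * (\<Prod>B\<in>I. c (card B)) *
    (LINT y : (\<Pi>\<^sub>E v\<in>V. Gam_neg \<delta>) | (\<Pi>\<^sub>M v\<in>V. Gam_measure \<delta>).
      (\<Prod>u\<in>inners {..<length Ts} T. green \<delta> m0 (parent_pos (\<lambda>i. (0, x i)) y u - y (Tree_Vertex u))) *
      (\<Prod>B\<in>I. \<Prod>u\<in>B. green \<delta> m0 (parent_pos (\<lambda>i. (0, x i)) y u - y (Empty_Vertex B))))"
proof -
  let ?A = "{..<length Ts}" and ?H = "reduced_graph Ts I"
  note af = addresses_families[of Ts T, OF T]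
  have dj: "inners ?A T \<inter> leaves1s ?A T = {}"
    unfolding af(1,2)[symmetric] by (auto simp: inner_addresses_def leaves1_def)
  have ad: "addresses Ts - leaves1 Ts = inners ?A T"
    using af l2 dj by auto
  have V: "verts ?H - range Root = V" unfolding V_def by (auto simp: reduced_graph_def ad)
  have fL: "finite (leaves1 Ts)" by (simp add: af(2))
  have fI: "finite I" by (rule finite_elements[OF fL I])
  have fB: "finite B" if "B \<in> I" for B using that partition_onD1[OF I] fL by (auto intro: finite_subset)
  have pr: "(\<Prod>e\<in>arcs ?H. green \<delta> m0 (position x y (tail ?H e) - position x y (head ?H e))) =
      (\<Prod>u\<in>inners ?A T. green \<delta> m0 (parent_pos (\<lambda>i. (0, x i)) y u - y (Tree_Vertex u))) *
      (\<Prod>B\<in>I. \<Prod>u\<in>B. green \<delta> m0 (parent_pos (\<lambda>i. (0, x i)) y u - y (Empty_Vertex B)))" (is "?l = ?r1 * ?r2") for y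
  proof -
    let ?g = "\<lambda>e. green \<delta> m0 (position x y (tail ?H e) - position x y (head ?H e))"
    have "?l = (\<Prod>e\<in>Tree_Edge ` inners ?A T. ?g e) * (\<Prod>e\<in>Noise_Edge ` leaves1 Ts. ?g e)"
    proof -
      have "arcs ?H = Tree_Edge ` inners ?A T \<union> Noise_Edge ` leaves1 Ts" by (simp add: reduced_graph_def ad)
      then show ?thesis using fL by (simp only:) (intro prod.union_disjoint, auto)
    qed
    also have "(\<Prod>e\<in>Tree_Edge ` inners ?A T. ?g e) = ?r1"
      by (subst prod.reindex) (auto simp: inj_on_def reduced_graph_def position_parent intro!: prod.cong)
    also have "(\<Prod>e\<in>Noise_Edge ` leaves1 Ts. ?g e) = (\<Prod>u\<in>leaves1 Ts. green \<delta> m0 (parent_pos (\<lambda>i. (0, x i)) y u - y (Empty_Vertex (block_of I u))))"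
      by (subst prod.reindex) (auto simp: inj_on_def reduced_graph_def position_parent intro!: prod.cong)
    also have "\<dots> = (\<Prod>B\<in>I. \<Prod>u\<in>B. green \<delta> m0 (parent_pos (\<lambda>i. (0, x i)) y u - y (Empty_Vertex (block_of I u))))"
      unfolding partition_onD1[OF I] using fB partition_onD2[OF I]
      by (intro prod.Union_disjoint[unfolded comp_def]) (auto simp: disjoint_def)
    also have "\<dots> = ?r2" using block_of_partition(2)[OF I] by (intro prod.cong refl) simp
    finally show ?thesis .
  qed
  have tf: "(\<Prod>i<length Ts. tree_factor p (Ts ! i)) = (\<Prod>i<length Ts. tree_factor p (T i))"
    using T by (intro prod.cong) auto
  show ?thesis unfolding graph_value_def Let_def prod.case V pr prod_vertex_factors tf ..
qed

lemma noise_pw_graphs_iff: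
  "(Ts, I) \<in> noise_pw_graphs p m n \<longleftrightarrow> length Ts = n \<and> (\<forall>T\<in>set Ts. admissible p T) \<and> sum_list (map inner_count Ts) = m \<and>
     partition_on (leaves1 Ts) I \<and> Digraph_Component.connected (pw_graph Ts I) \<and> leaves2 Ts = {}"
  by (simp add: noise_pw_graphs_def connected_pw_graphs_def trees_def conj_assoc)

text \<open>Lists of trees on one side, extensional functions on {..<n} on the other. The condition
  on leaves of type two is moved under the sum because the truncated moments at finite time run over
  all graphs, and those with such leaves tend to 0.\<close>

lemma sum_noise_pw_graphs:
  assumes n: "n \<ge> 1"
  shows "(\<Sum>g\<in>noise_pw_graphs p m n. h g) = (\<Sum>T\<in>tree_families p {..<n} m.
    \<Sum>I\<in>{I. partition_on (leaves1s {..<n} T) I \<and> conn {..<n} I}. if leaves2s {..<n} T = {} then h (map T [0..<n], I) else (0::real))"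
proof -
  let ?F = "{T \<in> tree_families p {..<n} m. leaves2s {..<n} T = {}}"
  let ?P = "\<lambda>T. {I. partition_on (leaves1s {..<n} T) I \<and> conn {..<n} I}"
  have fP: "finite (?P T)" for T
    using finitely_many_partition_on[OF finite_leaves1s[of "{..<n}" T]] by (rule finite_subset[rotated]) auto
  have fF: "finite (tree_families p {..<n} m)" by (rule finite_tree_families) simp
  have s: "sum_list (map inner_count Ts) = (\<Sum>i<length Ts. inner_count (Ts ! i))" for Ts
    by (simp add: sum_list_sum_nth lessThan_atLeast0)
  have "(\<Sum>g\<in>noise_pw_graphs p m n. h g) = (\<Sum>(T, I)\<in>(SIGMA T:?F. ?P T). h (map T [0..<n], I))"
  proof (rule sum.reindex_bij_witness[where j = "\<lambda>(Ts, I). (\<lambda>i\<in>{..<n}. Ts ! i, I)" and i = "\<lambda>(T, I). (map T [0..<n], I)"])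
    fix a assume "a \<in> noise_pw_graphs p m n"
    then obtain Ts I where a: "a = (Ts, I)" "length Ts = n" "\<forall>T\<in>set Ts. admissible p T" "sum_list (map inner_count Ts) = m"
        "partition_on (leaves1 Ts) I" "Digraph_Component.connected (pw_graph Ts I)" "leaves2 Ts = {}"
      by (auto simp: noise_pw_graphs_def connected_pw_graphs_def trees_def)
    have m: "map (\<lambda>i\<in>{..<n}. Ts ! i) [0..<n] = Ts" using a(2) by (intro nth_equalityI) auto
    then show "(case case a of (Ts, I) \<Rightarrow> (\<lambda>i\<in>{..<n}. Ts ! i, I) of (T, I) \<Rightarrow> (map T [0..<n], I)) = a" using a(1) by simp
    show "(case case a of (Ts, I) \<Rightarrow> (\<lambda>i\<in>{..<n}. Ts ! i, I) of (T, I) \<Rightarrow> h (map T [0..<n], I)) = h a" using a(1) m by simp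
    have T: "\<forall>i<length Ts. (\<lambda>i\<in>{..<n}. Ts ! i) i = Ts ! i" using a(2) by simp
    have "conn {..<n} I" using connected_pw_graph_iff[OF a(5)] a(2,6) n by (cases Ts) auto
    moreover have "(\<lambda>i\<in>{..<n}. Ts ! i) \<in> tree_families p {..<n} m"
      using a(2,3,4) by (auto simp: tree_families_def s)
    ultimately show "(case a of (Ts, I) \<Rightarrow> (\<lambda>i\<in>{..<n}. Ts ! i, I)) \<in> (SIGMA T:?F. ?P T)"
      using a(1,5,7) addresses_families(2,3)[OF T] a(2) by (simp only: prod.case mem_Sigma_iff mem_Collect_eq simp_thms)
  next
    fix b assume "b \<in> (SIGMA T:?F. ?P T)"
    then obtain T I where b: "b = (T, I)" "T \<in> tree_families p {..<n} m" "leaves2s {..<n} T = {}"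
      "partition_on (leaves1s {..<n} T) I" "conn {..<n} I" by auto
    let ?Ts = "map T [0..<n]"
    have l: "length ?Ts = n" by simp
    have T: "\<forall>i<length ?Ts. T i = ?Ts ! i" by simp
    note af = addresses_families[of ?Ts T, OF T, unfolded l]
    have "(\<lambda>i\<in>{..<n}. ?Ts ! i) = T"
    proof
      show "(\<lambda>i\<in>{..<n}. ?Ts ! i) k = T k" for k
        using b(2) by (cases "k < n") (auto simp: tree_families_def PiE_def extensional_def)
    qed
    then show "(case case b of (T, I) \<Rightarrow> (map T [0..<n], I) of (Ts, I) \<Rightarrow> (\<lambda>i\<in>{..<n}. Ts ! i, I)) = b"
      unfolding b(1) prod.case by (simp only:)
    have "conn {..<length ?Ts} I" using b(5) by simp
    then have cc: "Digraph_Component.connected (pw_graph ?Ts I)"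
      using connected_pw_graph_iff[of ?Ts I] b(4) n af(2) by simp
    have "sum_list (map inner_count ?Ts) = (\<Sum>i<length ?Ts. inner_count (?Ts ! i))" by (rule s)
    also have "\<dots> = (\<Sum>i<n. inner_count (T i))" by simp
    finally have sl: "sum_list (map inner_count ?Ts) = m" using b(2) by (simp only: tree_families_def mem_Collect_eq)
    have "\<forall>i<n. admissible p (T i)" using b(2) unfolding tree_families_def by (simp add: PiE_iff)
    then have ad: "\<forall>S\<in>set ?Ts. admissible p S" by simp
    have l1: "partition_on (leaves1 ?Ts) I" using af(2) b(4) by simp
    have l2: "leaves2 ?Ts = {}" using af(3) b(3) by simp
    have "(?Ts, I) \<in> noise_pw_graphs p m n"
      by (rule iffD2[OF noise_pw_graphs_iff conjI[OF l conjI[OF ad conjI[OF sl conjI[OF l1 conjI[OF cc l2]]]]]])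
    then show "(case b of (T, I) \<Rightarrow> (map T [0..<n], I)) \<in> noise_pw_graphs p m n"
      using b(1) by (simp only: prod.case)
  qed
  also have "\<dots> = (\<Sum>T\<in>?F. \<Sum>I\<in>?P T. h (map T [0..<n], I))"
    using fF by (intro sum.Sigma[symmetric] ballI fP) simp
  also have "\<dots> = (\<Sum>T\<in>tree_families p {..<n} m. if leaves2s {..<n} T = {} then \<Sum>I\<in>?P T. h (map T [0..<n], I) else 0)"
    by (rule sum.inter_filter[OF fF])
  also have "\<dots> = (\<Sum>T\<in>tree_families p {..<n} m. \<Sum>I\<in>?P T. if leaves2s {..<n} T = {} then h (map T [0..<n], I) else 0)"
  proof (intro sum.cong refl)
    fix T
    show "(if leaves2s {..<n} T = {} then \<Sum>I\<in>?P T. h (map T [0..<n], I) else 0) =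
        (\<Sum>I\<in>?P T. if leaves2s {..<n} T = {} then h (map T [0..<n], I) else 0)"
      by (cases "leaves2s {..<n} T = {}") (simp_all only: if_True if_False simp_thms sum.neutral_const)
  qed
  finally show ?thesis .
qed

section \<open>The limit of large times\<close>

text \<open>Boxes determine the product measure, and the preimage of a box under a coordinatewise
  map is a box.\<close>

lemma (in product_sigma_finite) distr_PiM_map:
  assumes I: "finite I" and f: "\<And>i. i \<in> I \<Longrightarrow> f i \<in> M i \<rightarrow>\<^sub>M M i" "\<And>i. i \<in> I \<Longrightarrow> distr (M i) (M i) (f i) = M i"
  shows "distr (PiM I M) (PiM I M) (\<lambda>y. \<lambda>i\<in>I. f i (y i)) = PiM I M"
proof (rule PiM_eqI[OF I])
  interpret finite_product_sigma_finite M I by unfold_locales (rule I)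
  have m: "(\<lambda>y. \<lambda>i\<in>I. f i (y i)) \<in> PiM I M \<rightarrow>\<^sub>M PiM I M"
  proof (rule measurable_restrict)
    fix i assume i: "i \<in> I"
    show "(\<lambda>y. f i (y i)) \<in> PiM I M \<rightarrow>\<^sub>M M i"
      by (rule measurable_compose[where f = "\<lambda>y. y i" and g = "f i", OF measurable_component_singleton[OF i, where M = M] f(1)[OF i]])
  qed
  fix A assume A: "\<And>i. i \<in> I \<Longrightarrow> A i \<in> sets (M i)"
  have e: "(\<lambda>y. \<lambda>i\<in>I. f i (y i)) -` Pi\<^sub>E I A \<inter> space (PiM I M) = Pi\<^sub>E I (\<lambda>i. f i -` A i \<inter> space (M i))"
    by (auto simp: space_PiM PiE_iff)
  have "emeasure (distr (PiM I M) (PiM I M) (\<lambda>y. \<lambda>i\<in>I. f i (y i))) (Pi\<^sub>E I A) = emeasure (PiM I M) (Pi\<^sub>E I (\<lambda>i. f i -` A i \<inter> space (M i)))"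
    using A I by (subst emeasure_distr[OF m]) (auto simp: e intro!: sets_PiM_I_finite)
  also have "\<dots> = (\<Prod>i\<in>I. emeasure (M i) (f i -` A i \<inter> space (M i)))"
    using A f(1) I by (intro emeasure_PiM) (auto intro: measurable_sets)
  also have "\<dots> = (\<Prod>i\<in>I. emeasure (distr (M i) (M i) (f i)) (A i))"
    using A f(1) by (intro prod.cong refl) (simp add: emeasure_distr)
  also have "\<dots> = (\<Prod>i\<in>I. emeasure (M i) (A i))" using f(2) by (intro prod.cong refl) simp
  finally show "emeasure (distr (PiM I M) (PiM I M) (\<lambda>y. \<lambda>i\<in>I. f i (y i))) (Pi\<^sub>E I A) = (\<Prod>i\<in>I. emeasure (M i) (A i))" .
qed simp

section \<open>The Green function, the noise and the initial value as an instance\<close>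

locale parisi_wu = noise_field \<delta> m0 a \<sigma> z r P Y
  for \<delta> m0 a \<sigma> z r and P :: "((real \<times> (real ^ 'd::finite) \<Rightarrow> real) \<Rightarrow> real) measure" and Y +
  fixes p :: nat and f :: "real ^ 'd \<Rightarrow> real"
  assumes f: "f \<in> schwartz_lattice \<delta>"
begin

abbreviation G :: "(real \<times> (real ^ 'd)) measure" where "G \<equiv> Gam_measure \<delta>"

abbreviation kernel :: "real \<times> (real ^ 'd) \<Rightarrow> real \<times> (real ^ 'd) \<Rightarrow> real" where
  "kernel x y \<equiv> green \<delta> m0 (x - y)"

definition initial :: "real \<times> (real ^ 'd) \<Rightarrow> real" where
  "initial = (\<lambda>(t, x). if t > 0 then conv_lattice \<delta> (heat_kernel \<delta> m0 t) f x else 0)"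

text \<open>A definite constant is required as a parameter of the instances below, hence the choice
  operator.\<close>

definition f_bound :: real where "f_bound = (SOME C. C \<ge> 0 \<and> (\<forall>y. \<bar>f y\<bar> \<le> C))"

lemma f_bound: "f_bound \<ge> 0" "\<bar>f y\<bar> \<le> f_bound"
proof -
  have h: "(\<forall>x. x \<notin> lattice \<delta> \<longrightarrow> f x = 0) \<and> (\<forall>N::nat. bdd_above ((\<lambda>x. (1 + (norm x)\<^sup>2) ^ N * \<bar>f x\<bar>) ` lattice \<delta>))"
    using f unfolding schwartz_lattice_def mem_Collect_eq .
  note f0 = h[THEN conjunct1]
  from h[THEN conjunct2, rule_format, of 0] obtain C where C: "\<And>x. x \<in> lattice \<delta> \<Longrightarrow> \<bar>f x\<bar> \<le> C" by (auto simp: bdd_above_def)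
  have "\<bar>f y\<bar> \<le> max C 0" for y using C[of y] f0 by (cases "y \<in> lattice \<delta>") (auto simp: le_max_iff_disj)
  then have "\<exists>C. C \<ge> 0 \<and> (\<forall>y. \<bar>f y\<bar> \<le> C)" by (intro exI[of _ "max C 0"]) auto
  from someI_ex[OF this] show "f_bound \<ge> 0" "\<bar>f y\<bar> \<le> f_bound" unfolding f_bound_def by auto
qed

lemma abs_initial_le: "w \<in> Gam \<delta> \<Longrightarrow> fst w \<ge> 0 \<Longrightarrow> \<bar>initial w\<bar> \<le> f_bound * exp (- m0\<^sup>2 * fst w)"
  using abs_conv_lattice_le[of "snd w" "fst w" f f_bound] f_bound by (auto simp: initial_def Gam_def split: prod.split)

lemma abs_initial_le': "w \<in> Gam \<delta> \<Longrightarrow> \<bar>initial w\<bar> \<le> f_bound"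
proof (cases "fst w > 0")
  case True
  assume w: "w \<in> Gam \<delta>"
  have "f_bound * exp (- m0\<^sup>2 * fst w) \<le> f_bound * 1" using f_bound True by (intro mult_left_mono) auto
  then show ?thesis using abs_initial_le[OF w] True by simp
next
  case False
  then show ?thesis using f_bound(1) by (cases w) (simp add: initial_def)
qed

lemma tree_kernel_green: "tree_kernel G kernel (1 / m0\<^sup>2) kmax"
proof -
  interpret sigma_finite_measure G by (rule sigma_finite_Gam_measure)
  show ?thesis
  proof unfold_locales
    show "(\<lambda>(x, y). kernel x y) \<in> borel_measurable (G \<Otimes>\<^sub>M G)" by (rule green_diff_measurable)
    fix x assume x: "x \<in> space G"
    then show "(\<integral>\<^sup>+y. ennreal (kernel x y) \<partial>G) \<le> ennreal (1 / m0\<^sup>2)" by (simp add: nn_integral_green)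
    fix y assume "y \<in> space G"
    then have "x - y \<in> Gam \<delta>" using x by (intro Gam_minus) auto
    then show "kernel x y \<ge> 0" "kernel x y \<le> kmax" unfolding kmax_def by (rule green_nonneg, rule green_le)
  qed
qed

text \<open>Empty vertices are confined to positive times because the noise law charges only the
  positive half. The initial time is visible in the graph integrals only through this region and
  through the leaves of type two.\<close>

sublocale S: noise_tree_solution G kernel "1 / m0\<^sup>2" kmax P Y initial f_bound "Gam_pos \<delta>" "levy_cumulant a \<sigma> z r" p
  "\<lambda>\<xi>. solution_coeff \<delta> m0 p f (Y \<xi>)"
proof -
  interpret tree_kernel G kernel "1 / m0\<^sup>2" kmax by (rule tree_kernel_green)
  have mb: "\<exists>C. \<forall>(S :: address set) w. finite S \<longrightarrow> card S = n \<longrightarrow> (\<forall>u\<in>S. w u \<in> space G) \<longrightarrow>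
      (\<integral>\<^sup>+\<xi>. (\<Prod>u\<in>S. ennreal \<bar>Y \<xi> (w u)\<bar>) \<partial>P) \<le> ennreal C" for n
    using moment_bound[of n] by simp
  show "noise_tree_solution G kernel (1 / m0\<^sup>2) kmax P Y initial f_bound (Gam_pos \<delta>) (levy_cumulant a \<sigma> z r) p
     (\<lambda>\<xi>. solution_coeff \<delta> m0 p f (Y \<xi>))"
  proof unfold_locales
    show "(\<lambda>(\<omega>, x). Y \<omega> x) \<in> borel_measurable (P \<Otimes>\<^sub>M G)" by (rule Y_joint)
    show "initial \<in> borel_measurable G" unfolding initial_def by (rule conv_lattice_measurable)
    show "\<bar>initial x\<bar> \<le> f_bound" if "x \<in> space G" for x using abs_initial_le'[of x] that by simp
    show "f_bound \<ge> 0" by (rule f_bound)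
    show "Gam_pos \<delta> \<in> sets G" by (rule Gam_pos_sets)
    show "(LINT \<omega> | P. (\<Prod>u\<in>S. Y \<omega> (w u))) = (\<Sum>\<pi>\<in>{\<pi>. partition_on S \<pi>}. \<Prod>B\<in>\<pi>. levy_cumulant a \<sigma> z r (card B) *
        (LINT y | G. indicator (Gam_pos \<delta>) y * (\<Prod>u\<in>B. kernel (w u) y)))"
      if "finite S" "\<And>u. u \<in> S \<Longrightarrow> w u \<in> space G" for S :: "address set" and w
      by (rule expectation_prod_Y(2)) (use that in auto)
    show "solution_coeff \<delta> m0 p f (Y \<omega>) 0 x = Y \<omega> x + initial x" if "x \<in> space G" for \<omega> x
      by (subst solution_coeff.simps) (simp add: initial_def split: prod.split)
    show "solution_coeff \<delta> m0 p f (Y \<omega>) j x = (LINT y | G. kernel x y *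
        (\<Sum>\<nu>\<in>multiplicities p j. fact p / (\<Prod>i<j. fact (\<nu> i)) * (\<Prod>i<j. solution_coeff \<delta> m0 p f (Y \<omega>) i y ^ \<nu> i)))"
      if "j \<ge> 1" for \<omega> x j
      using that by (subst solution_coeff.simps) (simp add: conv_Gam_def)
  qed (rule mb)
qed

text \<open>The same trees without noise and initial value: their integrands dominate all the others.\<close>

sublocale Z: noise_tree_kernel G kernel "1 / m0\<^sup>2" kmax P "\<lambda>_ _. 0" "\<lambda>_. 1" 1 "Gam \<delta>" "\<lambda>_. 0"
proof unfold_locales
  show "Gam \<delta> \<in> sets G" using sets.top[of G] by simp
  show "(LINT \<omega> | P. (\<Prod>u\<in>S. 0)) = (\<Sum>\<pi>\<in>{\<pi>. partition_on S \<pi>}. \<Prod>B\<in>\<pi>. 0 * (LINT y | G. indicator (Gam \<delta>) y * (\<Prod>u\<in>B. kernel (w u) y)))"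
    if S: "finite S" for S :: "address set" and w
  proof (cases "S = {}")
    case True
    then show ?thesis by (simp add: P.prob_space)
  next
    case False
    have "(\<Prod>B\<in>\<pi>. 0 * (LINT y | G. indicator (Gam \<delta>) y * (\<Prod>u\<in>B. kernel (w u) y))) = 0" if "partition_on S \<pi>" for \<pi>
    proof -
      have "\<pi> \<noteq> {}" "finite \<pi>" using that False finite_elements[OF S that] by (auto simp: partition_on_def)
      then show ?thesis by auto
    qed
    then have "(\<Sum>\<pi>\<in>{\<pi>. partition_on S \<pi>}. \<Prod>B\<in>\<pi>. 0 * (LINT y | G. indicator (Gam \<delta>) y * (\<Prod>u\<in>B. kernel (w u) y))) = 0"
      by (intro sum.neutral ballI) blast
    moreover have "(\<Prod>u\<in>S. 0 :: real) = 0" using S False by (auto simp: prod_zero_iff)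
    ultimately show ?thesis by simp
  qed
  show "\<exists>C. \<forall>(S :: address set) w. finite S \<longrightarrow> card S = n \<longrightarrow> (\<forall>u\<in>S. w u \<in> space G) \<longrightarrow>
      (\<integral>\<^sup>+\<omega>. (\<Prod>u\<in>S. ennreal \<bar>0\<bar>) \<partial>P) \<le> ennreal C" for n
    by (intro exI[of _ 1]) (auto simp: P.emeasure_space_1 prod_constant power_0_left)
qed auto

section \<open>Translation in time and the limit of graph values\<close>

definition shift :: "real \<Rightarrow> real \<times> (real ^ 'd) \<Rightarrow> real \<times> (real ^ 'd)" where
  "shift t y = (fst y + t, snd y)"

lemma shift_measurable: "shift t \<in> G \<rightarrow>\<^sub>M G"
  unfolding shift_def Gam_measure_def by measurable

lemma shift_Gam: "y \<in> Gam \<delta> \<Longrightarrow> shift t y \<in> Gam \<delta>"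
  by (auto simp: shift_def Gam_def)

lemma kernel_shift: "kernel (shift t x) (shift t y) = kernel x y"
  by (cases x; cases y) (simp add: shift_def)

lemma distr_shift_PiM:
  assumes "finite V"
  shows "distr (PiM V (\<lambda>_. G)) (PiM V (\<lambda>_. G)) (\<lambda>y. \<lambda>v\<in>V. shift t (y v)) = PiM V (\<lambda>_. G)"
proof -
  interpret sigma_finite_measure G by (rule sigma_finite_Gam_measure)
  interpret product_sigma_finite "\<lambda>_ :: 'b. G" by unfold_locales
  show ?thesis using assms shift_measurable distr_Gam_shift[of t]
    by (intro distr_PiM_map) (auto simp: shift_def[abs_def])
qed

definition shifted_integrand :: "real \<Rightarrow> nat set \<Rightarrow> (nat \<Rightarrow> ptree) \<Rightarrow> (nat \<Rightarrow> real ^ 'd) \<Rightarrow> address set set \<Rightarrow>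
    (vertex \<Rightarrow> real \<times> (real ^ 'd)) \<Rightarrow> real" where
  "shifted_integrand t A T x I y = S.kprod A T (\<lambda>i. (0, x i)) y *
     (\<Prod>u\<in>leaves2s A T. initial (shift t (parent_pos (\<lambda>i. (0, x i)) y u))) *
     (\<Prod>B\<in>I. indicator (Gam_pos \<delta>) (shift t (y (Empty_Vertex B))) *
       (\<Prod>u\<in>B. kernel (parent_pos (\<lambda>i. (0, x i)) y u) (y (Empty_Vertex B))))"

text \<open>Kernels depend on differences and do not notice the translation; t survives only in the
  initial values and in the cut-off for empty vertices.\<close>

lemma value_integrand_shift:
  assumes I: "\<And>B. B \<in> I \<Longrightarrow> B \<subseteq> leaves1s A T"
  shows "S.value_integrand A T (\<lambda>i. (t, x i)) I (\<lambda>v\<in>S.value_verts A T I. shift t (y v)) = shifted_integrand t A T x I y"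
proof -
  let ?y = "\<lambda>v\<in>S.value_verts A T I. shift t (y v)"
  have V: "Tree_Vertex u \<in> S.value_verts A T I \<longleftrightarrow> u \<in> inners A T" "Empty_Vertex B \<in> S.value_verts A T I \<longleftrightarrow> B \<in> I" for u B
    by (auto simp: S.value_verts_def)
  have pp: "parent_pos (\<lambda>i. (t, x i)) ?y u = shift t (parent_pos (\<lambda>i. (0, x i)) y u)"
    if "u \<in> inners A T \<union> leaves1s A T \<union> leaves2s A T" for u
  proof (cases u)
    case (Pair i w)
    then show ?thesis using parent_in_inners[of i w A T] that V by (auto simp: shift_def)
  qed
  have "S.kprod A T (\<lambda>i. (t, x i)) ?y = S.kprod A T (\<lambda>i. (0, x i)) y"
    unfolding S.kprod_def using pp V by (intro prod.cong refl) (simp add: kernel_shift)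
  moreover have "(\<Prod>u\<in>leaves2s A T. initial (parent_pos (\<lambda>i. (t, x i)) ?y u)) = (\<Prod>u\<in>leaves2s A T. initial (shift t (parent_pos (\<lambda>i. (0, x i)) y u)))"
    using pp by (intro prod.cong refl) simp
  moreover have "S.block_factor (\<lambda>i. (t, x i)) ?y B (?y (Empty_Vertex B)) =
      indicator (Gam_pos \<delta>) (shift t (y (Empty_Vertex B))) * (\<Prod>u\<in>B. kernel (parent_pos (\<lambda>i. (0, x i)) y u) (y (Empty_Vertex B)))"
    if B: "B \<in> I" for B
  proof -
    have "(\<Prod>u\<in>B. kernel (parent_pos (\<lambda>i. (t, x i)) ?y u) (?y (Empty_Vertex B))) =
        (\<Prod>u\<in>B. kernel (parent_pos (\<lambda>i. (0, x i)) y u) (y (Empty_Vertex B)))"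
      using I[OF B] B V by (intro prod.cong refl) (simp add: pp subsetD kernel_shift)
    then show ?thesis using V B by (simp add: S.block_factor_def)
  qed
  ultimately show ?thesis unfolding S.value_integrand_def S.fprod_def shifted_integrand_def by simp
qed

text \<open>A change of variables by the measure-preserving translation of all coordinates, which
  places the roots at time 0 and leaves a domain that does not depend on t.\<close>

lemma graph_val_shift:
  assumes A: "finite A" and x: "x ` A \<subseteq> lattice \<delta>" and I: "partition_on (leaves1s A T) I"
  shows "S.graph_val A T (\<lambda>i. (t, x i)) I = (LINT y | PiM (S.value_verts A T I) (\<lambda>_. G). shifted_integrand t A T x I y)"
    "shifted_integrand t A T x I \<in> borel_measurable (PiM (S.value_verts A T I) (\<lambda>_. G))"
proof -
  let ?V = "S.value_verts A T I" and ?sh = "\<lambda>y. \<lambda>v\<in>S.value_verts A T I. shift t (y v)"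
  note pl = S.partition_leaves[OF A I]
  have x': "(\<lambda>i. (t, x i)) ` A \<subseteq> space G" using x by (auto simp: Gam_def)
  have fV: "finite ?V" using pl(1) A by (simp add: S.value_verts_def)
  have m: "?sh \<in> PiM ?V (\<lambda>_. G) \<rightarrow>\<^sub>M PiM ?V (\<lambda>_. G)"
  proof (rule measurable_restrict)
    fix v assume v: "v \<in> ?V"
    show "(\<lambda>y. shift t (y v)) \<in> PiM ?V (\<lambda>_. G) \<rightarrow>\<^sub>M G"
      by (rule measurable_compose[where f = "\<lambda>y. y v" and g = "shift t", OF measurable_component_singleton[OF v] shift_measurable])
  qed
  have g: "S.value_integrand A T (\<lambda>i. (t, x i)) I \<in> borel_measurable (PiM ?V (\<lambda>_. G))"
    by (intro borel_measurable_integrable S.graph_val_fold(1) A x' pl)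
  have e: "(\<lambda>y. S.value_integrand A T (\<lambda>i. (t, x i)) I (?sh y)) = shifted_integrand t A T x I"
    using value_integrand_shift[OF pl(2)] by auto
  show "shifted_integrand t A T x I \<in> borel_measurable (PiM ?V (\<lambda>_. G))"
    using measurable_compose[OF m g] by (simp only: e)
  have "S.graph_val A T (\<lambda>i. (t, x i)) I = (LINT y | distr (PiM ?V (\<lambda>_. G)) (PiM ?V (\<lambda>_. G)) ?sh. S.value_integrand A T (\<lambda>i. (t, x i)) I y)"
    unfolding S.graph_val_def distr_shift_PiM[OF fV] ..
  also have "\<dots> = (LINT y | PiM ?V (\<lambda>_. G). S.value_integrand A T (\<lambda>i. (t, x i)) I (?sh y))"
    by (rule integral_distr[OF m g])
  finally show "S.graph_val A T (\<lambda>i. (t, x i)) I = (LINT y | PiM ?V (\<lambda>_. G). shifted_integrand t A T x I y)"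
    by (simp only: e)
qed

lemma indicator_shift_eventually:
  assumes "w \<in> Gam \<delta>"
  shows "\<forall>\<^sub>F t in at_top. indicator (Gam_pos \<delta>) (shift t w) = (1 :: real)"
  using eventually_gt_at_top[of "- fst w"]
proof eventually_elim
  case (elim t)
  then have "shift t w \<in> Gam_pos \<delta>" using assms by (auto simp: shift_def Gam_def Gam_pos_def)
  then show ?case by simp
qed

lemma initial_shift_tendsto:
  assumes w: "w \<in> Gam \<delta>"
  shows "((\<lambda>t. initial (shift t w)) \<longlongrightarrow> 0) at_top"
proof (rule Lim_null_comparison)
  show "\<forall>\<^sub>F t in at_top. norm (initial (shift t w)) \<le> f_bound * exp (- m0\<^sup>2 * (fst w + t))"
    using eventually_ge_at_top[of "- fst w"]
  proof eventually_elim
    case (elim t)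
    then show ?case using abs_initial_le[OF shift_Gam[OF w], of t] by (simp add: shift_def)
  qed
  have "filterlim (\<lambda>t. m0\<^sup>2 * (fst w + t)) at_top at_top"
    using m0 by (intro filterlim_tendsto_pos_mult_at_top[OF tendsto_const] filterlim_tendsto_add_at_top[OF tendsto_const] filterlim_ident) auto
  then have "filterlim (\<lambda>t. - (m0\<^sup>2 * (fst w + t))) at_bot at_top" by (simp add: filterlim_uminus_at_bot)
  from tendsto_mult_right_zero[OF filterlim_compose[OF exp_at_bot this]]
  show "((\<lambda>t. f_bound * exp (- m0\<^sup>2 * (fst w + t))) \<longlongrightarrow> 0) at_top" by simp
qed

text \<open>No restriction to negative times is imposed; it will follow from the support of the
  kernels.\<close>

definition limit_integrand :: "nat set \<Rightarrow> (nat \<Rightarrow> ptree) \<Rightarrow> (nat \<Rightarrow> real ^ 'd) \<Rightarrow> address set set \<Rightarrow>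
    (vertex \<Rightarrow> real \<times> (real ^ 'd)) \<Rightarrow> real" where
  "limit_integrand A T x I y = (\<Prod>u\<in>inners A T. kernel (parent_pos (\<lambda>i. (0, x i)) y u) (y (Tree_Vertex u))) *
     (\<Prod>B\<in>I. \<Prod>u\<in>B. kernel (parent_pos (\<lambda>i. (0, x i)) y u) (y (Empty_Vertex B)))"

text \<open>Up to a constant the majorant is the integrand without cut-off and with leaves of type
  two set to 1, that is, the one of the instance \<open>Z\<close>, whose integrability is already
  known. Pointwise, each cut-off is eventually 1, while a single leaf of type two forces the limit
  0.\<close>

lemma limit_integrand:
  assumes A: "finite A" and x: "x ` A \<subseteq> lattice \<delta>" and I: "partition_on (leaves1s A T) I"
  shows "integrable (PiM (S.value_verts A T I) (\<lambda>_. G)) (limit_integrand A T x I)"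
    "y \<in> space (PiM (S.value_verts A T I) (\<lambda>_. G)) \<Longrightarrow> \<bar>shifted_integrand t A T x I y\<bar> \<le> limit_integrand A T x I y * f_bound ^ card (leaves2s A T)"
    "y \<in> space (PiM (S.value_verts A T I) (\<lambda>_. G)) \<Longrightarrow>
       ((\<lambda>t. shifted_integrand t A T x I y) \<longlongrightarrow> (if leaves2s A T = {} then limit_integrand A T x I y else 0)) at_top"
proof -
  let ?V = "S.value_verts A T I" and ?x = "\<lambda>i. (0, x i) :: real \<times> (real ^ 'd)"
  note pl = S.partition_leaves[OF A I]
  have x': "?x ` A \<subseteq> space G" using x by (auto simp: Gam_def)
  have Vs: "Tree_Vertex ` inners A T \<subseteq> ?V" "\<And>B. B \<in> I \<Longrightarrow> Empty_Vertex B \<in> ?V" by (auto simp: S.value_verts_def)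
  have E: "y (Empty_Vertex B) \<in> Gam \<delta>" if "y \<in> space (PiM ?V (\<lambda>_. G))" "B \<in> I" for y B
    using that Vs(2) by (auto simp: space_PiM dest: PiE_mem)
  have pp: "parent_pos ?x y u \<in> Gam \<delta>"
    if "y \<in> space (PiM ?V (\<lambda>_. G))" "u \<in> inners A T \<union> leaves1s A T \<union> leaves2s A T" for y u
    using S.parent_pos_space[OF that(2) x' that(1) Vs(1)] by simp
  have "integrable (PiM ?V (\<lambda>_. G)) (Z.value_integrand A T ?x I)"
    using Z.graph_val_fold(1)[OF A x' pl] by (simp add: S.value_verts_def Z.value_verts_def)
  \<comment> \<open>On the product space all positions lie in \<Gamma>, so the indicator in the
    block factors of \<open>Z\<close> is 1.\<close>
  also have "?this \<longleftrightarrow> integrable (PiM ?V (\<lambda>_. G)) (limit_integrand A T x I)"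
    using E by (intro Bochner_Integration.integrable_cong refl)
      (simp add: Z.value_integrand_def Z.fprod_def S.kprod_def Z.block_factor_def limit_integrand_def)
  finally show "integrable (PiM ?V (\<lambda>_. G)) (limit_integrand A T x I)" .
  assume y: "y \<in> space (PiM ?V (\<lambda>_. G))"
  have knn: "S.kprod A T ?x y \<ge> 0" by (rule S.kprod_nonneg[OF x' y Vs(1)])
  have bnn: "(\<Prod>u\<in>B. kernel (parent_pos ?x y u) (y (Empty_Vertex B))) \<ge> 0" if "B \<in> I" for B
    using pl(2)[OF that] by (intro prod_nonneg green_nonneg Gam_minus pp[OF y] E[OF y that]) auto
  have l2: "(\<Prod>u\<in>leaves2s A T. \<bar>initial (shift t (parent_pos ?x y u))\<bar>) \<le> f_bound ^ card (leaves2s A T)"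
  proof -
    have "(\<Prod>u\<in>leaves2s A T. \<bar>initial (shift t (parent_pos ?x y u))\<bar>) \<le> (\<Prod>u\<in>leaves2s A T. f_bound)"
      by (intro prod_mono conjI abs_ge_zero abs_initial_le' shift_Gam pp[OF y]) auto
    then show ?thesis by simp
  qed
  have ib: "\<bar>\<Prod>B\<in>I. indicator (Gam_pos \<delta>) (shift t (y (Empty_Vertex B))) * (\<Prod>u\<in>B. kernel (parent_pos ?x y u) (y (Empty_Vertex B)))\<bar>
      \<le> (\<Prod>B\<in>I. \<Prod>u\<in>B. kernel (parent_pos ?x y u) (y (Empty_Vertex B)))"
    unfolding abs_prod using bnn by (intro prod_mono) (auto simp: indicator_def abs_mult)
  have "\<bar>shifted_integrand t A T x I y\<bar> \<le> (S.kprod A T ?x y * f_bound ^ card (leaves2s A T)) *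
      (\<Prod>B\<in>I. \<Prod>u\<in>B. kernel (parent_pos ?x y u) (y (Empty_Vertex B)))"
    unfolding shifted_integrand_def abs_mult using knn l2
    by (intro mult_mono ib mult_nonneg_nonneg) (auto simp: abs_prod intro!: prod_nonneg mult_nonneg_nonneg zero_le_power f_bound)
  then show "\<bar>shifted_integrand t A T x I y\<bar> \<le> limit_integrand A T x I y * f_bound ^ card (leaves2s A T)"
    by (simp add: limit_integrand_def S.kprod_def mult_ac)
  have l2t: "((\<lambda>t. \<Prod>u\<in>leaves2s A T. initial (shift t (parent_pos ?x y u))) \<longlongrightarrow> (\<Prod>u\<in>leaves2s A T. 0)) at_top"
    by (intro tendsto_prod initial_shift_tendsto pp[OF y]) auto
  have bt: "((\<lambda>t. \<Prod>B\<in>I. indicator (Gam_pos \<delta>) (shift t (y (Empty_Vertex B))) * (\<Prod>u\<in>B. kernel (parent_pos ?x y u) (y (Empty_Vertex B))))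
      \<longlongrightarrow> (\<Prod>B\<in>I. 1 * (\<Prod>u\<in>B. kernel (parent_pos ?x y u) (y (Empty_Vertex B))))) at_top"
    by (intro tendsto_prod tendsto_mult tendsto_const tendsto_eventually indicator_shift_eventually E[OF y])
  \<comment> \<open>An empty product is 1, a nonempty product of zeros is 0: this singles out the
    graphs without leaves of type two.\<close>
  have c0: "(\<Prod>u\<in>leaves2s A T. 0 :: real) = (if leaves2s A T = {} then 1 else 0)"
    using A by (auto simp: prod_constant power_0_left card_eq_0_iff)
  have "((\<lambda>t. shifted_integrand t A T x I y) \<longlongrightarrow> S.kprod A T ?x y * (\<Prod>u\<in>leaves2s A T. 0) *
      (\<Prod>B\<in>I. 1 * (\<Prod>u\<in>B. kernel (parent_pos ?x y u) (y (Empty_Vertex B))))) at_top"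
    unfolding shifted_integrand_def by (intro tendsto_mult tendsto_const l2t bt)
  also have "S.kprod A T ?x y * (\<Prod>u\<in>leaves2s A T. 0) *
      (\<Prod>B\<in>I. 1 * (\<Prod>u\<in>B. kernel (parent_pos ?x y u) (y (Empty_Vertex B)))) = (if leaves2s A T = {} then limit_integrand A T x I y else 0)"
    unfolding c0 by (simp add: limit_integrand_def S.kprod_def)
  finally show "((\<lambda>t. shifted_integrand t A T x I y) \<longlongrightarrow> (if leaves2s A T = {} then limit_integrand A T x I y else 0)) at_top" .
qed

text \<open>Dominated convergence along the continuous parameter t, with a majorant independent of
  t.\<close>

lemma graph_val_tendsto:
  assumes A: "finite A" and x: "x ` A \<subseteq> lattice \<delta>" and I: "partition_on (leaves1s A T) I"
  shows "((\<lambda>t. S.graph_val A T (\<lambda>i. (t, x i)) I) \<longlongrightarrow>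
    (if leaves2s A T = {} then LINT y | PiM (S.value_verts A T I) (\<lambda>_. G). limit_integrand A T x I y else 0)) at_top"
proof -
  let ?M = "PiM (S.value_verts A T I) (\<lambda>_. G)" and ?f = "\<lambda>y. if leaves2s A T = {} then limit_integrand A T x I y else 0"
  note li = limit_integrand[OF A x I]
  have fm: "?f \<in> borel_measurable ?M" using borel_measurable_integrable[OF li(1)] by (cases "leaves2s A T = {}") simp_all
  have "((\<lambda>t. LINT y | ?M. shifted_integrand t A T x I y) \<longlongrightarrow> (LINT y | ?M. ?f y)) at_top"
  proof (rule integral_dominated_convergence_at_top[OF fm _ _ _ ])
    show "integrable ?M (\<lambda>y. limit_integrand A T x I y * f_bound ^ card (leaves2s A T))" by (intro integrable_mult_left li(1))
    show "shifted_integrand t A T x I \<in> borel_measurable ?M" for t by (rule graph_val_shift(2)[OF A x I])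
    show "\<forall>\<^sub>F t in at_top. AE y in ?M. norm (shifted_integrand t A T x I y) \<le> limit_integrand A T x I y * f_bound ^ card (leaves2s A T)"
    proof (rule always_eventually, rule allI, rule AE_I2)
      fix t y assume "y \<in> space ?M"
      from li(2)[OF this, of t] show "norm (shifted_integrand t A T x I y) \<le> limit_integrand A T x I y * f_bound ^ card (leaves2s A T)"
        by simp
    qed
    show "AE y in ?M. ((\<lambda>t. shifted_integrand t A T x I y) \<longlongrightarrow> ?f y) at_top"
      using li(3) by (intro AE_I2)
  qed
  then show ?thesis by (cases "leaves2s A T = {}") (simp_all add: graph_val_shift(1)[OF A x I])
qed

lemma green_pos_time: "green \<delta> m0 w \<noteq> 0 \<Longrightarrow> fst w > 0"
  by (cases w) (auto simp: green_def split: if_splits)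

text \<open>Causality: a nonzero kernel forces its second argument to be strictly earlier. From the
  roots at time 0 it follows that all inner vertices and then all empty vertices have negative
  times, so integrating over \<Gamma> or over its negative half makes no difference.\<close>

lemma limit_integrand_support:
  assumes A: "finite A" and x: "x ` A \<subseteq> lattice \<delta>" and I: "partition_on (leaves1s A T) I"
    and y: "y \<in> space (PiM (S.value_verts A T I) (\<lambda>_. G))" and nz: "limit_integrand A T x I y \<noteq> 0"
  shows "y \<in> (\<Pi>\<^sub>E v\<in>S.value_verts A T I. Gam_neg \<delta>)"
proof -
  let ?x = "\<lambda>i. (0, x i) :: real \<times> (real ^ 'd)"
  note pl = S.partition_leaves[OF A I]
  have "finite (inners A T)" "finite I" "\<And>B. B \<in> I \<Longrightarrow> finite B"
    using A pl by (auto intro: finite_subset[OF _ finite_leaves1s])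
  then have nz': "\<forall>u\<in>inners A T. kernel (parent_pos ?x y u) (y (Tree_Vertex u)) \<noteq> 0"
      "\<forall>B\<in>I. \<forall>u\<in>B. kernel (parent_pos ?x y u) (y (Empty_Vertex B)) \<noteq> 0"
    using nz unfolding limit_integrand_def by (simp_all add: prod_zero_iff)
  have k: "kernel (parent_pos ?x y u) (y (Tree_Vertex u)) \<noteq> 0" if "u \<in> inners A T" for u
    using nz'(1) that by blast
  have e: "kernel (parent_pos ?x y u) (y (Empty_Vertex B)) \<noteq> 0" if "B \<in> I" "u \<in> B" for u B
    using nz'(2) that by blast
  \<comment> \<open>Induction along the path from the root; the empty path addresses the neighbour
    of the root, whose parent sits at time 0.\<close>
  have tv: "fst (y (Tree_Vertex (i, w))) < 0" if "(i, w) \<in> inners A T" for i w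
    using that
  proof (induction w rule: rev_induct)
    case Nil
    then show ?case using green_pos_time[OF k[OF Nil]] by simp
  next
    case (snoc l w)
    have "(i, w) \<in> inners A T" using parent_in_inners(2)[of i "w @ [l]" A T] snoc.prems by auto
    from snoc.IH[OF this] show ?case using green_pos_time[OF k[OF snoc.prems]] by simp
  qed
  have ev: "fst (y (Empty_Vertex B)) < 0" if B: "B \<in> I" for B
  proof -
    obtain u where u: "u \<in> B" using pl(3) B by (metis ex_in_conv)
    obtain i w where iw: "u = (i, w)" by (cases u)
    have "w = [] \<or> (i, butlast w) \<in> inners A T" using parent_in_inners(2)[of i w A T] pl(2)[OF B] u iw by auto
    then have "fst (parent_pos ?x y u) \<le> 0" using tv[of i "butlast w"] by (auto simp: iw)
    then show ?thesis using green_pos_time[OF e[OF B u]] by simp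
  qed
  have "y v \<in> Gam_neg \<delta>" if v: "v \<in> S.value_verts A T I" for v
  proof -
    have "y v \<in> Gam \<delta>" using y v by (auto simp: space_PiM dest: PiE_mem)
    moreover have "fst (y v) < 0" using v tv ev by (auto simp: S.value_verts_def)
    ultimately show ?thesis by (auto simp: Gam_def Gam_neg_def)
  qed
  then show ?thesis using y by (auto simp: space_PiM PiE_iff)
qed

text \<open>The signs multiply to (- 1)^m because the orders of the trees add up to m, and by
  causality the integral of the limit is the one over negative times in
  \<open>graph_value\<close>.\<close>

lemma graph_weight_tendsto:
  assumes x: "\<And>i. i < n \<Longrightarrow> x i \<in> lattice \<delta>" and T: "T \<in> tree_families p {..<n} m"
    and I: "partition_on (leaves1s {..<n} T) I"
  shows "((\<lambda>t. S.graph_weight (\<lambda>i. (t, x i)) {..<n} T I) \<longlongrightarrow>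
    (- 1) ^ m * (if leaves2s {..<n} T = {} then graph_value \<delta> m0 p (levy_cumulant a \<sigma> z r) x (map T [0..<n], I) else 0)) at_top"
proof -
  let ?A = "{..<n}" and ?V = "S.value_verts {..<n} T I"
  have x': "x ` ?A \<subseteq> lattice \<delta>" using x by auto
  have sgn: "(\<Prod>i\<in>?A. (- 1) ^ inner_count (T i) * tree_factor p (T i)) = (- 1) ^ m * (\<Prod>i<n. tree_factor p (T i))"
    using T by (simp add: prod.distrib tree_families_def power_sum[symmetric])
  have gv: "graph_value \<delta> m0 p (levy_cumulant a \<sigma> z r) x (map T [0..<n], I) =
      (\<Prod>i<n. tree_factor p (T i)) * (\<Prod>B\<in>I. levy_cumulant a \<sigma> z r (card B)) *
      (LINT y | PiM ?V (\<lambda>_. G). limit_integrand ?A T x I y)" if l2: "leaves2s ?A T = {}"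
  proof -
    let ?Ts = "map T [0..<n]"
    have l: "length ?Ts = n" by simp
    have eq: "\<forall>i<length ?Ts. T i = ?Ts ! i" by simp
    note af = addresses_families[OF eq, unfolded l]
    have "(LINT y : (\<Pi>\<^sub>E v\<in>?V. Gam_neg \<delta>) | PiM ?V (\<lambda>_. G). limit_integrand ?A T x I y) = (LINT y | PiM ?V (\<lambda>_. G). limit_integrand ?A T x I y)"
      unfolding set_lebesgue_integral_def
    proof (intro Bochner_Integration.integral_cong refl)
      fix y assume y: "y \<in> space (PiM ?V (\<lambda>_. G))"
      show "indicator (\<Pi>\<^sub>E v\<in>?V. Gam_neg \<delta>) y *\<^sub>R limit_integrand ?A T x I y = limit_integrand ?A T x I y"
        using limit_integrand_support[OF _ x' I y] by (cases "limit_integrand ?A T x I y = 0") auto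
    qed
    then show ?thesis
      using graph_value_eq[OF eq, of I \<delta> m0 p "levy_cumulant a \<sigma> z r" x] I l2 af
      unfolding l limit_integrand_def[abs_def] S.value_verts_def by simp
  qed
  have "((\<lambda>t. S.graph_weight (\<lambda>i. (t, x i)) ?A T I) \<longlongrightarrow>
      (- 1) ^ m * (\<Prod>i<n. tree_factor p (T i)) * ((\<Prod>C\<in>I. levy_cumulant a \<sigma> z r (card C)) *
      (if leaves2s ?A T = {} then LINT y | PiM ?V (\<lambda>_. G). limit_integrand ?A T x I y else 0))) at_top"
    unfolding S.graph_weight_def sgn by (intro tendsto_mult tendsto_const graph_val_tendsto x' I) simp
  then show ?thesis using gv by (cases "leaves2s ?A T = {}") (simp_all add: mult_ac)
qed

text \<open>In each order the families of trees and the connected partitions form finite sets that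
  do not depend on t, so the limit is taken term by term.\<close>

lemma truncated_moment_tendsto:
  assumes n: "n \<ge> 1" and x: "\<And>i. i < n \<Longrightarrow> x i \<in> lattice \<delta>"
  shows "((\<lambda>t. fps_nth (truncated (moment_series P (\<lambda>i \<xi>. solution_series \<delta> m0 p f (Y \<xi>) (t, x i))) {..<n}) m)
    \<longlongrightarrow> fps_nth (limit_series \<delta> m0 p (levy_cumulant a \<sigma> z r) n x) m) at_top"
proof -
  let ?P = "\<lambda>T. {I. partition_on (leaves1s {..<n} T) I \<and> conn {..<n} I}"
  have "fps_nth (truncated (moment_series P (\<lambda>i \<xi>. solution_series \<delta> m0 p f (Y \<xi>) (t, x i))) {..<n}) m =
      (\<Sum>T\<in>tree_families p {..<n} m. \<Sum>I\<in>?P T. S.graph_weight (\<lambda>i. (t, x i)) {..<n} T I)" for t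
  proof -
    have "truncated (moment_series P (\<lambda>i \<xi>. S.X_series \<xi> (t, x i))) {..<n} = S.truncated_series (\<lambda>i. (t, x i)) {..<n}"
      using n x by (intro S.truncated_moment_series) (auto simp: Gam_def lessThan_empty_iff)
    then show ?thesis by (simp add: S.X_series_def[abs_def] solution_series_def S.truncated_series_def)
  qed
  moreover have "fps_nth (limit_series \<delta> m0 p (levy_cumulant a \<sigma> z r) n x) m =
      (\<Sum>T\<in>tree_families p {..<n} m. \<Sum>I\<in>?P T. (- 1) ^ m *
        (if leaves2s {..<n} T = {} then graph_value \<delta> m0 p (levy_cumulant a \<sigma> z r) x (map T [0..<n], I) else 0))"
    by (simp only: limit_series_def fps_nth_Abs_fps sum_noise_pw_graphs[OF n] sum_distrib_left)
  moreover have "((\<lambda>t. \<Sum>T\<in>tree_families p {..<n} m. \<Sum>I\<in>?P T. S.graph_weight (\<lambda>i. (t, x i)) {..<n} T I) \<longlongrightarrow>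
      (\<Sum>T\<in>tree_families p {..<n} m. \<Sum>I\<in>?P T. (- 1) ^ m *
        (if leaves2s {..<n} T = {} then graph_value \<delta> m0 p (levy_cumulant a \<sigma> z r) x (map T [0..<n], I) else 0))) at_top"
    by (intro tendsto_sum graph_weight_tendsto x) auto
  ultimately show ?thesis by simp
qed

end

theorem theorem6p3:
  fixes \<delta> m0 a \<sigma> z :: real
    and p n m :: nat
    and r :: "real measure"
    and P :: "((real \<times> (real ^ 'd) \<Rightarrow> real) \<Rightarrow> real) measure"
    and Y :: "((real \<times> (real ^ 'd) \<Rightarrow> real) \<Rightarrow> real) \<Rightarrow> real \<times> (real ^ 'd) \<Rightarrow> real"
    and f :: "real ^ 'd \<Rightarrow> real"
    and x :: "nat \<Rightarrow> real ^ 'd"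
  assumes "\<delta> > 0" and "m0 > 0" and "p \<ge> 1" and "n \<ge> 1" and "z \<ge> 0"
    and "jump_law r"
    and "levy_noise_law \<delta> a \<sigma> z r P"
    and "noise_convolution \<delta> m0 P Y"
    and "f \<in> schwartz_lattice \<delta>"
    and "\<And>i. i < n \<Longrightarrow> x i \<in> lattice \<delta>"
  shows "((\<lambda>t. fps_nth
             (truncated
               (moment_series P (\<lambda>i \<xi>. solution_series \<delta> m0 p f (Y \<xi>) (t, x i)))
               {..<n}) m)
          \<longlongrightarrow> fps_nth (limit_series \<delta> m0 p (levy_cumulant a \<sigma> z r) n x) m) at_top"
proof -
  interpret parisi_wu \<delta> m0 a \<sigma> z r P Y p f
    by unfold_locales (use assms in auto)
  show ?thesis using assms by (intro truncated_moment_tendsto) auto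
qed

end
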